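(* Let $N\ge 2$ and let $B$ be the open unit ball of $\mathbb{R}^N$ centered at the origin. Let $f:[0,\infty)\times\mathbb{R}\to\mathbb{R}$, $(r,t)\mapsto f(r,t)$, be continuous with respect to $r$ and such that for every $r\ge 0$ the function $t\mapsto f(r,t)$ belongs to $W^{1,1}_{\mathrm{loc}}(\mathbb{R})$. Let $u\in H^1_0(B)$ be a weak solution to $-\Delta u=f(|x|,u)$ in $B$, $u=0$ on $\partial B$, such that $a(x):=f_u(|x|,u(x))$ belongs to $L^\infty(B)$. Then: (1) The Morse index of $u$ equals the number, counted with multiplicity, of negative singular eigenvalues $\widehat\Lambda_i$ associated to $a$. (2) If $\mathcal G$ is any subgroup of the orthogonal group $O(N)$ and $u$ is $\mathcal G$-invariant, then the $\mathcal G$-Morse index of $u$ equals the number, counted with multiplicity, of negative singular eigenvalues with $\mathcal G$-invariant eigenfunctions, i.e. of negative $\widehat\Lambda_i^{\mathcal G}$. (3) In particular, if $u$ is radial, then its radial Morse index equals the number of negative singular radial eigenvalues $\widehat\Lambda_i^{\mathrm{rad}}$ associated to $a$.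
   Context: Weak solution: $u\in H^1_0(B)$ with $\int_B(\nabla u\cdot\nabla\varphi-f(|x|,u)\varphi)\,dx=0$ for all $\varphi\in H^1_0(B)$. $f_u$ denotes the (weak) derivative of $f$ with respect to its second variable. Morse index: the maximal dimension of a subspace of $H^1_0(B)$ on which $\mathcal Q_u(w)=\int_B(|\nabla w|^2-f_u(|x|,u)w^2)\,dx$ is negative definite; equivalently the number, counted with multiplicity, of negative eigenvalues of $L_u=-\Delta-f_u(|x|,u)$ in $H^1_0(B)$. A function $w$ on $B$ is $\mathcal G$-invariant if $w(g(x))=w(x)$ for all $x\in B$, $g\in\mathcal G$. The $\mathcal G$-Morse index is the number, with multiplicity, of negative eigenvalues of $L_u$ in $H^1_{0,\mathcal G}(B)=\{w\in H^1_0(B): w\ \mathcal G\text{-invariant}\}$. The radial Morse index is the case $\mathcal G=O(N)$, where $H^1_{0,\mathcal G}(B)=H^1_{0,\mathrm{rad}}(B)$ is the space of radial functions in $H^1_0(B)$. Singular eigenvalues: for $a\in L^\infty(B)$ put $\mathcal Q_a(w)=\int_B(|\nabla w|^2-a w^2)\,dx$, $\mathcal L=\{w:B\to\mathbb{R}\text{ measurable}:\int_B|x|^{-2}w^2dx<\infty\}$ with scalar product $\int_B|x|^{-2}\eta\varphi\,dx$ (orthogonality for it is denoted $\underline\perp$), and $\mathcal H_0=H^1_0(B)\cap\mathcal L$. Set $$\widehat\Lambda_1=\inf_{w\in\mathcal H_0\setminus\{0\}}\frac{\mathcal Q_a(w)}{\int_B|x|^{-2}w^2dx},\qquad \widehat\Lambda_i=\inf_{\substack{w\in\mathcal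 H_0\setminus\{0\}\\ w\underline\perp\widehat\psi_1,\dots,\widehat\psi_{i-1}}}\frac{\mathcal Q_a(w)}{\int_B|x|^{-2}w^2dx}\quad(i\ge2),$$ where $\widehat\psi_j$ is a function attaining $\widehat\Lambda_j$ (the infimum is attained as long as it is $<(\frac{N-2}{2})^2$, and the iterative definition proceeds as long as $\widehat\Lambda_{i-1}<(\frac{N-2}{2})^2$). When $a$ is $\mathcal G$-invariant, $\widehat\Lambda_i^{\mathcal G}$ is defined in the same way with $\mathcal H_0$ replaced by $\mathcal H_0\cap H^1_{0,\mathcal G}(B)$; for $\mathcal G=O(N)$ one writes $\widehat\Lambda_i^{\mathrm{rad}}$. *)

theory Defs
  imports "HOL-Analysis.Analysis"
begin

text \<open>
  Elements of Lebesgue and Sobolev spaces are represented by functions on the whole space of which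
  only the restriction to the domain, up to null sets, matters. All function spaces below are closed
  under almost-everywhere equality on the domain, and dimensions are those of the quotients.
\<close>

section \<open>Weak derivatives and Sobolev spaces\<close>

fun C_k :: "nat \<Rightarrow> ('a::euclidean_space \<Rightarrow> real) \<Rightarrow> bool" where
  "C_k 0 \<phi> \<longleftrightarrow> continuous_on UNIV \<phi>"
| "C_k (Suc k) \<phi> \<longleftrightarrow> (\<forall>x. \<phi> differentiable (at x)) \<and>
     (\<forall>i\<in>Basis. C_k k (\<lambda>x. frechet_derivative \<phi> (at x) i))"

definition test_functions :: "'a::euclidean_space set \<Rightarrow> ('a \<Rightarrow> real) set" where
  "test_functions \<Omega> = {\<phi>. (\<forall>k. C_k k \<phi>) \<and>
     compact (closure {x. \<phi> x \<noteq> 0}) \<and> closure {x. \<phi> x \<noteq> 0} \<subseteq> \<Omega>}"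

definition L1_loc :: "'a::euclidean_space set \<Rightarrow> ('a \<Rightarrow> 'b::euclidean_space) set" where
  "L1_loc \<Omega> = {w. \<forall>K. compact K \<and> K \<subseteq> \<Omega> \<longrightarrow> integrable (lebesgue_on K) w}"

definition L2 :: "'a::euclidean_space set \<Rightarrow> ('a \<Rightarrow> 'b::euclidean_space) set" where
  "L2 \<Omega> = {w \<in> borel_measurable (lebesgue_on \<Omega>). integrable (lebesgue_on \<Omega>) (\<lambda>x. (norm (w x))\<^sup>2)}"

definition L_infinity :: "'a::euclidean_space set \<Rightarrow> ('a \<Rightarrow> real) set" where
  "L_infinity \<Omega> = {a \<in> borel_measurable (lebesgue_on \<Omega>). \<exists>C. AE x in lebesgue_on \<Omega>. \<bar>a x\<bar> \<le> C}"

definition has_weak_gradient ::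
    "'a::euclidean_space set \<Rightarrow> ('a \<Rightarrow> real) \<Rightarrow> ('a \<Rightarrow> 'a) \<Rightarrow> bool" where
  "has_weak_gradient \<Omega> w g \<longleftrightarrow> w \<in> L1_loc \<Omega> \<and> g \<in> L1_loc \<Omega> \<and>
     (\<forall>\<phi>\<in>test_functions \<Omega>. \<forall>i\<in>Basis.
        (LINT x|lebesgue_on \<Omega>. w x * frechet_derivative \<phi> (at x) i) =
        - (LINT x|lebesgue_on \<Omega>. (g x \<bullet> i) * \<phi> x))"

text \<open>On the real line the basis is \<open>{1}\<close>, so the weak gradient is the weak derivative.\<close>

definition W11_loc :: "'a::euclidean_space set \<Rightarrow> ('a \<Rightarrow> real) set" where
  "W11_loc \<Omega> = {w. \<exists>g. has_weak_gradient \<Omega> w g}"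

definition H1 :: "'a::euclidean_space set \<Rightarrow> ('a \<Rightarrow> real) set" where
  "H1 \<Omega> = {w \<in> L2 \<Omega>. \<exists>g\<in>L2 \<Omega>. has_weak_gradient \<Omega> w g}"

text \<open>The weak gradient of an \<open>H1\<close> function is unique up to a null set of \<open>\<Omega>\<close>.\<close>

definition weak_gradient :: "'a::euclidean_space set \<Rightarrow> ('a \<Rightarrow> real) \<Rightarrow> 'a \<Rightarrow> 'a" where
  "weak_gradient \<Omega> w = (SOME g. g \<in> L2 \<Omega> \<and> has_weak_gradient \<Omega> w g)"

definition H1_norm :: "'a::euclidean_space set \<Rightarrow> ('a \<Rightarrow> real) \<Rightarrow> real" where
  "H1_norm \<Omega> w = sqrt ((LINT x|lebesgue_on \<Omega>. (w x)\<^sup>2)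
     + (LINT x|lebesgue_on \<Omega>. (norm (weak_gradient \<Omega> w x))\<^sup>2))"

definition H10 :: "'a::euclidean_space set \<Rightarrow> ('a \<Rightarrow> real) set" where
  "H10 \<Omega> = {w \<in> H1 \<Omega>. \<forall>\<epsilon>>0. \<exists>\<phi>\<in>test_functions \<Omega>. H1_norm \<Omega> (\<lambda>x. w x - \<phi> x) < \<epsilon>}"

abbreviation unit_ball :: "'a::euclidean_space set" where
  "unit_ball \<equiv> ball 0 1"

abbreviation ball_measure :: "'a::euclidean_space measure" where
  "ball_measure \<equiv> lebesgue_on unit_ball"

abbreviation grad :: "('a::euclidean_space \<Rightarrow> real) \<Rightarrow> 'a \<Rightarrow> 'a" where
  "grad \<equiv> weak_gradient unit_ball"

definition ae_zero :: "('a::euclidean_space \<Rightarrow> real) \<Rightarrow> bool" where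
  "ae_zero w \<longleftrightarrow> (AE x in ball_measure. w x = 0)"


section \<open>Weak solutions and symmetry\<close>

definition weak_solution :: "(real \<Rightarrow> real \<Rightarrow> real) \<Rightarrow> ('a::euclidean_space \<Rightarrow> real) \<Rightarrow> bool" where
  "weak_solution f u \<longleftrightarrow> u \<in> H10 unit_ball \<and>
     (\<forall>\<phi>\<in>H10 unit_ball.
        has_bochner_integral ball_measure
          (\<lambda>x. grad u x \<bullet> grad \<phi> x - f (norm x) (u x) * \<phi> x) 0)"

definition orthogonal_group :: "('a::euclidean_space \<Rightarrow> 'a) set" where
  "orthogonal_group = {g. orthogonal_transformation g}"

definition orthogonal_subgroup :: "('a::euclidean_space \<Rightarrow> 'a) set \<Rightarrow> bool" where
  "orthogonal_subgroup G \<longleftrightarrow> G \<subseteq> orthogonal_group \<and> id \<in> G \<and>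
     (\<forall>g\<in>G. \<forall>h\<in>G. g \<circ> h \<in> G) \<and> (\<forall>g\<in>G. inv g \<in> G)"

text \<open>A class of functions is invariant if it has an invariant representative; likewise for
  radial classes.\<close>

definition invariant :: "('a::euclidean_space \<Rightarrow> 'a) set \<Rightarrow> ('a \<Rightarrow> real) \<Rightarrow> bool" where
  "invariant G w \<longleftrightarrow> (\<exists>v. (AE x in ball_measure. w x = v x) \<and>
     (\<forall>g\<in>G. \<forall>x\<in>unit_ball. v (g x) = v x))"

definition radial :: "('a::euclidean_space \<Rightarrow> real) \<Rightarrow> bool" where
  "radial w \<longleftrightarrow> (\<exists>h. AE x in ball_measure. w x = h (norm x))"

definition H10_inv :: "('a::euclidean_space \<Rightarrow> 'a) set \<Rightarrow> ('a \<Rightarrow> real) set" where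
  "H10_inv G = {w \<in> H10 unit_ball. invariant G w}"


section \<open>Morse index\<close>

definition quad_form :: "('a::euclidean_space \<Rightarrow> real) \<Rightarrow> ('a \<Rightarrow> real) \<Rightarrow> real" where
  "quad_form a w = (LINT x|ball_measure. (norm (grad w x))\<^sup>2 - a x * (w x)\<^sup>2)"

definition fun_subspace :: "('a \<Rightarrow> real) set \<Rightarrow> bool" where
  "fun_subspace V \<longleftrightarrow> (\<lambda>x. 0) \<in> V \<and> (\<forall>v\<in>V. \<forall>w\<in>V. (\<lambda>x. v x + w x) \<in> V) \<and>
     (\<forall>c. \<forall>v\<in>V. (\<lambda>x. c * v x) \<in> V)"

text \<open>The dimension of a space of functions modulo almost-everywhere equality on the ball,
  as the supremum of the lengths of linearly independent families.\<close>

definition ae_dim :: "('a::euclidean_space \<Rightarrow> real) set \<Rightarrow> enat" where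
  "ae_dim V = (SUP n\<in>{n. \<exists>w :: nat \<Rightarrow> 'a \<Rightarrow> real. (\<forall>i<n. w i \<in> V) \<and>
     (\<forall>c. ae_zero (\<lambda>x. \<Sum>i<n. c i * w i x) \<longrightarrow> (\<forall>i<n. c i = 0))}. enat n)"

definition morse_index :: "('a::euclidean_space \<Rightarrow> real) \<Rightarrow> enat" where
  "morse_index a = (SUP V\<in>{V. fun_subspace V \<and> V \<subseteq> H10 unit_ball \<and>
     (\<forall>w\<in>V. \<not> ae_zero w \<longrightarrow> quad_form a w < 0)}. ae_dim V)"

text \<open>Eigenfunctions, in the weak sense, of \<open>-\<Delta> - a\<close> in a subspace \<open>X\<close> of \<open>H10\<close> of the ball, for
  the eigenvalue \<open>\<mu>\<close>, together with \<open>0\<close>.\<close>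

definition eigenspace ::
    "('a::euclidean_space \<Rightarrow> real) set \<Rightarrow> ('a \<Rightarrow> real) \<Rightarrow> real \<Rightarrow> ('a \<Rightarrow> real) set" where
  "eigenspace X a \<mu> = {w \<in> X. \<forall>\<phi>\<in>X.
     (LINT x|ball_measure. grad w x \<bullet> grad \<phi> x - a x * w x * \<phi> x) =
     \<mu> * (LINT x|ball_measure. w x * \<phi> x)}"

text \<open>The sum of the multiplicities over all \<open>\<mu> < 0\<close>, i.e. the supremum of its finite partial sums;
  numbers that are not eigenvalues contribute \<open>0\<close>.\<close>

definition num_neg_eigenvalues ::
    "('a::euclidean_space \<Rightarrow> real) set \<Rightarrow> ('a \<Rightarrow> real) \<Rightarrow> enat" where
  "num_neg_eigenvalues X a = (SUP F\<in>{F. finite F \<and> F \<subseteq> {..<0}}. \<Sum>\<mu>\<in>F. ae_dim (eigenspace X a \<mu>))"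

definition inv_morse_index ::
    "('a::euclidean_space \<Rightarrow> 'a) set \<Rightarrow> ('a \<Rightarrow> real) \<Rightarrow> enat" where
  "inv_morse_index G a = num_neg_eigenvalues (H10_inv G) a"

definition radial_morse_index :: "('a::euclidean_space \<Rightarrow> real) \<Rightarrow> enat" where
  "radial_morse_index a = inv_morse_index orthogonal_group a"


section \<open>Singular eigenvalues\<close>

definition sing_inner :: "('a::euclidean_space \<Rightarrow> real) \<Rightarrow> ('a \<Rightarrow> real) \<Rightarrow> real" where
  "sing_inner \<eta> \<phi> = (LINT x|ball_measure. \<eta> x * \<phi> x / (norm x)\<^sup>2)"

definition sing_L2 :: "('a::euclidean_space \<Rightarrow> real) set" where
  "sing_L2 = {w \<in> borel_measurable ball_measure. integrable ball_measure (\<lambda>x. (w x)\<^sup>2 / (norm x)\<^sup>2)}"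

definition sing_admissible ::
    "('a::euclidean_space \<Rightarrow> real) set \<Rightarrow> ('a \<Rightarrow> real) set \<Rightarrow> ('a \<Rightarrow> real) set" where
  "sing_admissible X P = {w \<in> X \<inter> sing_L2. \<not> ae_zero w \<and> (\<forall>\<psi>\<in>P. sing_inner w \<psi> = 0)}"

definition sing_quotient :: "('a::euclidean_space \<Rightarrow> real) \<Rightarrow> ('a \<Rightarrow> real) \<Rightarrow> real" where
  "sing_quotient a w = quad_form a w / sing_inner w w"

definition sing_inf ::
    "('a::euclidean_space \<Rightarrow> real) set \<Rightarrow> ('a \<Rightarrow> real) \<Rightarrow> ('a \<Rightarrow> real) set \<Rightarrow> ereal" where
  "sing_inf X a P = (INF w\<in>sing_admissible X P. ereal (sing_quotient a w))"

definition attains_sing_inf ::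
    "('a::euclidean_space \<Rightarrow> real) set \<Rightarrow> ('a \<Rightarrow> real) \<Rightarrow> ('a \<Rightarrow> real) set \<Rightarrow> ('a \<Rightarrow> real) \<Rightarrow> bool" where
  "attains_sing_inf X a P \<psi> \<longleftrightarrow>
     \<psi> \<in> sing_admissible X P \<and> ereal (sing_quotient a \<psi>) = sing_inf X a P"

primrec sing_eigenfunctions ::
    "('a::euclidean_space \<Rightarrow> real) set \<Rightarrow> ('a \<Rightarrow> real) \<Rightarrow> nat \<Rightarrow> ('a \<Rightarrow> real) set" where
  "sing_eigenfunctions X a 0 = {}"
| "sing_eigenfunctions X a (Suc i) =
     insert (SOME \<psi>. attains_sing_inf X a (sing_eigenfunctions X a i) \<psi>) (sing_eigenfunctions X a i)"

text \<open>Indices start at \<open>0\<close>. The value at \<open>i\<close> is meaningful only if all previous ones are below the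
  Hardy constant \<open>((N - 2) / 2)\<^sup>2\<close>, so that they are attained; this is the condition under which the
  iteration reaches stage \<open>i\<close>.\<close>

definition sing_eigenvalue ::
    "('a::euclidean_space \<Rightarrow> real) set \<Rightarrow> ('a \<Rightarrow> real) \<Rightarrow> nat \<Rightarrow> ereal" where
  "sing_eigenvalue X a i = sing_inf X a (sing_eigenfunctions X a i)"

definition sing_eigenvalue_defined ::
    "('a::euclidean_space \<Rightarrow> real) set \<Rightarrow> ('a \<Rightarrow> real) \<Rightarrow> nat \<Rightarrow> bool" where
  "sing_eigenvalue_defined X a i \<longleftrightarrow>
     (\<forall>j<i. sing_eigenvalue X a j < ereal (((real DIM('a) - 2) / 2)\<^sup>2))"

definition enat_card :: "'b set \<Rightarrow> enat" where
  "enat_card S = (if finite S then enat (card S) else \<infinity>)"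

text \<open>Counting indices rather than values counts the eigenvalues with multiplicity.\<close>

definition num_neg_sing_eigenvalues ::
    "('a::euclidean_space \<Rightarrow> real) set \<Rightarrow> ('a \<Rightarrow> real) \<Rightarrow> enat" where
  "num_neg_sing_eigenvalues X a =
     enat_card {i. sing_eigenvalue_defined X a i \<and> sing_eigenvalue X a i < 0}"

end

theory Submission
  imports Defs "HOL-Library.Diagonal_Subsequence"
begin

text \<open>
  All three counts equal the maximal dimension of a subspace \<open>V\<close> of \<open>X\<close> (\<open>X\<close> being \<open>H\<^sup>1\<^sub>0\<close> or its
  \<open>\<G>\<close>-invariant part) on which the energy form \<open>Q\<close> is negative definite. Minimising \<open>Q / D\<close> successively,
  with \<open>D\<close> the \<open>L\<^sup>2\<close> or the singular inner product, produces \<open>k\<close> directions with negative values,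
  orthogonal for both \<open>Q\<close> and \<open>D\<close>, as long as a negative value exists on the orthogonal complement;
  Rellich's theorem yields the minimisers. If only \<open>k\<close> negative values occur then \<open>Q \<ge> 0\<close> on a
  subspace of codimension \<open>k\<close>. In the singular case this holds at first only on \<open>X \<inter> \<L>\<close>, and
  one needs that \<open>X \<inter> \<L>\<close> is dense in \<open>X\<close>. Density is obtained from multiplication by radial polynomials
  vanishing at the origin, whose gradients are dominated by the weight of a logarithmic Hardy
  inequality; this works in every dimension \<open>N \<ge> 2\<close> and preserves invariance.
\<close>

section \<open>Symmetric forms on spaces of functions\<close>

text \<open>The obstacle is the passage from \<open>X\<close> to \<open>X \<inter> sing_L2\<close>.
  Hardy's inequality degenerates in the plane, so \<open>sing_inner\<close> need not be finite on
  \<open>X\<close>, and neither the singular quotient nor singular orthogonality makes sense there.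
  Along a chain of minimisers with negative values, however, \<open>Q (\<psi> j)\<close> is a
  nonzero multiple of \<open>D (\<psi> j)\<close>. Orthogonality for \<open>D\<close> can therefore
  be replaced by orthogonality for \<open>Q\<close>, which is defined on all of \<open>X\<close> and
  survives the limit of cutoffs. The cutoffs must be spread over a logarithmic scale, since in the
  plane the origin is negligible for the energy only at logarithmic speed; the harmonic numbers
  provide this scale. Attainment is needed only below zero, where it comes cheaply: with
  \<open>\<lambda> < 0\<close> the form \<open>A - \<lambda> D\<close> dominates a multiple of the
  whole norm. Eigenfunctions thus come from minimisation instead of spectral theory. Each count is
  compared with the sizes of negative families one natural number at a time, so finiteness of the
  index need not be known beforehand.\<close>

definition form_on :: "('a \<Rightarrow> real) set \<Rightarrow> (('a \<Rightarrow> real) \<Rightarrow> ('a \<Rightarrow> real) \<Rightarrow> real) \<Rightarrow> bool" where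
  "form_on E B \<longleftrightarrow> (\<forall>u\<in>E. \<forall>v\<in>E. B u v = B v u) \<and>
     (\<forall>u\<in>E. \<forall>v\<in>E. \<forall>w\<in>E. B (\<lambda>x. u x + v x) w = B u w + B v w) \<and>
     (\<forall>c. \<forall>u\<in>E. \<forall>w\<in>E. B (\<lambda>x. c * u x) w = c * B u w)"

lemma fun_subspaceD:
  assumes "fun_subspace E"
  shows "(\<lambda>x. 0) \<in> E" "u \<in> E \<Longrightarrow> v \<in> E \<Longrightarrow> (\<lambda>x. u x + v x) \<in> E" "u \<in> E \<Longrightarrow> (\<lambda>x. c * u x) \<in> E"
  using assms by (auto simp: fun_subspace_def)

lemma fun_subspace_diff:
  assumes "fun_subspace E" "u \<in> E" "v \<in> E"
  shows "(\<lambda>x. u x - v x) \<in> E"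
  using fun_subspaceD(2)[OF assms(1,2) fun_subspaceD(3)[OF assms(1,3), of "-1"]] by simp

lemma fun_subspace_sum:
  assumes "fun_subspace E" "\<And>i. i \<in> I \<Longrightarrow> w i \<in> E"
  shows "(\<lambda>x. \<Sum>i\<in>I. c i * w i x) \<in> E"
  using assms(2)
proof (induction I rule: infinite_finite_induct)
  case (insert i I)
  then show ?case
    using fun_subspaceD(2)[OF assms(1) fun_subspaceD(3)[OF assms(1)], of "w i" _ "c i"] by auto
qed (use fun_subspaceD(1)[OF assms(1)] in auto)

lemma fun_subspace_orth:
  assumes "fun_subspace E" "form_on E D" "P \<subseteq> E"
  shows "fun_subspace {w \<in> E. \<forall>p\<in>P. D w p = 0}"
proof -
  have z: "D (\<lambda>x. 0) p = 0" if "p \<in> E" for p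
  proof -
    have "D (\<lambda>x. c * u x) p = c * D u p" if "u \<in> E" for c u
      using assms(2) that \<open>p \<in> E\<close> by (simp add: form_on_def)
    from this[OF fun_subspaceD(1)[OF assms(1)], of 0] show ?thesis by simp
  qed
  show ?thesis
    unfolding fun_subspace_def
  proof (intro conjI ballI allI)
    show "(\<lambda>x. 0) \<in> {w \<in> E. \<forall>p\<in>P. D w p = 0}" using z assms fun_subspaceD(1)[OF assms(1)] by auto
  next
    fix v w assume vw: "v \<in> {w \<in> E. \<forall>p\<in>P. D w p = 0}" "w \<in> {w \<in> E. \<forall>p\<in>P. D w p = 0}"
    then have "D (\<lambda>x. v x + w x) p = D v p + D w p" if "p \<in> P" for p
      using assms that by (auto simp: form_on_def subset_iff)
    then show "(\<lambda>x. v x + w x) \<in> {w \<in> E. \<forall>p\<in>P. D w p = 0}"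
      using vw fun_subspaceD(2)[OF assms(1)] by auto
  next
    fix c v assume v: "v \<in> {w \<in> E. \<forall>p\<in>P. D w p = 0}"
    then have "D (\<lambda>x. c * v x) p = c * D v p" if "p \<in> P" for p
      using assms that by (auto simp: form_on_def subset_iff)
    then show "(\<lambda>x. c * v x) \<in> {w \<in> E. \<forall>p\<in>P. D w p = 0}"
      using v fun_subspaceD(3)[OF assms(1)] by auto
  qed
qed

locale sym_form =
  fixes E :: "('a \<Rightarrow> real) set" and B :: "('a \<Rightarrow> real) \<Rightarrow> ('a \<Rightarrow> real) \<Rightarrow> real"
  assumes sub: "fun_subspace E" and form: "form_on E B"
begin

lemma sym: "u \<in> E \<Longrightarrow> v \<in> E \<Longrightarrow> B u v = B v u"
  using form by (simp add: form_on_def)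

lemma add_l: "u \<in> E \<Longrightarrow> v \<in> E \<Longrightarrow> w \<in> E \<Longrightarrow> B (\<lambda>x. u x + v x) w = B u w + B v w"
  using form by (simp add: form_on_def)

lemma scale_l: "u \<in> E \<Longrightarrow> w \<in> E \<Longrightarrow> B (\<lambda>x. c * u x) w = c * B u w"
  using form by (simp add: form_on_def)

lemma diff_l: "u \<in> E \<Longrightarrow> v \<in> E \<Longrightarrow> w \<in> E \<Longrightarrow> B (\<lambda>x. u x - v x) w = B u w - B v w"
  using add_l[of u "\<lambda>x. -1 * v x" w] scale_l[of v w "-1"] fun_subspaceD(3)[OF sub, of v "-1"] by simp

lemma add_r: "u \<in> E \<Longrightarrow> v \<in> E \<Longrightarrow> w \<in> E \<Longrightarrow> B w (\<lambda>x. u x + v x) = B w u + B w v"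
  using add_l[of u v w] sym[of w] fun_subspaceD(2)[OF sub, of u v] by simp

lemma scale_r: "u \<in> E \<Longrightarrow> w \<in> E \<Longrightarrow> B w (\<lambda>x. c * u x) = c * B w u"
  using scale_l[of u w c] sym[of w] fun_subspaceD(3)[OF sub, of u c] by simp

lemma diff_r: "u \<in> E \<Longrightarrow> v \<in> E \<Longrightarrow> w \<in> E \<Longrightarrow> B w (\<lambda>x. u x - v x) = B w u - B w v"
  using diff_l[of u v w] sym[of w] fun_subspace_diff[OF sub, of u v] by simp

lemma zero_l: "w \<in> E \<Longrightarrow> B (\<lambda>x. 0) w = 0"
  using scale_l[of "\<lambda>x. 0" w 0] fun_subspaceD(1)[OF sub] by simp

lemma sum_l:
  assumes "\<And>i. i \<in> I \<Longrightarrow> w i \<in> E" "v \<in> E"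
  shows "B (\<lambda>x. \<Sum>i\<in>I. c i * w i x) v = (\<Sum>i\<in>I. c i * B (w i) v)"
  using assms(1)
proof (induction I rule: infinite_finite_induct)
  case (insert i I)
  have "(\<lambda>x. c i * w i x) \<in> E" "(\<lambda>x. \<Sum>i\<in>I. c i * w i x) \<in> E"
    using insert.prems fun_subspaceD(3)[OF sub] fun_subspace_sum[OF sub, of I w c] by auto
  with insert show ?case using add_l[of "\<lambda>x. c i * w i x" _ v] assms(2) scale_l[of "w i" v] by simp
qed (use zero_l assms(2) in auto)

lemma sum_r:
  assumes "\<And>i. i \<in> I \<Longrightarrow> w i \<in> E" "v \<in> E"
  shows "B v (\<lambda>x. \<Sum>i\<in>I. c i * w i x) = (\<Sum>i\<in>I. c i * B v (w i))"
proof -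
  have "(\<lambda>x. \<Sum>i\<in>I. c i * w i x) \<in> E" using assms by (intro fun_subspace_sum[OF sub])
  then have "B v (\<lambda>x. \<Sum>i\<in>I. c i * w i x) = (\<Sum>i\<in>I. c i * B (w i) v)"
    using sum_l[of I w v c] assms sym[OF assms(2)] by auto
  also have "\<dots> = (\<Sum>i\<in>I. c i * B v (w i))"
    using assms(1) sym[OF _ assms(2)] by (intro sum.cong) auto
  finally show ?thesis .
qed

lemma square_add:
  assumes "u \<in> E" "v \<in> E"
  shows "B (\<lambda>x. u x + v x) (\<lambda>x. u x + v x) = B u u + 2 * B u v + B v v"
  using assms add_l add_r fun_subspaceD(2)[OF sub assms] sym[of v u] by simp

lemma square_diff:
  assumes "u \<in> E" "v \<in> E"
  shows "B (\<lambda>x. u x - v x) (\<lambda>x. u x - v x) = B u u - 2 * B u v + B v v"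
  using assms diff_l diff_r fun_subspace_diff[OF sub assms] sym[of v u] by simp

lemma square_scale:
  assumes "u \<in> E"
  shows "B (\<lambda>x. c * u x) (\<lambda>x. c * u x) = c\<^sup>2 * B u u"
  using assms scale_l scale_r fun_subspaceD(3)[OF sub assms] by (simp add: power2_eq_square)

lemma square_sum:
  assumes "\<And>i. i \<in> I \<Longrightarrow> w i \<in> E"
    and "\<And>i j. i \<in> I \<Longrightarrow> j \<in> I \<Longrightarrow> i \<noteq> j \<Longrightarrow> B (w i) (w j) = 0"
  shows "B (\<lambda>x. \<Sum>i\<in>I. c i * w i x) (\<lambda>x. \<Sum>i\<in>I. c i * w i x) = (\<Sum>i\<in>I. (c i)\<^sup>2 * B (w i) (w i))"
proof (cases "finite I")
  case True
  have "B (\<lambda>x. \<Sum>i\<in>I. c i * w i x) (\<lambda>x. \<Sum>i\<in>I. c i * w i x) = (\<Sum>i\<in>I. c i * (\<Sum>j\<in>I. c j * B (w i) (w j)))"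
    using assms(1) by (subst sum_l) (auto simp: fun_subspace_sum[OF sub] sum_r intro!: sum.cong)
  also have "\<dots> = (\<Sum>i\<in>I. c i * (\<Sum>j\<in>I. if j = i then c j * B (w i) (w i) else 0))"
    using assms(2) by (intro sum.cong arg_cong2[where f="(*)"] refl) auto
  finally show ?thesis using True by (simp add: power2_eq_square mult.assoc)
qed (use zero_l fun_subspaceD(1)[OF sub] in auto)

text \<open>The discriminant argument for \<open>B\<close> along the line \<open>u + t v\<close>.
  Nonnegativity is asked only on a subspace \<open>W\<close>, because \<open>Q - \<lambda> D\<close>
  is nonnegative only on the orthogonal complement of the earlier minimisers, and
  \<open>B v v = 0\<close> must be allowed for nonzero \<open>v\<close>.\<close>

lemma Cauchy_Schwarz_psd:
  assumes "fun_subspace W" "W \<subseteq> E" "\<And>w. w \<in> W \<Longrightarrow> 0 \<le> B w w" "u \<in> W" "v \<in> W"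
  shows "(B u v)\<^sup>2 \<le> B u u * B v v"
proof -
  have q: "0 \<le> B u u + 2 * t * B u v + t\<^sup>2 * B v v" for t
  proof -
    have tv: "(\<lambda>x. t * v x) \<in> W" using assms fun_subspaceD(3) by blast
    then have "0 \<le> B (\<lambda>x. u x + t * v x) (\<lambda>x. u x + t * v x)"
      using assms fun_subspaceD(2)[OF assms(1,4)] by blast
    moreover have "B u (\<lambda>x. t * v x) = t * B u v"
      using assms scale_r[of v u t] by auto
    ultimately show ?thesis
      using square_add[of u "\<lambda>x. t * v x"] square_scale[of v t] subsetD[OF assms(2)] assms(4,5) tv by (simp add: mult.assoc)
  qed
  show ?thesis
  proof (cases "B v v = 0")
    case True
    have "B u v = 0"
    proof (rule ccontr)
      assume "B u v \<noteq> 0"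
      \<comment> \<open>This value of \<open>t\<close> makes the affine function
        \<open>B u u + 2 * t * B u v\<close> equal to \<open>-1\<close>.\<close>
      then show False using q[of "- (B u u + 1) / (2 * B u v)"] True by (simp add: field_simps)
    qed
    then show ?thesis using True by simp
  next
    case False
    then have "0 < B v v" using assms(3)[OF assms(5)] by simp
    then show ?thesis using q[of "- B u v / B v v"]
      by (simp add: field_simps power2_eq_square)
  qed
qed

end

text \<open>Gaussian elimination by induction on the equations: an equation with a nonzero
  coefficient is solved for one unknown, which leaves one equation and one unknown fewer. It
  supplies the dimension count that would otherwise be made with subspaces and bases.\<close>

lemma homogeneous_system_nontrivial:
  fixes a :: "'i \<Rightarrow> 'j \<Rightarrow> real"
  assumes "finite J" "finite I" "card J < card I"
  shows "\<exists>c. (\<exists>i\<in>I. c i \<noteq> 0) \<and> (\<forall>j\<in>J. (\<Sum>i\<in>I. c i * a i j) = 0)"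
  using assms
proof (induction J arbitrary: I a rule: finite_induct)
  case empty
  then obtain i where "i \<in> I" by fastforce
  then show ?case by (intro exI[of _ "\<lambda>_. 1"]) auto
next
  case (insert j J)
  show ?case
  proof (cases "\<forall>i\<in>I. a i j = 0")
    case True
    obtain c where "\<exists>i\<in>I. c i \<noteq> 0" "\<forall>j\<in>J. (\<Sum>i\<in>I. c i * a i j) = 0"
      using insert.IH[of I a] insert.prems insert.hyps by auto
    then show ?thesis using True by (intro exI[of _ c]) auto
  next
    case False
    then obtain p where p: "p \<in> I" "a p j \<noteq> 0" by blast
    define a' where "a' i l = a i l - a i j / a p j * a p l" for i l
    have "card J < card (I - {p})" using insert.prems insert.hyps p by simp
    then obtain c where c: "\<exists>i\<in>I-{p}. c i \<noteq> 0" "\<forall>l\<in>J. (\<Sum>i\<in>I-{p}. c i * a' i l) = 0"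
      using insert.IH[of "I - {p}" a'] insert.prems by auto
    \<comment> \<open>The eliminated unknown \<open>p\<close> receives the value that satisfies
      equation \<open>j\<close>; with it the other equations agree with the reduced ones.\<close>
    define c' where "c' i = (if i = p then - (\<Sum>i\<in>I-{p}. c i * a i j) / a p j else c i)" for i
    have s: "(\<Sum>i\<in>I. c' i * a i l) = (\<Sum>i\<in>I-{p}. c i * a' i l)" for l
    proof -
      have "(\<Sum>i\<in>I. c' i * a i l) = c' p * a p l + (\<Sum>i\<in>I-{p}. c i * a i l)"
        using p insert.prems by (simp add: sum.remove c'_def)
      also have "c' p * a p l = - (\<Sum>i\<in>I-{p}. c i * (a i j / a p j * a p l))"
        by (simp add: c'_def sum_divide_distrib sum_distrib_right mult.assoc)
      finally show ?thesis by (simp add: a'_def algebra_simps sum_subtractf)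
    qed
    have "a' i j = 0" for i using p by (simp add: a'_def)
    then have "\<forall>l\<in>insert j J. (\<Sum>i\<in>I. c' i * a i l) = 0" using c(2) s by simp
    moreover have "\<exists>i\<in>I. c' i \<noteq> 0" using c(1) by (auto simp: c'_def)
    ultimately show ?thesis by blast
  qed
qed

text \<open>Linear independence is built in: strict negativity for every nontrivial coefficient
  vector excludes dependent families. Dimensions modulo null sets thus need no mention until the
  counts of the theorem are unfolded.\<close>

definition neg_family :: "('a \<Rightarrow> real) set \<Rightarrow> (('a \<Rightarrow> real) \<Rightarrow> ('a \<Rightarrow> real) \<Rightarrow> real) \<Rightarrow> nat \<Rightarrow> bool" where
  "neg_family X Q k \<longleftrightarrow> (\<exists>w. (\<forall>i<k. w i \<in> X) \<and>
     (\<forall>c. (\<exists>i<k. c i \<noteq> 0) \<longrightarrow> Q (\<lambda>x. \<Sum>i<k. c i * w i x) (\<lambda>x. \<Sum>i<k. c i * w i x) < 0))"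

section \<open>Successive minimisation of a quotient of forms\<close>

text \<open>\<open>A + D\<close> plays the part of a squared Hilbert norm: \<open>complete\<close>
  is completeness for it, and \<open>compact\<close> says that \<open>K\<close> is compact relative
  to it. \<open>D\<close> is only semidefinite, since functions that vanish almost everywhere are
  not identified with zero.\<close>

locale form_pencil =
  fixes E :: "('a \<Rightarrow> real) set" and A K D :: "('a \<Rightarrow> real) \<Rightarrow> ('a \<Rightarrow> real) \<Rightarrow> real" and C :: real
  assumes E: "fun_subspace E"
    and formA: "form_on E A" and formK: "form_on E K" and formD: "form_on E D"
    and A_nonneg: "u \<in> E \<Longrightarrow> 0 \<le> A u u" and D_nonneg: "u \<in> E \<Longrightarrow> 0 \<le> D u u"
    and K_bound: "u \<in> E \<Longrightarrow> \<bar>K u u\<bar> \<le> C * D u u" and C_nonneg: "0 \<le> C"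
    and complete: "\<And>w. (\<And>n. w n \<in> E) \<Longrightarrow>
      (\<And>e. e > 0 \<Longrightarrow> \<exists>N. \<forall>m\<ge>N. \<forall>n\<ge>N. A (\<lambda>x. w m x - w n x) (\<lambda>x. w m x - w n x) +
        D (\<lambda>x. w m x - w n x) (\<lambda>x. w m x - w n x) < e) \<Longrightarrow>
      \<exists>v\<in>E. (\<lambda>n. A (\<lambda>x. w n x - v x) (\<lambda>x. w n x - v x) + D (\<lambda>x. w n x - v x) (\<lambda>x. w n x - v x)) \<longlonglongrightarrow> 0"
    and compact: "\<And>w M. (\<And>n. w n \<in> E) \<Longrightarrow> (\<And>n. A (w n) (w n) + D (w n) (w n) \<le> M) \<Longrightarrow>
      \<exists>r :: nat \<Rightarrow> nat. strict_mono r \<and> (\<forall>e>0. \<exists>N. \<forall>m\<ge>N. \<forall>n\<ge>N.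
        \<bar>K (\<lambda>x. w (r m) x - w (r n) x) (\<lambda>x. w (r m) x - w (r n) x)\<bar> < e)"
begin

definition Q :: "('a \<Rightarrow> real) \<Rightarrow> ('a \<Rightarrow> real) \<Rightarrow> real" where "Q u v = A u v - K u v"

lemma form_combine: "form_on E (\<lambda>u v. Q u v - l * D u v)"
  using formA formK formD unfolding form_on_def Q_def by (auto simp: algebra_simps)

sublocale D: sym_form E D by standard (fact E formD)+
sublocale Q: sym_form E Q using form_combine[of 0] E by unfold_locales auto

lemma Q_lower: "u \<in> E \<Longrightarrow> - C * D u u \<le> Q u u"
  using A_nonneg[of u] K_bound[of u] by (simp add: Q_def abs_le_iff)

text \<open>The inequality between quotients is multiplied out. Competitors with
  \<open>D w w = 0\<close> then need no exclusion: for them it says \<open>0 \<le> Q w w\<close>, in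
  agreement with \<open>Q_lower\<close>.\<close>

definition minimizer :: "('a \<Rightarrow> real) set \<Rightarrow> ('a \<Rightarrow> real) \<Rightarrow> bool" where
  "minimizer P \<psi> \<longleftrightarrow> \<psi> \<in> E \<and> (\<forall>p\<in>P. D \<psi> p = 0) \<and> D \<psi> \<psi> \<noteq> 0 \<and>
     (\<forall>w\<in>E. (\<forall>p\<in>P. D w p = 0) \<longrightarrow> Q \<psi> \<psi> * D w w \<le> Q w w * D \<psi> \<psi>)"

text \<open>With \<open>\<lambda>\<close> the infimum and \<open>R = Q - \<lambda> D \<ge> 0\<close>, a minimising sequence satisfies \<open>R (w n) \<longlonglongrightarrow> 0\<close>,
  hence \<open>R (w m - w n) \<longlonglongrightarrow> 0\<close>. As \<open>\<lambda> < 0\<close>, the form \<open>R + K = A - \<lambda> D\<close> controls the norm, so compactness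
  of \<open>K\<close> makes a subsequence Cauchy, and no weak convergence is needed.\<close>

lemma minimizer_exists:
  assumes P: "P \<subseteq> E" and w0: "w0 \<in> E" "\<And>p. p \<in> P \<Longrightarrow> D w0 p = 0" "Q w0 w0 < 0"
  shows "\<exists>\<psi>. minimizer P \<psi>"
proof -
  define W where "W = {w \<in> E. \<forall>p\<in>P. D w p = 0}"
  have W: "fun_subspace W" "W \<subseteq> E"
    unfolding W_def using fun_subspace_orth[OF E formD P] by auto
  define S where "S = (\<lambda>w. Q w w / D w w) ` {w \<in> W. D w w \<noteq> 0}"
  define l where "l = Inf S"
  have pos: "0 < D w w" if "w \<in> E" "D w w \<noteq> 0" for w using D_nonneg[OF that(1)] that by simp
  have D0: "D w0 w0 \<noteq> 0" using Q_lower[OF w0(1)] w0(3) by auto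
  then have w0S: "Q w0 w0 / D w0 w0 \<in> S" using w0 by (auto simp: S_def W_def)
  have bdd: "bdd_below S"
    unfolding S_def
  proof (rule bdd_belowI2)
    fix w assume "w \<in> {w \<in> W. D w w \<noteq> 0}"
    then show "-C \<le> Q w w / D w w" using Q_lower[of w] pos[of w] W by (auto simp: field_simps)
  qed
  have "l \<le> Q w0 w0 / D w0 w0" unfolding l_def by (rule cInf_lower[OF w0S bdd])
  also have "\<dots> < 0" using w0 pos[of w0] D0 by (simp add: divide_neg_pos)
  finally have l: "l < 0" .
  define R where "R u v = Q u v - l * D u v" for u v
  interpret R: sym_form E R using form_combine[of l] E unfolding R_def by unfold_locales
  have R_nonneg: "0 \<le> R w w" if "w \<in> W" for w
  proof (cases "D w w = 0")
    case True then show ?thesis using Q_lower[of w] that W by (auto simp: R_def)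
  next
    case False
    then have "l \<le> Q w w / D w w" unfolding l_def S_def using that bdd
      by (intro cInf_lower) (auto simp: S_def)
    then show ?thesis using pos[of w] False that W by (auto simp: R_def field_simps)
  qed
  have "\<exists>w\<in>W. D w w = 1 \<and> R w w < 1 / Suc n" for n
  proof -
    have "Inf S < l + 1 / Suc n" by (simp add: l_def)
    then obtain s where s: "s \<in> S" "s < l + 1 / Suc n" using cInf_lessD w0S by blast
    then obtain w where w: "w \<in> W" "D w w \<noteq> 0" "s = Q w w / D w w" by (auto simp: S_def)
    define c where "c = 1 / sqrt (D w w)"
    have c: "c\<^sup>2 = 1 / D w w" using pos[of w] w W by (auto simp: c_def power_divide)
    have 1: "D (\<lambda>x. c * w x) (\<lambda>x. c * w x) = 1" "Q (\<lambda>x. c * w x) (\<lambda>x. c * w x) = s"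
      using D.square_scale[of w c] Q.square_scale[of w c] w W c by auto
    show ?thesis
      using s(2) 1 fun_subspaceD(3)[OF W(1) w(1), of c] by (intro bexI[of _ "\<lambda>x. c * w x"]) (auto simp: R_def)
  qed
  then obtain w where w: "\<And>n. w n \<in> W" "\<And>n. D (w n) (w n) = 1" "\<And>n. R (w n) (w n) < 1 / Suc n"
    by metis
  have wE: "w n \<in> E" for n using w(1) W by blast
  \<comment> \<open>Here \<open>A = R + K + l D\<close> with \<open>R < 1\<close>,
    \<open>\<bar>K\<bar> \<le> C\<close>, \<open>D = 1\<close> and \<open>l < 0\<close>.\<close>
  have AD: "A (w n) (w n) + D (w n) (w n) \<le> 2 + C" for n
  proof -
    have "1 / real (Suc n) \<le> 1" by simp
    then have "R (w n) (w n) < 1" using w(3)[of n] by linarith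
    then show ?thesis using w(2)[of n] l K_bound[OF wE[of n]] by (simp add: R_def Q_def abs_le_iff)
  qed
  from compact[where w=w, OF wE AD] obtain r :: "nat \<Rightarrow> nat" where r: "strict_mono r"
    "\<And>e. e > 0 \<Longrightarrow> \<exists>N. \<forall>m\<ge>N. \<forall>n\<ge>N. \<bar>K (\<lambda>x. w (r m) x - w (r n) x) (\<lambda>x. w (r m) x - w (r n) x)\<bar> < e"
    by (elim exE conjE) (rule that, assumption, blast)
  \<comment> \<open>The coercivity constant: \<open>A - l D\<close> dominates
    \<open>t (A + D)\<close> because \<open>t \<le> 1\<close> and \<open>t \<le> -l\<close>. It is
    positive because the infimum is negative.\<close>
  define t where "t = min 1 (-l)"
  have t: "0 < t" "t \<le> 1" "t \<le> -l" using l by (auto simp: t_def)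
  \<comment> \<open>The parallelogram identity with the nonnegative term for \<open>u + v\<close>
    dropped.\<close>
  have R2: "R (\<lambda>x. u x - v x) (\<lambda>x. u x - v x) \<le> 2 * R u u + 2 * R v v" if "u \<in> W" "v \<in> W" for u v
  proof -
    have "0 \<le> R (\<lambda>x. u x + v x) (\<lambda>x. u x + v x)" using R_nonneg fun_subspaceD(2)[OF W(1)] that by blast
    then show ?thesis using R.square_add[of u v] R.square_diff[of u v] that subsetD[OF W(2)] by simp
  qed
  have "\<exists>v\<in>E. (\<lambda>n. A (\<lambda>x. w (r n) x - v x) (\<lambda>x. w (r n) x - v x) + D (\<lambda>x. w (r n) x - v x) (\<lambda>x. w (r n) x - v x)) \<longlonglongrightarrow> 0"
  proof (rule complete)
    fix e :: real assume e: "e > 0"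
    have "e * t / 2 > 0" using e t by simp
    from r(2)[OF this] obtain N where N: "\<And>m n. m \<ge> N \<Longrightarrow> n \<ge> N \<Longrightarrow>
      \<bar>K (\<lambda>x. w (r m) x - w (r n) x) (\<lambda>x. w (r m) x - w (r n) x)\<bar> < e * t / 2" by blast
    \<comment> \<open>With \<open>R < e * t / 8\<close> for both terms the parallelogram bound
      contributes \<open>e * t / 2\<close>, and \<open>K\<close> contributes the other half.\<close>
    obtain N' :: nat where N': "8 / (e * t) < N'" using reals_Archimedean2 by blast
    have small: "R (w (r n)) (w (r n)) < e * t / 8" if "n \<ge> N'" for n
    proof -
      have "N' \<le> r n" using seq_suble[OF r(1), of n] that by simp
      then have "8 / (e * t) < Suc (r n)" using N' by linarith
      then have "1 / Suc (r n) < e * t / 8" using e t by (simp add: field_simps)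
      then show ?thesis using w(3)[of "r n"] by linarith
    qed
    show "\<exists>N. \<forall>m\<ge>N. \<forall>n\<ge>N. A (\<lambda>x. w (r m) x - w (r n) x) (\<lambda>x. w (r m) x - w (r n) x) +
        D (\<lambda>x. w (r m) x - w (r n) x) (\<lambda>x. w (r m) x - w (r n) x) < e"
    proof (intro exI allI impI)
      fix m n assume mn: "max N N' \<le> m" "max N N' \<le> n"
      let ?u = "\<lambda>x. w (r m) x - w (r n) x"
      have u: "?u \<in> E" using fun_subspace_diff[OF E] wE by blast
      have "t * (A ?u ?u + D ?u ?u) \<le> A ?u ?u + (-l) * D ?u ?u"
        using mult_right_mono[OF t(2) A_nonneg[OF u]] mult_right_mono[OF t(3) D_nonneg[OF u]]
        by (simp add: distrib_left)
      also have "\<dots> = R ?u ?u + K ?u ?u" by (simp add: R_def Q_def)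
      also have "\<dots> < e * t / 2 + e * t / 2"
        using R2[OF w(1)[of "r m"] w(1)[of "r n"]] small[of m] small[of n] N[of m n] mn by linarith
      finally show "A ?u ?u + D ?u ?u < e" using t by (simp add: mult.commute)
    qed
  qed (use wE in auto)
  then obtain v where v: "v \<in> E"
    "(\<lambda>n. A (\<lambda>x. w (r n) x - v x) (\<lambda>x. w (r n) x - v x) + D (\<lambda>x. w (r n) x - v x) (\<lambda>x. w (r n) x - v x)) \<longlonglongrightarrow> 0"
    by blast
  define d where "d n = (\<lambda>x. w (r n) x - v x)" for n
  have d: "d n \<in> E" for n unfolding d_def using fun_subspace_diff[OF E] wE v(1) by blast
  have AD0: "(\<lambda>n. A (d n) (d n) + D (d n) (d n)) \<longlonglongrightarrow> 0" using v(2) by (simp add: d_def)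
  have dA: "(\<lambda>n. A (d n) (d n)) \<longlonglongrightarrow> 0" and dD: "(\<lambda>n. D (d n) (d n)) \<longlonglongrightarrow> 0"
    using A_nonneg[OF d] D_nonneg[OF d]
    by (auto intro!: tendsto_sandwich[OF _ _ tendsto_const AD0] always_eventually)
  have dDp: "(\<lambda>n. D (d n) p) \<longlonglongrightarrow> 0" if p: "p \<in> E" for p
  proof (rule tendsto_0_le[where K=1])
    show "(\<lambda>n. sqrt (D (d n) (d n) * D p p)) \<longlonglongrightarrow> 0" using tendsto_real_sqrt[OF tendsto_mult_left_zero[OF dD]] by simp
    have "\<bar>D (d n) p\<bar> \<le> sqrt (D (d n) (d n) * D p p)" for n
      using D.Cauchy_Schwarz_psd[OF E subset_refl D_nonneg d p] by (simp add: real_le_rsqrt)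
    then show "\<forall>\<^sub>F n in sequentially. norm (D (d n) p) \<le> norm (sqrt (D (d n) (d n) * D p p)) * 1"
      using D_nonneg[OF d] D_nonneg[OF p] by (auto intro!: always_eventually)
  qed
  have vW: "v \<in> W"
  proof -
    have "D v p = 0" if p: "p \<in> P" for p
    proof -
      have "D (d n) p = - D v p" for n
        using w(1)[of "r n"] p P D.diff_l[of "w (r n)" v p] wE v by (auto simp: d_def W_def)
      then show ?thesis using dDp[of p] p P by (auto simp: LIMSEQ_const_iff)
    qed
    then show ?thesis using v by (simp add: W_def)
  qed
  have "D v v = 1"
  proof -
    have "D (w (r n)) (w (r n)) = D (d n) (d n) + 2 * D (d n) v + D v v" for n
      using D.square_add[OF d[of n] v(1)] by (simp add: d_def)
    then have "(\<lambda>n. D (d n) (d n) + 2 * D (d n) v + D v v) = (\<lambda>n. 1)" using w(2) by simp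
    moreover have "(\<lambda>n. D (d n) (d n) + 2 * D (d n) v + D v v) \<longlonglongrightarrow> 0 + 2 * 0 + D v v"
      by (intro tendsto_intros dD dDp v)
    ultimately show ?thesis by (simp add: LIMSEQ_const_iff)
  qed
  moreover have "R v v = 0"
  proof -
    \<comment> \<open>\<open>v\<close> is the difference of \<open>w (r n)\<close> and
      \<open>d n\<close>, both in \<open>W\<close>, so the parallelogram bound applies;
      \<open>R (d n) (d n)\<close> is controlled by \<open>A\<close> and \<open>D\<close> of
      \<open>d n\<close>, which tend to zero.\<close>
    have "R v v \<le> 2 / Suc n + 2 * (A (d n) (d n) + (C - l) * D (d n) (d n))" for n
    proof -
      have "v = (\<lambda>x. w (r n) x - d n x)" by (auto simp: d_def)
      moreover have "d n \<in> W" unfolding d_def using fun_subspace_diff[OF W(1) w(1) vW] .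
      ultimately have "R v v \<le> 2 * R (w (r n)) (w (r n)) + 2 * R (d n) (d n)"
        using R2[OF w(1)[of "r n"], of "d n"] by simp
      moreover have "R (d n) (d n) \<le> A (d n) (d n) + (C - l) * D (d n) (d n)"
        using K_bound[OF d[of n]] by (auto simp: R_def Q_def abs_le_iff algebra_simps)
      moreover have "R (w (r n)) (w (r n)) \<le> 1 / Suc n"
      proof -
        have "1 / real (Suc (r n)) \<le> 1 / Suc n" using seq_suble[OF r(1), of n] by (simp add: frac_le)
        then show ?thesis using w(3)[of "r n"] by linarith
      qed
      ultimately show ?thesis by simp
    qed
    moreover have "(\<lambda>n. 2 / Suc n + 2 * (A (d n) (d n) + (C - l) * D (d n) (d n))) \<longlonglongrightarrow> 0 + 2 * (0 + (C - l) * 0)"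
      by (intro tendsto_intros dA dD) (use LIMSEQ_Suc[OF lim_const_over_n[of "2::real"]] in simp)
    ultimately have "R v v \<le> 0" using LIMSEQ_le_const[of _ 0 "R v v"] by auto
    then show ?thesis using R_nonneg[OF vW] by simp
  qed
  ultimately have "minimizer P v"
    using R_nonneg vW unfolding minimizer_def W_def R_def by (auto simp: v)
  then show ?thesis by blast
qed

text \<open>Nothing is differentiated: with \<open>l\<close> the minimal quotient,
  \<open>Q - l D\<close> is nonnegative on the admissible competitors and vanishes at
  \<open>\<psi>\<close>, so Cauchy-Schwarz makes it vanish on every pair that contains
  \<open>\<psi>\<close>.\<close>

lemma minimizer_Euler_Lagrange:
  assumes P: "P \<subseteq> E" and m: "minimizer P \<psi>" and v: "v \<in> E" "\<And>p. p \<in> P \<Longrightarrow> D v p = 0"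
  shows "Q \<psi> v = Q \<psi> \<psi> / D \<psi> \<psi> * D \<psi> v"
proof -
  define W where "W = {w \<in> E. \<forall>p\<in>P. D w p = 0}"
  have W: "fun_subspace W" "W \<subseteq> E"
    unfolding W_def using fun_subspace_orth[OF E formD P] by auto
  define l where "l = Q \<psi> \<psi> / D \<psi> \<psi>"
  define R where "R u v = Q u v - l * D u v" for u v
  interpret R: sym_form E R using form_combine[of l] E unfolding R_def by unfold_locales
  have pos: "0 < D \<psi> \<psi>" using m D_nonneg[of \<psi>] by (simp add: minimizer_def less_le)
  have "0 \<le> R w w" if "w \<in> W" for w
    using m pos that by (auto simp: R_def l_def W_def minimizer_def field_simps)
  then have "(R \<psi> v)\<^sup>2 \<le> R \<psi> \<psi> * R v v"
    using R.Cauchy_Schwarz_psd[OF W, of \<psi> v] m v by (auto simp: minimizer_def W_def)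
  moreover have "R \<psi> \<psi> = 0" using pos by (simp add: R_def l_def)
  ultimately show ?thesis by (simp add: R_def l_def)
qed

definition chain :: "(nat \<Rightarrow> 'a \<Rightarrow> real) \<Rightarrow> nat \<Rightarrow> bool" where
  "chain \<psi> k \<longleftrightarrow> (\<forall>j<k. minimizer (\<psi> ` {..<j}) (\<psi> j) \<and> Q (\<psi> j) (\<psi> j) < 0)"

lemma chainD:
  assumes "chain \<psi> k" "j < k"
  shows "\<psi> j \<in> E" "Q (\<psi> j) (\<psi> j) < 0" "0 < D (\<psi> j) (\<psi> j)" "minimizer (\<psi> ` {..<j}) (\<psi> j)"
proof -
  show m: "minimizer (\<psi> ` {..<j}) (\<psi> j)" and "Q (\<psi> j) (\<psi> j) < 0"
    using assms by (auto simp: chain_def)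
  from m show 1: "\<psi> j \<in> E" by (auto simp: minimizer_def)
  show "0 < D (\<psi> j) (\<psi> j)" using D_nonneg[OF 1] m by (auto simp: minimizer_def less_le)
qed

lemma chain_orthogonal:
  assumes "chain \<psi> k" "i < k" "j < k" "i \<noteq> j"
  shows "D (\<psi> i) (\<psi> j) = 0"
proof (cases "i < j")
  case True
  then have "D (\<psi> j) (\<psi> i) = 0" using chainD(4)[OF assms(1,3)] by (auto simp: minimizer_def)
  then show ?thesis using D.sym chainD(1)[OF assms(1)] assms by simp
next
  case False
  then show ?thesis using chainD(4)[OF assms(1,2)] assms(4) by (auto simp: minimizer_def)
qed

text \<open>The Euler-Lagrange equation is known only against \<open>v\<close> orthogonal to the
  earlier members. Any other \<open>v\<close> differs from such a function by its projection
  \<open>p\<close> to their span, and on the span both sides vanish: \<open>D\<close> by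
  construction, and \<open>Q\<close> by symmetry and the equation for the earlier members, that is
  by induction.\<close>

lemma chain_eigen:
  assumes ch: "chain \<psi> k" and "j < k" "v \<in> E"
  shows "Q (\<psi> j) v = Q (\<psi> j) (\<psi> j) / D (\<psi> j) (\<psi> j) * D (\<psi> j) v"
  using assms(2,3)
proof (induction j arbitrary: v rule: less_induct)
  case (less j)
  have mem: "\<psi> i \<in> E" if "i \<le> j" for i using chainD(1)[OF ch] that less.prems by auto
  define c where "c i = D v (\<psi> i) / D (\<psi> i) (\<psi> i)" for i
  define p where "p = (\<lambda>x. \<Sum>i<j. c i * \<psi> i x)"
  define v' where "v' = (\<lambda>x. v x - p x)"
  have pE: "p \<in> E" unfolding p_def using mem by (intro fun_subspace_sum[OF E]) auto
  have v'E: "v' \<in> E" unfolding v'_def using fun_subspace_diff[OF E less.prems(2) pE] .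
  have Dp: "D p (\<psi> l) = D v (\<psi> l)" if l: "l < j" for l
  proof -
    have "D p (\<psi> l) = (\<Sum>i<j. c i * D (\<psi> i) (\<psi> l))" unfolding p_def using mem l by (intro D.sum_l) auto
    also have "\<dots> = (\<Sum>i<j. if i = l then c i * D (\<psi> l) (\<psi> l) else 0)"
      using chain_orthogonal[OF ch] l less.prems by (intro sum.cong) auto
    also have "\<dots> = D v (\<psi> l)" using l chainD(3)[OF ch, of l] less.prems by (simp add: c_def)
    finally show ?thesis .
  qed
  have "D v' q = 0" if "q \<in> \<psi> ` {..<j}" for q
    using that Dp D.diff_l[OF less.prems(2) pE] mem by (auto simp: v'_def)
  then have EL: "Q (\<psi> j) v' = Q (\<psi> j) (\<psi> j) / D (\<psi> j) (\<psi> j) * D (\<psi> j) v'"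
    by (intro minimizer_Euler_Lagrange[OF _ chainD(4)[OF ch less.prems(1)] v'E]) (auto simp: mem)
  have "Q (\<psi> j) p = (\<Sum>i<j. c i * Q (\<psi> j) (\<psi> i))" "D (\<psi> j) p = (\<Sum>i<j. c i * D (\<psi> j) (\<psi> i))"
    unfolding p_def using mem by (auto intro!: Q.sum_r D.sum_r)
  moreover have "Q (\<psi> j) (\<psi> i) = 0" "D (\<psi> j) (\<psi> i) = 0" if i: "i < j" for i
  proof -
    show "D (\<psi> j) (\<psi> i) = 0" using chain_orthogonal[OF ch less.prems(1), of i] i less.prems by auto
    then have "D (\<psi> i) (\<psi> j) = 0" using D.sym mem i by simp
    then have "Q (\<psi> i) (\<psi> j) = 0" using less.IH[OF i, of "\<psi> j"] mem i less.prems by simp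
    then show "Q (\<psi> j) (\<psi> i) = 0" using Q.sym mem i by simp
  qed
  ultimately have "Q (\<psi> j) p = 0" "D (\<psi> j) p = 0" by auto
  moreover have "Q (\<psi> j) v' = Q (\<psi> j) v - Q (\<psi> j) p" "D (\<psi> j) v' = D (\<psi> j) v - D (\<psi> j) p"
    unfolding v'_def
    using Q.diff_l[OF less.prems(2) pE mem[of j]] D.diff_l[OF less.prems(2) pE mem[of j]]
      Q.sym[of "\<psi> j"] D.sym[of "\<psi> j"] mem[of j] v'E less.prems pE by (auto simp: v'_def)
  ultimately show ?case using EL by simp
qed

lemma chain_Q_orthogonal:
  assumes "chain \<psi> k" "i < k" "j < k" "i \<noteq> j"
  shows "Q (\<psi> i) (\<psi> j) = 0"
  using chain_eigen[OF assms(1,2) chainD(1)[OF assms(1,3)]] chain_orthogonal[OF assms] by simp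

text \<open>On the span of a chain the form \<open>Q\<close> is diagonal, with negative diagonal
  entries.\<close>

lemma chain_neg_family:
  assumes ch: "chain \<psi> k"
  shows "neg_family E Q k"
  unfolding neg_family_def
proof (intro exI[of _ \<psi>] conjI allI impI)
  show "\<psi> i \<in> E" if "i < k" for i using chainD(1)[OF ch that] .
  fix c :: "nat \<Rightarrow> real" assume "\<exists>i<k. c i \<noteq> 0"
  then obtain i where i: "i < k" "c i \<noteq> 0" by blast
  have "Q (\<lambda>x. \<Sum>i<k. c i * \<psi> i x) (\<lambda>x. \<Sum>i<k. c i * \<psi> i x) = (\<Sum>i<k. (c i)\<^sup>2 * Q (\<psi> i) (\<psi> i))"
    using chainD(1)[OF ch] chain_Q_orthogonal[OF ch] by (intro Q.square_sum) auto
  also have "\<dots> < (\<Sum>i<k. 0)"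
    using chainD(2)[OF ch] i
    by (intro sum_strict_mono_ex1) (auto simp: mult_nonneg_nonpos less_imp_le intro!: bexI[of _ i] mult_pos_neg)
  finally show "Q (\<lambda>x. \<Sum>i<k. c i * \<psi> i x) (\<lambda>x. \<Sum>i<k. c i * \<psi> i x) < 0" by simp
qed

text \<open>Orthogonality to the chain with respect to \<open>D\<close> is expressed through \<open>Q\<close>, because
  \<open>D v (\<psi> j)\<close> need not be meaningful for \<open>v\<close> in the larger space \<open>X\<close>.\<close>

lemma neg_family_extends_chain:
  assumes X: "fun_subspace X" and QX: "form_on X Q" and EX: "E \<subseteq> X"
    and dense: "\<And>v. v \<in> X \<Longrightarrow> \<exists>s. (\<forall>n. s n \<in> E) \<and> (\<lambda>n. Q (s n) (s n)) \<longlonglongrightarrow> Q v v \<and>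
      (\<forall>\<phi>\<in>E. (\<lambda>n. Q (s n) \<phi>) \<longlonglongrightarrow> Q v \<phi>)"
    and neg: "neg_family X Q k" and ch: "chain \<psi> j" and "j < k"
  shows "\<exists>w\<in>E. (\<forall>p\<in>\<psi> ` {..<j}. D w p = 0) \<and> Q w w < 0"
proof -
  interpret X: sym_form X Q using X QX by unfold_locales
  obtain w where w: "\<And>i. i < k \<Longrightarrow> w i \<in> X"
    and wneg: "\<And>c. (\<exists>i<k. c i \<noteq> 0) \<Longrightarrow> Q (\<lambda>x. \<Sum>i<k. c i * w i x) (\<lambda>x. \<Sum>i<k. c i * w i x) < 0"
    using neg by (auto simp: neg_family_def)
  \<comment> \<open>These are \<open>j\<close> linear conditions on \<open>k > j\<close>
    coefficients, so some nontrivial combination \<open>v\<close> is \<open>Q\<close>-orthogonal to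
    the chain.\<close>
  obtain c where c: "\<exists>i\<in>{..<k}. c i \<noteq> 0" "\<forall>l\<in>{..<j}. (\<Sum>i<k. c i * Q (w i) (\<psi> l)) = 0"
    using homogeneous_system_nontrivial[of "{..<j}" "{..<k}" "\<lambda>i l. Q (w i) (\<psi> l)"] \<open>j < k\<close> by auto
  define v where "v = (\<lambda>x. \<Sum>i<k. c i * w i x)"
  have mem: "\<psi> l \<in> E" if "l < j" for l using chainD(1)[OF ch that] .
  have v: "v \<in> X" unfolding v_def using w by (intro fun_subspace_sum[OF X]) auto
  have vneg: "Q v v < 0" unfolding v_def using wneg[of c] c(1) by blast
  have v0: "Q v (\<psi> l) = 0" if "l < j" for l
    unfolding v_def using X.sum_l[of "{..<k}" w "\<psi> l" c] w mem[OF that] EX c(2) that by auto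
  obtain s where s: "\<And>n. s n \<in> E" "(\<lambda>n. Q (s n) (s n)) \<longlonglongrightarrow> Q v v"
      "\<And>\<phi>. \<phi> \<in> E \<Longrightarrow> (\<lambda>n. Q (s n) \<phi>) \<longlonglongrightarrow> Q v \<phi>"
    using dense[OF v] by blast
  \<comment> \<open>The coefficients of the \<open>Q\<close>-projection of the approximant
    \<open>s n\<close> to the chain. They tend to those of \<open>v\<close>, which vanish, so
    subtracting the projection \<open>p n\<close> restores orthogonality without changing the limit
    of the energy.\<close>
  define b where "b n l = Q (s n) (\<psi> l) / Q (\<psi> l) (\<psi> l)" for n l
  define p where "p n = (\<lambda>x. \<Sum>l<j. b n l * \<psi> l x)" for n
  have pE: "p n \<in> E" for n unfolding p_def using mem by (intro fun_subspace_sum[OF E]) auto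
  have b_sq: "(b n l)\<^sup>2 * Q (\<psi> l) (\<psi> l) = b n l * Q (s n) (\<psi> l)" if "l < j" for n l
    using chainD(2)[OF ch that] by (simp add: b_def power2_eq_square)
  have Qpp: "Q (p n) (p n) = (\<Sum>l<j. b n l * Q (s n) (\<psi> l))" for n
    unfolding p_def using mem chain_Q_orthogonal[OF ch] b_sq by (subst Q.square_sum) auto
  have Qsp: "Q (s n) (p n) = (\<Sum>l<j. b n l * Q (s n) (\<psi> l))" for n
    unfolding p_def using mem s(1) by (intro Q.sum_r) auto
  have Qd: "Q (\<lambda>x. s n x - p n x) (\<lambda>x. s n x - p n x) = Q (s n) (s n) - (\<Sum>l<j. b n l * Q (s n) (\<psi> l))" for n
    using Q.square_diff[OF s(1) pE, of n n] Qpp[of n] Qsp[of n] by simp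
  have "(\<lambda>n. Q (\<lambda>x. s n x - p n x) (\<lambda>x. s n x - p n x)) \<longlonglongrightarrow> Q v v - (\<Sum>l<j. (Q v (\<psi> l) / Q (\<psi> l) (\<psi> l)) * Q v (\<psi> l))"
    unfolding Qd b_def using chainD(2)[OF ch] mem by (intro tendsto_intros s) force+
  then have "(\<lambda>n. Q (\<lambda>x. s n x - p n x) (\<lambda>x. s n x - p n x)) \<longlonglongrightarrow> Q v v" using v0 by simp
  from order_tendstoD(2)[OF this vneg] obtain n where n: "Q (\<lambda>x. s n x - p n x) (\<lambda>x. s n x - p n x) < 0"
    using eventually_happens'[OF sequentially_bot] by blast
  let ?u = "\<lambda>x. s n x - p n x"
  have u: "?u \<in> E" using fun_subspace_diff[OF E s(1) pE] .
  have "D ?u (\<psi> l) = 0" if l: "l < j" for l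
  proof -
    have "Q (p n) (\<psi> l) = (\<Sum>i<j. b n i * Q (\<psi> i) (\<psi> l))" unfolding p_def using mem l by (intro Q.sum_l) auto
    also have "\<dots> = (\<Sum>i<j. if i = l then b n i * Q (\<psi> l) (\<psi> l) else 0)"
      using chain_Q_orthogonal[OF ch] l by (intro sum.cong) auto
    also have "\<dots> = Q (s n) (\<psi> l)" using l chainD(2)[OF ch l] by (simp add: b_def)
    finally have "Q ?u (\<psi> l) = 0" using Q.diff_l[OF s(1) pE mem[OF l]] by simp
    \<comment> \<open>The way back to \<open>D\<close>: the eigenvalue equation turns
      \<open>Q\<close>-orthogonality into \<open>D\<close>-orthogonality because the eigenvalue of
      \<open>\<psi> l\<close> is not zero.\<close>
    then have "Q (\<psi> l) ?u = 0" using Q.sym u mem l by simp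
    then have "D (\<psi> l) ?u = 0" using chain_eigen[OF ch l u] chainD(2,3)[OF ch l] by simp
    then show ?thesis using D.sym u mem l by simp
  qed
  then show ?thesis using n u by blast
qed

text \<open>The sign is asserted for every minimiser, since a chain is continued by an arbitrary
  choice among them.\<close>

lemma neg_family_minimizer:
  assumes "fun_subspace X" "form_on X Q" "E \<subseteq> X"
    and "\<And>v. v \<in> X \<Longrightarrow> \<exists>s. (\<forall>n. s n \<in> E) \<and> (\<lambda>n. Q (s n) (s n)) \<longlonglongrightarrow> Q v v \<and>
      (\<forall>\<phi>\<in>E. (\<lambda>n. Q (s n) \<phi>) \<longlonglongrightarrow> Q v \<phi>)"
    and "neg_family X Q k" and ch: "chain \<psi> j" and "j < k"
  shows "\<exists>\<phi>. minimizer (\<psi> ` {..<j}) \<phi>" "minimizer (\<psi> ` {..<j}) \<phi> \<Longrightarrow> Q \<phi> \<phi> < 0"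
proof -
  obtain w where w: "w \<in> E" "\<forall>p\<in>\<psi> ` {..<j}. D w p = 0" "Q w w < 0"
    using neg_family_extends_chain[OF assms] by blast
  show "\<exists>\<phi>. minimizer (\<psi> ` {..<j}) \<phi>"
    using w chainD(1)[OF ch] by (intro minimizer_exists[of _ w]) auto
  assume m: "minimizer (\<psi> ` {..<j}) \<phi>"
  then have \<phi>: "0 < D \<phi> \<phi>" using D_nonneg[of \<phi>] by (auto simp: minimizer_def less_le)
  have "Q \<phi> \<phi> * D w w \<le> Q w w * D \<phi> \<phi>" using m w by (auto simp: minimizer_def)
  also have "\<dots> < 0" using w \<phi> by (simp add: mult_neg_pos)
  finally show "Q \<phi> \<phi> < 0" using D_nonneg[OF w(1)] by (smt (verit) mult_nonneg_nonneg)
qed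

end

section \<open>Square integrable functions\<close>

definition square_integrable :: "'a measure \<Rightarrow> ('a \<Rightarrow> 'b::euclidean_space) \<Rightarrow> bool" where
  "square_integrable M f \<longleftrightarrow> f \<in> borel_measurable M \<and> integrable M (\<lambda>x. (norm (f x))\<^sup>2)"

lemma square_integrableD [simp]:
  "square_integrable M f \<Longrightarrow> f \<in> borel_measurable M"
  "square_integrable M f \<Longrightarrow> integrable M (\<lambda>x. (norm (f x))\<^sup>2)"
  by (auto simp: square_integrable_def)

lemma two_mult_le_squares: "2 * (a::real) * b \<le> a\<^sup>2 + b\<^sup>2"
  using sum_squares_bound[of a b] by simp

lemma norm_add_square_le: "(norm (x + y))\<^sup>2 \<le> 2 * (norm x)\<^sup>2 + 2 * (norm (y::'b::real_normed_vector))\<^sup>2"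
proof -
  have "(norm (x + y))\<^sup>2 \<le> (norm x + norm y)\<^sup>2" by (simp add: norm_triangle_ineq power_mono)
  also have "\<dots> \<le> 2 * (norm x)\<^sup>2 + 2 * (norm y)\<^sup>2"
    using two_mult_le_squares[of "norm x" "norm y"] by (simp add: power2_sum)
  finally show ?thesis .
qed

lemma norm_diff_square_le: "(norm (x - y))\<^sup>2 \<le> 2 * (norm x)\<^sup>2 + 2 * (norm (y::'b::real_normed_vector))\<^sup>2"
  using norm_add_square_le[of x "-y"] by simp

lemma square_integrable_bound:
  assumes "square_integrable M g" "f \<in> borel_measurable M" "AE x in M. norm (f x) \<le> c * norm (g x)"
  shows "square_integrable M f"
  unfolding square_integrable_def
proof
  show "integrable M (\<lambda>x. (norm (f x))\<^sup>2)"
  proof (rule Bochner_Integration.integrable_bound)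
    show "integrable M (\<lambda>x. c\<^sup>2 * (norm (g x))\<^sup>2)" using assms(1) by auto
    show "AE x in M. norm ((norm (f x))\<^sup>2) \<le> norm (c\<^sup>2 * (norm (g x))\<^sup>2)"
      using assms(3)
    proof eventually_elim
      case (elim x)
      then show ?case using power_mono[OF elim, of 2] by (simp add: power_mult_distrib)
    qed
  qed (use assms in measurable)
qed fact

lemma square_integrable_add:
  assumes "square_integrable M f" "square_integrable M g"
  shows "square_integrable M (\<lambda>x. f x + g x)"
  unfolding square_integrable_def
proof
  have [measurable]: "f \<in> borel_measurable M" "g \<in> borel_measurable M" using assms by simp_all
  show "(\<lambda>x. f x + g x) \<in> borel_measurable M" by measurable
  show "integrable M (\<lambda>x. (norm (f x + g x))\<^sup>2)"
  proof (rule Bochner_Integration.integrable_bound)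
    show "integrable M (\<lambda>x. 2 * (norm (f x))\<^sup>2 + 2 * (norm (g x))\<^sup>2)" using assms by simp
    show "AE x in M. norm ((norm (f x + g x))\<^sup>2) \<le> norm (2 * (norm (f x))\<^sup>2 + 2 * (norm (g x))\<^sup>2)"
      using norm_add_square_le by (intro AE_I2) simp
  qed measurable
qed

lemma square_integrable_scaleR:
  assumes "square_integrable M f"
  shows "square_integrable M (\<lambda>x. c *\<^sub>R f x)"
proof (rule square_integrable_bound[OF assms, of _ "\<bar>c\<bar>"])
  have [measurable]: "f \<in> borel_measurable M" using assms by simp
  show "(\<lambda>x. c *\<^sub>R f x) \<in> borel_measurable M" by measurable
qed auto

lemma square_integrable_diff:
  assumes "square_integrable M f" "square_integrable M g"
  shows "square_integrable M (\<lambda>x. f x - g x)"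
  using square_integrable_add[OF assms(1) square_integrable_scaleR[OF assms(2), of "-1"]] by simp

lemma square_integrable_inner:
  assumes "square_integrable M f" "square_integrable M g"
  shows "integrable M (\<lambda>x. f x \<bullet> g x)"
proof (rule Bochner_Integration.integrable_bound)
  have [measurable]: "f \<in> borel_measurable M" "g \<in> borel_measurable M" using assms by simp_all
  show "integrable M (\<lambda>x. (norm (f x))\<^sup>2 + (norm (g x))\<^sup>2)" using assms by simp
  show "(\<lambda>x. f x \<bullet> g x) \<in> borel_measurable M" by measurable
  have "\<bar>f x \<bullet> g x\<bar> \<le> (norm (f x))\<^sup>2 + (norm (g x))\<^sup>2" for x
    using Cauchy_Schwarz_ineq2[of "f x" "g x"] two_mult_le_squares[of "norm (f x)" "norm (g x)"]
      mult_nonneg_nonneg[OF norm_ge_zero[of "f x"] norm_ge_zero[of "g x"]] by linarith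
  then show "AE x in M. norm (f x \<bullet> g x) \<le> norm ((norm (f x))\<^sup>2 + (norm (g x))\<^sup>2)" by simp
qed

lemma square_integrable_mult:
  fixes f g :: "'a \<Rightarrow> real"
  assumes "square_integrable M f" "square_integrable M g"
  shows "integrable M (\<lambda>x. f x * g x)"
  using square_integrable_inner[OF assms] by simp

lemma L2_add_le:
  assumes "square_integrable M f" "square_integrable M g"
  shows "(LINT x|M. (norm (f x + g x))\<^sup>2) \<le> 2 * (LINT x|M. (norm (f x))\<^sup>2) + 2 * (LINT x|M. (norm (g x))\<^sup>2)"
proof -
  have "(LINT x|M. (norm (f x + g x))\<^sup>2) \<le> (LINT x|M. 2 * (norm (f x))\<^sup>2 + 2 * (norm (g x))\<^sup>2)"
    using assms square_integrable_add[OF assms] norm_add_square_le by (intro integral_mono) auto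
  then show ?thesis using assms by simp
qed

lemma L2_Cauchy_Schwarz:
  assumes f: "square_integrable M f" and g: "square_integrable M g"
  shows "(LINT x|M. f x \<bullet> g x)\<^sup>2 \<le> (LINT x|M. (norm (f x))\<^sup>2) * (LINT x|M. (norm (g x))\<^sup>2)"
proof -
  define a b c where "a = (LINT x|M. (norm (f x))\<^sup>2)" "b = (LINT x|M. f x \<bullet> g x)" "c = (LINT x|M. (norm (g x))\<^sup>2)"
  have q: "0 \<le> a + 2 * t * b + t\<^sup>2 * c" for t
  proof -
    have "(norm (f x + t *\<^sub>R g x))\<^sup>2 = (norm (f x))\<^sup>2 + 2 * t * (f x \<bullet> g x) + t\<^sup>2 * (norm (g x))\<^sup>2" for x
      unfolding power2_norm_eq_inner
      by (simp add: algebra_simps inner_commute power2_eq_square)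
    then have "(LINT x|M. (norm (f x + t *\<^sub>R g x))\<^sup>2) = (LINT x|M. (norm (f x))\<^sup>2 + 2 * t * (f x \<bullet> g x) + t\<^sup>2 * (norm (g x))\<^sup>2)"
      by simp
    also have "\<dots> = a + 2 * t * b + t\<^sup>2 * c"
      using f g square_integrable_inner[OF f g] by (simp add: a_b_c_def)
    finally have "(LINT x|M. (norm (f x + t *\<^sub>R g x))\<^sup>2) = a + 2 * t * b + t\<^sup>2 * c" .
    moreover have "0 \<le> (LINT x|M. (norm (f x + t *\<^sub>R g x))\<^sup>2)" by simp
    ultimately show ?thesis by linarith
  qed
  have c: "0 \<le> c" by (simp add: a_b_c_def)
  have "b\<^sup>2 \<le> a * c"
  proof (cases "c = 0")
    case True
    have "b = 0"
    proof (rule ccontr)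
      assume "b \<noteq> 0"
      then show False using q[of "- (a + 1) / (2 * b)"] True by (simp add: field_simps)
    qed
    then show ?thesis using True by simp
  next
    case False
    then show ?thesis using q[of "- b / c"] c by (simp add: field_simps power2_eq_square)
  qed
  then show ?thesis by (simp add: a_b_c_def)
qed

text \<open>Square integrability is part of the notion because the integral of a nonintegrable
  function is \<open>0\<close> by convention, so a limit of integrals alone would carry no
  information.\<close>

definition L2_tendsto :: "'a measure \<Rightarrow> (nat \<Rightarrow> 'a \<Rightarrow> 'b::euclidean_space) \<Rightarrow> ('a \<Rightarrow> 'b) \<Rightarrow> bool" where
  "L2_tendsto M s f \<longleftrightarrow> (\<forall>n. square_integrable M (s n)) \<and> square_integrable M f \<and>
     (\<lambda>n. LINT x|M. (norm (s n x - f x))\<^sup>2) \<longlonglongrightarrow> 0"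

lemma L2_tendsto_inner:
  assumes "L2_tendsto M s f" "square_integrable M g"
  shows "(\<lambda>n. LINT x|M. s n x \<bullet> g x) \<longlonglongrightarrow> (LINT x|M. f x \<bullet> g x)"
proof -
  have sf: "square_integrable M (s n)" "square_integrable M f" for n using assms by (auto simp: L2_tendsto_def)
  have lim: "(\<lambda>n. sqrt ((LINT x|M. (norm (s n x - f x))\<^sup>2) * (LINT x|M. (norm (g x))\<^sup>2))) \<longlonglongrightarrow> 0"
  proof -
    have "(\<lambda>n. LINT x|M. (norm (s n x - f x))\<^sup>2) \<longlonglongrightarrow> 0" using assms(1) by (simp add: L2_tendsto_def)
    then show ?thesis using tendsto_real_sqrt[OF tendsto_mult_left_zero] by fastforce
  qed
  have "(\<lambda>n. (LINT x|M. s n x \<bullet> g x) - (LINT x|M. f x \<bullet> g x)) \<longlonglongrightarrow> 0"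
  proof (rule Lim_null_comparison[OF _ lim], intro always_eventually allI)
    fix n
    have "(LINT x|M. s n x \<bullet> g x) - (LINT x|M. f x \<bullet> g x) = (LINT x|M. (s n x - f x) \<bullet> g x)"
      using square_integrable_inner[OF sf(1) assms(2)] square_integrable_inner[OF sf(2) assms(2)] by (simp add: inner_diff_left)
    moreover have "\<bar>LINT x|M. (s n x - f x) \<bullet> g x\<bar> \<le> sqrt ((LINT x|M. (norm (s n x - f x))\<^sup>2) * (LINT x|M. (norm (g x))\<^sup>2))"
      using L2_Cauchy_Schwarz[OF square_integrable_diff[OF sf] assms(2)] by (intro real_le_rsqrt) simp
    ultimately show "norm ((LINT x|M. s n x \<bullet> g x) - (LINT x|M. f x \<bullet> g x)) \<le>
        sqrt ((LINT x|M. (norm (s n x - f x))\<^sup>2) * (LINT x|M. (norm (g x))\<^sup>2))" by simp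
  qed
  then show ?thesis by (simp add: LIM_zero_iff)
qed

lemma L2_tendsto_norm:
  assumes "L2_tendsto M s f"
  shows "(\<lambda>n. LINT x|M. (norm (s n x))\<^sup>2) \<longlonglongrightarrow> (LINT x|M. (norm (f x))\<^sup>2)"
proof -
  have sf: "square_integrable M (s n)" "square_integrable M f" for n using assms by (auto simp: L2_tendsto_def)
  have eq: "(LINT x|M. (norm (s n x))\<^sup>2) = (LINT x|M. (norm (s n x - f x))\<^sup>2)
      + 2 * (LINT x|M. s n x \<bullet> f x) - (LINT x|M. (norm (f x))\<^sup>2)" for n
  proof -
    have "(norm (s n x))\<^sup>2 = (norm (s n x - f x))\<^sup>2 + 2 * (s n x \<bullet> f x) - (norm (f x))\<^sup>2" for x
      unfolding power2_norm_eq_inner by (simp add: algebra_simps inner_commute)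
    then have "(LINT x|M. (norm (s n x))\<^sup>2) = (LINT x|M. (norm (s n x - f x))\<^sup>2 + 2 * (s n x \<bullet> f x) - (norm (f x))\<^sup>2)" by presburger
    also have "\<dots> = (LINT x|M. (norm (s n x - f x))\<^sup>2) + 2 * (LINT x|M. s n x \<bullet> f x) - (LINT x|M. (norm (f x))\<^sup>2)"
      using square_integrable_inner[OF sf(1) sf(2)] square_integrableD(2)[OF square_integrable_diff[OF sf]] square_integrableD(2)[OF sf(2)]
      by simp
    finally show ?thesis .
  qed
  have "(\<lambda>n. (LINT x|M. (norm (s n x - f x))\<^sup>2) + 2 * (LINT x|M. s n x \<bullet> f x) - (LINT x|M. (norm (f x))\<^sup>2))
     \<longlonglongrightarrow> 0 + 2 * (LINT x|M. f x \<bullet> f x) - (LINT x|M. (norm (f x))\<^sup>2)"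
    using assms by (intro tendsto_intros L2_tendsto_inner sf) (auto simp: L2_tendsto_def)
  then show ?thesis unfolding eq[symmetric] by (simp add: power2_norm_eq_inner)
qed

lemma L2_tendsto_AE_subseq:
  fixes s :: "nat \<Rightarrow> 'a \<Rightarrow> 'b::euclidean_space"
  assumes "L2_tendsto M s f"
  shows "\<exists>r::nat\<Rightarrow>nat. strict_mono r \<and> (AE x in M. (\<lambda>n. s (r n) x) \<longlonglongrightarrow> f x)"
proof -
  have sf: "square_integrable M (s n)" "square_integrable M f" for n using assms by (auto simp: L2_tendsto_def)
  have "\<exists>r::nat\<Rightarrow>nat. strict_mono r \<and> (AE x in M. (\<lambda>n. (norm (s (r n) x - f x))\<^sup>2) \<longlonglongrightarrow> 0)"
    using square_integrableD(2)[OF square_integrable_diff[OF sf]] assms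
    by (intro tendsto_L1_AE_subseq) (auto simp: L2_tendsto_def)
  then obtain r :: "nat \<Rightarrow> nat" where r: "strict_mono r" "AE x in M. (\<lambda>n. (norm (s (r n) x - f x))\<^sup>2) \<longlonglongrightarrow> 0" by blast
  from r(2) have "AE x in M. (\<lambda>n. s (r n) x) \<longlonglongrightarrow> f x"
  proof eventually_elim
    case (elim x)
    have "(\<lambda>n. sqrt ((norm (s (r n) x - f x))\<^sup>2)) \<longlonglongrightarrow> sqrt 0" by (rule tendsto_real_sqrt[OF elim])
    then have "(\<lambda>n. norm (s (r n) x - f x)) \<longlonglongrightarrow> 0" by (simp only: real_sqrt_abs abs_norm_cancel real_sqrt_zero)
    then show ?case by (rule LIM_zero_cancel[OF tendsto_norm_zero_cancel])
  qed
  with r(1) show ?thesis by blast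
qed

text \<open>The terms of a summable series are bounded, so the increments are at most
  \<open>sqrt B\<close> times powers of \<open>1 / sqrt 2\<close>, and the telescoping series
  converges absolutely.\<close>

lemma Cauchy_if_geometric_sum:
  fixes s :: "nat \<Rightarrow> 'b::banach"
  assumes "summable (\<lambda>n. 2 ^ n * (norm (s (Suc n) - s n))\<^sup>2)"
  shows "convergent s"
proof -
  obtain B where B: "\<And>n. \<bar>2 ^ n * (norm (s (Suc n) - s n))\<^sup>2\<bar> \<le> B"
    using summable_imp_Bseq[OF assms] by (auto simp: Bseq_def)
  define q where "q = 1 / sqrt 2"
  have q: "0 < q" "q < 1" "q\<^sup>2 = 1 / 2" by (auto simp: q_def power_divide)
  have "norm (s (Suc n) - s n) \<le> sqrt B * q ^ n" for n
  proof -
    have "(norm (s (Suc n) - s n))\<^sup>2 \<le> B * (1/2) ^ n" using B[of n] by (simp add: field_simps)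
    also have "(1/2) ^ n = (q ^ n)\<^sup>2" using q(3) by (metis power_even_eq power_mult mult.commute)
    finally have "norm (s (Suc n) - s n) \<le> sqrt (B * (q ^ n)\<^sup>2)" by (rule real_le_rsqrt)
    then show ?thesis using q by (simp add: real_sqrt_mult)
  qed
  note bound = this
  have "summable (\<lambda>n. s (Suc n) - s n)"
  proof (rule summable_comparison_test'[where g="\<lambda>n. sqrt B * q ^ n" and N=0])
    have "norm q < 1" using q(1,2) by simp
    from summable_mult[OF summable_geometric[OF this]] show "summable (\<lambda>n. sqrt B * q ^ n)" .
  qed (rule bound)
  then have "convergent (\<lambda>n. s n - s 0)"
    by (simp only: summable_iff_convergent sum_lessThan_telescope)
  then have "convergent (\<lambda>n. (s n - s 0) + s 0)" by (intro convergent_add convergent_const)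
  then show ?thesis by simp
qed

text \<open>Fatou's lemma. It yields square integrability of the limit together with the bound;
  membership in weighted spaces is later obtained from pointwise limits in this way.\<close>

lemma L2_bound_of_AE_lim:
  fixes s :: "nat \<Rightarrow> 'a \<Rightarrow> 'b::euclidean_space"
  assumes s: "\<And>n. square_integrable M (s n)" and f: "f \<in> borel_measurable M"
    and lim: "AE x in M. (\<lambda>n. s n x) \<longlonglongrightarrow> f x"
    and bd: "\<And>n. n \<ge> N \<Longrightarrow> (LINT x|M. (norm (s n x))\<^sup>2) \<le> c"
  shows "square_integrable M f" "(LINT x|M. (norm (f x))\<^sup>2) \<le> c"
proof -
  have [measurable]: "s n \<in> borel_measurable M" "f \<in> borel_measurable M" for n using s f by simp_all
  have c: "0 \<le> c" using bd[OF order_refl] by (rule order_trans[rotated]) simp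
  have "(\<integral>\<^sup>+x. ennreal ((norm (f x))\<^sup>2) \<partial>M) \<le> (\<integral>\<^sup>+x. liminf (\<lambda>n. ennreal ((norm (s n x))\<^sup>2)) \<partial>M)"
    using lim
  proof (intro nn_integral_mono_AE, eventually_elim)
    case (elim x)
    have "(\<lambda>n. ennreal ((norm (s n x))\<^sup>2)) \<longlonglongrightarrow> ennreal ((norm (f x))\<^sup>2)"
      by (intro tendsto_intros elim)
    then show ?case using lim_imp_Liminf[OF sequentially_bot] by fastforce
  qed
  also have "\<dots> \<le> liminf (\<lambda>n. \<integral>\<^sup>+x. ennreal ((norm (s n x))\<^sup>2) \<partial>M)"
    by (rule nn_integral_liminf) measurable
  also have "\<dots> \<le> liminf (\<lambda>n. ennreal c)"
  proof (rule Liminf_mono)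
    show "\<forall>\<^sub>F n in sequentially. (\<integral>\<^sup>+x. ennreal ((norm (s n x))\<^sup>2) \<partial>M) \<le> ennreal c"
      using eventually_ge_at_top[of N]
    proof eventually_elim
      case (elim n)
      then show ?case using bd[OF elim] s[of n] by (subst nn_integral_eq_integral) (auto simp: ennreal_leI)
    qed
  qed
  finally have le: "(\<integral>\<^sup>+x. ennreal ((norm (f x))\<^sup>2) \<partial>M) \<le> ennreal c" by (simp add: Liminf_const)
  show 1: "square_integrable M f"
    unfolding square_integrable_def
    using le by (intro conjI f integrableI_nonneg) (auto intro: le_less_trans)
  have "ennreal (LINT x|M. (norm (f x))\<^sup>2) \<le> ennreal c"
    using le 1 by (subst (asm) nn_integral_eq_integral) auto
  then show "(LINT x|M. (norm (f x))\<^sup>2) \<le> c" using c by (simp add: ennreal_le_iff)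
qed

text \<open>Along a fast subsequence the squared increments have integrals at most
  \<open>(1/4) ^ k\<close>, which stay summable after multiplication by \<open>2 ^ k\<close>. The
  weighted squares are therefore summable almost everywhere, and the subsequence converges
  pointwise. Fatou's lemma then gives convergence in norm of the whole sequence.\<close>

theorem Riesz_Fischer:
  fixes s :: "nat \<Rightarrow> 'a \<Rightarrow> 'b::euclidean_space"
  assumes s: "\<And>n. square_integrable M (s n)"
    and cauchy: "\<And>e. e > 0 \<Longrightarrow> \<exists>N. \<forall>m\<ge>N. \<forall>n\<ge>N. (LINT x|M. (norm (s m x - s n x))\<^sup>2) < e"
  shows "\<exists>f. L2_tendsto M s f"
proof -
  have [measurable]: "s n \<in> borel_measurable M" for n using s by auto
  have sd: "square_integrable M (\<lambda>x. s m x - s n x)" for m n by (intro square_integrable_diff s)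
  have "\<exists>N. \<forall>m\<ge>N. \<forall>n\<ge>N. (LINT x|M. (norm (s m x - s n x))\<^sup>2) < (1/4) ^ k" for k :: nat
    by (rule cauchy) simp
  then obtain N where N: "\<And>k m n. m \<ge> N k \<Longrightarrow> n \<ge> N k \<Longrightarrow> (LINT x|M. (norm (s m x - s n x))\<^sup>2) < (1/4) ^ k"
    by metis
  \<comment> \<open>Adding \<open>k\<close> and all thresholds up to \<open>N k\<close> makes
    \<open>r\<close> monotone, at least \<open>N k\<close> and at least \<open>k\<close>.\<close>
  define r where "r k = k + (\<Sum>i\<le>k. N i)" for k
  have r: "N k \<le> r k" "r k \<le> r (Suc k)" "k \<le> r k" for k
    using member_le_sum[of k "{..k}" N] by (auto simp: r_def)
  have d: "(LINT x|M. (norm (s (r (Suc k)) x - s (r k) x))\<^sup>2) \<le> (1/4) ^ k" for k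
    using N[of k "r (Suc k)" "r k"] r(1,2)[of k] by fastforce
  define h where "h k x = 2 ^ k * (norm (s (r (Suc k)) x - s (r k) x))\<^sup>2" for k x
  have [measurable]: "h k \<in> borel_measurable M" for k unfolding h_def by measurable
  have "(\<integral>\<^sup>+x. (\<Sum>k. ennreal (h k x)) \<partial>M) = (\<Sum>k. \<integral>\<^sup>+x. ennreal (h k x) \<partial>M)"
    by (rule nn_integral_suminf) measurable
  also have "\<dots> \<le> (\<Sum>k. ennreal ((1/2) ^ k))"
  proof (intro suminf_le)
    fix k
    have int: "integrable M (h k)" unfolding h_def using sd[of "r (Suc k)" "r k"] by auto
    have "(\<integral>\<^sup>+x. ennreal (h k x) \<partial>M) = ennreal (LINT x|M. h k x)"
      by (rule nn_integral_eq_integral[OF int]) (simp add: h_def)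
    also have "(LINT x|M. h k x) \<le> 2 ^ k * (1/4) ^ k"
      unfolding h_def using sd[of "r (Suc k)" "r k"] d[of k] by simp
    also have "2 ^ k * (1/4) ^ k = (1/2 :: real) ^ k" by (simp flip: power_mult_distrib)
    finally show "(\<integral>\<^sup>+x. ennreal (h k x) \<partial>M) \<le> ennreal ((1/2) ^ k)" by (simp add: ennreal_leI)
  qed auto
  also have "\<dots> < \<infinity>"
    by (subst suminf_ennreal_eq[OF _ summable_sums[OF summable_geometric]]) auto
  finally have "AE x in M. (\<Sum>k. ennreal (h k x)) \<noteq> \<infinity>"
    by (intro nn_integral_PInf_AE) auto
  then have conv: "AE x in M. convergent (\<lambda>k. s (r k) x)"
  proof eventually_elim
    case (elim x)
    have "summable (\<lambda>k. h k x)"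
      using elim by (intro summable_suminf_not_top) (auto simp: h_def)
    then show ?case unfolding h_def by (rule Cauchy_if_geometric_sum)
  qed
  define f where "f x = lim (\<lambda>k. s (r k) x)" for x
  have f[measurable]: "f \<in> borel_measurable M" unfolding f_def by measurable
  from conv have lim: "AE x in M. (\<lambda>k. s (r k) x) \<longlonglongrightarrow> f x"
    by eventually_elim (simp add: f_def convergent_LIMSEQ_iff)
  have sqf: "square_integrable M (\<lambda>x. s n x - f x)"
    and le: "\<And>e N. (\<And>m k. m \<ge> N \<Longrightarrow> k \<ge> N \<Longrightarrow> (LINT x|M. (norm (s m x - s k x))\<^sup>2) \<le> e) \<Longrightarrow> n \<ge> N \<Longrightarrow> (LINT x|M. (norm (s n x - f x))\<^sup>2) \<le> e" for n
  proof -
    have lim': "AE x in M. (\<lambda>k. s n x - s (r k) x) \<longlonglongrightarrow> s n x - f x"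
      using lim by eventually_elim (intro tendsto_intros)
    note B = L2_bound_of_AE_lim[where s="\<lambda>k x. s n x - s (r k) x" and f="\<lambda>x. s n x - f x", OF sd _ lim']
    { fix e N assume "\<And>m k. m \<ge> N \<Longrightarrow> k \<ge> N \<Longrightarrow> (LINT x|M. (norm (s m x - s k x))\<^sup>2) \<le> e" "n \<ge> N"
      then show "(LINT x|M. (norm (s n x - f x))\<^sup>2) \<le> e"
        using order_trans[OF _ r(3)] by (intro B(2)[where N=N]) auto }
    have "(LINT x|M. (norm (s n x - s (r k) x))\<^sup>2) \<le> 2 * (LINT x|M. (norm (s n x - s (N 0) x))\<^sup>2) + 2" if "k \<ge> N 0" for k
    proof -
      have "(LINT x|M. (norm (s n x - s (r k) x))\<^sup>2) \<le> 2 * (LINT x|M. (norm (s n x - s (N 0) x))\<^sup>2) + 2 * (LINT x|M. (norm (s (N 0) x - s (r k) x))\<^sup>2)"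
        using L2_add_le[OF sd[of n "N 0"] sd[of "N 0" "r k"]] by simp
      then show ?thesis using N[of 0 "N 0" "r k"] that r(3)[of k] by fastforce
    qed
    then show "square_integrable M (\<lambda>x. s n x - f x)" by (intro B(1)) auto
  qed
  have "(\<lambda>n. LINT x|M. (norm (s n x - f x))\<^sup>2) \<longlonglongrightarrow> 0"
  proof (rule LIMSEQ_I)
    fix e :: real assume "0 < e"
    then obtain N where "\<forall>m\<ge>N. \<forall>n\<ge>N. (LINT x|M. (norm (s m x - s n x))\<^sup>2) < e/2" using cauchy[of "e/2"] by auto
    then have "(LINT x|M. (norm (s n x - f x))\<^sup>2) \<le> e/2" if "n \<ge> N" for n
      using that by (intro le[of N]) (auto simp: less_imp_le)
    then show "\<exists>N. \<forall>n\<ge>N. norm ((LINT x|M. (norm (s n x - f x))\<^sup>2) - 0) < e"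
      using \<open>0 < e\<close> by (intro exI[of _ N]) fastforce
  qed
  moreover have "square_integrable M f" using square_integrable_diff[OF s[of 0] sqf[of 0]] by simp
  ultimately show ?thesis using s by (auto simp: L2_tendsto_def)
qed

section \<open>Smooth functions\<close>

definition smooth :: "('a::euclidean_space \<Rightarrow> real) \<Rightarrow> bool" where
  "smooth \<phi> \<longleftrightarrow> (\<forall>k. C_k k \<phi>)"

lemma C_k_SucI:
  assumes "\<And>x. (\<phi> has_derivative \<phi>' x) (at x)" "\<And>i. i \<in> Basis \<Longrightarrow> C_k k (\<lambda>x. \<phi>' x i)"
  shows "C_k (Suc k) \<phi>"
proof -
  have "frechet_derivative \<phi> (at x) = \<phi>' x" for x using frechet_derivative_at[OF assms(1)] by simp
  then show ?thesis using assms by (auto simp: differentiable_def)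
qed

lemma C_k_Suc_derivative:
  assumes "C_k (Suc k) \<phi>"
  shows "(\<phi> has_derivative frechet_derivative \<phi> (at x)) (at x)"
    and "i \<in> Basis \<Longrightarrow> C_k k (\<lambda>x. frechet_derivative \<phi> (at x) i)"
  using assms by (auto simp: frechet_derivative_works)

lemma C_k_mono: "C_k (Suc k) \<phi> \<Longrightarrow> C_k k \<phi>"
proof (induction k arbitrary: \<phi>)
  case 0
  then show ?case using C_k_Suc_derivative(1)[OF 0]
    by (auto intro!: continuous_at_imp_continuous_on has_derivative_continuous)
next
  case (Suc k)
  then show ?case by (metis C_k.simps(2))
qed

lemma C_k_const: "C_k k (\<lambda>x. c)"
proof (induction k arbitrary: c)
  case (Suc k)
  show ?case by (rule C_k_SucI[where \<phi>'="\<lambda>_ _. 0"]) (use Suc in auto)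
qed simp

lemma C_k_inner: "C_k k (\<lambda>x. x \<bullet> b)"
proof (cases k)
  case (Suc j)
  show ?thesis unfolding Suc
    by (rule C_k_SucI[where \<phi>'="\<lambda>_ h. h \<bullet> b"]) (auto intro!: derivative_eq_intros C_k_const)
qed (auto intro!: continuous_intros)

lemma C_k_add: "C_k k f \<Longrightarrow> C_k k g \<Longrightarrow> C_k k (\<lambda>x. f x + g x)"
proof (induction k arbitrary: f g)
  case (Suc k)
  show ?case
    by (rule C_k_SucI[OF has_derivative_add[OF C_k_Suc_derivative(1)[OF Suc.prems(1)] C_k_Suc_derivative(1)[OF Suc.prems(2)]]])
      (intro Suc.IH C_k_Suc_derivative(2)[OF Suc.prems(1)] C_k_Suc_derivative(2)[OF Suc.prems(2)])
qed (auto intro!: continuous_intros)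

lemma C_k_mult: "C_k k f \<Longrightarrow> C_k k g \<Longrightarrow> C_k k (\<lambda>x. f x * g x)"
proof (induction k arbitrary: f g)
  case (Suc k)
  show ?case
    by (rule C_k_SucI[OF has_derivative_mult[OF C_k_Suc_derivative(1)[OF Suc.prems(1)] C_k_Suc_derivative(1)[OF Suc.prems(2)]]])
      (intro C_k_add Suc.IH C_k_mono[OF Suc.prems(1)] C_k_mono[OF Suc.prems(2)]
        C_k_Suc_derivative(2)[OF Suc.prems(1)] C_k_Suc_derivative(2)[OF Suc.prems(2)])
qed (auto intro!: continuous_intros)

text \<open>\<open>H\<close> is the sequence of all derivatives of the outer function. The induction
  needs every \<open>n\<close> at once, since the chain rule passes from \<open>H n\<close> to
  \<open>H (Suc n)\<close>.\<close>

lemma C_k_compose: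
  assumes H: "\<And>n t. (H n has_real_derivative H (Suc n) t) (at t)"
  shows "C_k k f \<Longrightarrow> C_k k (\<lambda>x. H n (f x))"
proof (induction k arbitrary: n)
  case 0
  have "continuous_on UNIV (H n)" using H by (auto intro!: continuous_at_imp_continuous_on DERIV_isCont)
  then show ?case using 0 by (auto intro: continuous_on_compose2)
next
  case (Suc k)
  have "((\<lambda>x. H n (f x)) has_derivative (\<lambda>h. H (Suc n) (f x) * frechet_derivative f (at x) h)) (at x)" for x
    using DERIV_compose_FDERIV[OF H C_k_Suc_derivative(1)[OF Suc.prems], of n x] by (simp add: mult.commute)
  then show ?case
    by (rule C_k_SucI) (intro C_k_mult Suc.IH C_k_mono[OF Suc.prems] C_k_Suc_derivative(2)[OF Suc.prems])
qed

lemma smooth_const: "smooth (\<lambda>x. c)" by (simp add: smooth_def C_k_const)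
lemma smooth_inner: "smooth (\<lambda>x. x \<bullet> b)" by (simp add: smooth_def C_k_inner)
lemma smooth_add: "smooth f \<Longrightarrow> smooth g \<Longrightarrow> smooth (\<lambda>x. f x + g x)" by (simp add: smooth_def C_k_add)
lemma smooth_mult: "smooth f \<Longrightarrow> smooth g \<Longrightarrow> smooth (\<lambda>x. f x * g x)" by (simp add: smooth_def C_k_mult)
lemma smooth_diff: "smooth f \<Longrightarrow> smooth g \<Longrightarrow> smooth (\<lambda>x. f x - g x)"
  using smooth_add[of f "\<lambda>x. -1 * g x"] smooth_mult[OF smooth_const, of g "-1"] by simp
lemma smooth_compose:
  "(\<And>n t. (H n has_real_derivative H (Suc n) t) (at t)) \<Longrightarrow> smooth f \<Longrightarrow> smooth (\<lambda>x. H n (f x))"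
  by (simp add: smooth_def C_k_compose)

lemma smooth_sum: "(\<And>i. i \<in> I \<Longrightarrow> smooth (f i)) \<Longrightarrow> smooth (\<lambda>x. \<Sum>i\<in>I. f i x)"
  by (induction I rule: infinite_finite_induct) (auto intro: smooth_const smooth_add)

lemma smooth_prod: "(\<And>i. i \<in> I \<Longrightarrow> smooth (f i)) \<Longrightarrow> smooth (\<lambda>x. \<Prod>i\<in>I. f i x)"
  by (induction I rule: infinite_finite_induct) (auto intro: smooth_const smooth_mult)

lemma smooth_power: "smooth f \<Longrightarrow> smooth (\<lambda>x. f x ^ n)"
  by (induction n) (auto intro: smooth_const smooth_mult)

lemma smooth_norm_square: "smooth (\<lambda>x. (norm x)\<^sup>2)"
proof -
  have "(\<lambda>x::'a. (norm x)\<^sup>2) = (\<lambda>x. \<Sum>i\<in>Basis. (x \<bullet> i) * (x \<bullet> i))"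
    by (simp add: power2_norm_eq_inner euclidean_inner[symmetric])
  then show ?thesis by (auto intro!: smooth_sum smooth_mult smooth_inner)
qed

lemma smooth_exp: "smooth f \<Longrightarrow> smooth (\<lambda>x. exp (c * f x))"
proof -
  assume f: "smooth f"
  have "smooth (\<lambda>x. (\<lambda>n t. c ^ n * exp (c * t)) 0 (f x))"
    by (rule smooth_compose[OF _ f]) (auto intro!: derivative_eq_intros)
  then show ?thesis by simp
qed

lemma smooth_derivative:
  assumes "smooth f"
  shows "(f has_derivative frechet_derivative f (at x)) (at x)"
    and "i \<in> Basis \<Longrightarrow> smooth (\<lambda>x. frechet_derivative f (at x) i)"
  using assms C_k_Suc_derivative unfolding smooth_def by blast+

lemma smooth_continuous: "smooth f \<Longrightarrow> continuous_on A f"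
  using C_k.simps(1) unfolding smooth_def by (metis continuous_on_subset subset_UNIV)

subsection \<open>Test functions concentrated on boxes and balls\<close>

text \<open>With \<open>y = 1 / t\<close>, the derivative of \<open>p(y) exp(-y)\<close> with
  respect to \<open>t\<close> is \<open>y^2 (p(y) - p'(y)) exp(-y)\<close>; the coefficient list
  \<open>[:0, 0, 1:]\<close> is the factor \<open>y^2\<close>.\<close>

fun step_poly :: "nat \<Rightarrow> real poly" where
  "step_poly 0 = 1"
| "step_poly (Suc n) = [:0, 0, 1:] * (step_poly n - pderiv (step_poly n))"

text \<open>The \<open>n\<close>-th derivative of \<open>exp (-1/t)\<close>, extended by \<open>0\<close>.\<close>

definition smooth_step :: "nat \<Rightarrow> real \<Rightarrow> real" where
  "smooth_step n t = (if t > 0 then poly (step_poly n) (1 / t) * exp (- 1 / t) else 0)"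

lemma poly_over_exp_tendsto_0: "((\<lambda>y. poly p y * exp (- y)) \<longlongrightarrow> 0) (at_top :: real filter)"
proof (induction p)
  case (pCons a p)
  have *: "((\<lambda>y. poly p y * y * exp (- y)) \<longlongrightarrow> 0) at_top"
  proof -
    have "((\<lambda>y. (\<Sum>i\<le>degree p. coeff p i * (y ^ Suc i / exp y))) \<longlongrightarrow> (\<Sum>i\<le>degree p. coeff p i * 0)) at_top"
      by (intro tendsto_intros tendsto_power_div_exp_0)
    moreover have "(\<Sum>i\<le>degree p. coeff p i * (y ^ Suc i / exp y)) = poly p y * y * exp (- y)" for y
      by (simp add: poly_altdef exp_minus sum_distrib_left sum_distrib_right divide_inverse mult_ac)
    ultimately show ?thesis by simp
  qed
  have "((\<lambda>y. a * (y ^ 0 / exp y) + poly p y * y * exp (- y)) \<longlongrightarrow> a * 0 + 0) at_top"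
    by (intro tendsto_intros tendsto_power_div_exp_0 *)
  then show ?case by (simp add: field_simps exp_minus)
qed simp

lemma smooth_step_derivative: "(smooth_step n has_real_derivative smooth_step (Suc n) t) (at t)"
proof -
  consider "t > 0" | "t < 0" | "t = 0" by linarith
  then show ?thesis
  proof cases
    case 1
    have "((\<lambda>t. poly (step_poly n) (1 / t) * exp (- 1 / t)) has_real_derivative smooth_step (Suc n) t) (at t)"
      using 1 by (auto intro!: derivative_eq_intros simp: smooth_step_def field_simps power2_eq_square)
    then show ?thesis
      by (rule DERIV_cong_ev[THEN iffD1, rotated 3])
        (use 1 eventually_nhds_in_open[of "{0<..}" t] in \<open>auto elim!: eventually_mono simp: smooth_step_def\<close>)
  next
    case 2
    have "((\<lambda>t. 0) has_real_derivative smooth_step (Suc n) t) (at t)"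
      using 2 by (auto simp: smooth_step_def)
    then show ?thesis
      by (rule DERIV_cong_ev[THEN iffD1, rotated 3])
        (use 2 eventually_nhds_in_open[of "{..<0}" t] in \<open>auto elim!: eventually_mono simp: smooth_step_def\<close>)
  next
    case 3
    have "((\<lambda>h. smooth_step n h / h) \<longlongrightarrow> 0) (at_right 0)"
    proof -
      \<comment> \<open>For \<open>h > 0\<close> the difference quotient at the origin is
        \<open>y p(y) exp(-y)\<close> with \<open>y = 1 / h\<close>, and exponential decay beats the
        polynomial.\<close>
      have "((\<lambda>y. poly ([:0, 1:] * step_poly n) y * exp (- y)) \<longlongrightarrow> 0) at_top"
        by (rule poly_over_exp_tendsto_0)
      then have "((\<lambda>h. poly ([:0, 1:] * step_poly n) (inverse h) * exp (- inverse h)) \<longlongrightarrow> 0) (at_right 0)"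
        using filterlim_compose[OF _ filterlim_inverse_at_top_right] by blast
      then show ?thesis
        by (rule Lim_transform_eventually)
          (auto simp: eventually_at_filter smooth_step_def field_simps intro!: always_eventually)
    qed
    moreover have "((\<lambda>h. smooth_step n h / h) \<longlongrightarrow> 0) (at_left 0)"
      by (rule Lim_transform_eventually[OF tendsto_const])
        (auto simp: eventually_at_filter smooth_step_def)
    ultimately have "((\<lambda>h. smooth_step n h / h) \<longlongrightarrow> 0) (at 0)"
      by (simp add: filterlim_at_split)
    then show ?thesis using 3 by (simp add: DERIV_def smooth_step_def)
  qed
qed

definition step :: "real \<Rightarrow> real" where "step = smooth_step 0"

lemma step_pos: "t > 0 \<Longrightarrow> step t > 0" and step_zero: "t \<le> 0 \<Longrightarrow> step t = 0" and step_nonneg: "0 \<le> step t"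
  by (auto simp: step_def smooth_step_def)

lemma smooth_step_comp: "smooth f \<Longrightarrow> smooth (\<lambda>x. step (f x))"
  unfolding step_def by (rule smooth_compose[of smooth_step, OF smooth_step_derivative])

definition box_bump :: "'a::euclidean_space \<Rightarrow> 'a \<Rightarrow> 'a \<Rightarrow> real" where
  "box_bump a b x = (\<Prod>i\<in>Basis. step (x \<bullet> i - a \<bullet> i) * step (b \<bullet> i - x \<bullet> i))"

lemma smooth_box_bump: "smooth (box_bump a b)"
  unfolding box_bump_def
  by (intro smooth_prod smooth_mult smooth_step_comp smooth_diff smooth_inner smooth_const)

lemma box_bump_nonneg: "0 \<le> box_bump a b x"
  by (simp add: box_bump_def prod_nonneg step_nonneg)

lemma box_bump_pos_iff: "0 < box_bump a b x \<longleftrightarrow> x \<in> box a b"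
proof
  assume "0 < box_bump a b x"
  have "step (x \<bullet> i - a \<bullet> i) * step (b \<bullet> i - x \<bullet> i) \<noteq> 0" if "i \<in> Basis" for i
  proof
    assume "step (x \<bullet> i - a \<bullet> i) * step (b \<bullet> i - x \<bullet> i) = 0"
    then have "box_bump a b x = 0"
      unfolding box_bump_def by (intro prod_zero finite_Basis bexI[OF _ that])
    then show False using \<open>0 < box_bump a b x\<close> by simp
  qed
  note nonzero = this
  have "0 < x \<bullet> i - a \<bullet> i \<and> 0 < b \<bullet> i - x \<bullet> i" if "i \<in> Basis" for i
  proof (rule ccontr)
    assume "\<not> (0 < x \<bullet> i - a \<bullet> i \<and> 0 < b \<bullet> i - x \<bullet> i)"
    then consider "x \<bullet> i - a \<bullet> i \<le> 0" | "b \<bullet> i - x \<bullet> i \<le> 0" by linarith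
    then show False using nonzero[OF that] by cases (simp_all add: step_zero)
  qed
  then show "x \<in> box a b" by (simp add: mem_box)
next
  assume "x \<in> box a b"
  then show "0 < box_bump a b x" unfolding box_bump_def
    by (intro prod_pos mult_pos_pos step_pos) (auto simp: mem_box)
qed

lemma test_functionsD:
  assumes "\<phi> \<in> test_functions \<Omega>"
  shows "smooth \<phi>" "compact (closure {x. \<phi> x \<noteq> 0})" "closure {x. \<phi> x \<noteq> 0} \<subseteq> \<Omega>"
    "x \<notin> \<Omega> \<Longrightarrow> \<phi> x = 0"
  using assms closure_subset[of "{x. \<phi> x \<noteq> 0}"] by (auto simp: test_functions_def smooth_def)

lemma test_functionsI:
  assumes "smooth \<phi>" "compact K" "K \<subseteq> \<Omega>" "\<And>x. x \<notin> K \<Longrightarrow> \<phi> x = 0"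
  shows "\<phi> \<in> test_functions \<Omega>"
proof -
  have "closure {x. \<phi> x \<noteq> 0} \<subseteq> K"
    using assms by (intro closure_minimal compact_imp_closed) auto
  moreover from this have "compact (closure {x. \<phi> x \<noteq> 0})"
    using compact_Int_closed[OF assms(2), of "closure {x. \<phi> x \<noteq> 0}"] by (simp add: Int_absorb1)
  ultimately show ?thesis using assms unfolding test_functions_def smooth_def by auto
qed

lemma test_functions_zero: "(\<lambda>x. 0) \<in> test_functions \<Omega>"
  by (rule test_functionsI[OF smooth_const compact_empty]) auto

lemma test_functions_add:
  assumes "\<phi> \<in> test_functions \<Omega>" "\<psi> \<in> test_functions \<Omega>"
  shows "(\<lambda>x. \<phi> x + \<psi> x) \<in> test_functions \<Omega>"
proof (rule test_functionsI)
  note t = test_functionsD[OF assms(1)] test_functionsD[OF assms(2)]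
  show "smooth (\<lambda>x. \<phi> x + \<psi> x)" using t by (intro smooth_add)
  show "compact (closure {x. \<phi> x \<noteq> 0} \<union> closure {x. \<psi> x \<noteq> 0})" using t by (intro compact_Un)
  show "closure {x. \<phi> x \<noteq> 0} \<union> closure {x. \<psi> x \<noteq> 0} \<subseteq> \<Omega>" using t by auto
  show "\<phi> x + \<psi> x = 0" if "x \<notin> closure {x. \<phi> x \<noteq> 0} \<union> closure {x. \<psi> x \<noteq> 0}" for x
  proof -
    have "x \<notin> {x. \<phi> x \<noteq> 0}" "x \<notin> {x. \<psi> x \<noteq> 0}"
      using that by (meson UnI1 UnI2 closure_subset subsetD)+
    then show ?thesis by simp
  qed
qed

lemma test_functions_mult:
  assumes "smooth m" "\<phi> \<in> test_functions \<Omega>"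
  shows "(\<lambda>x. m x * \<phi> x) \<in> test_functions \<Omega>"
proof (rule test_functionsI)
  note t = test_functionsD[OF assms(2)]
  show "smooth (\<lambda>x. m x * \<phi> x)" using t assms by (intro smooth_mult)
  show "compact (closure {x. \<phi> x \<noteq> 0})" "closure {x. \<phi> x \<noteq> 0} \<subseteq> \<Omega>" using t by auto
  show "m x * \<phi> x = 0" if "x \<notin> closure {x. \<phi> x \<noteq> 0}" for x
    using that closure_subset[of "{x. \<phi> x \<noteq> 0}"] by auto
qed

text \<open>For a smooth \<open>b \<ge> 0\<close> the functions \<open>1 - exp (- n b)\<close>
  increase, with values in the unit interval, to the indicator of the set where
  \<open>b > 0\<close>, here a box cut by the ball of radius \<open>r\<close>. With
  \<open>r < 1\<close> the support stays compact inside the unit ball.\<close>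

definition box_ball_test :: "'a::euclidean_space \<Rightarrow> 'a \<Rightarrow> real \<Rightarrow> nat \<Rightarrow> 'a \<Rightarrow> real" where
  "box_ball_test a b r n x = 1 - exp (- real n * (box_bump a b x * step (r\<^sup>2 - (norm x)\<^sup>2)))"

lemma box_ball_test:
  assumes "0 < r" "r < 1"
  shows "box_ball_test a b r n \<in> test_functions unit_ball"
proof (rule test_functionsI)
  show "smooth (box_ball_test a b r n)"
    unfolding box_ball_test_def
    by (intro smooth_diff smooth_const smooth_exp smooth_mult smooth_box_bump smooth_step_comp smooth_norm_square)
  show "compact (cball 0 r :: 'a set)" by simp
  show "cball 0 r \<subseteq> (ball 0 1 :: 'a set)" using assms by auto
  fix x :: 'a assume "x \<notin> cball 0 r"
  then have "r\<^sup>2 \<le> (norm x)\<^sup>2" using assms by (intro power_mono) auto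
  then show "box_ball_test a b r n x = 0" by (simp add: box_ball_test_def step_zero)
qed

lemma box_ball_test_bounds: "0 \<le> box_ball_test a b r n x" "box_ball_test a b r n x \<le> 1"
  by (auto simp: box_ball_test_def box_bump_nonneg step_nonneg)

lemma box_ball_test_tendsto:
  assumes "0 < r"
  shows "(\<lambda>n. box_ball_test a b r n x) \<longlonglongrightarrow> indicator (box a b \<inter> ball 0 r) x"
proof (cases "x \<in> box a b \<inter> ball 0 r")
  case True
  define c where "c = box_bump a b x * step (r\<^sup>2 - (norm x)\<^sup>2)"
  have "(norm x)\<^sup>2 < r\<^sup>2" using True by (intro power_strict_mono) auto
  then have "0 < c" using True by (simp add: c_def box_bump_pos_iff step_pos)
  have "(\<lambda>n. 1 - exp (- real n * c)) \<longlonglongrightarrow> 1 - 0"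
  proof (intro tendsto_intros filterlim_compose[OF exp_at_bot])
    have "filterlim (\<lambda>n. real n * c) at_top sequentially"
      by (rule filterlim_at_top_mult_tendsto_pos[OF tendsto_const \<open>0 < c\<close> filterlim_real_sequentially])
    then show "filterlim (\<lambda>n. - real n * c) at_bot sequentially"
      by (simp add: filterlim_uminus_at_top)
  qed
  then show ?thesis using True by (simp add: box_ball_test_def c_def)
next
  case False
  have "box_bump a b x * step (r\<^sup>2 - (norm x)\<^sup>2) = 0"
  proof (cases "x \<in> box a b")
    case True
    then have "r\<^sup>2 \<le> (norm x)\<^sup>2" using False assms by (intro power_mono) auto
    then show ?thesis by (simp add: step_zero)
  next
    case False
    then show ?thesis using box_bump_nonneg[of a b x] box_bump_pos_iff[of a b x] by simp
  qed
  then have "box_ball_test a b r n x = 0" for n by (simp only: box_ball_test_def mult_zero_right exp_zero diff_self)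
  then show ?thesis using False by simp
qed

section \<open>Integration on the unit ball\<close>

lemma square_integrable_L2: "w \<in> L2 \<Omega> \<longleftrightarrow> square_integrable (lebesgue_on \<Omega>) w"
  by (auto simp only: L2_def square_integrable_def mem_Collect_eq)

lemma finite_ball_measure: "finite_measure (ball_measure :: 'a::euclidean_space measure)"
  by (rule finite_measure_lebesgue_on) simp

lemma continuous_measurable_ball:
  fixes f :: "'a::euclidean_space \<Rightarrow> 'b::euclidean_space"
  assumes "continuous_on unit_ball f"
  shows "f \<in> borel_measurable ball_measure"
  using assms by (intro continuous_imp_measurable_on_sets_lebesgue) auto

lemma square_integrable_bounded:
  fixes f :: "'a \<Rightarrow> 'b::euclidean_space"
  assumes "finite_measure M" "f \<in> borel_measurable M" "AE x in M. norm (f x) \<le> c"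
  shows "square_integrable M f"
proof (rule square_integrable_bound)
  interpret finite_measure M by fact
  have "integrable M (\<lambda>x. (norm (1::real))\<^sup>2)" by simp
  then show "square_integrable M (\<lambda>x. 1::real)" unfolding square_integrable_def by (intro conjI) measurable
  show "AE x in M. norm (f x) \<le> c * norm (1::real)" using assms(3) by simp
qed fact

lemma square_integrable_integrable:
  fixes f :: "'a \<Rightarrow> 'b::euclidean_space"
  assumes "finite_measure M" "square_integrable M f"
  shows "integrable M f"
proof -
  interpret finite_measure M by fact
  have "square_integrable M (\<lambda>x. 1::real)" by (rule square_integrable_bounded[of _ _ 1]) (auto intro: assms)
  moreover have "square_integrable M (\<lambda>x. norm (f x))"
  proof (rule square_integrable_bound[OF assms(2), of _ 1])
    have [measurable]: "f \<in> borel_measurable M" using assms(2) by simp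
    show "(\<lambda>x. norm (f x)) \<in> borel_measurable M" by measurable
  qed simp
  ultimately have "integrable M (\<lambda>x. norm (f x))" using square_integrable_mult by fastforce
  then show ?thesis using assms(2) by (subst (asm) integrable_norm_iff) auto
qed

lemma continuous_bounded_ball:
  fixes f :: "'a::euclidean_space \<Rightarrow> 'b::euclidean_space"
  assumes "continuous_on UNIV f"
  shows "\<exists>C\<ge>0. \<forall>x\<in>cball 0 R. norm (f x) \<le> C"
proof -
  have "compact (f ` cball 0 R)" using assms continuous_on_subset by (intro compact_continuous_image) auto
  then obtain C where "\<forall>y\<in>f ` cball 0 R. norm y \<le> C" using compact_imp_bounded bounded_iff by metis
  then show ?thesis by (intro exI[of _ "max C 0"]) (auto simp: le_max_iff_disj)
qed

lemma continuous_square_integrable_ball: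
  fixes f :: "'a::euclidean_space \<Rightarrow> 'b::euclidean_space"
  assumes "continuous_on UNIV f"
  shows "square_integrable ball_measure f"
proof -
  obtain C where C: "\<forall>x\<in>cball 0 1. norm (f x) \<le> C" using continuous_bounded_ball[OF assms] by metis
  have "AE x in ball_measure. norm (f x) \<le> C"
    using C by (intro AE_I2) auto
  then show ?thesis
    using continuous_on_subset[OF assms]
    by (intro square_integrable_bounded[OF finite_ball_measure continuous_measurable_ball]) auto
qed

text \<open>The function spaces live on \<open>lebesgue_on\<close>, whereas translation invariance
  and Fubini are used for \<open>lborel\<close>. Borel functions that vanish off the ball pass
  freely between the two.\<close>

lemma integral_ball_lborel:
  fixes f :: "'a::euclidean_space \<Rightarrow> real"
  assumes "f \<in> borel_measurable borel" "\<And>x. x \<notin> unit_ball \<Longrightarrow> f x = 0"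
  shows "(LINT x|ball_measure. f x) = (LINT x|lborel. f x)"
    "integrable ball_measure f \<longleftrightarrow> integrable lborel f"
proof -
  have [measurable]: "f \<in> borel_measurable lborel" using assms by simp
  have eq: "indicator unit_ball x *\<^sub>R f x = f x" for x using assms(2)[of x] by (auto simp: indicator_def)
  have ball: "unit_ball \<inter> space lebesgue \<in> sets (lebesgue :: 'a measure)" by simp
  show "(LINT x|ball_measure. f x) = (LINT x|lborel. f x)"
    unfolding integral_restrict_space[OF ball] eq
    by (rule integral_completion) measurable
  show "integrable ball_measure f \<longleftrightarrow> integrable lborel f"
    unfolding integrable_restrict_space[OF ball] eq
    by (rule integrable_completion) measurable
qed

lemma AE_ball_of_lborel:
  assumes "AE x in lborel. P (x :: 'a::euclidean_space)"
  shows "AE x in ball_measure. P x"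
proof -
  have ball: "unit_ball \<inter> space lebesgue \<in> sets (lebesgue :: 'a measure)" by simp
  show ?thesis
    unfolding AE_restrict_space_iff[OF ball] using AE_completion[OF assms] by eventually_elim simp
qed

section \<open>Translation invariance and vanishing integrals of partial derivatives\<close>

lemma integral_translate:
  fixes f :: "'a::euclidean_space \<Rightarrow> real"
  assumes [measurable]: "f \<in> borel_measurable borel"
  shows "(LINT x|lborel. f (c + x)) = (LINT x|lborel. f x)"
    "integrable lborel (\<lambda>x. f (c + x)) \<longleftrightarrow> integrable lborel f"
proof -
  have "(LINT x|lborel. f x) = (LINT x|distr lborel borel ((+) c). f x)" by (simp add: lborel_distr_plus)
  also have "\<dots> = (LINT x|lborel. f (c + x))" by (rule integral_distr) measurable
  finally show "(LINT x|lborel. f (c + x)) = (LINT x|lborel. f x)" by simp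
  have "integrable lborel f \<longleftrightarrow> integrable (distr lborel borel ((+) c)) f" by (simp add: lborel_distr_plus)
  also have "\<dots> \<longleftrightarrow> integrable lborel (\<lambda>x. f (c + x))" by (rule integrable_distr_eq) measurable
  finally show "integrable lborel (\<lambda>x. f (c + x)) \<longleftrightarrow> integrable lborel f" by simp
qed

text \<open>By translation invariance every difference quotient has integral zero.\<close>

lemma integral_partial_derivative_zero:
  fixes \<psi> :: "'a::euclidean_space \<Rightarrow> real"
  assumes d: "\<And>x. (\<psi> has_derivative \<psi>' x) (at x)"
    and c: "continuous_on UNIV (\<lambda>x. \<psi>' x i)" and i: "norm i = 1"
    and supp: "\<And>x. x \<notin> unit_ball \<Longrightarrow> \<psi> x = 0"
  shows "(LINT x|lborel. \<psi>' x i) = 0"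
proof -
  have cont: "continuous_on UNIV \<psi>" using d by (auto intro!: continuous_at_imp_continuous_on has_derivative_continuous)
  then have [measurable]: "\<psi> \<in> borel_measurable borel" by (rule borel_measurable_continuous_onI)
  have [measurable]: "(\<lambda>x. \<psi>' x i) \<in> borel_measurable borel" using c by (rule borel_measurable_continuous_onI)
  \<comment> \<open>If \<open>norm x \<le> 2\<close>, the intermediate point of the mean value
    theorem has norm at most \<open>3\<close>; if \<open>norm x > 2\<close>, both values of
    \<open>\<psi>\<close> in the difference quotient vanish because
    \<open>h n \<le> 1\<close>.\<close>
  obtain C where C: "C \<ge> 0" "\<And>x. norm x \<le> 3 \<Longrightarrow> \<bar>\<psi>' x i\<bar> \<le> C"
    using continuous_bounded_ball[OF c, of 3] by auto
  have line: "((\<lambda>t. \<psi> (x + t *\<^sub>R i)) has_real_derivative \<psi>' (x + t *\<^sub>R i) i) (at t)" for x t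
  proof -
    have "((\<lambda>t. \<psi> (x + t *\<^sub>R i)) has_derivative (\<lambda>s. \<psi>' (x + t *\<^sub>R i) (s *\<^sub>R i))) (at t)"
      by (rule has_derivative_compose[OF _ d]) (auto intro!: derivative_eq_intros)
    moreover have "\<psi>' (x + t *\<^sub>R i) (s *\<^sub>R i) = \<psi>' (x + t *\<^sub>R i) i * s" for s
      using has_derivative_linear[OF d] by (simp add: linear_cmul)
    ultimately show ?thesis by (simp add: has_field_derivative_def)
  qed
  define h where "h n = 1 / real (Suc n)" for n
  have h: "0 < h n" "h n \<le> 1" for n by (auto simp: h_def)
  define s where "s n x = (\<psi> (h n *\<^sub>R i + x) - \<psi> x) / h n" for n x
  have [measurable]: "s n \<in> borel_measurable borel" for n unfolding s_def by measurable
  have int: "integrable lborel \<psi>"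
    using integral_ball_lborel(2)[of \<psi>] supp
      square_integrable_integrable[OF finite_ball_measure continuous_square_integrable_ball[OF cont]] by auto
  have s0: "(LINT x|lborel. s n x) = 0" for n
    unfolding s_def using int integral_translate[of \<psi> "h n *\<^sub>R i"] by simp
  have "(\<lambda>n. LINT x|lborel. s n x) \<longlonglongrightarrow> (LINT x|lborel. \<psi>' x i)"
  proof (rule integral_dominated_convergence[where w="\<lambda>x. C * indicator (cball 0 2) x"])
    show "integrable lborel (\<lambda>x::'a. C * indicator (cball 0 2) x)"
      using emeasure_lborel_cball_finite[of "0::'a" 2] by (intro integrable_mult_right) (simp add: integrable_indicator_iff)
    show "AE x in lborel. (\<lambda>n. s n x) \<longlonglongrightarrow> \<psi>' x i"
    proof (intro AE_I2)
      fix x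
      have "((\<lambda>t. (\<psi> (x + t *\<^sub>R i) - \<psi> x) / t) \<longlongrightarrow> \<psi>' x i) (at 0)"
        using line[of x 0] by (simp add: DERIV_def)
      moreover have "filterlim h (at 0) sequentially"
        unfolding h_def using LIMSEQ_inverse_real_of_nat
        by (auto simp: filterlim_at inverse_eq_divide intro!: always_eventually)
      ultimately show "(\<lambda>n. s n x) \<longlonglongrightarrow> \<psi>' x i"
        unfolding s_def using filterlim_compose by (fastforce simp: add.commute)
    qed
    show "AE x in lborel. norm (s n x) \<le> C * indicator (cball 0 2) x" for n
    proof (intro AE_I2)
      fix x
      show "norm (s n x) \<le> C * indicator (cball 0 2) x"
      proof (cases "norm x \<le> 2")
        case True
        obtain t where t: "0 < t" "t < h n" "\<psi> (x + h n *\<^sub>R i) - \<psi> (x + 0 *\<^sub>R i) = (h n - 0) * \<psi>' (x + t *\<^sub>R i) i"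
          using MVT2[OF h(1)[of n] line] by blast
        have "norm (x + t *\<^sub>R i) \<le> norm x + norm (t *\<^sub>R i)" by (rule norm_triangle_ineq)
        also have "\<dots> \<le> 3" using True t h(2)[of n] i by simp
        finally have "\<bar>\<psi>' (x + t *\<^sub>R i) i\<bar> \<le> C" by (rule C(2))
        moreover have "s n x = \<psi>' (x + t *\<^sub>R i) i" using t h[of n] by (simp add: s_def add.commute)
        ultimately show ?thesis using True by simp
      next
        case False
        have "norm x \<le> norm (h n *\<^sub>R i + x) + norm (h n *\<^sub>R i)"
          using norm_triangle_ineq4[of "h n *\<^sub>R i + x" "h n *\<^sub>R i"] by simp
        then have "\<psi> (h n *\<^sub>R i + x) = 0" "\<psi> x = 0" using supp False h[of n] i by auto
        then show ?thesis using C by (simp add: s_def)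
      qed
    qed
  qed measurable
  then show ?thesis using s0 by (simp add: LIMSEQ_const_iff)
qed

text \<open>Dynkin's theorem: open boxes form an intersection-stable generator of the Borel sets,
  and the sets over which \<open>h\<close> has integral zero are closed under countable disjoint
  unions and, thanks to \<open>tot\<close>, under complements.\<close>

lemma AE_zero_if_box_integrals_zero:
  fixes h :: "'a::euclidean_space \<Rightarrow> real"
  assumes h: "integrable lborel h" and box: "\<And>a b. (LINT x|lborel. indicator (box a b) x * h x) = 0"
    and tot: "(LINT x|lborel. h x) = 0"
  shows "AE x in lborel. h x = 0"
proof -
  have [measurable]: "h \<in> borel_measurable borel" using borel_measurable_integrable[OF h] by simp
  have ind: "integrable lborel (\<lambda>x. indicator A x * h x)" if "A \<in> sets borel" for A
    using integrable_mult_indicator[of A lborel h] h that by simp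
  have z: "(LINT x|lborel. indicator A x * h x) = 0" if A: "A \<in> sets borel" for A
  proof -
    have S: "sets borel = sigma_sets UNIV (range (\<lambda>(a, b). box a b :: 'a set))"
      unfolding borel_eq_box by (rule sets_measure_of) auto
    have "Int_stable (range (\<lambda>(a, b). box a b :: 'a set))"
      by (auto simp: Int_stable_def box_Int_box)
    moreover have "range (\<lambda>(a, b). box a b :: 'a set) \<subseteq> Pow UNIV" by simp
    moreover have "A \<in> sigma_sets UNIV (range (\<lambda>(a, b). box a b :: 'a set))" using A by (simp only: S)
    ultimately show ?thesis
    proof (induction rule: sigma_sets_induct_disjoint)
      case (basic A) then show ?case using box by auto
    next
      case empty then show ?case by simp
    next
      case (compl A)
      have A: "A \<in> sets borel" using compl(1) by (simp only: S)
      have "(LINT x|lborel. indicator (UNIV - A) x * h x) = (LINT x|lborel. h x - indicator A x * h x)"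
        by (intro Bochner_Integration.integral_cong) (auto simp: indicator_def)
      also have "\<dots> = 0" using compl h ind[OF A] tot by simp
      finally show ?case .
    next
      case (union A)
      have A[measurable]: "A n \<in> sets borel" for n using union(2) by (auto simp only: S)
      have "(\<lambda>n. LINT x|lborel. indicator (\<Union>i<n. A i) x * h x) \<longlonglongrightarrow> (LINT x|lborel. indicator (\<Union>i. A i) x * h x)"
      proof (rule integral_dominated_convergence[where w="\<lambda>x. \<bar>h x\<bar>"])
        show "integrable lborel (\<lambda>x. \<bar>h x\<bar>)" using h by simp
        show "AE x in lborel. (\<lambda>n. indicator (\<Union>i<n. A i) x * h x) \<longlonglongrightarrow> indicator (\<Union>i. A i) x * h x"
          by (intro AE_I2 tendsto_intros LIMSEQ_indicator_UN)
      qed (auto simp: indicator_def)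
      moreover have "(LINT x|lborel. indicator (\<Union>i<n. A i) x * h x) = 0" for n
      proof -
        have "indicator (\<Union>i<n. A i) x = (\<Sum>i<n. indicator (A i) x :: real)" for x
          using union(1) by (intro indicator_UN_disjoint) (auto intro: disjoint_family_on_mono)
        then have "(LINT x|lborel. indicator (\<Union>i<n. A i) x * h x) = (LINT x|lborel. (\<Sum>i<n. indicator (A i) x * h x))"
          by (simp only: sum_distrib_right)
        also have "\<dots> = (\<Sum>i<n. LINT x|lborel. indicator (A i) x * h x)"
          by (rule Bochner_Integration.integral_sum) (rule ind[OF A])
        also have "\<dots> = 0" by (simp only: union(3) sum.neutral_const)
        finally show ?thesis .
      qed
      ultimately show ?case by (simp add: LIMSEQ_const_iff)
    qed
  qed
  show ?thesis
    by (rule density_unique_real) (use z h in \<open>auto simp: set_lebesgue_integral_def\<close>)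
qed

text \<open>Test functions approximate the indicators of boxes cut by smaller balls; dominated
  convergence with majorant \<open>\<bar>h\<bar>\<close> carries the hypothesis to these sets and,
  as the radius tends to \<open>1\<close>, to boxes.\<close>

lemma fundamental_lemma:
  fixes h :: "'a::euclidean_space \<Rightarrow> real"
  assumes h: "integrable ball_measure h" and z: "\<And>\<phi>. \<phi> \<in> test_functions unit_ball \<Longrightarrow> (LINT x|ball_measure. h x * \<phi> x) = 0"
  shows "AE x in ball_measure. h x = 0"
proof -
  have [measurable]: "h \<in> borel_measurable ball_measure" using h by simp
  have m: "f \<in> borel_measurable borel \<Longrightarrow> f \<in> borel_measurable ball_measure" for f :: "'a \<Rightarrow> real"
    by (intro measurable_restrict_space1 measurable_completion) simp
  have step1: "(LINT x|ball_measure. h x * indicator (box a b \<inter> ball 0 r) x) = 0" if r: "0 < r" "r < 1" for a b r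
  proof -
    have "(\<lambda>n. LINT x|ball_measure. h x * box_ball_test a b r n x) \<longlonglongrightarrow> (LINT x|ball_measure. h x * indicator (box a b \<inter> ball 0 r) x)"
    proof (rule integral_dominated_convergence[where w="\<lambda>x. \<bar>h x\<bar>"])
      show "integrable ball_measure (\<lambda>x. \<bar>h x\<bar>)" using h by simp
      have "(indicator (box a b \<inter> ball 0 r) :: 'a \<Rightarrow> real) \<in> borel_measurable ball_measure" by (rule m[OF borel_measurable_indicator]) simp
      then show "(\<lambda>x. h x * indicator (box a b \<inter> ball 0 r) x) \<in> borel_measurable ball_measure" by measurable
      have "box_ball_test a b r n \<in> borel_measurable ball_measure" for n
        using box_ball_test[OF r] test_functionsD(1) smooth_continuous
        by (intro continuous_measurable_ball) blast
      then show "(\<lambda>x. h x * box_ball_test a b r n x) \<in> borel_measurable ball_measure" for n by measurable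
      show "AE x in ball_measure. (\<lambda>n. h x * box_ball_test a b r n x) \<longlonglongrightarrow> h x * indicator (box a b \<inter> ball 0 r) x"
        by (intro AE_I2 tendsto_intros box_ball_test_tendsto r)
      show "AE x in ball_measure. norm (h x * box_ball_test a b r n x) \<le> \<bar>h x\<bar>" for n
        using box_ball_test_bounds[of a b r n] by (intro AE_I2) (auto simp: abs_mult intro!: mult_left_le)
    qed
    then show ?thesis using z[OF box_ball_test[OF r]] by (simp add: LIMSEQ_const_iff)
  qed
  define r where "r n = 1 - 1 / (real n + 2)" for n :: nat
  have r: "0 < r n" "r n < 1" for n by (auto simp: r_def field_simps)
  have rlim: "r \<longlonglongrightarrow> 1"
  proof -
    have "(\<lambda>n. 1 - inverse (real (Suc (Suc n)))) \<longlonglongrightarrow> 1 - 0"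
      by (intro tendsto_intros LIMSEQ_Suc[OF LIMSEQ_inverse_real_of_nat])
    then show ?thesis unfolding r_def by (simp add: inverse_eq_divide add.commute)
  qed
  have step2: "(LINT x|ball_measure. h x * indicator (box a b) x) = 0" for a b
  proof -
    have "(\<lambda>n. LINT x|ball_measure. h x * indicator (box a b \<inter> ball 0 (r n)) x) \<longlonglongrightarrow> (LINT x|ball_measure. h x * indicator (box a b) x)"
    proof (rule integral_dominated_convergence[where w="\<lambda>x. \<bar>h x\<bar>"])
      show "integrable ball_measure (\<lambda>x. \<bar>h x\<bar>)" using h by simp
      have "(indicator (box a b \<inter> ball 0 r) :: 'a \<Rightarrow> real) \<in> borel_measurable ball_measure" for r by (rule m[OF borel_measurable_indicator]) simp
      then show "(\<lambda>x. h x * indicator (box a b \<inter> ball 0 (r n)) x) \<in> borel_measurable ball_measure" for n by measurable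
      have "(indicator (box a b) :: 'a \<Rightarrow> real) \<in> borel_measurable ball_measure" by (rule m[OF borel_measurable_indicator]) simp
      then show "(\<lambda>x. h x * indicator (box a b) x) \<in> borel_measurable ball_measure" by measurable
      show "AE x in ball_measure. (\<lambda>n. h x * indicator (box a b \<inter> ball 0 (r n)) x) \<longlonglongrightarrow> h x * indicator (box a b) x"
      proof (intro AE_I2 tendsto_intros)
        fix x :: 'a assume "x \<in> space ball_measure"
        then have "\<forall>\<^sub>F n in sequentially. norm x < r n" using order_tendstoD(1)[OF rlim] by simp
        then show "(\<lambda>n. indicator (box a b \<inter> ball 0 (r n)) x) \<longlonglongrightarrow> (indicator (box a b) x :: real)"
          by (intro tendsto_eventually) (auto elim!: eventually_mono simp: indicator_def)
      qed
    qed (auto simp: indicator_def)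
    then show ?thesis using step1[OF r] by (simp add: LIMSEQ_const_iff)
  qed
  define h0 where "h0 x = indicator unit_ball x * h x" for x
  have h0: "integrable lebesgue h0"
  proof -
    have "h0 = (\<lambda>x. indicator unit_ball x *\<^sub>R h x)" by (auto simp: h0_def)
    then show ?thesis using h by (subst (asm) integrable_restrict_space) auto
  qed
  \<comment> \<open>The extension by zero is only Lebesgue measurable; on \<open>lborel\<close> a
    Borel representative takes its place.\<close>
  obtain h' where h': "h' \<in> borel_measurable lborel" "AE x in lborel. h0 x = h' x"
    using completion_ex_borel_measurable_real[OF borel_measurable_integrable[OF h0]] by blast
  have ae: "AE x in lebesgue. h0 x = h' x" using AE_completion[OF h'(2)] .
  have inth': "integrable lborel h'"
  proof -
    have "integrable lebesgue h'"
      by (rule integrable_cong_AE_imp[OF h0 measurable_completion[OF h'(1)] ae])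
    then show ?thesis using integrable_completion[OF h'(1)] by simp
  qed
  have tr: "(LINT x|lborel. indicator A x * h' x) = (LINT x|ball_measure. h x * indicator A x)" if A: "A \<in> sets borel" for A
  proof -
    have [measurable]: "A \<in> sets lborel" "h' \<in> borel_measurable lborel" "h0 \<in> borel_measurable lebesgue"
      "h' \<in> borel_measurable lebesgue" "A \<in> sets lebesgue"
      using A h'(1) borel_measurable_integrable[OF h0] measurable_completion[OF h'(1)] by (simp_all add: sets_completionI_sets)
    have "(LINT x|lborel. indicator A x * h' x) = (LINT x|lebesgue. indicator A x * h' x)"
      by (rule integral_completion[symmetric]) measurable
    also have "\<dots> = (LINT x|lebesgue. indicator A x * h0 x)"
      by (rule integral_cong_AE) (use ae in \<open>auto elim: eventually_mono\<close>)
    also have "\<dots> = (LINT x|lebesgue. indicator unit_ball x *\<^sub>R (h x * indicator A x))"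
      by (simp add: h0_def mult_ac)
    also have "\<dots> = (LINT x|ball_measure. h x * indicator A x)"
      by (rule integral_restrict_space[symmetric]) simp
    finally show ?thesis .
  qed
  have "AE x in lborel. h' x = 0"
  proof (rule AE_zero_if_box_integrals_zero[OF inth'])
    show "(LINT x|lborel. indicator (box a b) x * h' x) = 0" for a b using tr step2 by simp
    \<comment> \<open>A box that contains the ball turns the total integral into a box
      integral.\<close>
    have sub: "unit_ball \<subseteq> (box (- (2 *\<^sub>R One)) (2 *\<^sub>R One) :: 'a set)"
    proof
      fix x :: 'a assume "x \<in> unit_ball"
      then have "\<bar>x \<bullet> i\<bar> < 2" if "i \<in> Basis" for i using Basis_le_norm[OF that, of x] by simp
      then show "x \<in> box (- (2 *\<^sub>R One)) (2 *\<^sub>R One)" by (auto simp: mem_box abs_less_iff minus_less_iff)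
    qed
    have "(LINT x|lborel. h' x) = (LINT x|ball_measure. h x)" using tr[of UNIV] by simp
    also have "\<dots> = (LINT x|ball_measure. h x * indicator (box (- (2 *\<^sub>R One)) (2 *\<^sub>R One)) x)"
      using sub by (intro Bochner_Integration.integral_cong) (auto simp: indicator_def)
    finally show "(LINT x|lborel. h' x) = 0" using step2 by simp
  qed
  with h'(2) have "AE x in lborel. h0 x = 0" by eventually_elim simp
  from AE_ball_of_lborel[OF this] show ?thesis
    by (rule AE_mp) (auto intro!: AE_I2 simp: h0_def)
qed

section \<open>Weak gradients on the unit ball\<close>

lemma squeeze_zero:
  fixes f g :: "nat \<Rightarrow> real"
  assumes "\<And>n. 0 \<le> f n" "\<And>n. f n \<le> g n" "g \<longlonglongrightarrow> 0"
  shows "f \<longlonglongrightarrow> 0"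
  by (rule tendsto_sandwich[OF _ _ tendsto_const assms(3)]) (use assms in auto)

section \<open>Stability of convergence in \<open>L2\<close>\<close>

lemma L2_tendsto_close:
  assumes f: "L2_tendsto M f g" and s: "\<And>n. square_integrable M (s n)"
    and lim: "(\<lambda>n. LINT x|M. (norm (s n x - f n x))\<^sup>2) \<longlonglongrightarrow> 0"
  shows "L2_tendsto M s g"
  unfolding L2_tendsto_def
proof (intro conjI allI s)
  have sf: "square_integrable M (f n)" "square_integrable M g" for n using f by (auto simp: L2_tendsto_def)
  show "square_integrable M g" by (rule sf)
  have b: "(\<lambda>n. 2 * (LINT x|M. (norm (s n x - f n x))\<^sup>2) + 2 * (LINT x|M. (norm (f n x - g x))\<^sup>2)) \<longlonglongrightarrow> 2 * 0 + 2 * 0"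
    using f by (intro tendsto_intros lim) (simp add: L2_tendsto_def)
  show "(\<lambda>n. LINT x|M. (norm (s n x - g x))\<^sup>2) \<longlonglongrightarrow> 0"
  proof (rule tendsto_sandwich[OF _ _ tendsto_const b[simplified]])
    have "(LINT x|M. (norm (s n x - g x))\<^sup>2) \<le>
      2 * (LINT x|M. (norm (s n x - f n x))\<^sup>2) + 2 * (LINT x|M. (norm (f n x - g x))\<^sup>2)" for n
      using L2_add_le[OF square_integrable_diff[OF s[of n] sf(1)[of n]] square_integrable_diff[OF sf(1)[of n] sf(2)]] by simp
    then show "\<forall>\<^sub>F n in sequentially. (LINT x|M. (norm (s n x - g x))\<^sup>2) \<le>
      2 * (LINT x|M. (norm (s n x - f n x))\<^sup>2) + 2 * (LINT x|M. (norm (f n x - g x))\<^sup>2)" by simp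
  qed simp
qed

text \<open>The common source of stability under sums, multiples, multiplication by bounded
  functions and passage to components: a pointwise Lipschitz bound transfers convergence, and the
  codomains may differ.\<close>

lemma L2_tendsto_dominated:
  fixes t :: "nat \<Rightarrow> 'a \<Rightarrow> 'c::euclidean_space" and s :: "nat \<Rightarrow> 'a \<Rightarrow> 'b::euclidean_space"
  assumes st: "L2_tendsto M s f" and t: "\<And>n. square_integrable M (t n)" "square_integrable M g"
    and b: "\<And>n. AE x in M. norm (t n x - g x) \<le> C * norm (s n x - f x)"
  shows "L2_tendsto M t g"
  unfolding L2_tendsto_def
proof (intro conjI allI t)
  have sf: "square_integrable M (s n)" "square_integrable M f" for n using st by (auto simp: L2_tendsto_def)
  have lim: "(\<lambda>n. C\<^sup>2 * (LINT x|M. (norm (s n x - f x))\<^sup>2)) \<longlonglongrightarrow> C\<^sup>2 * 0"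
    using st by (intro tendsto_intros) (simp add: L2_tendsto_def)
  have le: "(LINT x|M. (norm (t n x - g x))\<^sup>2) \<le> C\<^sup>2 * (LINT x|M. (norm (s n x - f x))\<^sup>2)" for n
  proof -
    have "(LINT x|M. (norm (t n x - g x))\<^sup>2) \<le> (LINT x|M. C\<^sup>2 * (norm (s n x - f x))\<^sup>2)"
    proof (rule integral_mono_AE)
      show "integrable M (\<lambda>x. (norm (t n x - g x))\<^sup>2)" by (rule square_integrableD[OF square_integrable_diff[OF t]])
      show "integrable M (\<lambda>x. C\<^sup>2 * (norm (s n x - f x))\<^sup>2)"
        by (intro integrable_mult_right square_integrableD[OF square_integrable_diff[OF sf]])
      show "AE x in M. (norm (t n x - g x))\<^sup>2 \<le> C\<^sup>2 * (norm (s n x - f x))\<^sup>2"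
        using b[of n]
      proof eventually_elim
        case (elim x) then show ?case using power_mono[OF elim, of 2] by (simp add: power_mult_distrib)
      qed
    qed
    then show ?thesis by simp
  qed
  show "(\<lambda>n. LINT x|M. (norm (t n x - g x))\<^sup>2) \<longlonglongrightarrow> 0"
    by (rule tendsto_sandwich[OF _ _ tendsto_const lim[simplified]]) (use le in auto)
qed

lemma L2_tendsto_add:
  assumes "L2_tendsto M s f" "L2_tendsto M t g"
  shows "L2_tendsto M (\<lambda>n x. s n x + t n x) (\<lambda>x. f x + g x)"
proof -
  have sq: "square_integrable M (s n)" "square_integrable M f" "square_integrable M (t n)" "square_integrable M g" for n
    using assms by (auto simp: L2_tendsto_def)
  have 1: "L2_tendsto M (\<lambda>n x. s n x + g x) (\<lambda>x. f x + g x)"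
    by (rule L2_tendsto_dominated[OF assms(1), where C=1]) (auto intro: square_integrable_add sq)
  show ?thesis
    by (rule L2_tendsto_close[OF 1]) (use assms sq in \<open>auto intro: square_integrable_add simp: L2_tendsto_def\<close>)
qed

lemma L2_tendsto_scaleR:
  assumes "L2_tendsto M s f"
  shows "L2_tendsto M (\<lambda>n x. c *\<^sub>R s n x) (\<lambda>x. c *\<^sub>R f x)"
proof (rule L2_tendsto_dominated[OF assms, where C="\<bar>c\<bar>"])
  show "AE x in M. norm (c *\<^sub>R s n x - c *\<^sub>R f x) \<le> \<bar>c\<bar> * norm (s n x - f x)" for n
    by (simp flip: scaleR_diff_right)
qed (use assms in \<open>auto intro: square_integrable_scaleR simp: L2_tendsto_def\<close>)

lemma L2_tendsto_const: "square_integrable M f \<Longrightarrow> L2_tendsto M (\<lambda>n. f) f"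
  by (simp add: L2_tendsto_def)

lemma L2_tendsto_cong:
  assumes "L2_tendsto M s f" "square_integrable M g" "AE x in M. f x = g x"
  shows "L2_tendsto M s g"
  by (rule L2_tendsto_dominated[OF assms(1), where C=1])
    (use assms in \<open>auto simp: L2_tendsto_def elim: eventually_mono\<close>)

text \<open>The gradient is an argument rather than the value of a choice. The local integrability
  clauses are absent because square integrability on the ball, a set of finite measure, implies
  them.\<close>

definition wgrad :: "('a::euclidean_space \<Rightarrow> real) \<Rightarrow> ('a \<Rightarrow> 'a) \<Rightarrow> bool" where
  "wgrad w g \<longleftrightarrow> square_integrable ball_measure w \<and> square_integrable ball_measure g \<and>
     (\<forall>\<phi>\<in>test_functions unit_ball. \<forall>i\<in>Basis.
        (LINT x|ball_measure. w x * frechet_derivative \<phi> (at x) i) = - (LINT x|ball_measure. (g x \<bullet> i) * \<phi> x))"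

lemma L2_imp_L1_loc:
  fixes w :: "'a::euclidean_space \<Rightarrow> 'b::euclidean_space"
  assumes "square_integrable ball_measure w"
  shows "w \<in> L1_loc unit_ball"
  unfolding L1_loc_def
proof (intro CollectI allI impI)
  fix K :: "'a set" assume K: "compact K \<and> K \<subseteq> unit_ball"
  then have [simp]: "K \<in> sets lebesgue" by (simp add: lmeasurable_compact fmeasurableD)
  have w: "integrable ball_measure w" by (rule square_integrable_integrable[OF finite_ball_measure assms])
  then have "integrable lebesgue (\<lambda>x. indicator unit_ball x *\<^sub>R w x)" by (subst (asm) integrable_restrict_space) auto
  then have "integrable lebesgue (\<lambda>x. indicator K x *\<^sub>R (indicator unit_ball x *\<^sub>R w x))"
    by (rule integrable_mult_indicator[rotated]) simp
  also have "(\<lambda>x. indicator K x *\<^sub>R (indicator unit_ball x *\<^sub>R w x)) = (\<lambda>x. indicator K x *\<^sub>R w x)"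
    using K by (auto simp: indicator_def fun_eq_iff)
  finally show "integrable (lebesgue_on K) w" by (subst integrable_restrict_space) auto
qed

lemma wgrad_iff:
  "wgrad w g \<longleftrightarrow> w \<in> L2 unit_ball \<and> g \<in> L2 unit_ball \<and> has_weak_gradient unit_ball w g"
  by (auto simp only: wgrad_def square_integrable_L2 has_weak_gradient_def intro: L2_imp_L1_loc)

lemma wgrad_grad: "w \<in> H1 unit_ball \<Longrightarrow> wgrad w (grad w)"
proof -
  assume "w \<in> H1 unit_ball"
  then have w: "w \<in> L2 unit_ball" and "\<exists>g. g \<in> L2 unit_ball \<and> has_weak_gradient unit_ball w g"
    by (auto simp: H1_def)
  from someI_ex[OF this(2)] show ?thesis using w unfolding wgrad_iff weak_gradient_def by blast
qed

lemma wgrad_H1: "wgrad w g \<Longrightarrow> w \<in> H1 unit_ball"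
  by (auto simp: wgrad_iff H1_def)

lemma test_function_square_integrable:
  "\<phi> \<in> test_functions \<Omega> \<Longrightarrow> square_integrable ball_measure \<phi>"
  using test_functionsD(1) smooth_continuous continuous_square_integrable_ball by blast

lemma wgrad_unique:
  fixes w :: "'a::euclidean_space \<Rightarrow> real"
  assumes "wgrad w g" "wgrad w h"
  shows "AE x in ball_measure. g x = h x"
proof -
  have sq: "square_integrable ball_measure g" "square_integrable ball_measure h" using assms by (auto simp: wgrad_def)
  have "AE x in ball_measure. (g x - h x) \<bullet> i = 0" if i: "i \<in> Basis" for i
  proof (rule fundamental_lemma)
    have [measurable]: "g \<in> borel_measurable ball_measure" "h \<in> borel_measurable ball_measure" using sq by simp_all
    have sqi: "square_integrable ball_measure (\<lambda>x. u x \<bullet> i)" if "square_integrable ball_measure u" for u :: "'a \<Rightarrow> 'a"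
    proof (rule square_integrable_bound[OF that, of _ 1])
      have [measurable]: "u \<in> borel_measurable ball_measure" using that by simp
      show "(\<lambda>x. u x \<bullet> i) \<in> borel_measurable ball_measure" by measurable
      show "AE x in ball_measure. norm (u x \<bullet> i) \<le> 1 * norm (u x)" using Basis_le_norm[OF i] by simp
    qed
    show "integrable ball_measure (\<lambda>x. (g x - h x) \<bullet> i)"
      by (intro square_integrable_integrable finite_ball_measure sqi square_integrable_diff sq)
    fix \<phi> :: "'a \<Rightarrow> real" assume \<phi>: "\<phi> \<in> test_functions unit_ball"
    note sq\<phi> = test_function_square_integrable[OF \<phi>]
    have "(LINT x|ball_measure. (g x \<bullet> i) * \<phi> x) = (LINT x|ball_measure. (h x \<bullet> i) * \<phi> x)"
      using assms \<phi> i by (simp add: wgrad_def)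
    then show "(LINT x|ball_measure. ((g x - h x) \<bullet> i) * \<phi> x) = 0"
      using square_integrable_mult[OF sqi[OF sq(1)] sq\<phi>] square_integrable_mult[OF sqi[OF sq(2)] sq\<phi>]
      by (simp add: inner_diff_left left_diff_distrib)
  qed
  then have "AE x in ball_measure. \<forall>i\<in>Basis. (g x - h x) \<bullet> i = 0"
    by (intro AE_finite_allI) auto
  then show ?thesis
    by eventually_elim (simp add: euclidean_eq_iff[where 'a='a] inner_diff_left)
qed

lemma frechet_continuous: "smooth \<phi> \<Longrightarrow> i \<in> Basis \<Longrightarrow> continuous_on UNIV (\<lambda>x. frechet_derivative \<phi> (at x) i)"
  using smooth_derivative(2) smooth_continuous by blast

lemma frechet_square_integrable:
  "smooth \<phi> \<Longrightarrow> i \<in> Basis \<Longrightarrow> square_integrable ball_measure (\<lambda>x. frechet_derivative \<phi> (at x) i)"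
  by (intro continuous_square_integrable_ball frechet_continuous)

lemma inner_square_integrable:
  fixes u :: "'a \<Rightarrow> 'b::euclidean_space"
  assumes "square_integrable M u"
  shows "square_integrable M (\<lambda>x. u x \<bullet> i)"
proof (rule square_integrable_bound[OF assms, of _ "norm i"])
  have [measurable]: "u \<in> borel_measurable M" using assms by simp
  show "(\<lambda>x. u x \<bullet> i) \<in> borel_measurable M" by measurable
  show "AE x in M. norm (u x \<bullet> i) \<le> norm i * norm (u x)" 
    by (intro AE_I2) (metis Cauchy_Schwarz_ineq2 mult.commute real_norm_def)
qed

lemma L2_tendsto_inner_const:
  assumes "L2_tendsto M s f"
  shows "L2_tendsto M (\<lambda>n x. s n x \<bullet> i) (\<lambda>x. f x \<bullet> i)"
proof (rule L2_tendsto_dominated[OF assms, where C="norm i"])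
  show "AE x in M. norm (s n x \<bullet> i - f x \<bullet> i) \<le> norm i * norm (s n x - f x)" for n
    by (intro AE_I2) (metis Cauchy_Schwarz_ineq2 mult.commute real_norm_def inner_diff_left)
qed (use assms in \<open>auto intro: inner_square_integrable simp: L2_tendsto_def\<close>)

lemma wgrad_closed:
  assumes w: "\<And>n. wgrad (w n) (g n)" and lw: "L2_tendsto ball_measure w v" and lg: "L2_tendsto ball_measure g h"
  shows "wgrad v h"
  unfolding wgrad_def
proof (intro conjI ballI)
  show "square_integrable ball_measure v" "square_integrable ball_measure h" using lw lg by (auto simp: L2_tendsto_def)
  fix \<phi> :: "'a \<Rightarrow> real" and i :: 'a assume \<phi>: "\<phi> \<in> test_functions unit_ball" and i: "i \<in> Basis"
  have "(\<lambda>n. LINT x|ball_measure. w n x * frechet_derivative \<phi> (at x) i) \<longlonglongrightarrow> (LINT x|ball_measure. v x * frechet_derivative \<phi> (at x) i)"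
    using L2_tendsto_inner[OF lw frechet_square_integrable[OF test_functionsD(1)[OF \<phi>] i]] by simp
  moreover have "(\<lambda>n. - (LINT x|ball_measure. (g n x \<bullet> i) * \<phi> x)) \<longlonglongrightarrow> - (LINT x|ball_measure. (h x \<bullet> i) * \<phi> x)"
    using L2_tendsto_inner[OF L2_tendsto_inner_const[OF lg, of i] test_function_square_integrable[OF \<phi>]]
    by (intro tendsto_minus) simp
  ultimately show "(LINT x|ball_measure. v x * frechet_derivative \<phi> (at x) i) = - (LINT x|ball_measure. (h x \<bullet> i) * \<phi> x)"
    using w \<phi> i LIMSEQ_unique by (simp add: wgrad_def)
qed

section \<open>Classical gradients as weak gradients\<close>

definition cgrad :: "('a::euclidean_space \<Rightarrow> real) \<Rightarrow> 'a \<Rightarrow> 'a" where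
  "cgrad \<phi> x = (\<Sum>i\<in>Basis. frechet_derivative \<phi> (at x) i *\<^sub>R i)"

lemma cgrad_inner: "i \<in> Basis \<Longrightarrow> cgrad \<phi> x \<bullet> i = frechet_derivative \<phi> (at x) i"
  by (simp add: cgrad_def inner_sum_left_Basis)

lemma cgrad_continuous: "smooth \<phi> \<Longrightarrow> continuous_on UNIV (cgrad \<phi>)"
  unfolding cgrad_def by (intro continuous_intros frechet_continuous)

lemma cgrad_eqI:
  assumes "(\<phi> has_derivative (\<lambda>h. g \<bullet> h)) (at x)"
  shows "cgrad \<phi> x = g"
proof -
  have "frechet_derivative \<phi> (at x) = (\<lambda>h. g \<bullet> h)" using frechet_derivative_at[OF assms] by simp
  then show ?thesis by (simp add: cgrad_def euclidean_representation)
qed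

lemma has_derivative_cgrad:
  assumes "smooth \<phi>"
  shows "(\<phi> has_derivative (\<lambda>h. cgrad \<phi> x \<bullet> h)) (at x)"
proof -
  let ?D = "frechet_derivative \<phi> (at x)"
  have "linear ?D" using has_derivative_linear[OF smooth_derivative(1)[OF assms]] .
  have "?D h = cgrad \<phi> x \<bullet> h" for h
  proof -
    have "?D h = ?D (\<Sum>i\<in>Basis. (h \<bullet> i) *\<^sub>R i)" by (simp add: euclidean_representation)
    also have "\<dots> = (\<Sum>i\<in>Basis. (h \<bullet> i) * ?D i)"
      by (simp add: linear_sum[OF \<open>linear ?D\<close>] linear_cmul[OF \<open>linear ?D\<close>])
    also have "\<dots> = cgrad \<phi> x \<bullet> h"
      unfolding cgrad_def inner_sum_left inner_scaleR_left by (simp add: inner_commute mult.commute)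
    finally show ?thesis .
  qed
  then have "?D = (\<lambda>h. cgrad \<phi> x \<bullet> h)" by blast
  then show ?thesis using smooth_derivative(1)[OF assms, of x] by simp
qed

lemma cgrad_add:
  assumes f: "smooth f" and g: "smooth g"
  shows "cgrad (\<lambda>x. f x + g x) x = cgrad f x + cgrad g x"
  using has_derivative_add[OF has_derivative_cgrad[OF f, of x] has_derivative_cgrad[OF g, of x]]
  by (intro cgrad_eqI) (simp add: inner_add_left)

lemma cgrad_mult:
  assumes f: "smooth f" and g: "smooth g"
  shows "cgrad (\<lambda>x. f x * g x) x = f x *\<^sub>R cgrad g x + g x *\<^sub>R cgrad f x"
  using has_derivative_mult[OF has_derivative_cgrad[OF f, of x] has_derivative_cgrad[OF g, of x]]
  by (intro cgrad_eqI) (simp add: inner_add_left mult.commute)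

lemma cgrad_scale:
  assumes f: "smooth f"
  shows "cgrad (\<lambda>x. c * f x) x = c *\<^sub>R cgrad f x"
  using has_derivative_mult_right[OF has_derivative_cgrad[OF f, of x], of c]
  by (intro cgrad_eqI) simp

lemma cgrad_square_integrable: "smooth \<phi> \<Longrightarrow> square_integrable ball_measure (cgrad \<phi>)"
  by (intro continuous_square_integrable_ball cgrad_continuous)

lemma cgrad_zero_outside:
  assumes "\<phi> \<in> test_functions unit_ball" "x \<notin> unit_ball"
  shows "cgrad \<phi> x = 0"
proof -
  let ?K = "closure {x. \<phi> x \<noteq> 0}"
  have x: "x \<in> - ?K" and o: "open (- ?K)" using test_functionsD(3)[OF assms(1)] assms(2) by auto
  have z: "0 = \<phi> y" if "y \<in> - ?K" for y
  proof (rule ccontr)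
    assume "0 \<noteq> \<phi> y"
    then have "y \<in> ?K" by (intro subsetD[OF closure_subset]) simp
    then show False using that by simp
  qed
  have "(\<phi> has_derivative (\<lambda>h. 0)) (at x)"
    by (rule has_derivative_transform_within_open[OF has_derivative_const o x z])
  then have "(\<phi> has_derivative (\<lambda>h. 0 \<bullet> h)) (at x)" by simp
  then show ?thesis by (rule cgrad_eqI)
qed

text \<open>Integration by parts: the product with a test function is again a test function, so the
  integral of its partial derivative vanishes.\<close>

lemma wgrad_smooth:
  assumes f: "smooth f"
  shows "wgrad f (cgrad f)"
  unfolding wgrad_def
proof (intro conjI ballI)
  show "square_integrable ball_measure f" "square_integrable ball_measure (cgrad f)"
    using f by (auto intro!: continuous_square_integrable_ball smooth_continuous cgrad_continuous)
  note sqf = this(1)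
  fix \<phi> :: "'a \<Rightarrow> real" and i :: 'a assume \<phi>: "\<phi> \<in> test_functions unit_ball" and i: "i \<in> Basis"
  have s\<phi>: "smooth \<phi>" using test_functionsD(1)[OF \<phi>] .
  have t: "(\<lambda>x. f x * \<phi> x) \<in> test_functions unit_ball" by (rule test_functions_mult[OF f \<phi>])
  have st: "smooth (\<lambda>x. f x * \<phi> x)" using test_functionsD(1)[OF t] .
  have "(LINT x|lborel. cgrad (\<lambda>x. f x * \<phi> x) x \<bullet> i) = 0"
    using test_functionsD(4)[OF t] i cgrad_continuous[OF st]
    by (intro integral_partial_derivative_zero[OF has_derivative_cgrad[OF st]]) (auto intro!: continuous_intros)
  moreover have "(LINT x|lborel. cgrad (\<lambda>x. f x * \<phi> x) x \<bullet> i) = (LINT x|ball_measure. cgrad (\<lambda>x. f x * \<phi> x) x \<bullet> i)"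
    using cgrad_zero_outside[OF t] cgrad_continuous[OF st]
    by (intro integral_ball_lborel(1)[symmetric] borel_measurable_continuous_onI) (auto intro!: continuous_intros)
  moreover have "cgrad (\<lambda>x. f x * \<phi> x) x \<bullet> i = f x * frechet_derivative \<phi> (at x) i + (cgrad f x \<bullet> i) * \<phi> x" for x
    using i by (simp add: cgrad_mult f s\<phi> inner_add_left cgrad_inner mult.commute)
  ultimately have "(LINT x|ball_measure. f x * frechet_derivative \<phi> (at x) i + (cgrad f x \<bullet> i) * \<phi> x) = 0" by simp
  moreover have "integrable ball_measure (\<lambda>x. f x * frechet_derivative \<phi> (at x) i)"
    by (intro square_integrable_mult sqf frechet_square_integrable s\<phi> i)
  moreover have "integrable ball_measure (\<lambda>x. (cgrad f x \<bullet> i) * \<phi> x)"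
    by (intro square_integrable_mult inner_square_integrable cgrad_square_integrable f test_function_square_integrable[OF \<phi>])
  ultimately show "(LINT x|ball_measure. f x * frechet_derivative \<phi> (at x) i) = - (LINT x|ball_measure. (cgrad f x \<bullet> i) * \<phi> x)"
    by simp
qed

lemma wgrad_add:
  assumes "wgrad w g" "wgrad v h"
  shows "wgrad (\<lambda>x. w x + v x) (\<lambda>x. g x + h x)"
  unfolding wgrad_def
proof (intro conjI ballI)
  have sq: "square_integrable ball_measure w" "square_integrable ball_measure v"
    "square_integrable ball_measure g" "square_integrable ball_measure h" using assms by (auto simp: wgrad_def)
  then show "square_integrable ball_measure (\<lambda>x. w x + v x)" "square_integrable ball_measure (\<lambda>x. g x + h x)"
    by (auto intro: square_integrable_add)
  fix \<phi> :: "'a \<Rightarrow> real" and i :: 'a assume \<phi>: "\<phi> \<in> test_functions unit_ball" and i: "i \<in> Basis"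
  note f = frechet_square_integrable[OF test_functionsD(1)[OF \<phi>] i]
  note p = test_function_square_integrable[OF \<phi>]
  show "(LINT x|ball_measure. (w x + v x) * frechet_derivative \<phi> (at x) i) = - (LINT x|ball_measure. ((g x + h x) \<bullet> i) * \<phi> x)"
    using assms \<phi> i square_integrable_mult[OF sq(1) f] square_integrable_mult[OF sq(2) f]
      square_integrable_mult[OF inner_square_integrable[OF sq(3), of i] p] square_integrable_mult[OF inner_square_integrable[OF sq(4), of i] p]
    by (simp add: wgrad_def distrib_right inner_add_left)
qed

lemma wgrad_scale:
  assumes "wgrad w g"
  shows "wgrad (\<lambda>x. c * w x) (\<lambda>x. c *\<^sub>R g x)"
  using assms square_integrable_scaleR[of ball_measure w c] square_integrable_scaleR[of ball_measure g c]
  unfolding wgrad_def by (auto simp: mult.assoc)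

section \<open>The space of functions vanishing on the boundary\<close>

text \<open>The closure of the test functions in the graph norm, recorded as pairs. Linearity and
  closedness become statements about limits, with no reference to the gradient that
  \<open>weak_gradient\<close> happens to choose.\<close>

definition h10 :: "('a::euclidean_space \<Rightarrow> real) \<Rightarrow> ('a \<Rightarrow> 'a) \<Rightarrow> bool" where
  "h10 w g \<longleftrightarrow> (\<exists>s. (\<forall>n. s n \<in> test_functions unit_ball) \<and> L2_tendsto ball_measure s w \<and>
     L2_tendsto ball_measure (\<lambda>n. cgrad (s n)) g)"

lemma h10_wgrad: "h10 w g \<Longrightarrow> wgrad w g"
  unfolding h10_def by (elim exE conjE) (rule wgrad_closed[OF wgrad_smooth[OF test_functionsD(1)]], auto)

lemma h10_square_integrable:
  "h10 w g \<Longrightarrow> square_integrable ball_measure w" "h10 w g \<Longrightarrow> square_integrable ball_measure g"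
  using h10_wgrad by (auto simp: wgrad_def)

lemma test_functions_scale:
  assumes "\<phi> \<in> test_functions \<Omega>"
  shows "(\<lambda>x. c * \<phi> x) \<in> test_functions \<Omega>"
  using test_functions_mult[OF smooth_const assms] .

lemma h10_grad:
  assumes "h10 w g"
  shows "AE x in ball_measure. grad w x = g x" "w \<in> H1 unit_ball"
  using wgrad_unique[OF wgrad_grad[OF wgrad_H1[OF h10_wgrad[OF assms]]] h10_wgrad[OF assms]]
    wgrad_H1[OF h10_wgrad[OF assms]] by auto

lemma H1_norm_wgrad:
  assumes "wgrad w g"
  shows "(H1_norm unit_ball w)\<^sup>2 = (LINT x|ball_measure. (w x)\<^sup>2) + (LINT x|ball_measure. (norm (g x))\<^sup>2)"
proof -
  note g = wgrad_grad[OF wgrad_H1[OF assms]]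
  have "(LINT x|ball_measure. (norm (grad w x))\<^sup>2) = (LINT x|ball_measure. (norm (g x))\<^sup>2)"
  proof (rule integral_cong_AE)
    show "AE x in ball_measure. (norm (grad w x))\<^sup>2 = (norm (g x))\<^sup>2"
      using wgrad_unique[OF g assms] by eventually_elim simp
  qed (use g assms in \<open>auto simp: wgrad_def intro!: borel_measurable_integrable\<close>)
  then show ?thesis by (simp add: H1_norm_def)
qed

text \<open>In both directions the choice of a gradient is harmless, because
  \<open>H1_norm_wgrad\<close> computes the norm from any weak gradient.\<close>

lemma H10_iff: "w \<in> H10 unit_ball \<longleftrightarrow> (\<exists>g. h10 w g)"
proof
  assume w: "w \<in> H10 unit_ball"
  then have g: "wgrad w (grad w)" using wgrad_grad by (auto simp: H10_def)
  have "\<exists>\<phi>\<in>test_functions unit_ball. H1_norm unit_ball (\<lambda>x. w x - \<phi> x) < inverse (real (Suc n))" for n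
    using w by (simp add: H10_def)
  then obtain s where s: "\<And>n. s n \<in> test_functions unit_ball" "\<And>n. H1_norm unit_ball (\<lambda>x. w x - s n x) < inverse (real (Suc n))"
    by metis
  have sm: "smooth (s n)" for n using s(1) test_functionsD(1) by blast
  have d: "wgrad (\<lambda>x. w x - s n x) (\<lambda>x. grad w x - cgrad (s n) x)" for n
    using wgrad_add[OF g wgrad_scale[OF wgrad_smooth[OF sm[of n]], of "-1"]] by simp
  have le: "(LINT x|ball_measure. (w x - s n x)\<^sup>2) + (LINT x|ball_measure. (norm (grad w x - cgrad (s n) x))\<^sup>2) \<le> (inverse (real (Suc n)))\<^sup>2" for n
    using power_mono[OF less_imp_le[OF s(2)[of n]], of 2] H1_norm_wgrad[OF d[of n]] by (simp add: H1_norm_def)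
  have lim: "(\<lambda>n. (inverse (real (Suc n)))\<^sup>2) \<longlonglongrightarrow> 0"
    using tendsto_power[OF LIMSEQ_inverse_real_of_nat, of 2] by (simp only: power_zero_numeral)
  have "(\<lambda>n. LINT x|ball_measure. (norm (s n x - w x))\<^sup>2) \<longlonglongrightarrow> 0"
  proof (rule squeeze_zero[OF _ _ lim])
    show "(LINT x|ball_measure. (norm (s n x - w x))\<^sup>2) \<le> (inverse (real (Suc n)))\<^sup>2" for n
      using order_trans[OF _ le[of n], of "LINT x|ball_measure. (w x - s n x)\<^sup>2"] by (simp add: power2_commute)
  qed simp
  moreover have "(\<lambda>n. LINT x|ball_measure. (norm (cgrad (s n) x - grad w x))\<^sup>2) \<longlonglongrightarrow> 0"
  proof (rule squeeze_zero[OF _ _ lim])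
    show "(LINT x|ball_measure. (norm (cgrad (s n) x - grad w x))\<^sup>2) \<le> (inverse (real (Suc n)))\<^sup>2" for n
      using order_trans[OF _ le[of n], of "LINT x|ball_measure. (norm (grad w x - cgrad (s n) x))\<^sup>2"] by (simp add: norm_minus_commute)
  qed simp
  ultimately have "h10 w (grad w)"
    unfolding h10_def L2_tendsto_def using s g test_function_square_integrable cgrad_square_integrable[OF sm]
    by (intro exI[of _ s]) (auto simp: wgrad_def)
  then show "\<exists>g. h10 w g" by (intro exI[of _ "grad w"])
next
  assume "\<exists>g. h10 w g"
  then obtain g where g: "h10 w g" ..
  then obtain s where s: "\<And>n. s n \<in> test_functions unit_ball" "L2_tendsto ball_measure s w"
      "L2_tendsto ball_measure (\<lambda>n. cgrad (s n)) g" by (auto simp: h10_def)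
  have sm: "smooth (s n)" for n using s(1) test_functionsD(1) by blast
  have d: "wgrad (\<lambda>x. w x - s n x) (\<lambda>x. g x - cgrad (s n) x)" for n
    using wgrad_add[OF h10_wgrad[OF g] wgrad_scale[OF wgrad_smooth[OF sm[of n]], of "-1"]] by simp
  have "(\<lambda>n. (LINT x|ball_measure. (w x - s n x)\<^sup>2) + (LINT x|ball_measure. (norm (g x - cgrad (s n) x))\<^sup>2)) \<longlonglongrightarrow> 0 + 0"
    using s(2,3) by (intro tendsto_add) (simp_all add: L2_tendsto_def power2_commute norm_minus_commute)
  then have lim: "(\<lambda>n. (H1_norm unit_ball (\<lambda>x. w x - s n x))\<^sup>2) \<longlonglongrightarrow> 0"
    by (simp add: H1_norm_wgrad[OF d])
  show "w \<in> H10 unit_ball"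
    unfolding H10_def
  proof (intro CollectI conjI allI impI)
    show "w \<in> H1 unit_ball" by (rule h10_grad(2)[OF g])
    fix e :: real assume e: "0 < e"
    then obtain n where "(H1_norm unit_ball (\<lambda>x. w x - s n x))\<^sup>2 < e\<^sup>2"
      using order_tendstoD(2)[OF lim, of "e\<^sup>2"] eventually_happens'[OF sequentially_bot] by fastforce
    then have "H1_norm unit_ball (\<lambda>x. w x - s n x) < e" using e power2_less_imp_less[of _ e] by simp
    then show "\<exists>\<phi>\<in>test_functions unit_ball. H1_norm unit_ball (\<lambda>x. w x - \<phi> x) < e" using s(1) by blast
  qed
qed

lemma h10_test: "\<phi> \<in> test_functions unit_ball \<Longrightarrow> h10 \<phi> (cgrad \<phi>)"
proof -
  assume \<phi>: "\<phi> \<in> test_functions unit_ball"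
  have "L2_tendsto ball_measure (\<lambda>n. \<phi>) \<phi>" "L2_tendsto ball_measure (\<lambda>n. cgrad \<phi>) (cgrad \<phi>)"
    by (intro L2_tendsto_const test_function_square_integrable[OF \<phi>] cgrad_square_integrable test_functionsD(1)[OF \<phi>])+
  then show ?thesis unfolding h10_def using \<phi> by (intro exI[of _ "\<lambda>_. \<phi>"]) simp
qed

lemma h10_add:
  assumes "h10 w g" "h10 v h"
  shows "h10 (\<lambda>x. w x + v x) (\<lambda>x. g x + h x)"
proof -
  obtain s where s: "\<And>n. s n \<in> test_functions unit_ball" "L2_tendsto ball_measure s w"
      "L2_tendsto ball_measure (\<lambda>n. cgrad (s n)) g" using assms(1) by (auto simp: h10_def)
  obtain t where t: "\<And>n. t n \<in> test_functions unit_ball" "L2_tendsto ball_measure t v"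
      "L2_tendsto ball_measure (\<lambda>n. cgrad (t n)) h" using assms(2) by (auto simp: h10_def)
  have "cgrad (\<lambda>x. s n x + t n x) = (\<lambda>x. cgrad (s n) x + cgrad (t n) x)" for n
    using cgrad_add[OF test_functionsD(1)[OF s(1)] test_functionsD(1)[OF t(1)]] by blast
  then show ?thesis
    unfolding h10_def using s t
    by (intro exI[of _ "\<lambda>n x. s n x + t n x"]) (auto intro: test_functions_add L2_tendsto_add)
qed

lemma h10_scale:
  assumes "h10 w g"
  shows "h10 (\<lambda>x. c * w x) (\<lambda>x. c *\<^sub>R g x)"
proof -
  obtain s where s: "\<And>n. s n \<in> test_functions unit_ball" "L2_tendsto ball_measure s w"
      "L2_tendsto ball_measure (\<lambda>n. cgrad (s n)) g" using assms(1) by (auto simp: h10_def)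
  have "cgrad (\<lambda>x. c * s n x) = (\<lambda>x. c *\<^sub>R cgrad (s n) x)" for n
    using cgrad_scale[OF test_functionsD(1)[OF s(1)]] by blast
  then show ?thesis
    unfolding h10_def using s L2_tendsto_scaleR[OF s(2), of c] L2_tendsto_scaleR[OF s(3), of c]
    by (intro exI[of _ "\<lambda>n x. c * s n x"]) (auto intro: test_functions_scale)
qed

lemma h10_diff:
  assumes "h10 w g" "h10 v h"
  shows "h10 (\<lambda>x. w x - v x) (\<lambda>x. g x - h x)"
  using h10_add[OF assms(1) h10_scale[OF assms(2), of "-1"]] by simp

text \<open>A diagonal choice: each \<open>w n\<close> is replaced by a test function within
  \<open>1 / (n + 1)\<close> of it in both squared norms.\<close>

lemma h10_closed:
  assumes w: "\<And>n. h10 (w n) (g n)" and lw: "L2_tendsto ball_measure w v" and lg: "L2_tendsto ball_measure g h"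
  shows "h10 v h"
proof -
  have ex: "\<exists>\<phi>. \<phi> \<in> test_functions unit_ball \<and> (LINT x|ball_measure. (norm (\<phi> x - w n x))\<^sup>2) < inverse (real (Suc n)) \<and>
    (LINT x|ball_measure. (norm (cgrad \<phi> x - g n x))\<^sup>2) < inverse (real (Suc n))" for n
  proof -
    obtain s where s: "\<And>n. s n \<in> test_functions unit_ball" "L2_tendsto ball_measure s (w n)"
        "L2_tendsto ball_measure (\<lambda>n. cgrad (s n)) (g n)" using w[of n] by (auto simp: h10_def)
    have "\<forall>\<^sub>F k in sequentially. (LINT x|ball_measure. (norm (s k x - w n x))\<^sup>2) < inverse (real (Suc n))"
      "\<forall>\<^sub>F k in sequentially. (LINT x|ball_measure. (norm (cgrad (s k) x - g n x))\<^sup>2) < inverse (real (Suc n))"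
      using s(2,3) by (auto simp: L2_tendsto_def intro!: order_tendstoD(2))
    from eventually_happens'[OF sequentially_bot eventually_conj[OF this]] show ?thesis using s(1) by blast
  qed
  from choice[OF allI, OF ex] obtain s where "\<forall>n. s n \<in> test_functions unit_ball \<and>
    (LINT x|ball_measure. (norm (s n x - w n x))\<^sup>2) < inverse (real (Suc n)) \<and>
    (LINT x|ball_measure. (norm (cgrad (s n) x - g n x))\<^sup>2) < inverse (real (Suc n))" by (rule exE)
  then have s: "\<And>n. s n \<in> test_functions unit_ball"
    "\<And>n. (LINT x|ball_measure. (norm (s n x - w n x))\<^sup>2) < inverse (real (Suc n))"
    "\<And>n. (LINT x|ball_measure. (norm (cgrad (s n) x - g n x))\<^sup>2) < inverse (real (Suc n))"
    by simp_all
  have "(\<lambda>n. LINT x|ball_measure. (norm (s n x - w n x))\<^sup>2) \<longlonglongrightarrow> 0"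
    by (rule squeeze_zero[OF _ less_imp_le[OF s(2)] LIMSEQ_inverse_real_of_nat]) simp
  then have 1: "L2_tendsto ball_measure s v"
    by (intro L2_tendsto_close[OF lw] test_function_square_integrable[OF s(1)])
  have "(\<lambda>n. LINT x|ball_measure. (norm (cgrad (s n) x - g n x))\<^sup>2) \<longlonglongrightarrow> 0"
    by (rule squeeze_zero[OF _ less_imp_le[OF s(3)] LIMSEQ_inverse_real_of_nat]) simp
  then have 2: "L2_tendsto ball_measure (\<lambda>n. cgrad (s n)) h"
    by (intro L2_tendsto_close[OF lg] cgrad_square_integrable test_functionsD(1)[OF s(1)])
  show ?thesis unfolding h10_def by (intro exI[of _ s] conjI allI s(1) 1 2)
qed

lemma bounded_mult_square_integrable:
  fixes w :: "'a \<Rightarrow> 'b::euclidean_space" and m :: "'a \<Rightarrow> real"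
  assumes "square_integrable M w" "m \<in> borel_measurable M" "AE x in M. \<bar>m x\<bar> \<le> C"
  shows "square_integrable M (\<lambda>x. m x *\<^sub>R w x)"
proof (rule square_integrable_bound[OF assms(1), of _ C])
  have [measurable]: "w \<in> borel_measurable M" "m \<in> borel_measurable M" using assms by simp_all
  show "(\<lambda>x. m x *\<^sub>R w x) \<in> borel_measurable M" by measurable
  show "AE x in M. norm (m x *\<^sub>R w x) \<le> C * norm (w x)"
    using assms(3) by eventually_elim (simp add: mult_right_mono)
qed

text \<open>The product rule holds for the approximating test functions; on the closed ball
  \<open>m\<close> and its gradient are bounded, so each term converges.\<close>

lemma h10_mult:
  assumes m: "smooth m" and w: "h10 w g"
  shows "h10 (\<lambda>x. m x * w x) (\<lambda>x. m x *\<^sub>R g x + w x *\<^sub>R cgrad m x)"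
proof -
  obtain s where s: "\<And>n. s n \<in> test_functions unit_ball" "L2_tendsto ball_measure s w"
      "L2_tendsto ball_measure (\<lambda>n. cgrad (s n)) g" using w by (auto simp: h10_def)
  have sm: "smooth (s n)" for n using s(1) test_functionsD(1) by blast
  have mM: "m \<in> borel_measurable ball_measure" "cgrad m \<in> borel_measurable ball_measure"
    by (auto intro!: continuous_measurable_ball smooth_continuous m continuous_on_subset[OF cgrad_continuous[OF m]])
  obtain C where C: "\<And>x. x \<in> cball 0 1 \<Longrightarrow> norm (m x) \<le> C"
    using continuous_bounded_ball[OF smooth_continuous[OF m], of 1] by blast
  obtain C' where C': "\<And>x. x \<in> cball 0 1 \<Longrightarrow> norm (cgrad m x) \<le> C'"
    using continuous_bounded_ball[OF cgrad_continuous[OF m], of 1] by blast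
  have aeC: "AE x in ball_measure. \<bar>m x\<bar> \<le> C" using C by (intro AE_I2) auto
  have aeC': "AE x in ball_measure. norm (cgrad m x) \<le> C'" using C' by (intro AE_I2) auto
  have sq1: "square_integrable ball_measure (\<lambda>x. m x *\<^sub>R u x)" if "square_integrable ball_measure u" for u :: "'a \<Rightarrow> 'c::euclidean_space"
    by (rule bounded_mult_square_integrable[OF that mM(1) aeC])
  have sq2: "square_integrable ball_measure (\<lambda>x. u x *\<^sub>R cgrad m x)" if u: "square_integrable ball_measure u" for u :: "'a \<Rightarrow> real"
  proof (rule square_integrable_bound[OF u, of _ C'])
    have [measurable]: "u \<in> borel_measurable ball_measure" using u by simp
    show "(\<lambda>x. u x *\<^sub>R cgrad m x) \<in> borel_measurable ball_measure" using mM(2) by measurable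
    show "AE x in ball_measure. norm (u x *\<^sub>R cgrad m x) \<le> C' * norm (u x)"
      using aeC' by eventually_elim (simp add: mult.commute[of C'] mult_left_mono)
  qed
  note sw = h10_square_integrable[OF w]
  have 1: "L2_tendsto ball_measure (\<lambda>n x. m x * s n x) (\<lambda>x. m x * w x)"
  proof (rule L2_tendsto_dominated[OF s(2), where C=C])
    show "AE x in ball_measure. norm (m x * s n x - m x * w x) \<le> C * norm (s n x - w x)" for n
      using aeC by eventually_elim (simp add: abs_mult mult_right_mono flip: right_diff_distrib)
  qed (use sq1[of "s _"] sq1[OF sw(1)] s(2) in \<open>auto simp: L2_tendsto_def\<close>)
  have 2: "L2_tendsto ball_measure (\<lambda>n x. m x *\<^sub>R cgrad (s n) x) (\<lambda>x. m x *\<^sub>R g x)"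
  proof (rule L2_tendsto_dominated[OF s(3), where C=C])
    show "AE x in ball_measure. norm (m x *\<^sub>R cgrad (s n) x - m x *\<^sub>R g x) \<le> C * norm (cgrad (s n) x - g x)" for n
      using aeC by eventually_elim (simp add: mult_right_mono flip: scaleR_diff_right)
  qed (use sq1[OF cgrad_square_integrable[OF sm]] sq1[OF sw(2)] in auto)
  have 3: "L2_tendsto ball_measure (\<lambda>n x. s n x *\<^sub>R cgrad m x) (\<lambda>x. w x *\<^sub>R cgrad m x)"
  proof (rule L2_tendsto_dominated[OF s(2), where C=C'])
    show "AE x in ball_measure. norm (s n x *\<^sub>R cgrad m x - w x *\<^sub>R cgrad m x) \<le> C' * norm (s n x - w x)" for n
      using aeC' by eventually_elim (simp add: mult.commute[of C'] mult_left_mono flip: scaleR_diff_left)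
  qed (use sq2[of "s _"] sq2[OF sw(1)] s(2) in \<open>auto simp: L2_tendsto_def\<close>)
  have "cgrad (\<lambda>x. m x * s n x) = (\<lambda>x. m x *\<^sub>R cgrad (s n) x + s n x *\<^sub>R cgrad m x)" for n
    using cgrad_mult[OF m sm[of n]] by blast
  then show ?thesis
    unfolding h10_def using L2_tendsto_add[OF 2 3] 1
    by (intro exI[of _ "\<lambda>n x. m x * s n x"]) (auto intro: test_functions_mult[OF m s(1)])
qed

section \<open>A logarithmic Hardy inequality\<close>

text \<open>At \<open>d = 0\<close> this is the weight \<open>1 / norm x\<close> of Hardy's
  inequality divided by a logarithmic factor, which keeps the inequality valid in the plane. A
  positive \<open>d\<close> makes the weight continuous, so that fields built from it can be
  integrated by parts.\<close>

definition log_weight :: "real \<Rightarrow> 'a::euclidean_space \<Rightarrow> real" where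
  "log_weight d x = 1 / (sqrt ((norm x)\<^sup>2 + d\<^sup>2) * (1 + ln (1 + 1 / ((norm x)\<^sup>2 + d\<^sup>2))))"

text \<open>Integrate the divergence of \<open>\<phi>\<^sup>2 F\<close> for \<open>F x = x / (q (1 + ln (1 + 1/q)))\<close> with
  \<open>q = \<bar>x\<bar>\<^sup>2 + d\<^sup>2\<close>.\<close>

lemma log_Hardy_test:
  fixes \<phi> :: "'a::euclidean_space \<Rightarrow> real"
  assumes dim: "DIM('a) \<ge> 2" and d: "0 < d" "d \<le> 1" and \<phi>: "\<phi> \<in> test_functions unit_ball"
  shows "(LINT x|ball_measure. (log_weight d x * \<phi> x)\<^sup>2) \<le> 9 * (LINT x|ball_measure. (norm (cgrad \<phi> x))\<^sup>2)"
proof -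
  define q where "q x = (norm x)\<^sup>2 + d\<^sup>2" for x :: 'a
  define \<rho> where "\<rho> x = 1 + ln (1 + 1 / q x)" for x
  \<comment> \<open>The vector field is \<open>k x\<close> times \<open>x\<close>, and
    \<open>k'\<close> is the derivative of \<open>k\<close> as a function of
    \<open>q\<close>.\<close>
  define k where "k x = 1 / (q x * \<rho> x)" for x
  define k' where "k' x = - 1 / ((q x)\<^sup>2 * \<rho> x) + 1 / ((q x)\<^sup>2 * (1 + q x) * (\<rho> x)\<^sup>2)" for x
  have q: "0 < q x" for x using d by (simp add: q_def add_nonneg_pos)
  have \<rho>: "1 \<le> \<rho> x" for x using q[of x] by (simp add: \<rho>_def)
  have nz: "q x \<noteq> 0" "\<rho> x \<noteq> 0" "q x + 1 \<noteq> 0" "1 + q x \<noteq> 0" for x using q[of x] \<rho>[of x] by auto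
  have sm: "smooth \<phi>" using test_functionsD(1)[OF \<phi>] .
  have lw: "(log_weight d x)\<^sup>2 = 1 / (q x * (\<rho> x)\<^sup>2)" for x
    using q[of x] by (simp add: log_weight_def q_def \<rho>_def power_divide power_mult_distrib)
  have cont: "continuous_on UNIV q" "continuous_on UNIV \<rho>" "continuous_on UNIV k" "continuous_on UNIV k'"
  proof -
    show 1: "continuous_on UNIV q" unfolding q_def by (intro continuous_intros)
    have "1 + 1 / q x \<noteq> 0" for x using q[of x] by (simp add: field_simps)
    then show 2: "continuous_on UNIV \<rho>" unfolding \<rho>_def using nz by (intro continuous_intros 1) auto
    show "continuous_on UNIV k" "continuous_on UNIV k'" unfolding k_def k'_def
      by (intro continuous_intros 1 2; simp add: nz)+
  qed
  have cm: "continuous_on UNIV \<phi>" "continuous_on UNIV (cgrad \<phi>)" using sm by (auto intro: smooth_continuous cgrad_continuous)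
  have dq: "(q has_derivative (\<lambda>h. 2 * (x \<bullet> h))) (at x)" for x
    unfolding q_def power2_norm_eq_inner
    by (auto intro!: derivative_eq_intros simp: inner_commute)
  have dk: "(k has_derivative (\<lambda>h. k' x * (2 * (x \<bullet> h)))) (at x)" for x
  proof -
    define kk where "kk s = 1 / (s * (1 + ln (1 + 1 / s)))" for s :: real
    have pos: "0 < 1 + 1 / q x" "0 < 1 + ln (1 + 1 / q x)" using q[of x] \<rho>[of x] by (auto simp: \<rho>_def add_pos_pos)
    have "(kk has_real_derivative k' x) (at (q x))"
      unfolding kk_def
      apply (rule derivative_eq_intros refl | (use q[of x] pos in simp; fail))+
      using q[of x] \<rho>[of x] nz[of x] unfolding k'_def \<rho>_def[symmetric]
      apply (simp add: divide_simps power2_eq_square)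
      apply (simp add: algebra_simps)
      done
    from DERIV_compose_FDERIV[OF this dq] show ?thesis
      by (simp add: kk_def k_def[abs_def] \<rho>_def mult.commute)
  qed
  \<comment> \<open>The \<open>i\<close>-th partial derivative of the \<open>i\<close>-th component
    of the field \<open>\<phi>\<^sup>2 F\<close>.\<close>
  define G where "G i x = (k x * (\<phi> x)\<^sup>2) + (x \<bullet> i)\<^sup>2 * (2 * k' x * (\<phi> x)\<^sup>2)
     + 2 * k x * \<phi> x * ((x \<bullet> i) * (cgrad \<phi> x \<bullet> i))" for i x
  have cG: "continuous_on UNIV (G i)" for i unfolding G_def by (intro continuous_intros cont cm)
  have out: "\<phi> x = 0" "cgrad \<phi> x = 0" if "x \<notin> unit_ball" for x
    using test_functionsD(4)[OF \<phi> that] cgrad_zero_outside[OF \<phi> that] by auto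
  have "(LINT x|lborel. G i x) = 0" if i: "i \<in> Basis" for i
  proof -
    define \<psi>' where "\<psi>' x h = (x \<bullet> i) * (k x * (2 * \<phi> x * (cgrad \<phi> x \<bullet> h)) + (k' x * (2 * (x \<bullet> h))) * (\<phi> x)\<^sup>2)
       + (h \<bullet> i) * (k x * (\<phi> x)\<^sup>2)" for x h
    have G: "G i = (\<lambda>x. \<psi>' x i)"
      using i by (auto simp: G_def \<psi>'_def algebra_simps power2_eq_square inner_same_Basis)
    have D: "((\<lambda>x. (x \<bullet> i) * (k x * (\<phi> x)\<^sup>2)) has_derivative \<psi>' x) (at x)" for x
      unfolding \<psi>'_def
      by (auto intro!: derivative_eq_intros dk has_derivative_cgrad[OF sm] simp: power2_eq_square algebra_simps)
    show ?thesis unfolding G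
      using cG[of i] i out unfolding G by (intro integral_partial_derivative_zero[OF D]) auto
  qed
  moreover have intG: "integrable ball_measure (G i)" for i
    by (intro square_integrable_integrable finite_ball_measure continuous_square_integrable_ball cG)
  moreover have "(LINT x|ball_measure. G i x) = (LINT x|lborel. G i x)" for i
    using out cG by (intro integral_ball_lborel borel_measurable_continuous_onI) (auto simp: G_def)
  ultimately have z: "(LINT x|ball_measure. (\<Sum>i\<in>Basis. G i x)) = 0" by simp
  have sumG: "(\<Sum>i\<in>Basis. G i x) = (DIM('a) * k x + 2 * (norm x)\<^sup>2 * k' x) * (\<phi> x)\<^sup>2 + 2 * k x * \<phi> x * (x \<bullet> cgrad \<phi> x)" for x
  proof -
    have "(\<Sum>i\<in>Basis. G i x) = DIM('a) * (k x * (\<phi> x)\<^sup>2) + (\<Sum>i\<in>Basis. (x \<bullet> i)\<^sup>2) * (2 * k' x * (\<phi> x)\<^sup>2)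
      + 2 * k x * \<phi> x * (\<Sum>i\<in>Basis. (x \<bullet> i) * (cgrad \<phi> x \<bullet> i))"
      by (simp add: G_def sum.distrib sum_distrib_left sum_distrib_right mult_ac)
    also have "(\<Sum>i\<in>Basis. (x \<bullet> i)\<^sup>2) = (norm x)\<^sup>2"
      by (subst power2_norm_eq_inner, subst euclidean_inner) (simp add: power2_eq_square)
    also have "(\<Sum>i\<in>Basis. (x \<bullet> i) * (cgrad \<phi> x \<bullet> i)) = x \<bullet> cgrad \<phi> x" by (rule euclidean_inner[symmetric])
    finally show ?thesis by (simp add: algebra_simps)
  qed
  \<comment> \<open>The divergence of the field contributes \<open>2/3\<close> of the squared
    weight, and Young's inequality takes back \<open>1/3\<close> at the price of three times the
    squared gradient. The quotient of \<open>3\<close> by \<open>1/3\<close> is the constant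
    \<open>9\<close>.\<close>
  have le: "(\<Sum>i\<in>Basis. G i x) \<ge> 1/3 * (log_weight d x * \<phi> x)\<^sup>2 - 3 * (norm (cgrad \<phi> x))\<^sup>2" if x: "x \<in> unit_ball" for x
  proof -
    define L where "L = log_weight d x"
    have L: "L\<^sup>2 = 1 / (q x * (\<rho> x)\<^sup>2)" unfolding L_def by (rule lw)
    have s: "(norm x)\<^sup>2 \<le> 1" using x by (simp add: power_le_one less_imp_le)
    have d2: "d\<^sup>2 \<le> 1" using d by (simp add: power_le_one)
    have "2/3 * L\<^sup>2 \<le> DIM('a) * k x + 2 * (norm x)\<^sup>2 * k' x"
    proof -
      have "2 * k x \<le> DIM('a) * k x" using dim q[of x] \<rho>[of x] by (intro mult_right_mono) (auto simp: k_def)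
      \<comment> \<open>In the plane the leading terms of the divergence cancel up to the
        contribution of \<open>d\<close>. What remains carries an extra factor
        \<open>1 / \<rho> x\<close>, whence the square of the logarithm in the squared
        weight.\<close>
      moreover have "2 * k x + 2 * (norm x)\<^sup>2 * k' x = 2 * (d\<^sup>2 * \<rho> x + (norm x)\<^sup>2 / (1 + q x)) / ((q x)\<^sup>2 * (\<rho> x)\<^sup>2)"
      proof -
        have n: "(norm x)\<^sup>2 = q x - d\<^sup>2" by (simp add: q_def)
        show ?thesis unfolding n k_def k'_def using nz[of x] by (simp add: divide_simps) (simp add: algebra_simps power2_eq_square)
      qed
      \<comment> \<open>On the ball \<open>q x \<le> 2\<close>, so \<open>1 + q x \<le> 3\<close>;
        this is the origin of the factor \<open>1/3\<close>.\<close>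
      moreover have "1/3 * q x \<le> d\<^sup>2 * \<rho> x + (norm x)\<^sup>2 / (1 + q x)"
      proof -
        have gen: "1/3 * (n + e) \<le> r + z" if "e \<le> r" "n / 3 \<le> z" "0 \<le> e" for n e r z :: real
        proof -
          have "1/3 * (n + e) = n / 3 + e / 3" by simp
          then show ?thesis using that by linarith
        qed
        have "1 * d\<^sup>2 \<le> \<rho> x * d\<^sup>2" using \<rho>[of x] by (intro mult_right_mono) auto
        then have 1: "d\<^sup>2 \<le> d\<^sup>2 * \<rho> x" by (simp add: mult.commute)
        have 2: "(norm x)\<^sup>2 / 3 \<le> (norm x)\<^sup>2 / (1 + q x)"
          using s d2 q[of x] by (intro divide_left_mono) (auto simp: q_def)
        have eq: "(norm x)\<^sup>2 + d\<^sup>2 = q x" by (simp add: q_def)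
        show ?thesis using gen[OF 1 2] unfolding eq by simp
      qed
      then have "2 * (1/3 * q x) / ((q x)\<^sup>2 * (\<rho> x)\<^sup>2) \<le> 2 * (d\<^sup>2 * \<rho> x + (norm x)\<^sup>2 / (1 + q x)) / ((q x)\<^sup>2 * (\<rho> x)\<^sup>2)"
        by (intro divide_right_mono mult_left_mono) auto
      moreover have "2 * (1/3 * q x) / ((q x)\<^sup>2 * (\<rho> x)\<^sup>2) = 2/3 * L\<^sup>2"
        unfolding L using nz[of x] by (simp add: power2_eq_square)
      ultimately show ?thesis by linarith
    qed
    then have "2/3 * L\<^sup>2 * (\<phi> x)\<^sup>2 \<le> (DIM('a) * k x + 2 * (norm x)\<^sup>2 * k' x) * (\<phi> x)\<^sup>2"
      by (rule mult_right_mono) simp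
    moreover have "\<bar>2 * k x * \<phi> x * (x \<bullet> cgrad \<phi> x)\<bar> \<le> 1/3 * (L * \<phi> x)\<^sup>2 + 3 * (norm (cgrad \<phi> x))\<^sup>2"
    proof -
      have kL: "k x * norm x \<le> \<bar>L\<bar>"
      proof (rule power2_le_imp_le)
        have "(norm x)\<^sup>2 \<le> q x" by (simp add: q_def)
        then have "(norm x)\<^sup>2 / ((q x)\<^sup>2 * (\<rho> x)\<^sup>2) \<le> q x / ((q x)\<^sup>2 * (\<rho> x)\<^sup>2)" by (intro divide_right_mono) auto
        also have "\<dots> = 1 / (q x * (\<rho> x)\<^sup>2)" using nz[of x] by (simp add: power2_eq_square)
        finally show "(k x * norm x)\<^sup>2 \<le> \<bar>L\<bar>\<^sup>2"
          by (simp add: L k_def power_mult_distrib power_divide)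
      qed simp
      have k0: "0 \<le> k x" using q[of x] \<rho>[of x] by (simp add: k_def)
      have "\<bar>2 * k x * \<phi> x * (x \<bullet> cgrad \<phi> x)\<bar> = 2 * k x * \<bar>\<phi> x\<bar> * \<bar>x \<bullet> cgrad \<phi> x\<bar>" using k0 by (simp add: abs_mult)
      also have "\<dots> \<le> 2 * k x * \<bar>\<phi> x\<bar> * (norm x * norm (cgrad \<phi> x))"
        using k0 by (intro mult_left_mono Cauchy_Schwarz_ineq2) auto
      also have "\<dots> = 2 * \<bar>\<phi> x\<bar> * norm (cgrad \<phi> x) * (k x * norm x)" by simp
      also have "\<dots> \<le> 2 * \<bar>\<phi> x\<bar> * norm (cgrad \<phi> x) * \<bar>L\<bar>" by (intro mult_left_mono kL) auto
      also have "\<dots> \<le> 1/3 * (L * \<phi> x)\<^sup>2 + 3 * (norm (cgrad \<phi> x))\<^sup>2"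
      proof -
        have "0 \<le> (\<bar>L\<bar> * \<bar>\<phi> x\<bar> - 3 * norm (cgrad \<phi> x))\<^sup>2" by simp
        then show ?thesis by (simp add: power2_diff power_mult_distrib algebra_simps)
      qed
      finally show ?thesis .
    qed
    ultimately show ?thesis unfolding sumG L_def[symmetric] by (simp add: power_mult_distrib)
  qed
  have lwc: "continuous_on UNIV (\<lambda>x. log_weight d x * \<phi> x)"
  proof -
    have 1: "(norm x)\<^sup>2 + d\<^sup>2 \<noteq> 0" "1 + 1 / ((norm x)\<^sup>2 + d\<^sup>2) \<noteq> 0" "1 + ln (1 + 1 / ((norm x)\<^sup>2 + d\<^sup>2)) \<noteq> 0" for x :: 'a
      using q[of x] \<rho>[of x] nz[of x] unfolding q_def \<rho>_def by (auto simp: divide_simps)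
    show ?thesis unfolding log_weight_def using 1 by (intro continuous_intros cm) auto
  qed
  have i1: "integrable ball_measure (\<lambda>x. (log_weight d x * \<phi> x)\<^sup>2)"
    using square_integrableD(2)[OF continuous_square_integrable_ball[OF lwc]] by simp
  have i2: "integrable ball_measure (\<lambda>x. (norm (cgrad \<phi> x))\<^sup>2)"
    by (rule square_integrableD(2)[OF cgrad_square_integrable[OF sm]])
  have "(LINT x|ball_measure. 1/3 * (log_weight d x * \<phi> x)\<^sup>2 - 3 * (norm (cgrad \<phi> x))\<^sup>2) \<le> (LINT x|ball_measure. (\<Sum>i\<in>Basis. G i x))"
  proof (rule integral_mono)
    show "integrable ball_measure (\<lambda>x. 1/3 * (log_weight d x * \<phi> x)\<^sup>2 - 3 * (norm (cgrad \<phi> x))\<^sup>2)" 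
      by (intro Bochner_Integration.integrable_diff integrable_mult_right i1 i2)
    show "integrable ball_measure (\<lambda>x. \<Sum>i\<in>Basis. G i x)" by (intro Bochner_Integration.integrable_sum intG)
  qed (use le in auto)
  then show ?thesis unfolding z using i1 i2 by simp
qed

text \<open>The inequality for test functions is uniform in \<open>d\<close>. Letting
  \<open>d\<close> tend to zero together with the approximants, Fatou's lemma bounds the limit with
  the singular weight.\<close>

lemma log_Hardy:
  fixes w :: "'a::euclidean_space \<Rightarrow> real"
  assumes dim: "DIM('a) \<ge> 2" and w: "h10 w g"
  shows "square_integrable ball_measure (\<lambda>x. log_weight 0 x * w x)"
proof -
  obtain s where s: "\<And>n. s n \<in> test_functions unit_ball" "L2_tendsto ball_measure s w"
      "L2_tendsto ball_measure (\<lambda>n. cgrad (s n)) g" using w by (auto simp: h10_def)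
  obtain r :: "nat \<Rightarrow> nat" where r: "strict_mono r" "AE x in ball_measure. (\<lambda>n. s (r n) x) \<longlonglongrightarrow> w x"
    using L2_tendsto_AE_subseq[OF s(2)] by blast
  define d where "d n = inverse (real (Suc n))" for n
  have d: "0 < d n" "d n \<le> 1" for n by (auto simp: d_def field_simps)
  have dlim: "d \<longlonglongrightarrow> 0" unfolding d_def by (rule LIMSEQ_inverse_real_of_nat)
  obtain B where B: "\<And>n. (LINT x|ball_measure. (norm (cgrad (s n) x))\<^sup>2) \<le> B"
    using convergent_imp_Bseq[OF convergentI[OF L2_tendsto_norm[OF s(3)]]] by (auto simp: Bseq_def abs_le_iff)
  have m: "f \<in> borel_measurable borel \<Longrightarrow> f \<in> borel_measurable ball_measure" for f :: "'a \<Rightarrow> real"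
    by (intro measurable_restrict_space1 measurable_completion) simp
  have lwm: "(log_weight e :: 'a \<Rightarrow> real) \<in> borel_measurable ball_measure" for e
  proof -
    have "log_weight e \<in> borel_measurable (borel :: 'a measure)" unfolding log_weight_def[abs_def] by measurable
    then show ?thesis by (rule m)
  qed
  have sm: "s n \<in> borel_measurable ball_measure" "w \<in> borel_measurable ball_measure" for n
    using s(2) by (auto simp: L2_tendsto_def)
  have nz: "AE x in ball_measure. (x :: 'a) \<noteq> 0"
    by (rule AE_ball_of_lborel) (rule AE_lborel_singleton)
  show ?thesis
  proof (rule L2_bound_of_AE_lim[where s="\<lambda>n x. log_weight (d n) x * s (r n) x" and N=0])
    show "(\<lambda>x. log_weight 0 x * w x) \<in> borel_measurable ball_measure" using lwm sm by measurable
    have nz': "(norm x)\<^sup>2 + (d n)\<^sup>2 \<noteq> 0" "1 + 1 / ((norm x)\<^sup>2 + (d n)\<^sup>2) \<noteq> 0" "1 + ln (1 + 1 / ((norm x)\<^sup>2 + (d n)\<^sup>2)) \<noteq> 0" for x :: 'a and n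
    proof -
      have *: "0 < (norm x)\<^sup>2 + (d n)\<^sup>2" using d(1)[of n] by (simp add: add_nonneg_pos)
      then have "0 < 1 / ((norm x)\<^sup>2 + (d n)\<^sup>2)" by simp
      with * show "(norm x)\<^sup>2 + (d n)\<^sup>2 \<noteq> 0" "1 + 1 / ((norm x)\<^sup>2 + (d n)\<^sup>2) \<noteq> 0" by linarith+
      have "0 \<le> ln (1 + 1 / ((norm x)\<^sup>2 + (d n)\<^sup>2))" using * by simp
      then show "1 + ln (1 + 1 / ((norm x)\<^sup>2 + (d n)\<^sup>2)) \<noteq> 0" by linarith
    qed
    have "continuous_on UNIV (\<lambda>x. log_weight (d n) x * s (r n) x)" for n
      unfolding log_weight_def using nz'
      by (intro continuous_intros smooth_continuous test_functionsD(1)[OF s(1)]) auto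
    then show "square_integrable ball_measure (\<lambda>x. log_weight (d n) x * s (r n) x)" for n
      by (rule continuous_square_integrable_ball)
    show "AE x in ball_measure. (\<lambda>n. log_weight (d n) x * s (r n) x) \<longlonglongrightarrow> log_weight 0 x * w x"
      using r(2) nz
    proof eventually_elim
      case (elim x)
      have *: "0 < (norm x)\<^sup>2 + 0\<^sup>2" using elim(2) by simp
      then have ***: "0 < 1 / ((norm x)\<^sup>2 + 0\<^sup>2)" by simp
      then have **: "0 \<le> ln (1 + 1 / ((norm x)\<^sup>2 + 0\<^sup>2))" by simp
      have nonzero: "(norm x)\<^sup>2 + 0\<^sup>2 \<noteq> 0" "1 + 1 / ((norm x)\<^sup>2 + 0\<^sup>2) \<noteq> 0"
        "1 + ln (1 + 1 / ((norm x)\<^sup>2 + 0\<^sup>2)) \<noteq> 0" using * ** *** by linarith+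
      then have "sqrt ((norm x)\<^sup>2 + 0\<^sup>2) * (1 + ln (1 + 1 / ((norm x)\<^sup>2 + 0\<^sup>2))) \<noteq> 0" by simp
      then show ?case unfolding log_weight_def
        using nonzero by (intro tendsto_intros dlim elim(1))
    qed
    show "(LINT x|ball_measure. (norm (log_weight (d n) x * s (r n) x))\<^sup>2) \<le> 9 * B" for n
      using log_Hardy_test[OF dim d s(1)] B[of "r n"] by (simp, meson order_trans mult_left_mono zero_le_numeral)
  qed
qed

section \<open>Multipliers vanishing at the origin\<close>

lemma L2_tendsto_dominated_convergence:
  fixes s :: "nat \<Rightarrow> 'a \<Rightarrow> 'b::euclidean_space"
  assumes s: "\<And>n. square_integrable M (s n)" "square_integrable M f"
    and lim: "AE x in M. (\<lambda>n. s n x) \<longlonglongrightarrow> f x"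
    and G: "square_integrable M (G :: 'a \<Rightarrow> real)" and b: "\<And>n. AE x in M. norm (s n x - f x) \<le> G x"
  shows "L2_tendsto M s f"
  unfolding L2_tendsto_def
proof (intro conjI allI s)
  have "(\<lambda>n. LINT x|M. (norm (s n x - f x))\<^sup>2) \<longlonglongrightarrow> (LINT x|M. 0)"
  proof (rule integral_dominated_convergence[where w="\<lambda>x. (G x)\<^sup>2"])
    show "integrable M (\<lambda>x. (G x)\<^sup>2)" using square_integrableD(2)[OF G] by simp
    show "(\<lambda>x. (norm (s n x - f x))\<^sup>2) \<in> borel_measurable M" for n
      by (rule borel_measurable_integrable[OF square_integrableD(2)[OF square_integrable_diff[OF s]]])
    show "AE x in M. (\<lambda>n. (norm (s n x - f x))\<^sup>2) \<longlonglongrightarrow> 0"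
      using lim
    proof eventually_elim
      case (elim x)
      have "(\<lambda>n. (norm (s n x - f x))\<^sup>2) \<longlonglongrightarrow> (norm (f x - f x))\<^sup>2" by (intro tendsto_intros elim)
      then show ?case by simp
    qed
    show "AE x in M. norm ((norm (s n x - f x))\<^sup>2) \<le> (G x)\<^sup>2" for n
      using b[of n] by eventually_elim (simp add: power_mono)
  qed simp
  then show "(\<lambda>n. LINT x|M. (norm (s n x - f x))\<^sup>2) \<longlonglongrightarrow> 0" by simp
qed

text \<open>A radial polynomial cutoff on a logarithmic scale: as a function of \<open>s = \<bar>x\<bar>\<^sup>2\<close> its derivative is
  \<open>(1 - (1 - s)\<^sup>n) / (s H\<^sub>n)\<close>, where \<open>H\<^sub>n\<close> is the harmonic number.\<close>

definition cutoff :: "nat \<Rightarrow> 'a::euclidean_space \<Rightarrow> real" where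
  "cutoff n x = 1 - (\<Sum>k=1..n. (1 - (norm x)\<^sup>2) ^ k / real k) / harm n"

lemma smooth_cutoff: "smooth (cutoff n)"
  unfolding cutoff_def divide_inverse
  by (intro smooth_diff smooth_const smooth_mult smooth_sum smooth_power smooth_norm_square)

lemma harm_ge_1: "n \<ge> 1 \<Longrightarrow> 1 \<le> (harm n :: real)"
  using harm_mono[of 1 n] by (simp add: harm_expand(2))

lemma one_minus_power_le:
  assumes "0 \<le> s" "s \<le> (1::real)"
  shows "1 - (1 - s) ^ k \<le> real k * s" "0 \<le> 1 - (1 - s) ^ k" "1 - (1 - s) ^ k \<le> 1"
  using Bernoulli_inequality[of "-s" k] assms by (auto simp: power_le_one)

text \<open>The cutoff is also the sum of \<open>(1 - (1 - s) ^ k) / k\<close> divided by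
  \<open>harm n\<close>, and Bernoulli's inequality bounds each summand by \<open>s\<close>. The
  third bound puts products with the cutoff into \<open>sing_L2\<close>; the fourth, a comparison
  with a geometric sum, gives pointwise convergence to \<open>1\<close> off the origin.\<close>

lemma cutoff_bounds:
  assumes "n \<ge> 1" "norm x < 1"
  shows "0 \<le> cutoff n x" "cutoff n x \<le> 1" "cutoff n x \<le> real n * (norm x)\<^sup>2"
    "x \<noteq> 0 \<Longrightarrow> 1 - cutoff n x \<le> 1 / (norm x)\<^sup>2 / harm n"
proof -
  define s where "s = (norm x)\<^sup>2"
  have s: "0 \<le> s" "s < 1" using assms by (auto simp: s_def power_less_one_iff)
  have H: "1 \<le> (harm n :: real)" by (rule harm_ge_1[OF assms(1)])
  have e: "cutoff n x = 1 - (\<Sum>k=1..n. (1 - s) ^ k / real k) / harm n" by (simp add: cutoff_def s_def)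
  have e2: "cutoff n x = (\<Sum>k=1..n. (1 - (1 - s) ^ k) / real k) / harm n"
  proof -
    have "cutoff n x = (harm n - (\<Sum>k=1..n. (1 - s) ^ k / real k)) / harm n" using H by (simp add: e diff_divide_distrib)
    then show ?thesis by (simp add: harm_def sum_subtractf[symmetric] inverse_eq_divide diff_divide_distrib)
  qed
  have "0 \<le> (\<Sum>k=1..n. (1 - s) ^ k / real k)" using s by (intro sum_nonneg) auto
  then show "cutoff n x \<le> 1" using H by (simp add: e)
  have "0 \<le> (\<Sum>k=1..n. (1 - (1 - s) ^ k) / real k)"
    using one_minus_power_le[of s] s by (intro sum_nonneg divide_nonneg_nonneg) auto
  then show "0 \<le> cutoff n x" using H unfolding e2 by simp
  have "(\<Sum>k=1..n. (1 - (1 - s) ^ k) / real k) \<le> (\<Sum>k=1..n. s)"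
    using one_minus_power_le(1)[of s] s by (intro sum_mono) (auto simp: field_simps)
  then have "(\<Sum>k=1..n. (1 - (1 - s) ^ k) / real k) \<le> real n * s" by simp
  moreover have "real n * s * 1 \<le> real n * s * harm n" using H s by (intro mult_left_mono) auto
  ultimately have "(\<Sum>k=1..n. (1 - (1 - s) ^ k) / real k) \<le> real n * s * harm n" by linarith
  then show "cutoff n x \<le> real n * (norm x)\<^sup>2" unfolding e2 s_def[symmetric] using H by (simp add: divide_le_eq)
  assume "x \<noteq> 0"
  then have s0: "0 < s" by (simp add: s_def)
  have "(\<Sum>k=1..n. (1 - s) ^ k / real k) \<le> (\<Sum>k<n. (1 - s) ^ k)"
  proof -
    have "(\<Sum>k=1..n. (1 - s) ^ k / real k) \<le> (\<Sum>k=1..n. (1 - s) ^ (k - 1))"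
    proof (rule sum_mono)
      fix k assume k: "k \<in> {1..n}"
      then obtain j where j: "k = Suc j" by (cases k) auto
      have "(1 - s) ^ k / real k \<le> (1 - s) ^ k / 1" using k s by (intro divide_left_mono) auto
      also have "\<dots> \<le> (1 - s) ^ (k - 1)" using s j by (simp add: mult_left_le_one_le)
      finally show "(1 - s) ^ k / real k \<le> (1 - s) ^ (k - 1)" .
    qed
    also have "\<dots> = (\<Sum>k<n. (1 - s) ^ k)" by (rule sum.reindex_bij_witness[of _ Suc "\<lambda>k. k - 1"]) auto
    finally show ?thesis .
  qed
  also have "\<dots> = (1 - (1 - s) ^ n) / s" using s0 by (subst sum_gp_strict) auto
  also have "\<dots> \<le> 1 / s" using s s0 one_minus_power_le(3)[of s n] by (intro divide_right_mono) auto
  finally have "(\<Sum>k=1..n. (1 - s) ^ k / real k) / harm n \<le> 1 / s / harm n" using H by (intro divide_right_mono) auto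
  then show "1 - cutoff n x \<le> 1 / (norm x)\<^sup>2 / harm n" unfolding e s_def[symmetric] by simp
qed

lemma cgrad_cutoff:
  assumes "n \<ge> 1" "norm x < 1" "x \<noteq> 0"
  shows "cgrad (cutoff n) x = (2 * (1 - (1 - (norm x)\<^sup>2) ^ n) / ((norm x)\<^sup>2 * harm n)) *\<^sub>R x"
proof (rule cgrad_eqI)
  have s0: "(norm x)\<^sup>2 \<noteq> 0" using assms by simp
  define p where "p s = 1 - (\<Sum>k=1..n. (1 - s) ^ k / real k) / harm n" for s :: real
  have H: "1 \<le> (harm n :: real)" by (rule harm_ge_1[OF assms(1)])
  have "(p has_real_derivative (1 - (1 - (norm x)\<^sup>2) ^ n) / ((norm x)\<^sup>2 * harm n)) (at ((norm x)\<^sup>2))"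
  proof -
    have "(p has_real_derivative (\<Sum>k=1..n. (1 - (norm x)\<^sup>2) ^ (k - 1)) / harm n) (at ((norm x)\<^sup>2))"
      unfolding p_def using H by (auto intro!: derivative_eq_intros simp: sum_negf[symmetric] sum_divide_distrib intro!: sum.cong)
    also have "(\<Sum>k=1..n. (1 - (norm x)\<^sup>2) ^ (k - 1)) = (\<Sum>k<n. (1 - (norm x)\<^sup>2) ^ k)"
      by (rule sum.reindex_bij_witness[of _ Suc "\<lambda>k. k - 1"]) auto
    also have "\<dots> = (1 - (1 - (norm x)\<^sup>2) ^ n) / (norm x)\<^sup>2" using s0 by (subst sum_gp_strict) auto
    finally show ?thesis by simp
  qed
  moreover have "((\<lambda>x. (norm x)\<^sup>2) has_derivative (\<lambda>h. 2 * (x \<bullet> h))) (at x)"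
    unfolding power2_norm_eq_inner by (auto intro!: derivative_eq_intros simp: inner_commute)
  ultimately have "((\<lambda>x. p ((norm x)\<^sup>2)) has_derivative (\<lambda>h. (2 * (x \<bullet> h)) * ((1 - (1 - (norm x)\<^sup>2) ^ n) / ((norm x)\<^sup>2 * harm n)))) (at x)"
    by (rule DERIV_compose_FDERIV)
  then show "(cutoff n has_derivative (\<lambda>h. (2 * (1 - (1 - (norm x)\<^sup>2) ^ n) / ((norm x)\<^sup>2 * harm n)) *\<^sub>R x \<bullet> h)) (at x)"
    unfolding cutoff_def p_def by (simp add: mult_ac)
qed

text \<open>The first bound gives pointwise decay as \<open>n\<close> grows. The second is uniform
  in \<open>n\<close>: after multiplication by a function of \<open>H10\<close> its right side is
  square integrable by \<open>log_Hardy\<close>.\<close>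

lemma cgrad_cutoff_bounds:
  assumes "n \<ge> 1" "norm x < 1" "x \<noteq> 0"
  shows "norm (cgrad (cutoff n) x) \<le> 2 / norm x / harm n"
    "norm (cgrad (cutoff n) x) \<le> 6 * log_weight 0 x"
proof -
  define s where "s = (norm x)\<^sup>2"
  have s: "0 < s" "s < 1" using assms by (auto simp: s_def power_less_one_iff)
  have H: "1 \<le> (harm n :: real)" by (rule harm_ge_1[OF assms(1)])
  note b = one_minus_power_le[of s n]
  have e: "norm (cgrad (cutoff n) x) = 2 * (1 - (1 - s) ^ n) / harm n / norm x"
    using cgrad_cutoff[OF assms] s H b assms(3) by (simp add: s_def abs_mult power2_eq_square)
  have "2 * (1 - (1 - s) ^ n) / harm n / norm x \<le> 2 * 1 / harm n / norm x"
    using s H b by (intro divide_right_mono mult_left_mono) auto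
  then show "norm (cgrad (cutoff n) x) \<le> 2 / norm x / harm n" unfolding e by (simp add: mult.commute)
  define l where "l = 1 + ln (1 + 1 / s)"
  have l: "1 \<le> l" using s by (simp add: l_def)
  have lnH: "ln (real n + 1) \<le> harm n" using ln_le_harm[of n] by simp
  \<comment> \<open>The regimes are separated by \<open>s = 1 / n\<close>. Above it
    \<open>ln (1 + 1 / s)\<close> is at most \<open>ln (n + 1)\<close>, hence at most
    \<open>harm n\<close>. Below it Bernoulli's inequality supplies the factor
    \<open>y = n s < 1\<close>, and \<open>- y ln y \<le> 1\<close> absorbs the excess of the
    logarithm.\<close>
  have key: "(1 - (1 - s) ^ n) * l \<le> 3 * harm n"
  proof (cases "1 / real n \<le> s")
    case True
    have "1 / s \<le> real n" using True s assms(1) by (simp add: field_simps)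
    then have "ln (1 + 1 / s) \<le> ln (real n + 1)" using s by (subst ln_le_cancel_iff) (auto simp: add_pos_pos)
    then have "l \<le> 3 * harm n" using lnH H by (simp add: l_def)
    moreover have "(1 - (1 - s) ^ n) * l \<le> 1 * l" using b s l by (intro mult_right_mono) auto
    ultimately show ?thesis by linarith
  next
    case False
    define y where "y = real n * s"
    have y: "0 < y" "y < 1" using False s assms(1) by (auto simp: y_def field_simps)
    have "1 + 1 / s \<le> (real n + 1) / y"
      using s assms(1) y by (simp add: y_def field_simps)
    then have "ln (1 + 1 / s) \<le> ln ((real n + 1) / y)" using s y by (subst ln_le_cancel_iff) (auto simp: add_pos_pos)
    also have "\<dots> = ln (real n + 1) - ln y" using y by (simp add: ln_div)
    finally have 1: "l \<le> 1 + ln (real n + 1) - ln y" by (simp add: l_def)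
    have "- ln y \<le> 1 / y - 1" using ln_le_minus_one[of "1 / y"] y by (simp add: ln_div)
    then have "y * (- ln y) \<le> y * (1 / y - 1)" using y by (intro mult_left_mono) auto
    then have 2: "y * (- ln y) \<le> 1" using y by (simp add: algebra_simps)
    have "(1 - (1 - s) ^ n) * l \<le> y * l" using b s l by (intro mult_right_mono) (auto simp: y_def)
    also have "\<dots> \<le> y * (1 + ln (real n + 1) - ln y)" using y 1 by (intro mult_left_mono) auto
    also have "\<dots> = y * (1 + ln (real n + 1)) + y * (- ln y)" by (simp add: algebra_simps)
    also have "\<dots> \<le> 1 * (1 + ln (real n + 1)) + 1" using y 2 by (intro add_mono mult_right_mono) auto
    also have "\<dots> \<le> 3 * harm n" using lnH H by simp
    finally show ?thesis .
  qed
  have "log_weight 0 x = 1 / (norm x * l)" by (simp add: log_weight_def s_def l_def)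
  moreover have "2 * X / harm n \<le> 6 / l" if "X * l \<le> 3 * harm n" for X :: real
  proof -
    have "2 * X \<le> 6 * harm n / l" using that l by (simp add: pos_le_divide_eq)
    then show ?thesis using assms(1) by (simp add: pos_divide_le_eq)
  qed
  from this[OF key] have "2 * (1 - (1 - s) ^ n) / harm n \<le> 6 / l" .
  then have "2 * (1 - (1 - s) ^ n) / harm n / norm x \<le> 6 / l / norm x" by (intro divide_right_mono) auto
  ultimately show "norm (cgrad (cutoff n) x) \<le> 6 * log_weight 0 x" unfolding e by (simp add: mult.commute)
qed

lemma harm_inverse_tendsto: "(\<lambda>n. c / harm (Suc n)) \<longlonglongrightarrow> (0::real)"
proof -
  have "(\<lambda>n. c / harm n) \<longlonglongrightarrow> 0"
    by (intro tendsto_divide_0[OF tendsto_const]) (rule filterlim_at_top_imp_at_infinity[OF harm_at_top])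
  then show ?thesis by (rule LIMSEQ_Suc)
qed

text \<open>The delicate term of the gradient is \<open>w\<close> times the gradient of the cutoff.
  It tends to zero pointwise and its norm is at most six times that of
  \<open>log_weight 0 x * w x\<close>, so dominated convergence applies.\<close>

lemma cutoff_approximation:
  fixes w :: "'a::euclidean_space \<Rightarrow> real"
  assumes dim: "DIM('a) \<ge> 2" and w: "h10 w g"
  defines "v \<equiv> \<lambda>n x. cutoff (Suc n) x * w x"
    and "g' \<equiv> \<lambda>n x. cutoff (Suc n) x *\<^sub>R g x + w x *\<^sub>R cgrad (cutoff (Suc n)) x"
  shows "h10 (v n) (g' n)" "L2_tendsto ball_measure v w" "L2_tendsto ball_measure g' g" "v n \<in> sing_L2"
proof -
  show h: "h10 (v n) (g' n)" for n unfolding v_def g'_def by (rule h10_mult[OF smooth_cutoff w])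
  note sq = h10_square_integrable[OF w]
  note sqv = h10_square_integrable[OF h]
  have nz: "AE x in ball_measure. (x :: 'a) \<noteq> 0"
    by (rule AE_ball_of_lborel) (rule AE_lborel_singleton)
  have inb: "AE x in ball_measure. norm (x :: 'a) < 1" by (rule AE_I2) simp
  have c1: "(\<lambda>n. cutoff (Suc n) x) \<longlonglongrightarrow> 1" if "x \<noteq> 0" "norm x < 1" for x :: 'a
  proof -
    have "(\<lambda>n. 1 - cutoff (Suc n) x) \<longlonglongrightarrow> 0"
      by (rule squeeze_zero[OF _ cutoff_bounds(4)[OF _ that(2,1)] harm_inverse_tendsto]) (use cutoff_bounds(2)[OF _ that(2)] in auto)
    then have "(\<lambda>n. 1 - (1 - cutoff (Suc n) x)) \<longlonglongrightarrow> 1 - 0" by (intro tendsto_intros)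
    then show ?thesis by simp
  qed
  have c2: "(\<lambda>n. cgrad (cutoff (Suc n)) x) \<longlonglongrightarrow> 0" if "x \<noteq> 0" "norm x < 1" for x :: 'a
  proof (rule tendsto_norm_zero_cancel)
    show "(\<lambda>n. norm (cgrad (cutoff (Suc n)) x)) \<longlonglongrightarrow> 0"
      by (rule squeeze_zero[OF _ cgrad_cutoff_bounds(1)[OF _ that(2,1)] harm_inverse_tendsto]) auto
  qed
  have cb: "\<bar>cutoff (Suc n) x - 1\<bar> \<le> 1" if "norm x < 1" for x :: 'a and n
    using cutoff_bounds(1,2)[of "Suc n" x] that by auto
  have sqabs: "square_integrable ball_measure (\<lambda>x. norm (u x))" if u: "square_integrable ball_measure u" for u :: "'a \<Rightarrow> 'b::euclidean_space"
  proof (rule square_integrable_bound[OF u, of _ 1])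
    have [measurable]: "u \<in> borel_measurable ball_measure" using u by simp
    show "(\<lambda>x. norm (u x)) \<in> borel_measurable ball_measure" by measurable
  qed simp
  show "L2_tendsto ball_measure v w"
  proof (rule L2_tendsto_dominated_convergence[OF sqv(1) sq(1) _ sqabs[OF sq(1)]])
    show "AE x in ball_measure. (\<lambda>n. v n x) \<longlonglongrightarrow> w x"
      using nz inb
    proof eventually_elim
      case (elim x)
      have "(\<lambda>n. cutoff (Suc n) x * w x) \<longlonglongrightarrow> 1 * w x" by (intro tendsto_intros c1 elim)
      then show ?case by (simp add: v_def)
    qed
    show "AE x in ball_measure. norm (v n x - w x) \<le> norm (w x)" for n
      using inb
    proof eventually_elim
      case (elim x)
      have "v n x - w x = (cutoff (Suc n) x - 1) * w x" by (simp add: v_def algebra_simps)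
      then show ?case using mult_right_mono[OF cb[OF elim, of n], of "\<bar>w x\<bar>"] by (simp add: abs_mult)
    qed
  qed
  show "L2_tendsto ball_measure g' g"
  proof (rule L2_tendsto_dominated_convergence[OF sqv(2) sq(2)])
    show "AE x in ball_measure. (\<lambda>n. g' n x) \<longlonglongrightarrow> g x"
      using nz inb
    proof eventually_elim
      case (elim x)
      have "(\<lambda>n. cutoff (Suc n) x *\<^sub>R g x + w x *\<^sub>R cgrad (cutoff (Suc n)) x) \<longlonglongrightarrow> 1 *\<^sub>R g x + w x *\<^sub>R 0"
        by (intro tendsto_intros c1 c2 elim)
      then show ?case by (simp add: g'_def)
    qed
    show "square_integrable ball_measure (\<lambda>x. norm (g x) + 6 * norm (log_weight 0 x * w x))"
      using square_integrable_scaleR[OF sqabs[OF log_Hardy[OF dim w]], of 6]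
      by (intro square_integrable_add sqabs[OF sq(2)]) simp
    show "AE x in ball_measure. norm (g' n x - g x) \<le> norm (g x) + 6 * norm (log_weight 0 x * w x)" for n
      using nz inb
    proof eventually_elim
      case (elim x)
      have lw0: "0 \<le> log_weight 0 x"
      proof -
        have "0 \<le> ln (1 + 1 / ((norm x)\<^sup>2))" using elim by simp
        then show ?thesis by (simp add: log_weight_def)
      qed
      have "g' n x - g x = (cutoff (Suc n) x - 1) *\<^sub>R g x + w x *\<^sub>R cgrad (cutoff (Suc n)) x"
        by (simp add: g'_def algebra_simps)
      then have "norm (g' n x - g x) \<le> \<bar>cutoff (Suc n) x - 1\<bar> * norm (g x) + \<bar>w x\<bar> * norm (cgrad (cutoff (Suc n)) x)"
        by (metis norm_triangle_ineq norm_scaleR)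
      also have "\<dots> \<le> 1 * norm (g x) + \<bar>w x\<bar> * (6 * log_weight 0 x)"
        using cb[OF elim(2), of n] cgrad_cutoff_bounds(2)[OF _ elim(2,1), of "Suc n"]
        by (intro add_mono mult_right_mono mult_left_mono) auto
      finally show ?case using lw0 by (simp add: abs_mult mult_ac)
    qed
  qed
  show "v n \<in> sing_L2"
  proof -
    have [measurable]: "v n \<in> borel_measurable ball_measure" using sqv(1)[of n] by simp
    have "integrable ball_measure (\<lambda>x. (v n x)\<^sup>2 / (norm x)\<^sup>2)"
    proof (rule Bochner_Integration.integrable_bound)
      show "integrable ball_measure (\<lambda>x. (real (Suc n))\<^sup>2 * (w x)\<^sup>2)"
        using square_integrableD(2)[OF sq(1)] by simp
      have "(\<lambda>x::'a. (norm x)\<^sup>2) \<in> borel_measurable ball_measure"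
        by (intro continuous_measurable_ball continuous_intros)
      then show "(\<lambda>x. (v n x)\<^sup>2 / (norm x)\<^sup>2) \<in> borel_measurable ball_measure" by measurable
      show "AE x in ball_measure. norm ((v n x)\<^sup>2 / (norm x)\<^sup>2) \<le> norm ((real (Suc n))\<^sup>2 * (w x)\<^sup>2)"
        using nz inb
      proof eventually_elim
        case (elim x)
        have n2: "0 < (norm x)\<^sup>2" "(norm x)\<^sup>2 \<le> 1" using elim by (auto simp: power_le_one)
        have "(cutoff (Suc n) x)\<^sup>2 \<le> (real (Suc n) * (norm x)\<^sup>2)\<^sup>2"
          using cutoff_bounds(1,3)[of "Suc n" x] elim by (intro power_mono) auto
        also have "\<dots> \<le> (real (Suc n))\<^sup>2 * (norm x)\<^sup>2"
          using power_decreasing[of 2 4 "norm x"] elim(2) by (simp add: power_mult_distrib mult_left_mono del: of_nat_Suc)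
        finally have "(cutoff (Suc n) x)\<^sup>2 * (w x)\<^sup>2 \<le> (real (Suc n))\<^sup>2 * (norm x)\<^sup>2 * (w x)\<^sup>2"
          by (rule mult_right_mono) simp
        then have "(v n x)\<^sup>2 / (norm x)\<^sup>2 \<le> (real (Suc n))\<^sup>2 * (w x)\<^sup>2"
          using n2(1) by (simp add: v_def power_mult_distrib divide_le_eq mult_ac)
        then show ?case by simp
      qed
    qed
    then show ?thesis unfolding sing_L2_def by simp
  qed
qed

section \<open>Compactness\<close>

lemma nn_integral_translate:
  fixes f :: "'a::euclidean_space \<Rightarrow> ennreal"
  assumes [measurable]: "f \<in> borel_measurable borel"
  shows "(\<integral>\<^sup>+x. f (c + x) \<partial>lborel) = (\<integral>\<^sup>+x. f x \<partial>lborel)"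
proof -
  have "(\<integral>\<^sup>+x. f x \<partial>lborel) = (\<integral>\<^sup>+x. f x \<partial>distr lborel borel ((+) c))" by (simp add: lborel_distr_plus)
  also have "\<dots> = (\<integral>\<^sup>+x. f (c + x) \<partial>lborel)" by (rule nn_integral_distr) measurable
  finally show ?thesis by simp
qed

text \<open>The fundamental theorem of calculus along the segment from \<open>x\<close> to
  \<open>x + h\<close>, followed by Cauchy-Schwarz against the indicator of the unit interval. The
  right side is a nonnegative integral over the line, ready for Tonelli's theorem.\<close>

lemma increment_square_le:
  fixes \<phi> :: "'a::euclidean_space \<Rightarrow> real"
  assumes \<phi>: "smooth \<phi>"
  shows "ennreal ((\<phi> (x + h) - \<phi> x)\<^sup>2) \<le>
    (\<integral>\<^sup>+t. ennreal ((norm h)\<^sup>2) * (ennreal ((norm (cgrad \<phi> (t *\<^sub>R h + x)))\<^sup>2) * indicator {0..1} t) \<partial>lborel)"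
proof -
  define f where "f t = (cgrad \<phi> (t *\<^sub>R h + x) \<bullet> h) * indicator {0..1} t" for t :: real
  define F where "F t = (norm h)\<^sup>2 * (norm (cgrad \<phi> (t *\<^sub>R h + x)))\<^sup>2 * indicator {0..1} t" for t :: real
  have cg: "continuous_on UNIV (cgrad \<phi>)" by (rule cgrad_continuous[OF \<phi>])
  have cont: "continuous_on UNIV (\<lambda>t. cgrad \<phi> (t *\<^sub>R h + x))"
    by (rule continuous_on_compose2[OF cg]) (auto intro!: continuous_intros)
  have d: "((\<lambda>t. \<phi> (t *\<^sub>R h + x)) has_real_derivative (cgrad \<phi> (t *\<^sub>R h + x) \<bullet> h)) (at t)" for t
  proof -
    have "((\<lambda>t. \<phi> (t *\<^sub>R h + x)) has_derivative (\<lambda>s. cgrad \<phi> (t *\<^sub>R h + x) \<bullet> (s *\<^sub>R h))) (at t)"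
      by (rule has_derivative_compose[OF _ has_derivative_cgrad[OF \<phi>]]) (auto intro!: derivative_eq_intros)
    then show ?thesis by (simp add: has_field_derivative_def mult_commute_abs)
  qed
  have "has_bochner_integral lborel f (\<phi> (1 *\<^sub>R h + x) - \<phi> (0 *\<^sub>R h + x))"
    unfolding f_def
  proof (rule has_bochner_integral_FTC_Icc_real)
    show "DERIV (\<lambda>t. \<phi> (t *\<^sub>R h + x)) t :> cgrad \<phi> (t *\<^sub>R h + x) \<bullet> h" for t by (rule d)
    have "continuous_on UNIV (\<lambda>t. cgrad \<phi> (t *\<^sub>R h + x) \<bullet> h)" by (intro continuous_intros cont)
    then show "isCont (\<lambda>t. cgrad \<phi> (t *\<^sub>R h + x) \<bullet> h) t" for t by (simp add: continuous_on_eq_continuous_at)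
  qed simp
  then have FTC: "(LINT t|lborel. f t) = \<phi> (1 *\<^sub>R h + x) - \<phi> (0 *\<^sub>R h + x)" and "integrable lborel f"
    by (auto simp: has_bochner_integral_iff)
  have iF: "integrable lborel F"
  proof -
    have "continuous_on {0..1} (\<lambda>t. (norm h)\<^sup>2 * (norm (cgrad \<phi> (t *\<^sub>R h + x)))\<^sup>2)"
      by (intro continuous_intros continuous_on_subset[OF cont]) simp
    from borel_integrable_compact[OF compact_Icc this] show ?thesis
      unfolding F_def by (simp add: mult_ac)
  qed
  have sqf: "square_integrable lborel f"
    unfolding square_integrable_def
  proof
    show [measurable]: "f \<in> borel_measurable lborel" using \<open>integrable lborel f\<close> by simp
    show "integrable lborel (\<lambda>t. (norm (f t))\<^sup>2)"
    proof (rule Bochner_Integration.integrable_bound[OF iF])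
      have "(cgrad \<phi> (t *\<^sub>R h + x) \<bullet> h)\<^sup>2 \<le> (norm h)\<^sup>2 * (norm (cgrad \<phi> (t *\<^sub>R h + x)))\<^sup>2" for t
        using power_mono[OF Cauchy_Schwarz_ineq2[of "cgrad \<phi> (t *\<^sub>R h + x)" h], of 2] by (simp add: power_mult_distrib mult.commute)
      then show "AE t in lborel. norm ((norm (f t))\<^sup>2) \<le> norm (F t)"
        by (intro AE_I2) (auto simp: f_def F_def indicator_def)
    qed measurable
  qed
  have sq1: "square_integrable lborel (indicator {0..1} :: real \<Rightarrow> real)"
  proof -
    have "(\<lambda>t. (norm (indicator {0..1} t :: real))\<^sup>2) = (indicator {0..1} :: real \<Rightarrow> real)" by (auto simp: indicator_def)
    then show ?thesis unfolding square_integrable_def by simp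
  qed
  have i1: "(LINT t|lborel. (norm (indicator {0..1::real} t :: real))\<^sup>2) = (1::real)"
  proof -
    have "(\<lambda>t. (norm (indicator {0..1::real} t :: real))\<^sup>2) = (indicator {0..1} :: real \<Rightarrow> real)" by (auto simp: indicator_def)
    then have "(LINT t|lborel. (norm (indicator {0..1::real} t :: real))\<^sup>2) = integral\<^sup>L lborel (indicator {0..1} :: real \<Rightarrow> real)"
      by (rule arg_cong)
    then show ?thesis by simp
  qed
  have "(\<lambda>t. f t \<bullet> indicator {0..1} t) = f" by (auto simp: f_def indicator_def)
  then have "(\<phi> (x + h) - \<phi> x)\<^sup>2 \<le> (LINT t|lborel. (norm (f t))\<^sup>2)"
    using L2_Cauchy_Schwarz[OF sqf sq1] FTC i1 by (simp add: add.commute)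
  also have "\<dots> \<le> (LINT t|lborel. F t)"
  proof (rule integral_mono[OF square_integrableD(2)[OF sqf] iF])
    fix t
    have "(cgrad \<phi> (t *\<^sub>R h + x) \<bullet> h)\<^sup>2 \<le> (norm h)\<^sup>2 * (norm (cgrad \<phi> (t *\<^sub>R h + x)))\<^sup>2"
      using power_mono[OF Cauchy_Schwarz_ineq2[of "cgrad \<phi> (t *\<^sub>R h + x)" h], of 2] by (simp add: power_mult_distrib mult.commute)
    then show "(norm (f t))\<^sup>2 \<le> F t" by (auto simp: f_def F_def indicator_def)
  qed
  finally have "ennreal ((\<phi> (x + h) - \<phi> x)\<^sup>2) \<le> ennreal (LINT t|lborel. F t)" by (rule ennreal_leI)
  also have "\<dots> = (\<integral>\<^sup>+t. ennreal (F t) \<partial>lborel)"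
    by (rule nn_integral_eq_integral[symmetric, OF iF]) (simp add: F_def)
  also have "\<dots> = (\<integral>\<^sup>+t. ennreal ((norm h)\<^sup>2) * (ennreal ((norm (cgrad \<phi> (t *\<^sub>R h + x)))\<^sup>2) * indicator {0..1} t) \<partial>lborel)"
    by (intro nn_integral_cong) (auto simp: F_def indicator_def ennreal_mult)
  finally show ?thesis .
qed

text \<open>When the increment bound is integrated over \<open>x\<close> and the integrals are
  exchanged, each shift by \<open>t\<close> times \<open>h\<close> drops out by translation
  invariance.\<close>

lemma translation_estimate:
  fixes \<phi> :: "'a::euclidean_space \<Rightarrow> real"
  assumes \<phi>: "smooth \<phi>"
  shows "(\<integral>\<^sup>+x. ennreal ((\<phi> (x + h) - \<phi> x)\<^sup>2) \<partial>lborel) \<le>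
    ennreal ((norm h)\<^sup>2) * (\<integral>\<^sup>+x. ennreal ((norm (cgrad \<phi> x))\<^sup>2) \<partial>lborel)"
proof -
  have [measurable]: "cgrad \<phi> \<in> borel_measurable borel" by (rule borel_measurable_continuous_onI[OF cgrad_continuous[OF \<phi>]])
  define E where "E = (\<integral>\<^sup>+x. ennreal ((norm (cgrad \<phi> x))\<^sup>2) \<partial>lborel)"
  have "(\<integral>\<^sup>+x. ennreal ((\<phi> (x + h) - \<phi> x)\<^sup>2) \<partial>lborel) \<le>
     (\<integral>\<^sup>+x. \<integral>\<^sup>+t. ennreal ((norm h)\<^sup>2) * (ennreal ((norm (cgrad \<phi> (t *\<^sub>R h + x)))\<^sup>2) * indicator {0..1::real} t) \<partial>lborel \<partial>lborel)"
    by (intro nn_integral_mono increment_square_le \<phi>)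
  also have "\<dots> = (\<integral>\<^sup>+t. \<integral>\<^sup>+x. ennreal ((norm h)\<^sup>2) * (ennreal ((norm (cgrad \<phi> (t *\<^sub>R h + x)))\<^sup>2) * indicator {0..1::real} t) \<partial>lborel \<partial>lborel)"
    by (rule lborel_pair.Fubini') measurable
  also have "\<dots> = (\<integral>\<^sup>+t. ennreal ((norm h)\<^sup>2) * E * indicator {0..1::real} t \<partial>lborel)"
  proof (rule nn_integral_cong)
    fix t :: real
    have "(\<integral>\<^sup>+x. ennreal ((norm h)\<^sup>2) * (ennreal ((norm (cgrad \<phi> (t *\<^sub>R h + x)))\<^sup>2) * indicator {0..1::real} t) \<partial>lborel)
       = (\<integral>\<^sup>+x. ennreal ((norm h)\<^sup>2) * indicator {0..1::real} t * ennreal ((norm (cgrad \<phi> (t *\<^sub>R h + x)))\<^sup>2) \<partial>lborel)"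
      by (simp only: mult_ac)
    also have "\<dots> = ennreal ((norm h)\<^sup>2) * indicator {0..1::real} t * (\<integral>\<^sup>+x. ennreal ((norm (cgrad \<phi> (t *\<^sub>R h + x)))\<^sup>2) \<partial>lborel)"
      by (rule nn_integral_cmult) measurable
    also have "(\<integral>\<^sup>+x. ennreal ((norm (cgrad \<phi> (t *\<^sub>R h + x)))\<^sup>2) \<partial>lborel) = E"
      unfolding E_def by (rule nn_integral_translate[of "\<lambda>x. ennreal ((norm (cgrad \<phi> x))\<^sup>2)"]) measurable
    finally show "(\<integral>\<^sup>+x. ennreal ((norm h)\<^sup>2) * (ennreal ((norm (cgrad \<phi> (t *\<^sub>R h + x)))\<^sup>2) * indicator {0..1::real} t) \<partial>lborel)
      = ennreal ((norm h)\<^sup>2) * E * indicator {0..1::real} t" by (simp only: mult_ac)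
  qed
  also have "\<dots> = ennreal ((norm h)\<^sup>2) * E"
    by (subst nn_integral_cmult_indicator) auto
  finally show ?thesis unfolding E_def .
qed

text \<open>For \<open>d > 0\<close> these are half-open cubes of side \<open>d\<close>: the floor
  function makes distinct ones disjoint and leaves no gaps. A cell depends only on the values of
  \<open>c\<close> on \<open>Basis\<close>, which is why index functions are later taken
  extensional.\<close>

definition cell :: "real \<Rightarrow> ('a::euclidean_space \<Rightarrow> int) \<Rightarrow> 'a set" where
  "cell d c = {x. \<forall>i\<in>Basis. \<lfloor>(x \<bullet> i) / d\<rfloor> = c i}"

lemma cell_borel [measurable]: "cell d c \<in> sets borel"
proof -
  have "cell d c = (\<Inter>i\<in>Basis. {x. \<lfloor>(x \<bullet> i) / d\<rfloor> = c i})" by (auto simp: cell_def)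
  also have "\<dots> \<in> sets borel"
    by (intro sets.finite_INT) auto
  finally show ?thesis .
qed

lemma cell_emeasure:
  fixes c :: "'a::euclidean_space \<Rightarrow> int"
  assumes d: "0 < d"
  shows "emeasure lborel (cell d c) < \<infinity>" "d ^ DIM('a) \<le> measure lborel (cell d c)"
proof -
  define l where "l = (\<Sum>i\<in>Basis. (d * of_int (c i)) *\<^sub>R (i :: 'a))"
  define u where "u = (\<Sum>i\<in>Basis. (d * (of_int (c i) + 1)) *\<^sub>R (i :: 'a))"
  have lu: "l \<bullet> i = d * of_int (c i)" "u \<bullet> i = d * (of_int (c i) + 1)" if "i \<in> Basis" for i
    using that by (simp_all add: l_def u_def inner_sum_left_Basis)
  have sub1: "cell d c \<subseteq> cbox l u"
  proof
    fix x assume "x \<in> cell d c"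
    then have "l \<bullet> i \<le> x \<bullet> i \<and> x \<bullet> i \<le> u \<bullet> i" if "i \<in> Basis" for i
      using that d lu[OF that] floor_correct[of "(x \<bullet> i) / d"] by (auto simp: cell_def field_simps)
    then show "x \<in> cbox l u" by (simp add: mem_box)
  qed
  have sub2: "box l u \<subseteq> cell d c"
  proof
    fix x assume "x \<in> box l u"
    then have "d * of_int (c i) < x \<bullet> i" "x \<bullet> i < d * (of_int (c i) + 1)" if "i \<in> Basis" for i
      using that lu[OF that] by (auto simp: mem_box)
    then have "\<lfloor>(x \<bullet> i) / d\<rfloor> = c i" if "i \<in> Basis" for i
      using that d by (intro floor_unique) (auto simp: field_simps less_imp_le)
    then show "x \<in> cell d c" by (simp add: cell_def)
  qed
  have "emeasure lborel (cell d c) \<le> emeasure lborel (cbox l u)" by (rule emeasure_mono[OF sub1]) simp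
  also have "\<dots> < \<infinity>" by (rule emeasure_lborel_cbox_finite)
  finally show fin: "emeasure lborel (cell d c) < \<infinity>" .
  have "measure lborel (box l u) \<le> measure lborel (cell d c)"
    using fin sub2 by (intro measure_mono_fmeasurable) (auto simp: fmeasurable_def)
  moreover have "measure lborel (box l u) = d ^ DIM('a)"
  proof -
    have "l \<bullet> i \<le> u \<bullet> i" if "i \<in> Basis" for i using lu[OF that] d by simp
    then have "measure lborel (box l u) = (\<Prod>i\<in>Basis. (u - l) \<bullet> i)" by (rule measure_lborel_box)
    also have "\<dots> = (\<Prod>i\<in>(Basis::'a set). d)" by (intro prod.cong) (auto simp: lu inner_diff_left algebra_simps)
    finally show ?thesis by simp
  qed
  ultimately show "d ^ DIM('a) \<le> measure lborel (cell d c)" by simp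
qed

text \<open>The variance identity: half the double integral is the measure of \<open>Q\<close> times
  the integral of the square, minus the square of the integral. The left side uses nonnegative
  integrals because the order of integration will be exchanged there.\<close>

lemma double_integral_square_diff:
  fixes f :: "'a::euclidean_space \<Rightarrow> real"
  assumes Q[measurable]: "Q \<in> sets borel" and fin: "emeasure lborel Q < \<infinity>"
    and f[measurable]: "f \<in> borel_measurable borel" and i1: "integrable lborel f" and i2: "integrable lborel (\<lambda>x. (f x)\<^sup>2)"
  shows "(\<integral>\<^sup>+x. \<integral>\<^sup>+y. indicator Q x * (indicator Q y * ennreal ((f y - f x)\<^sup>2)) \<partial>lborel \<partial>lborel)
    = ennreal (2 * measure lborel Q * (LINT x|lborel. indicator Q x * (f x)\<^sup>2) - 2 * (LINT x|lborel. indicator Q x * f x)\<^sup>2)"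
proof -
  define k where "k = measure lborel Q"
  define J where "J = (LINT x|lborel. indicator Q x * (f x)\<^sup>2)"
  define I where "I = (LINT x|lborel. indicator Q x * f x)"
  have q0: "integrable lborel (indicator Q :: 'a \<Rightarrow> real)" using fin by (simp add: integrable_indicator_iff)
  have q1: "integrable lborel (\<lambda>x. indicator Q x * f x)" using integrable_mult_indicator[OF _ i1, of Q] by simp
  have q2: "integrable lborel (\<lambda>x. indicator Q x * (f x)\<^sup>2)" using integrable_mult_indicator[OF _ i2, of Q] by simp
  have inner: "(\<integral>\<^sup>+y. indicator Q x * (indicator Q y * ennreal ((f y - f x)\<^sup>2)) \<partial>lborel)
    = ennreal (indicator Q x * (J - 2 * f x * I + k * (f x)\<^sup>2))" for x
  proof -
    have e: "indicator Q y * (f y - f x)\<^sup>2 = indicator Q y * (f y)\<^sup>2 - 2 * f x * (indicator Q y * f y) + indicator Q y * (f x)\<^sup>2" for y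
      by (simp add: power2_diff algebra_simps)
    have int: "integrable lborel (\<lambda>y. indicator Q y * (f y - f x)\<^sup>2)" unfolding e using q0 q1 q2 by simp
    have "(LINT y|lborel. indicator Q y * (f y - f x)\<^sup>2) = J - 2 * f x * I + k * (f x)\<^sup>2"
      unfolding e J_def I_def k_def using q0 q1 q2 by simp
    then have "(\<integral>\<^sup>+y. ennreal (indicator Q y * (f y - f x)\<^sup>2) \<partial>lborel) = ennreal (J - 2 * f x * I + k * (f x)\<^sup>2)"
      using nn_integral_eq_integral[OF int] by simp
    moreover have "ennreal (indicator Q y * (f y - f x)\<^sup>2) = indicator Q y * ennreal ((f y - f x)\<^sup>2)" for y
      by (simp add: indicator_def)
    ultimately show ?thesis by (subst nn_integral_cmult) (auto simp: indicator_def)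
  qed
  have e: "indicator Q x * (J - 2 * f x * I + k * (f x)\<^sup>2) = indicator Q x * J - 2 * I * (indicator Q x * f x) + k * (indicator Q x * (f x)\<^sup>2)" for x
    by (simp add: algebra_simps)
  have nonneg: "0 \<le> indicator Q x * (J - 2 * f x * I + k * (f x)\<^sup>2)" for x
  proof -
    have "0 \<le> (LINT y|lborel. indicator Q y * (f y - f x)\<^sup>2)" by simp
    also have "(LINT y|lborel. indicator Q y * (f y - f x)\<^sup>2) = J - 2 * f x * I + k * (f x)\<^sup>2"
    proof -
      have e: "indicator Q y * (f y - f x)\<^sup>2 = indicator Q y * (f y)\<^sup>2 - 2 * f x * (indicator Q y * f y) + indicator Q y * (f x)\<^sup>2" for y
        by (simp add: power2_diff algebra_simps)
      show ?thesis unfolding e J_def I_def k_def using q0 q1 q2 by simp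
    qed
    finally show ?thesis by (intro mult_nonneg_nonneg) auto
  qed
  have int: "integrable lborel (\<lambda>x. indicator Q x * (J - 2 * f x * I + k * (f x)\<^sup>2))" unfolding e using q0 q1 q2 by simp
  have "(\<integral>\<^sup>+x. \<integral>\<^sup>+y. indicator Q x * (indicator Q y * ennreal ((f y - f x)\<^sup>2)) \<partial>lborel \<partial>lborel)
    = ennreal (LINT x|lborel. indicator Q x * (J - 2 * f x * I + k * (f x)\<^sup>2))"
    unfolding inner using nonneg by (intro nn_integral_eq_integral[OF int]) auto
  also have "(LINT x|lborel. indicator Q x * (J - 2 * f x * I + k * (f x)\<^sup>2)) = k * J - 2 * I * I + k * J"
    unfolding e using q0 q1 q2 by (simp add: J_def I_def k_def)
  finally show ?thesis by (simp add: k_def I_def J_def power2_eq_square algebra_simps)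
qed

text \<open>The variance of \<open>\<phi>\<close> over a cell is a double integral over pairs of
  points of that cell. Such pairs differ by a vector of the cube \<open>C\<close>, so the sum over
  the cells is at most the integral over \<open>h \<in> C\<close> of the squared increments by
  \<open>h\<close>, to which the translation estimate applies. Small \<open>d\<close> makes the
  gradient constant small, and the remaining integrals over cells are finitely many linear
  functionals.\<close>

lemma cells_Poincare_test:
  fixes \<phi> :: "'a::euclidean_space \<Rightarrow> real" and d :: real
  assumes d: "0 < d" and \<phi>: "\<phi> \<in> test_functions unit_ball"
    and I: "finite I" "I \<subseteq> extensional Basis" "unit_ball \<subseteq> (\<Union>c\<in>I. cell d c)"
  shows "(LINT x|ball_measure. (\<phi> x)\<^sup>2) \<le> 2 ^ DIM('a) * (DIM('a) * d)\<^sup>2 * (LINT x|ball_measure. (norm (cgrad \<phi> x))\<^sup>2)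
    + (1 / d ^ DIM('a)) * (\<Sum>c\<in>I. (LINT x|ball_measure. \<phi> x * indicator (cell d c) x)\<^sup>2)"
proof -
  have sm: "smooth \<phi>" using test_functionsD(1)[OF \<phi>] .
  have [measurable]: "\<phi> \<in> borel_measurable borel" "cgrad \<phi> \<in> borel_measurable borel"
    by (auto intro!: borel_measurable_continuous_onI smooth_continuous sm cgrad_continuous)
  have out: "\<phi> x = 0" "cgrad \<phi> x = 0" if "x \<notin> unit_ball" for x
    using test_functionsD(4)[OF \<phi> that] cgrad_zero_outside[OF \<phi> that] by auto
  have i1: "integrable lborel \<phi>"
    using integral_ball_lborel(2)[of \<phi>] out square_integrable_integrable[OF finite_ball_measure test_function_square_integrable[OF \<phi>]] by auto
  have i2: "integrable lborel (\<lambda>x. (\<phi> x)\<^sup>2)"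
    using integral_ball_lborel(2)[of "\<lambda>x. (\<phi> x)\<^sup>2"] out square_integrableD(2)[OF test_function_square_integrable[OF \<phi>]] by auto
  have i3: "integrable lborel (\<lambda>x. (norm (cgrad \<phi> x))\<^sup>2)"
    using integral_ball_lborel(2)[of "\<lambda>x. (norm (cgrad \<phi> x))\<^sup>2"] out square_integrableD(2)[OF cgrad_square_integrable[OF sm]] by auto
  define E where "E = (LINT x|lborel. (norm (cgrad \<phi> x))\<^sup>2)"
  have E: "(\<integral>\<^sup>+x. ennreal ((norm (cgrad \<phi> x))\<^sup>2) \<partial>lborel) = ennreal E" "0 \<le> E"
    unfolding E_def using nn_integral_eq_integral[OF i3] by auto
  define J where "J c = (LINT x|lborel. indicator (cell d c) x * (\<phi> x)\<^sup>2)" for c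
  define m where "m c = (LINT x|lborel. indicator (cell d c) x * \<phi> x)" for c
  define k where "k c = measure lborel (cell d c)" for c :: "'a \<Rightarrow> int"
  define C where "C = cbox (- (d *\<^sub>R One)) (d *\<^sub>R One :: 'a)"
  have cell_unique: "c = c'" if "c \<in> I" "c' \<in> I" "x \<in> cell d c" "x \<in> cell d c'" for c c' x
    using that I(2) by (intro extensionalityI[of c Basis c']) (auto simp: cell_def)
  \<comment> \<open>Two points lie in at most one common cell, and in that case their difference
    lies in \<open>C\<close>.\<close>
  have ind_le: "(\<Sum>c\<in>I. indicator (cell d c) x * indicator (cell d c) y) \<le> (indicator C (y - x) :: ennreal)" for x y
  proof (cases "\<exists>c\<in>I. x \<in> cell d c \<and> y \<in> cell d c")
    case True
    then obtain c where c: "c \<in> I" "x \<in> cell d c" "y \<in> cell d c" by blast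
    have "(\<Sum>c\<in>I. indicator (cell d c) x * indicator (cell d c) y) = (\<Sum>c'\<in>I. if c' = c then 1 else 0 :: ennreal)"
    proof (rule sum.cong[OF refl])
      fix c' assume c': "c' \<in> I"
      show "indicator (cell d c') x * indicator (cell d c') y = (if c' = c then 1 else 0 :: ennreal)"
      proof (cases "c' = c")
        case False
        then have "x \<notin> cell d c'" using cell_unique[OF c' c(1) _ c(2)] by blast
        then show ?thesis using False by simp
      qed (use c in simp)
    qed
    also have "\<dots> = 1" using c(1) I(1) by simp
    also have "\<dots> = indicator C (y - x)"
    proof -
      have "\<bar>(y - x) \<bullet> i\<bar> \<le> d" if i: "i \<in> Basis" for i
      proof -
        have "\<lfloor>(x \<bullet> i) / d\<rfloor> = \<lfloor>(y \<bullet> i) / d\<rfloor>" using c i by (simp add: cell_def)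
        then have "\<bar>(y \<bullet> i) / d - (x \<bullet> i) / d\<bar> \<le> 1"
          using floor_correct[of "(x \<bullet> i) / d"] floor_correct[of "(y \<bullet> i) / d"] by linarith
        then have "\<bar>((y - x) \<bullet> i) / d\<bar> \<le> 1" by (simp add: inner_diff_left diff_divide_distrib)
        then show ?thesis using d by (simp add: abs_divide)
      qed
      then have "y - x \<in> C" unfolding C_def by (simp add: mem_box abs_le_iff minus_le_iff)
      then show ?thesis by simp
    qed
    finally show ?thesis by simp
  next
    case False
    then have "(\<Sum>c\<in>I. indicator (cell d c) x * indicator (cell d c) y) = (0 :: ennreal)"
      by (intro sum.neutral) (auto simp: indicator_def)
    then show ?thesis by simp
  qed
  have [measurable]: "C \<in> sets borel" by (simp add: C_def)
  have cm: "emeasure lborel C = ennreal ((2 * d) ^ DIM('a))"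
  proof -
    have "emeasure lborel C = ennreal (\<Prod>i\<in>(Basis::'a set). (d *\<^sub>R One - - (d *\<^sub>R One)) \<bullet> i)"
      unfolding C_def using d by (intro emeasure_lborel_cbox) auto
    also have "(\<Prod>i\<in>(Basis::'a set). (d *\<^sub>R One - - (d *\<^sub>R One)) \<bullet> i) = (\<Prod>i\<in>(Basis::'a set). 2 * d)"
      by (intro prod.cong) (auto simp: inner_add_left)
    finally show ?thesis by simp
  qed
  \<comment> \<open>This lets the sum move through \<open>ennreal\<close>, which truncates negative
    numbers to zero. The inequality is Cauchy-Schwarz on a cell.\<close>
  have nonneg: "0 \<le> 2 * k c * J c - 2 * (m c)\<^sup>2" for c
  proof -
    have "(m c)\<^sup>2 \<le> k c * J c"
    proof -
      have q: "square_integrable lborel (indicator (cell d c) :: 'a \<Rightarrow> real)"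
        unfolding square_integrable_def
      proof
        have "(\<lambda>x. (norm (indicator (cell d c) x :: real))\<^sup>2) = indicator (cell d c)" by (auto simp: indicator_def)
        then show "integrable lborel (\<lambda>x. (norm (indicator (cell d c) x :: real))\<^sup>2)"
          using cell_emeasure(1)[OF d, of c] by (simp add: integrable_indicator_iff)
      qed simp
      have p: "square_integrable lborel (\<lambda>x. indicator (cell d c) x * \<phi> x)"
        unfolding square_integrable_def
      proof
        have "(\<lambda>x. (norm (indicator (cell d c) x * \<phi> x))\<^sup>2) = (\<lambda>x. indicator (cell d c) x *\<^sub>R (\<phi> x)\<^sup>2)" by (auto simp: indicator_def)
        then show "integrable lborel (\<lambda>x. (norm (indicator (cell d c) x * \<phi> x))\<^sup>2)"
          using integrable_mult_indicator[OF _ i2, of "cell d c"] by simp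
      qed measurable
      have e: "(LINT x|lborel. (norm (indicator (cell d c) x :: real))\<^sup>2) = k c"
      proof -
        have "(\<lambda>x. (norm (indicator (cell d c) x :: real))\<^sup>2) = indicator (cell d c)" by (auto simp: indicator_def)
        then show ?thesis by (simp add: k_def)
      qed
      have e2: "(norm (indicator (cell d c) x * \<phi> x))\<^sup>2 = indicator (cell d c) x * (\<phi> x)\<^sup>2"
        "(indicator (cell d c) x :: real) \<bullet> (indicator (cell d c) x * \<phi> x) = indicator (cell d c) x * \<phi> x" for x
        by (auto simp: indicator_def)
      show ?thesis using L2_Cauchy_Schwarz[OF q p] unfolding e e2 by (simp add: m_def J_def)
    qed
    then show ?thesis by simp
  qed
  have "ennreal (\<Sum>c\<in>I. 2 * k c * J c - 2 * (m c)\<^sup>2)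
    = (\<Sum>c\<in>I. \<integral>\<^sup>+x. \<integral>\<^sup>+y. indicator (cell d c) x * (indicator (cell d c) y * ennreal ((\<phi> y - \<phi> x)\<^sup>2)) \<partial>lborel \<partial>lborel)"
  proof -
    have "(\<integral>\<^sup>+x. \<integral>\<^sup>+y. indicator (cell d c) x * (indicator (cell d c) y * ennreal ((\<phi> y - \<phi> x)\<^sup>2)) \<partial>lborel \<partial>lborel)
      = ennreal (2 * k c * J c - 2 * (m c)\<^sup>2)" for c
      unfolding k_def J_def m_def
      by (rule double_integral_square_diff[OF cell_borel cell_emeasure(1)[OF d] _ i1 i2]) measurable
    then show ?thesis by (simp only: sum_ennreal[OF nonneg])
  qed
  also have "\<dots> = (\<integral>\<^sup>+x. \<integral>\<^sup>+y. (\<Sum>c\<in>I. indicator (cell d c) x * (indicator (cell d c) y * ennreal ((\<phi> y - \<phi> x)\<^sup>2))) \<partial>lborel \<partial>lborel)"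
    by (subst nn_integral_sum[symmetric], measurable, intro nn_integral_cong, subst nn_integral_sum[symmetric], measurable)
  also have "\<dots> \<le> (\<integral>\<^sup>+x. \<integral>\<^sup>+y. indicator C (y - x) * ennreal ((\<phi> y - \<phi> x)\<^sup>2) \<partial>lborel \<partial>lborel)"
    using ind_le by (intro nn_integral_mono) (auto simp: mult.assoc[symmetric] sum_distrib_right[symmetric] intro!: mult_right_mono)
  also have "\<dots> = (\<integral>\<^sup>+x. \<integral>\<^sup>+h. indicator C h * ennreal ((\<phi> (x + h) - \<phi> x)\<^sup>2) \<partial>lborel \<partial>lborel)"
  proof (rule nn_integral_cong)
    fix x :: 'a
    show "(\<integral>\<^sup>+y. indicator C (y - x) * ennreal ((\<phi> y - \<phi> x)\<^sup>2) \<partial>lborel) = (\<integral>\<^sup>+h. indicator C h * ennreal ((\<phi> (x + h) - \<phi> x)\<^sup>2) \<partial>lborel)"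
      using nn_integral_translate[of "\<lambda>y. indicator C (y - x) * ennreal ((\<phi> y - \<phi> x)\<^sup>2)" x] by simp
  qed
  also have "\<dots> = (\<integral>\<^sup>+h. \<integral>\<^sup>+x. indicator C h * ennreal ((\<phi> (x + h) - \<phi> x)\<^sup>2) \<partial>lborel \<partial>lborel)"
    by (rule lborel_pair.Fubini') measurable
  also have "\<dots> \<le> (\<integral>\<^sup>+h. ennreal ((DIM('a) * d)\<^sup>2 * E) * indicator C h \<partial>lborel)"
  proof (rule nn_integral_mono)
    fix h :: 'a
    have "(\<integral>\<^sup>+x. indicator C h * ennreal ((\<phi> (x + h) - \<phi> x)\<^sup>2) \<partial>lborel) = indicator C h * (\<integral>\<^sup>+x. ennreal ((\<phi> (x + h) - \<phi> x)\<^sup>2) \<partial>lborel)"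
      by (rule nn_integral_cmult) measurable
    also have "\<dots> \<le> indicator C h * (ennreal ((norm h)\<^sup>2) * ennreal E)"
      using translation_estimate[OF sm, of h] unfolding E by (intro mult_left_mono) auto
    also have "\<dots> \<le> ennreal ((DIM('a) * d)\<^sup>2 * E) * indicator C h"
    proof (cases "h \<in> C")
      case True
      have "norm h \<le> (\<Sum>i\<in>Basis. \<bar>h \<bullet> i\<bar>)" by (rule norm_le_l1)
      also have "\<dots> \<le> (\<Sum>i\<in>(Basis::'a set). d)"
        using True by (intro sum_mono) (auto simp: C_def mem_box abs_le_iff minus_le_iff)
      finally have "(norm h)\<^sup>2 \<le> (DIM('a) * d)\<^sup>2" by (intro power_mono) auto
      then show ?thesis using True E(2) by (simp add: ennreal_mult[symmetric] mult_right_mono ennreal_leI)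
    qed simp
    finally show "(\<integral>\<^sup>+x. indicator C h * ennreal ((\<phi> (x + h) - \<phi> x)\<^sup>2) \<partial>lborel) \<le> ennreal ((DIM('a) * d)\<^sup>2 * E) * indicator C h" .
  qed
  also have "\<dots> = ennreal ((DIM('a) * d)\<^sup>2 * E * (2 * d) ^ DIM('a))"
    using d E(2) by (simp add: nn_integral_cmult_indicator cm ennreal_mult[symmetric])
  finally have "(\<Sum>c\<in>I. 2 * k c * J c - 2 * (m c)\<^sup>2) \<le> (DIM('a) * d)\<^sup>2 * E * (2 * d) ^ DIM('a)"
    using d E(2) by (subst (asm) ennreal_le_iff) auto
  moreover have "2 * d ^ DIM('a) * (\<Sum>c\<in>I. J c) \<le> (\<Sum>c\<in>I. 2 * k c * J c)"
    unfolding sum_distrib_left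
  proof (intro sum_mono mult_right_mono)
    show "0 \<le> J c" for c unfolding J_def by simp
    show "2 * d ^ DIM('a) \<le> 2 * k c" for c using cell_emeasure(2)[OF d, of c] by (simp add: k_def)
  qed
  moreover have "(\<Sum>c\<in>I. J c) = (LINT x|lborel. (\<phi> x)\<^sup>2)"
  proof -
    have "(\<Sum>c\<in>I. J c) = (LINT x|lborel. (\<Sum>c\<in>I. indicator (cell d c) x * (\<phi> x)\<^sup>2))"
      unfolding J_def using integrable_mult_indicator[OF _ i2] by (intro Bochner_Integration.integral_sum[symmetric]) simp
    also have "\<dots> = (LINT x|lborel. (\<phi> x)\<^sup>2)"
    proof (rule Bochner_Integration.integral_cong[OF refl])
      fix x
      show "(\<Sum>c\<in>I. indicator (cell d c) x * (\<phi> x)\<^sup>2) = (\<phi> x)\<^sup>2"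
      proof (cases "x \<in> unit_ball")
        case True
        then obtain c where c: "c \<in> I" "x \<in> cell d c" using I(3) by auto
        have "(\<Sum>c\<in>I. indicator (cell d c) x * (\<phi> x)\<^sup>2) = (\<Sum>c'\<in>I. if c' = c then (\<phi> x)\<^sup>2 else 0)"
        proof (rule sum.cong[OF refl])
          fix c' assume c': "c' \<in> I"
          show "indicator (cell d c') x * (\<phi> x)\<^sup>2 = (if c' = c then (\<phi> x)\<^sup>2 else 0)"
          proof (cases "c' = c")
            case False
            then have "x \<notin> cell d c'" using cell_unique[OF c' c(1) _ c(2)] by blast
            then show ?thesis using False by simp
          qed (use c in simp)
        qed
        then show ?thesis using c I(1) by simp
      qed (simp add: out)
    qed
    finally show ?thesis .
  qed
  ultimately have "2 * d ^ DIM('a) * (LINT x|lborel. (\<phi> x)\<^sup>2) \<le> (DIM('a) * d)\<^sup>2 * E * (2 * d) ^ DIM('a) + 2 * (\<Sum>c\<in>I. (m c)\<^sup>2)"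
    by (simp add: sum_subtractf sum_distrib_left)
  \<comment> \<open>The gradient constant is rounded up by a factor of two, which clears a
    fraction.\<close>
  also have "\<dots> \<le> 2 * d ^ DIM('a) * (2 ^ DIM('a) * (DIM('a) * d)\<^sup>2 * E + (1 / d ^ DIM('a)) * (\<Sum>c\<in>I. (m c)\<^sup>2))"
  proof -
    define p where "p = (DIM('a) * d)\<^sup>2 * E * (2 * d) ^ DIM('a)"
    have "0 \<le> p" using E(2) d by (simp add: p_def)
    moreover have "2 * d ^ DIM('a) * (2 ^ DIM('a) * (DIM('a) * d)\<^sup>2 * E + (1 / d ^ DIM('a)) * (\<Sum>c\<in>I. (m c)\<^sup>2)) = 2 * p + 2 * (\<Sum>c\<in>I. (m c)\<^sup>2)"
      using d by (simp add: p_def power_mult_distrib algebra_simps)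
    ultimately show ?thesis unfolding p_def[symmetric] by simp
  qed
  finally have "(LINT x|lborel. (\<phi> x)\<^sup>2) \<le> 2 ^ DIM('a) * (DIM('a) * d)\<^sup>2 * E + (1 / d ^ DIM('a)) * (\<Sum>c\<in>I. (m c)\<^sup>2)"
    using d by (subst (asm) mult_le_cancel_left_pos) auto
  moreover have "(LINT x|ball_measure. (\<phi> x)\<^sup>2) = (LINT x|lborel. (\<phi> x)\<^sup>2)"
    by (rule integral_ball_lborel) (auto simp: out)
  moreover have "(LINT x|ball_measure. (norm (cgrad \<phi> x))\<^sup>2) = E"
    unfolding E_def by (rule integral_ball_lborel) (auto simp: out)
  moreover have "(LINT x|ball_measure. \<phi> x * indicator (cell d c) x) = m c" for c
    unfolding m_def by (subst integral_ball_lborel) (auto simp: out mult.commute)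
  ultimately show ?thesis by simp
qed

section \<open>From cell integrals to Rellich's theorem\<close>

lemma indicator_square_integrable:
  fixes A :: "'a::euclidean_space set"
  assumes "A \<in> sets borel"
  shows "square_integrable ball_measure (indicator A :: 'a \<Rightarrow> real)"
proof (rule square_integrable_bounded[OF finite_ball_measure, of _ 1])
  show "(indicator A :: 'a \<Rightarrow> real) \<in> borel_measurable ball_measure"
    using assms by (intro measurable_restrict_space1 measurable_completion) simp
qed (auto simp: indicator_def)

text \<open>An inequality of Ehrling type: up to an arbitrarily small multiple of the gradient term,
  the norm is controlled by finitely many continuous functionals that do not depend on
  \<open>w\<close>. The side of the cells is chosen so that the gradient constant is exactly
  \<open>e\<close>.\<close>

lemma cells_Poincare:
  fixes e :: real
  assumes e: "0 < e"
  shows "\<exists>(J::nat) (Q :: nat \<Rightarrow> 'a::euclidean_space set) C. (\<forall>j. Q j \<in> sets borel) \<and> (\<forall>w g. h10 w g \<longrightarrow>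
    (LINT x|ball_measure. (w x)\<^sup>2) \<le> e * (LINT x|ball_measure. (norm (g x))\<^sup>2) + C * (\<Sum>j<J. (LINT x|ball_measure. w x * indicator (Q j) x)\<^sup>2))"
proof -
  define K where "K = 2 ^ DIM('a) * (real DIM('a))\<^sup>2"
  have K: "0 < K" by (simp add: K_def)
  define d where "d = sqrt (e / K)"
  have d: "0 < d" "d\<^sup>2 = e / K" using e K by (auto simp: d_def)
  \<comment> \<open>Coordinates in the ball are at most \<open>1\<close> in absolute value, so all
    cell indices that occur lie between \<open>-b\<close> and \<open>b\<close>.\<close>
  define b where "b = \<lceil>1 / d\<rceil>"
  define I where "I = (Basis :: 'a set) \<rightarrow>\<^sub>E {-b..b}"
  have I: "finite I" "I \<subseteq> extensional Basis" unfolding I_def by (rule finite_PiE; simp) (auto simp: PiE_def)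
  have cov: "unit_ball \<subseteq> (\<Union>c\<in>I. cell d c)"
  proof
    fix x :: 'a assume "x \<in> unit_ball"
    then have x: "\<bar>x \<bullet> i\<bar> \<le> 1" if "i \<in> Basis" for i using Basis_le_norm[OF that, of x] by simp
    define c where "c = restrict (\<lambda>i. \<lfloor>(x \<bullet> i) / d\<rfloor>) Basis"
    have "\<lfloor>(x \<bullet> i) / d\<rfloor> \<in> {-b..b}" if i: "i \<in> Basis" for i
    proof -
      have "\<bar>(x \<bullet> i) / d\<bar> \<le> 1 / d" using x[OF i] d by (simp add: divide_right_mono)
      then have "- of_int b \<le> (x \<bullet> i) / d" "(x \<bullet> i) / d \<le> of_int b"
        using le_of_int_ceiling[of "1 / d"] unfolding b_def by linarith+
      then show ?thesis by (auto simp: le_floor_iff) (metis floor_mono floor_of_int)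
    qed
    then have "c \<in> I" by (auto simp: c_def I_def)
    moreover have "x \<in> cell d c" by (simp add: cell_def c_def)
    ultimately show "x \<in> (\<Union>c\<in>I. cell d c)" by blast
  qed
  define C where "C = 1 / d ^ DIM('a)"
  have Kd: "2 ^ DIM('a) * (DIM('a) * d)\<^sup>2 = e" using d(2) K by (simp add: power_mult_distrib K_def)
  have main: "(LINT x|ball_measure. (w x)\<^sup>2) \<le> e * (LINT x|ball_measure. (norm (g x))\<^sup>2) + C * (\<Sum>c\<in>I. (LINT x|ball_measure. w x * indicator (cell d c) x)\<^sup>2)"
    if wg: "h10 w g" for w :: "'a \<Rightarrow> real" and g
  proof -
    obtain s where s: "\<And>n. s n \<in> test_functions unit_ball" "L2_tendsto ball_measure s w"
        "L2_tendsto ball_measure (\<lambda>n. cgrad (s n)) g" using wg by (auto simp: h10_def)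
    have "(\<lambda>n. LINT x|ball_measure. (s n x)\<^sup>2) \<longlonglongrightarrow> (LINT x|ball_measure. (w x)\<^sup>2)"
      using L2_tendsto_norm[OF s(2)] by simp
    moreover have "(\<lambda>n. LINT x|ball_measure. s n x * indicator (cell d c) x) \<longlonglongrightarrow> (LINT x|ball_measure. w x * indicator (cell d c) x)" for c
      using L2_tendsto_inner[OF s(2) indicator_square_integrable[OF cell_borel]] by simp
    then have "(\<lambda>n. e * (LINT x|ball_measure. (norm (cgrad (s n) x))\<^sup>2) + C * (\<Sum>c\<in>I. (LINT x|ball_measure. s n x * indicator (cell d c) x)\<^sup>2))
      \<longlonglongrightarrow> e * (LINT x|ball_measure. (norm (g x))\<^sup>2) + C * (\<Sum>c\<in>I. (LINT x|ball_measure. w x * indicator (cell d c) x)\<^sup>2)"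
      by (intro tendsto_intros L2_tendsto_norm s(3))
    moreover have "(LINT x|ball_measure. (s n x)\<^sup>2) \<le> e * (LINT x|ball_measure. (norm (cgrad (s n) x))\<^sup>2) + C * (\<Sum>c\<in>I. (LINT x|ball_measure. s n x * indicator (cell d c) x)\<^sup>2)" for n
      using cells_Poincare_test[OF d(1) s(1) I cov, of n] unfolding Kd C_def .
    ultimately show ?thesis by (intro LIMSEQ_le) auto
  qed
  obtain f where f: "bij_betw f {..<card I} I"
    using ex_bij_betw_nat_finite[OF I(1)] by (auto simp: atLeast0LessThan)
  show ?thesis
  proof (intro exI conjI allI impI)
    show "cell d (f j) \<in> sets borel" for j by (rule cell_borel)
    fix w :: "'a \<Rightarrow> real" and g assume "h10 w g"
    from main[OF this] show "(LINT x|ball_measure. (w x)\<^sup>2) \<le> e * (LINT x|ball_measure. (norm (g x))\<^sup>2)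
      + C * (\<Sum>j<card I. (LINT x|ball_measure. w x * indicator (cell d (f j)) x)\<^sup>2)"
      unfolding sum.reindex_bij_betw[OF f, of "\<lambda>c. (LINT x|ball_measure. w x * indicator (cell d c) x)\<^sup>2"] .
  qed
qed

text \<open>Along a diagonal subsequence the integrals over all cells converge, for every constant
  \<open>1 / (k + 1)\<close> in the inequality of Ehrling type. Applied to differences, that
  inequality turns the convergence of numbers into the Cauchy property in \<open>L2\<close>.\<close>

theorem Rellich:
  fixes w :: "nat \<Rightarrow> 'a::euclidean_space \<Rightarrow> real"
  assumes h: "\<And>n. h10 (w n) (g n)"
    and M: "\<And>n. (LINT x|ball_measure. (w n x)\<^sup>2) + (LINT x|ball_measure. (norm (g n x))\<^sup>2) \<le> M"
  shows "\<exists>r::nat\<Rightarrow>nat. strict_mono r \<and> (\<forall>e>0. \<exists>N. \<forall>m\<ge>N. \<forall>n\<ge>N. (LINT x|ball_measure. (w (r m) x - w (r n) x)\<^sup>2) < e)"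
proof -
  note sq = h10_square_integrable[OF h]
  have b1: "(LINT x|ball_measure. (w n x)\<^sup>2) \<le> M" "(LINT x|ball_measure. (norm (g n x))\<^sup>2) \<le> M" for n
  proof -
    have "0 \<le> (LINT x|ball_measure. (w n x)\<^sup>2)" "0 \<le> (LINT x|ball_measure. (norm (g n x))\<^sup>2)" by simp_all
    then show "(LINT x|ball_measure. (w n x)\<^sup>2) \<le> M" "(LINT x|ball_measure. (norm (g n x))\<^sup>2) \<le> M" using M[of n] by linarith+
  qed
  have M0: "0 \<le> M" using b1(1)[of 0] by (rule order_trans[rotated]) simp
  have "\<forall>k. \<exists>(J::nat) (Q :: nat \<Rightarrow> 'a set) C. (\<forall>j. Q j \<in> sets borel) \<and> (\<forall>w g. h10 w g \<longrightarrow>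
    (LINT x|ball_measure. (w x)\<^sup>2) \<le> (1 / real (Suc k)) * (LINT x|ball_measure. (norm (g x))\<^sup>2) + C * (\<Sum>j<J. (LINT x|ball_measure. w x * indicator (Q j) x)\<^sup>2))"
    by (intro allI cells_Poincare) simp
  from choice[OF this] obtain J where "\<forall>k. \<exists>(Q :: nat \<Rightarrow> 'a set) C. (\<forall>j. Q j \<in> sets borel) \<and> (\<forall>w g. h10 w g \<longrightarrow>
    (LINT x|ball_measure. (w x)\<^sup>2) \<le> (1 / real (Suc k)) * (LINT x|ball_measure. (norm (g x))\<^sup>2) + C * (\<Sum>j<J k. (LINT x|ball_measure. w x * indicator (Q j) x)\<^sup>2))"
    by (rule exE)
  from choice[OF this] obtain Q where "\<forall>k. \<exists>C. (\<forall>j. Q k j \<in> sets (borel :: 'a measure)) \<and> (\<forall>w g. h10 w g \<longrightarrow>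
    (LINT x|ball_measure. (w x)\<^sup>2) \<le> (1 / real (Suc k)) * (LINT x|ball_measure. (norm (g x))\<^sup>2) + C * (\<Sum>j<J k. (LINT x|ball_measure. w x * indicator (Q k j) x)\<^sup>2))"
    by (rule exE)
  from choice[OF this] obtain C where all: "\<forall>k. (\<forall>j. Q k j \<in> sets (borel :: 'a measure)) \<and> (\<forall>w g. h10 w g \<longrightarrow>
    (LINT x|ball_measure. (w x)\<^sup>2) \<le> (1 / real (Suc k)) * (LINT x|ball_measure. (norm (g x))\<^sup>2) + C k * (\<Sum>j<J k. (LINT x|ball_measure. w x * indicator (Q k j) x)\<^sup>2))"
    by (rule exE)
  have Q: "Q k j \<in> sets borel" for k j using all by (rule allE[of _ k]) (elim conjE allE[of _ j])
  have P: "(LINT x|ball_measure. (w x)\<^sup>2) \<le> (1 / real (Suc k)) * (LINT x|ball_measure. (norm (g x))\<^sup>2)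
      + C k * (\<Sum>j<J k. (LINT x|ball_measure. w x * indicator (Q k j) x)\<^sup>2)" if "h10 w g" for k w g
    using spec[OF all, of k] that by (elim conjE) (drule spec[of _ w], drule spec[of _ g], erule mp)
  \<comment> \<open>The level \<open>k\<close> and the cell \<open>j\<close> are coded by one
    natural number, which indexes the steps of the diagonal procedure.\<close>
  define a where "a p n = (LINT x|ball_measure. w n x * indicator (Q (fst (prod_decode p)) (snd (prod_decode p))) x)" for p n
  have abd: "bounded (range (a p))" for p
  proof -
    let ?i = "indicator (Q (fst (prod_decode p)) (snd (prod_decode p))) :: 'a \<Rightarrow> real"
    note qi = indicator_square_integrable[OF Q]
    have "\<bar>a p n\<bar> \<le> sqrt (M * (LINT x|ball_measure. (norm (?i x))\<^sup>2))" for n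
    proof (rule real_le_rsqrt)
      have "(a p n)\<^sup>2 \<le> (LINT x|ball_measure. (norm (w n x))\<^sup>2) * (LINT x|ball_measure. (norm (?i x))\<^sup>2)"
        using L2_Cauchy_Schwarz[OF sq(1)[of n] qi] by (simp add: a_def)
      also have "\<dots> \<le> M * (LINT x|ball_measure. (norm (?i x))\<^sup>2)" using b1(1)[of n] by (intro mult_right_mono) auto
      finally show "\<bar>a p n\<bar>\<^sup>2 \<le> M * (LINT x|ball_measure. (norm (?i x))\<^sup>2)" by simp
    qed
    then show ?thesis by (intro boundedI) auto
  qed
  interpret subseqs "\<lambda>p s. convergent (\<lambda>n. a p (s n))"
  proof
    fix p and s :: "nat \<Rightarrow> nat" assume "strict_mono s"
    have "bounded (range (a p \<circ> s))" using abd[of p] by (rule bounded_subset) auto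
    then obtain l and r :: "nat \<Rightarrow> nat" where "strict_mono r" "((a p \<circ> s) \<circ> r) \<longlonglongrightarrow> l"
      using bounded_imp_convergent_subsequence by blast
    then show "\<exists>r'. strict_mono r' \<and> convergent (\<lambda>n. a p ((s \<circ> r') n))"
      by (auto simp: comp_def convergent_def)
  qed
  have conv: "convergent (\<lambda>n. a p (diagseq n))" for p
  proof -
    have "convergent (\<lambda>n. a p ((diagseq \<circ> (+) (Suc p)) n))"
    proof (rule diagseq_holds)
      fix r s :: "nat \<Rightarrow> nat" and n assume "strict_mono r" "convergent (\<lambda>k. a n (s k))"
      then show "convergent (\<lambda>k. a n ((s \<circ> r) k))"
        using convergent_subseq_convergent[of "\<lambda>k. a n (s k)" r] by (simp add: comp_def)
    qed
    \<comment> \<open>The diagonal sequence is known to follow the choice made for \<open>p\<close>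
      only from position \<open>Suc p\<close> on; the initial segment does not affect
      convergence.\<close>
    then have "convergent (\<lambda>n. a p (diagseq (n + Suc p)))" by (simp add: comp_def add.commute)
    then show ?thesis using convergent_ignore_initial_segment[of "\<lambda>n. a p (diagseq n)" "Suc p"] by simp
  qed
  define l where "l p = lim (\<lambda>n. a p (diagseq n))" for p
  have l: "(\<lambda>n. a p (diagseq n)) \<longlonglongrightarrow> l p" for p
    using conv[of p] unfolding l_def by (simp only: convergent_LIMSEQ_iff)
  show ?thesis
  proof (intro exI[of _ diagseq] conjI allI impI)
    show "strict_mono diagseq" by (rule subseq_diagseq)
    fix e :: real assume e: "0 < e"
    \<comment> \<open>A difference of two members has squared gradient norm at most
      \<open>4 * M\<close>; this \<open>k\<close> keeps its contribution below
      \<open>e / 2\<close>.\<close>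
    obtain k :: nat where k: "8 * M / e < real k" using reals_Archimedean2 by blast
    then have k: "(1 / real (Suc k)) * (4 * M) < e / 2" using e by (simp add: field_simps)
    define p where "p j = prod_encode (k, j)" for j
    define t where "t n = 2 * \<bar>C k\<bar> * (\<Sum>j<J k. (a (p j) (diagseq n) - l (p j))\<^sup>2)" for n
    have "t \<longlonglongrightarrow> 2 * \<bar>C k\<bar> * (\<Sum>j<J k. (l (p j) - l (p j))\<^sup>2)" unfolding t_def by (intro tendsto_intros l)
    then have "t \<longlonglongrightarrow> 0" by simp
    then have "\<forall>\<^sub>F n in sequentially. t n < e / 4" using e by (intro order_tendstoD(2)) auto
    then obtain N where N: "\<And>n. n \<ge> N \<Longrightarrow> t n < e / 4" by (auto simp: eventually_sequentially)
    show "\<exists>N. \<forall>m\<ge>N. \<forall>n\<ge>N. (LINT x|ball_measure. (w (diagseq m) x - w (diagseq n) x)\<^sup>2) < e"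
    proof (intro exI[of _ N] allI impI)
      fix m n assume mn: "N \<le> m" "N \<le> n"
      let ?u = "\<lambda>x. w (diagseq m) x - w (diagseq n) x" and ?g = "\<lambda>x. g (diagseq m) x - g (diagseq n) x"
      have "(LINT x|ball_measure. (norm (?g x))\<^sup>2) \<le> 4 * M"
        using L2_add_le[OF sq(2) square_integrable_scaleR[OF sq(2), of "-1"], of "diagseq m" "diagseq n"] b1(2)[of "diagseq m"] b1(2)[of "diagseq n"] by simp
      then have 1: "(1 / real (Suc k)) * (LINT x|ball_measure. (norm (?g x))\<^sup>2) \<le> (1 / real (Suc k)) * (4 * M)"
        by (intro mult_left_mono) auto
      have "(LINT x|ball_measure. ?u x * indicator (Q k j) x) = a (p j) (diagseq m) - a (p j) (diagseq n)" for j
        using square_integrable_mult[OF sq(1)[of "diagseq m"] indicator_square_integrable[OF Q[of k j]]]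
          square_integrable_mult[OF sq(1)[of "diagseq n"] indicator_square_integrable[OF Q[of k j]]]
        by (simp add: a_def p_def left_diff_distrib)
      then have "C k * (\<Sum>j<J k. (LINT x|ball_measure. ?u x * indicator (Q k j) x)\<^sup>2)
        \<le> \<bar>C k\<bar> * (\<Sum>j<J k. (a (p j) (diagseq m) - a (p j) (diagseq n))\<^sup>2)"
        by (simp add: mult_right_mono sum_nonneg)
      also have "\<dots> \<le> \<bar>C k\<bar> * (\<Sum>j<J k. 2 * (a (p j) (diagseq m) - l (p j))\<^sup>2 + 2 * (a (p j) (diagseq n) - l (p j))\<^sup>2)"
      proof (intro mult_left_mono sum_mono)
        fix j
        show "(a (p j) (diagseq m) - a (p j) (diagseq n))\<^sup>2 \<le> 2 * (a (p j) (diagseq m) - l (p j))\<^sup>2 + 2 * (a (p j) (diagseq n) - l (p j))\<^sup>2"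
          using norm_diff_square_le[of "a (p j) (diagseq m) - l (p j)" "a (p j) (diagseq n) - l (p j)"] by simp
      qed simp
      also have "\<dots> = t m + t n" by (simp add: t_def sum.distrib sum_distrib_left[symmetric] algebra_simps)
      also have "\<dots> < e / 2" using N[OF mn(1)] N[OF mn(2)] by simp
      finally show "(LINT x|ball_measure. (?u x)\<^sup>2) < e"
        using P[OF h10_diff[OF h[of "diagseq m"] h[of "diagseq n"]], of k] 1 k by linarith
    qed
  qed
qed

section \<open>The forms of the problem\<close>

definition dirichlet_form :: "('a::euclidean_space \<Rightarrow> real) \<Rightarrow> ('a \<Rightarrow> real) \<Rightarrow> real" where
  "dirichlet_form u v = (LINT x|ball_measure. grad u x \<bullet> grad v x)"

definition potential_form :: "('a::euclidean_space \<Rightarrow> real) \<Rightarrow> ('a \<Rightarrow> real) \<Rightarrow> ('a \<Rightarrow> real) \<Rightarrow> real" where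
  "potential_form a u v = (LINT x|ball_measure. a x * u x * v x)"

definition l2_form :: "('a::euclidean_space \<Rightarrow> real) \<Rightarrow> ('a \<Rightarrow> real) \<Rightarrow> real" where
  "l2_form u v = (LINT x|ball_measure. u x * v x)"

definition energy_form :: "('a::euclidean_space \<Rightarrow> real) \<Rightarrow> ('a \<Rightarrow> real) \<Rightarrow> ('a \<Rightarrow> real) \<Rightarrow> real" where
  "energy_form a u v = dirichlet_form u v - potential_form a u v"

text \<open>The gradient chosen by \<open>weak_gradient\<close> agrees almost everywhere with the
  limit of the gradients of an approximating sequence, so it may serve as the companion of
  \<open>u\<close>.\<close>

lemma h10_grad_self:
  assumes "u \<in> H10 unit_ball"
  shows "h10 u (grad u)"
proof -
  obtain g where g: "h10 u g" using assms by (auto simp: H10_iff)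
  have sq: "square_integrable ball_measure (grad u)"
    using wgrad_grad[OF h10_grad(2)[OF g]] by (simp add: wgrad_def)
  have ae: "AE x in ball_measure. g x = grad u x" using h10_grad(1)[OF g] by eventually_elim simp
  obtain s where s: "\<And>n. s n \<in> test_functions unit_ball" "L2_tendsto ball_measure s u"
      "L2_tendsto ball_measure (\<lambda>n. cgrad (s n)) g" using g by (auto simp: h10_def)
  have "L2_tendsto ball_measure (\<lambda>n. cgrad (s n)) (grad u)" by (rule L2_tendsto_cong[OF s(3) sq ae])
  then show ?thesis unfolding h10_def by (intro exI[of _ s] conjI allI s(1,2))
qed

lemma H10_square_integrable:
  assumes "u \<in> H10 unit_ball"
  shows "square_integrable ball_measure u" "square_integrable ball_measure (grad u)"
  using h10_square_integrable[OF h10_grad_self[OF assms]] by auto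

lemma dirichlet_form_eq:
  assumes "h10 u g" "h10 v h"
  shows "dirichlet_form u v = (LINT x|ball_measure. g x \<bullet> h x)"
  unfolding dirichlet_form_def
proof (rule integral_cong_AE)
  have "u \<in> H10 unit_ball" "v \<in> H10 unit_ball" using assms by (auto simp: H10_iff)
  then show "(\<lambda>x. grad u x \<bullet> grad v x) \<in> borel_measurable ball_measure"
    using square_integrable_inner[OF H10_square_integrable(2) H10_square_integrable(2)] by auto
  show "(\<lambda>x. g x \<bullet> h x) \<in> borel_measurable ball_measure"
    using square_integrable_inner[OF h10_square_integrable(2)[OF assms(1)] h10_square_integrable(2)[OF assms(2)]] by auto
  show "AE x in ball_measure. grad u x \<bullet> grad v x = g x \<bullet> h x"
    using h10_grad(1)[OF assms(1)] h10_grad(1)[OF assms(2)] by eventually_elim simp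
qed

lemma fun_subspace_H10: "fun_subspace (H10 unit_ball)"
  unfolding fun_subspace_def H10_iff
proof (intro conjI ballI allI)
  show "\<exists>g. h10 (\<lambda>x. 0) g" using h10_test[OF test_functions_zero] by blast
qed (auto simp: H10_iff intro: h10_add h10_scale)

lemma form_on_dirichlet: "form_on (H10 unit_ball) dirichlet_form"
  unfolding form_on_def
proof (intro conjI ballI allI)
  fix u v :: "'a \<Rightarrow> real" assume "u \<in> H10 unit_ball" "v \<in> H10 unit_ball"
  then show "dirichlet_form u v = dirichlet_form v u" by (simp add: dirichlet_form_def inner_commute)
next
  fix u v w :: "'a \<Rightarrow> real" assume m: "u \<in> H10 unit_ball" "v \<in> H10 unit_ball" "w \<in> H10 unit_ball"
  note s = H10_square_integrable(2)[OF m(1)] H10_square_integrable(2)[OF m(2)] H10_square_integrable(2)[OF m(3)]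
  show "dirichlet_form (\<lambda>x. u x + v x) w = dirichlet_form u w + dirichlet_form v w"
    using dirichlet_form_eq[OF h10_add[OF h10_grad_self[OF m(1)] h10_grad_self[OF m(2)]] h10_grad_self[OF m(3)]]
      square_integrable_inner[OF s(1,3)] square_integrable_inner[OF s(2,3)]
    by (simp add: dirichlet_form_def inner_add_left)
next
  fix c and u w :: "'a \<Rightarrow> real" assume m: "u \<in> H10 unit_ball" "w \<in> H10 unit_ball"
  show "dirichlet_form (\<lambda>x. c * u x) w = c * dirichlet_form u w"
    using dirichlet_form_eq[OF h10_scale[OF h10_grad_self[OF m(1)], of c] h10_grad_self[OF m(2)]]
    by (simp add: dirichlet_form_def)
qed

lemma form_on_l2: "form_on (H10 unit_ball) l2_form"
  unfolding form_on_def
proof (intro conjI ballI allI)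
  fix u v w :: "'a \<Rightarrow> real" assume m: "u \<in> H10 unit_ball" "v \<in> H10 unit_ball" "w \<in> H10 unit_ball"
  note s = H10_square_integrable(1)[OF m(1)] H10_square_integrable(1)[OF m(2)] H10_square_integrable(1)[OF m(3)]
  show "l2_form (\<lambda>x. u x + v x) w = l2_form u w + l2_form v w"
    using square_integrable_mult[OF s(1,3)] square_integrable_mult[OF s(2,3)] by (simp add: l2_form_def distrib_right)
qed (auto simp: l2_form_def mult.commute mult.left_commute)

section \<open>Bounded potentials\<close>

lemma L_infinity_bound:
  assumes "a \<in> L_infinity unit_ball"
  obtains C where "0 \<le> C" "AE x in ball_measure. \<bar>a x\<bar> \<le> C" "a \<in> borel_measurable ball_measure"
proof -
  obtain C where "AE x in ball_measure. \<bar>a x\<bar> \<le> C" "a \<in> borel_measurable ball_measure"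
    using assms by (auto simp: L_infinity_def)
  then show thesis by (intro that[of "max C 0"]) (auto elim!: eventually_mono)
qed

lemma L_infinity_mult:
  assumes "a \<in> L_infinity unit_ball" "square_integrable ball_measure u"
  shows "square_integrable ball_measure (\<lambda>x. a x * u x)"
proof -
  obtain C where C: "AE x in ball_measure. \<bar>a x\<bar> \<le> C" "a \<in> borel_measurable ball_measure"
    using L_infinity_bound[OF assms(1)] by metis
  show ?thesis using bounded_mult_square_integrable[OF assms(2) C(2,1)] by simp
qed

lemma form_on_potential:
  assumes "a \<in> L_infinity unit_ball"
  shows "form_on (H10 unit_ball) (potential_form a)"
  unfolding form_on_def
proof (intro conjI ballI allI)
  fix u v w :: "'a \<Rightarrow> real" assume m: "u \<in> H10 unit_ball" "v \<in> H10 unit_ball" "w \<in> H10 unit_ball"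
  note s = L_infinity_mult[OF assms H10_square_integrable(1)[OF m(1)]]
    L_infinity_mult[OF assms H10_square_integrable(1)[OF m(2)]] H10_square_integrable(1)[OF m(3)]
  show "potential_form a (\<lambda>x. u x + v x) w = potential_form a u w + potential_form a v w"
    using square_integrable_mult[OF s(1,3)] square_integrable_mult[OF s(2,3)]
    by (simp add: potential_form_def distrib_right distrib_left)
next
  fix c and u w :: "'a \<Rightarrow> real"
  have "a x * (c * u x) * w x = c * (a x * u x * w x)" for x by simp
  then show "potential_form a (\<lambda>x. c * u x) w = c * potential_form a u w"
    unfolding potential_form_def by (simp only: integral_mult_right_zero)
next
  fix u v :: "'a \<Rightarrow> real"
  have "a x * u x * v x = a x * v x * u x" for x by simp
  then show "potential_form a u v = potential_form a v u" unfolding potential_form_def by presburger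
qed

lemma form_on_subset: "form_on E B \<Longrightarrow> E' \<subseteq> E \<Longrightarrow> form_on E' B"
  unfolding form_on_def by (meson subsetD)

lemma form_on_energy:
  assumes "a \<in> L_infinity unit_ball"
  shows "form_on (H10 unit_ball) (energy_form a)"
  using form_on_dirichlet form_on_potential[OF assms]
  unfolding form_on_def energy_form_def by (auto simp: algebra_simps)

lemma potential_bound:
  assumes a: "a \<in> L_infinity unit_ball"
  shows "\<exists>C\<ge>0. \<forall>u\<in>H10 unit_ball. \<bar>potential_form a u u\<bar> \<le> C * l2_form u u"
proof -
  obtain C where C: "0 \<le> C" "AE x in ball_measure. \<bar>a x\<bar> \<le> C" "a \<in> borel_measurable ball_measure"
    using L_infinity_bound[OF a] .
  have "\<bar>potential_form a u u\<bar> \<le> C * l2_form u u" if u: "u \<in> H10 unit_ball" for u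
  proof -
    note s = H10_square_integrable(1)[OF u]
    have i: "integrable ball_measure (\<lambda>x. a x * u x * u x)" by (intro square_integrable_mult L_infinity_mult a s)
    have i2: "integrable ball_measure (\<lambda>x. u x * u x)" by (intro square_integrable_mult s)
    have "\<bar>potential_form a u u\<bar> \<le> (LINT x|ball_measure. \<bar>a x * u x * u x\<bar>)"
      unfolding potential_form_def by (rule integral_abs_bound)
    also have "\<dots> \<le> (LINT x|ball_measure. C * (u x * u x))"
    proof (rule integral_mono_AE)
      show "AE x in ball_measure. \<bar>a x * u x * u x\<bar> \<le> C * (u x * u x)"
        using C(2)
      proof eventually_elim
        case (elim x)
        then have "\<bar>a x\<bar> * (u x * u x) \<le> C * (u x * u x)" by (intro mult_right_mono) auto
        then show ?case by (simp add: abs_mult mult.assoc)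
      qed
    qed (use i i2 in auto)
    finally show ?thesis by (simp add: l2_form_def)
  qed
  then show ?thesis using C(1) by blast
qed

lemma quad_form_energy:
  assumes a: "a \<in> L_infinity unit_ball" and u: "u \<in> H10 unit_ball"
  shows "quad_form a u = energy_form a u u"
proof -
  note s = H10_square_integrable[OF u]
  have "integrable ball_measure (\<lambda>x. a x * u x * u x)" by (intro square_integrable_mult L_infinity_mult a s)
  then show ?thesis
    using square_integrableD(2)[OF s(2)]
    by (simp add: quad_form_def energy_form_def dirichlet_form_def potential_form_def power2_eq_square
        mult.assoc flip: power2_norm_eq_inner)
qed

lemma ae_zero_iff_l2:
  assumes "square_integrable ball_measure u"
  shows "ae_zero u \<longleftrightarrow> (LINT x|ball_measure. u x * u x) = 0"
  unfolding ae_zero_def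
  by (subst integral_nonneg_eq_0_iff_AE[OF square_integrable_mult[OF assms assms]]) auto

text \<open>Division by \<open>norm x\<close> reduces the weighted space to the unweighted theory.
  At the origin both quotients are \<open>0\<close> by convention.\<close>

lemma sing_L2_iff:
  "w \<in> sing_L2 \<longleftrightarrow> w \<in> borel_measurable ball_measure \<and> square_integrable ball_measure (\<lambda>x. w x / norm x)"
proof -
  have "(\<lambda>x. w x / norm x) \<in> borel_measurable ball_measure" if [measurable]: "w \<in> borel_measurable ball_measure"
  proof -
    have "(\<lambda>x::'a. norm x) \<in> borel_measurable ball_measure"
      by (intro continuous_measurable_ball continuous_intros)
    then show ?thesis by measurable
  qed
  then show ?thesis unfolding sing_L2_def square_integrable_def by (auto simp: power_divide)
qed

lemma sing_inner_eq: "sing_inner u v = (LINT x|ball_measure. (u x / norm x) * (v x / norm x))"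
  by (simp add: sing_inner_def power2_eq_square)

lemma fun_subspace_sing_L2: "fun_subspace sing_L2"
  unfolding fun_subspace_def
proof (intro conjI ballI allI)
  show "(\<lambda>x. 0) \<in> sing_L2" by (simp add: sing_L2_def)
next
  fix u v :: "'a \<Rightarrow> real" assume "u \<in> sing_L2" "v \<in> sing_L2"
  then show "(\<lambda>x. u x + v x) \<in> sing_L2"
    using square_integrable_add[of ball_measure "\<lambda>x. u x / norm x" "\<lambda>x. v x / norm x"]
    by (auto simp: sing_L2_iff add_divide_distrib)
next
  fix c and u :: "'a \<Rightarrow> real" assume "u \<in> sing_L2"
  then show "(\<lambda>x. c * u x) \<in> sing_L2"
    using square_integrable_scaleR[of ball_measure "\<lambda>x. u x / norm x" c] by (auto simp: sing_L2_iff)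
qed

lemma form_on_sing: "form_on sing_L2 sing_inner"
  unfolding form_on_def
proof (intro conjI ballI allI)
  fix u v w :: "'a \<Rightarrow> real" assume "u \<in> sing_L2" "v \<in> sing_L2" "w \<in> sing_L2"
  then have s: "square_integrable ball_measure (\<lambda>x. u x / norm x)" "square_integrable ball_measure (\<lambda>x. v x / norm x)"
    "square_integrable ball_measure (\<lambda>x. w x / norm x)" by (auto simp: sing_L2_iff)
  show "sing_inner (\<lambda>x. u x + v x) w = sing_inner u w + sing_inner v w"
    using square_integrable_mult[OF s(1,3)] square_integrable_mult[OF s(2,3)]
    by (simp add: sing_inner_eq add_divide_distrib distrib_right)
next
  fix c and u w :: "'a \<Rightarrow> real"
  have "c * u x * w x / (norm x)\<^sup>2 = c * (u x * w x / (norm x)\<^sup>2)" for x by simp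
  then show "sing_inner (\<lambda>x. c * u x) w = c * sing_inner u w"
    unfolding sing_inner_def by (simp only: integral_mult_right_zero)
next
  fix u v :: "'a \<Rightarrow> real"
  show "sing_inner u v = sing_inner v u" by (simp add: sing_inner_def mult.commute)
qed

text \<open>The weight is at least \<open>1\<close> on the ball. This transfers the bound and the
  compactness of the potential form from the unweighted to the singular setting.\<close>

lemma l2_le_sing:
  assumes u: "u \<in> sing_L2" and s: "square_integrable ball_measure u"
  shows "l2_form u u \<le> sing_inner u u"
  unfolding l2_form_def sing_inner_def
proof (rule integral_mono_AE)
  have nz: "AE x in ball_measure. (x :: 'a) \<noteq> 0"
    by (rule AE_ball_of_lborel) (rule AE_lborel_singleton)
  have inb: "AE x in ball_measure. norm (x :: 'a) < 1" by (rule AE_I2) simp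
  show "integrable ball_measure (\<lambda>x. u x * u x)" by (intro square_integrable_mult s)
  show "integrable ball_measure (\<lambda>x. u x * u x / (norm x)\<^sup>2)"
    using u by (simp add: sing_L2_def power2_eq_square)
  show "AE x in ball_measure. u x * u x \<le> u x * u x / (norm x)\<^sup>2"
    using nz inb
  proof eventually_elim
    case (elim x)
    have "0 < (norm x)\<^sup>2" "(norm x)\<^sup>2 \<le> 1" using elim by (auto simp: power_le_one)
    then show ?case using mult_left_mono[of "(norm x)\<^sup>2" 1 "u x * u x"] by (simp add: le_divide_eq)
  qed
qed

lemma ae_zero_iff_sing:
  assumes u: "u \<in> sing_L2" and s: "square_integrable ball_measure u"
  shows "ae_zero u \<longleftrightarrow> sing_inner u u = 0"
proof
  assume z: "ae_zero u"
  have "AE x in ball_measure. u x * u x / (norm x)\<^sup>2 = 0"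
    using z unfolding ae_zero_def by eventually_elim simp
  then show "sing_inner u u = 0" unfolding sing_inner_def by (rule integral_eq_zero_AE)
next
  assume "sing_inner u u = 0"
  then have "l2_form u u \<le> 0" using l2_le_sing[OF assms] by simp
  moreover have "0 \<le> l2_form u u" by (simp add: l2_form_def)
  ultimately show "ae_zero u" unfolding ae_zero_iff_l2[OF s] l2_form_def by simp
qed

section \<open>Admissible subspaces\<close>

text \<open>What \<open>H10\<close> and its invariant parts share: closedness, which gives
  completeness, and stability under radial cutoffs, which gives density. Closedness is stated for
  \<open>L2\<close> limits that are known to lie in \<open>H10\<close>, the form in which invariance
  passes to limits.\<close>

definition admissible_space :: "('a::euclidean_space \<Rightarrow> real) set \<Rightarrow> bool" where
  "admissible_space X \<longleftrightarrow> fun_subspace X \<and> X \<subseteq> H10 unit_ball \<and>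
     (\<forall>w v. (\<forall>n::nat. w n \<in> X) \<longrightarrow> L2_tendsto ball_measure w v \<longrightarrow> v \<in> H10 unit_ball \<longrightarrow> v \<in> X) \<and>
     (\<forall>n. \<forall>w\<in>X. (\<lambda>x. cutoff (Suc n) x * w x) \<in> X)"

lemma admissible_spaceD:
  assumes "admissible_space X"
  shows "fun_subspace X" "X \<subseteq> H10 unit_ball"
    "(\<And>n::nat. w n \<in> X) \<Longrightarrow> L2_tendsto ball_measure w v \<Longrightarrow> v \<in> H10 unit_ball \<Longrightarrow> v \<in> X"
    "v \<in> X \<Longrightarrow> (\<lambda>x. cutoff (Suc n) x * v x) \<in> X"
  using assms unfolding admissible_space_def by blast+

lemma admissible_H10: "admissible_space (H10 unit_ball)"
proof -
  have "(\<lambda>x. cutoff (Suc n) x * w x) \<in> H10 unit_ball" if "w \<in> H10 unit_ball" for n and w :: "'a \<Rightarrow> real"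
    using h10_mult[OF smooth_cutoff h10_grad_self[OF that]] by (auto simp: H10_iff)
  then show ?thesis using fun_subspace_H10 unfolding admissible_space_def by blast
qed

lemma invariantI:
  "(AE x in ball_measure. w x = v x) \<Longrightarrow> (\<And>g x. g \<in> G \<Longrightarrow> x \<in> unit_ball \<Longrightarrow> v (g x) = v x) \<Longrightarrow> invariant G w"
  unfolding invariant_def by blast

lemma invariant_add: "invariant G u \<Longrightarrow> invariant G v \<Longrightarrow> invariant G (\<lambda>x. u x + v x)"
proof -
  assume "invariant G u" "invariant G v"
  then obtain u' v' where u: "AE x in ball_measure. u x = u' x" "\<forall>g\<in>G. \<forall>x\<in>unit_ball. u' (g x) = u' x"
    and v: "AE x in ball_measure. v x = v' x" "\<forall>g\<in>G. \<forall>x\<in>unit_ball. v' (g x) = v' x"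
    unfolding invariant_def by blast
  show ?thesis
  proof (rule invariantI[where v="\<lambda>x. u' x + v' x"])
    show "AE x in ball_measure. u x + v x = u' x + v' x" using u(1) v(1) by eventually_elim simp
  qed (use u v in simp)
qed

lemma invariant_mult:
  assumes "invariant G u" "\<And>g x. g \<in> G \<Longrightarrow> x \<in> unit_ball \<Longrightarrow> m (g x) = m x"
  shows "invariant G (\<lambda>x. m x * u x)"
proof -
  obtain u' where u: "AE x in ball_measure. u x = u' x" "\<forall>g\<in>G. \<forall>x\<in>unit_ball. u' (g x) = u' x"
    using assms(1) unfolding invariant_def by blast
  show ?thesis
  proof (rule invariantI[where v="\<lambda>x. m x * u' x"])
    show "AE x in ball_measure. m x * u x = m x * u' x" using u(1) by eventually_elim simp
  qed (use u assms(2) in simp)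
qed

text \<open>The group may be uncountable, so exceptional null sets must not depend on its elements.
  The pointwise \<open>lim\<close> of exactly invariant representatives along an almost everywhere
  convergent subsequence is exactly invariant: at \<open>x\<close> and at \<open>g x\<close> it is
  formed from the same sequence, convergent or not.\<close>

lemma invariant_limit:
  fixes w :: "nat \<Rightarrow> 'a::euclidean_space \<Rightarrow> real"
  assumes w: "\<And>n. invariant G (w n)" and lim: "L2_tendsto ball_measure w v"
  shows "invariant G v"
proof -
  have "\<forall>n. \<exists>u. (AE x in ball_measure. w n x = u x) \<and> (\<forall>g\<in>G. \<forall>x\<in>unit_ball. u (g x) = u x)"
    using w unfolding invariant_def by blast
  from choice[OF this] obtain u where u: "\<And>n. AE x in ball_measure. w n x = u n x"
    "\<And>n g x. g \<in> G \<Longrightarrow> x \<in> unit_ball \<Longrightarrow> u n (g x) = u n x" by blast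
  obtain r :: "nat \<Rightarrow> nat" where r: "AE x in ball_measure. (\<lambda>n. w (r n) x) \<longlonglongrightarrow> v x"
    using L2_tendsto_AE_subseq[OF lim] by blast
  have ae: "AE x in ball_measure. \<forall>n. w n x = u n x" using u(1) by (simp add: AE_all_countable)
  show ?thesis
  proof (rule invariantI[where v="\<lambda>x. lim (\<lambda>n. u (r n) x)"])
    show "AE x in ball_measure. v x = lim (\<lambda>n. u (r n) x)"
      using r ae by eventually_elim (simp add: limI)
  qed (simp add: u(2))
qed

lemma admissible_H10_inv:
  assumes G: "G \<subseteq> orthogonal_group"
  shows "admissible_space (H10_inv G)"
  unfolding admissible_space_def
proof (intro conjI allI ballI impI)
  \<comment> \<open>Orthogonal maps preserve the norm, through which alone the cutoff depends on the
    point.\<close>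
  have cut: "cutoff n (g x) = cutoff n x" if "g \<in> G" for n g and x :: 'a
    using that G orthogonal_transformation_norm[of g x] by (auto simp: cutoff_def orthogonal_group_def subset_iff)
  show "fun_subspace (H10_inv G)"
    unfolding fun_subspace_def
  proof (intro conjI ballI allI)
    show "(\<lambda>x. 0) \<in> H10_inv G"
      using fun_subspaceD(1)[OF fun_subspace_H10] by (auto simp: H10_inv_def intro!: invariantI[where v="\<lambda>x. 0"])
  next
    fix u v :: "'a \<Rightarrow> real" assume "u \<in> H10_inv G" "v \<in> H10_inv G"
    then show "(\<lambda>x. u x + v x) \<in> H10_inv G"
      using fun_subspaceD(2)[OF fun_subspace_H10] by (auto simp: H10_inv_def intro: invariant_add)
  next
    fix c and u :: "'a \<Rightarrow> real" assume "u \<in> H10_inv G"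
    then show "(\<lambda>x. c * u x) \<in> H10_inv G"
      using fun_subspaceD(3)[OF fun_subspace_H10] by (auto simp: H10_inv_def intro!: invariant_mult)
  qed
  show "H10_inv G \<subseteq> H10 unit_ball" by (auto simp: H10_inv_def)
  show "v \<in> H10_inv G" if "\<forall>n::nat. w n \<in> H10_inv G" "L2_tendsto ball_measure w v" "v \<in> H10 unit_ball" for w v
    using that invariant_limit[of G w v] by (auto simp: H10_inv_def)
  show "(\<lambda>x. cutoff (Suc n) x * w x) \<in> H10_inv G" if "w \<in> H10_inv G" for n w
    using that admissible_spaceD(4)[OF admissible_H10] cut by (auto simp: H10_inv_def intro!: invariant_mult)
qed

text \<open>Functions and gradients converge separately in \<open>L2\<close>; closedness of
  \<open>h10\<close> identifies the second limit as the gradient of the first.\<close>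

lemma L2_Cauchy_limit:
  fixes w :: "nat \<Rightarrow> 'a::euclidean_space \<Rightarrow> real"
  assumes X: "admissible_space X" and w: "\<And>n. w n \<in> X"
    and cauchy: "\<And>e. e > 0 \<Longrightarrow> \<exists>N. \<forall>m\<ge>N. \<forall>n\<ge>N.
      dirichlet_form (\<lambda>x. w m x - w n x) (\<lambda>x. w m x - w n x) + l2_form (\<lambda>x. w m x - w n x) (\<lambda>x. w m x - w n x) < e"
  shows "\<exists>v\<in>X. L2_tendsto ball_measure w v \<and> (\<lambda>n. dirichlet_form (\<lambda>x. w n x - v x) (\<lambda>x. w n x - v x)) \<longlonglongrightarrow> 0"
proof -
  have H: "w n \<in> H10 unit_ball" for n using w admissible_spaceD(2)[OF X] by blast
  note h = h10_grad_self[OF H]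
  note sq = h10_square_integrable[OF h]
  have D: "dirichlet_form (\<lambda>x. w m x - w n x) (\<lambda>x. w m x - w n x) = (LINT x|ball_measure. (norm (grad (w m) x - grad (w n) x))\<^sup>2)" for m n
    using dirichlet_form_eq[OF h10_diff[OF h h] h10_diff[OF h h]] by (simp add: power2_norm_eq_inner)
  have L: "l2_form (\<lambda>x. w m x - w n x) (\<lambda>x. w m x - w n x) = (LINT x|ball_measure. (norm (w m x - w n x))\<^sup>2)" for m n
    by (simp add: l2_form_def power2_eq_square)
  have pos: "0 \<le> (LINT x|ball_measure. (norm (w m x - w n x))\<^sup>2)" "0 \<le> (LINT x|ball_measure. (norm (grad (w m) x - grad (w n) x))\<^sup>2)" for m n
    by simp_all
  have c: "\<exists>N. \<forall>m\<ge>N. \<forall>n\<ge>N. (LINT x|ball_measure. (norm (grad (w m) x - grad (w n) x))\<^sup>2) + (LINT x|ball_measure. (norm (w m x - w n x))\<^sup>2) < e"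
    if "e > 0" for e using cauchy[OF that] unfolding D L .
  have "\<exists>v. L2_tendsto ball_measure w v"
  proof (rule Riesz_Fischer[OF sq(1)])
    fix e :: real assume "0 < e"
    then obtain N where "\<And>m n. m \<ge> N \<Longrightarrow> n \<ge> N \<Longrightarrow> (LINT x|ball_measure. (norm (grad (w m) x - grad (w n) x))\<^sup>2) + (LINT x|ball_measure. (norm (w m x - w n x))\<^sup>2) < e"
      using c by blast
    then show "\<exists>N. \<forall>m\<ge>N. \<forall>n\<ge>N. (LINT x|ball_measure. (norm (w m x - w n x))\<^sup>2) < e"
      using pos(2) by (intro exI[of _ N] allI impI) (meson add_increasing le_less_trans order_refl)
  qed
  then obtain v where v: "L2_tendsto ball_measure w v" by blast
  have "\<exists>g. L2_tendsto ball_measure (\<lambda>n. grad (w n)) g"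
  proof (rule Riesz_Fischer[OF sq(2)])
    fix e :: real assume "0 < e"
    then obtain N where "\<And>m n. m \<ge> N \<Longrightarrow> n \<ge> N \<Longrightarrow> (LINT x|ball_measure. (norm (grad (w m) x - grad (w n) x))\<^sup>2) + (LINT x|ball_measure. (norm (w m x - w n x))\<^sup>2) < e"
      using c by blast
    then show "\<exists>N. \<forall>m\<ge>N. \<forall>n\<ge>N. (LINT x|ball_measure. (norm (grad (w m) x - grad (w n) x))\<^sup>2) < e"
      using pos(1) by (intro exI[of _ N] allI impI) (meson add_increasing2 le_less_trans order_refl)
  qed
  then obtain g where g: "L2_tendsto ball_measure (\<lambda>n. grad (w n)) g" by blast
  have vg: "h10 v g" by (rule h10_closed[OF h v g])
  then have "v \<in> H10 unit_ball" by (auto simp: H10_iff)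
  then have "v \<in> X" using admissible_spaceD(3)[OF X w v] by blast
  moreover have "dirichlet_form (\<lambda>x. w n x - v x) (\<lambda>x. w n x - v x) = (LINT x|ball_measure. (norm (grad (w n) x - g x))\<^sup>2)" for n
    using dirichlet_form_eq[OF h10_diff[OF h vg] h10_diff[OF h vg]] by (simp add: power2_norm_eq_inner)
  ultimately show ?thesis using v g by (intro bexI[of _ v]) (auto simp: L2_tendsto_def)
qed

lemma potential_compact:
  fixes w :: "nat \<Rightarrow> 'a::euclidean_space \<Rightarrow> real"
  assumes a: "a \<in> L_infinity unit_ball" and w: "\<And>n. w n \<in> H10 unit_ball"
    and M: "\<And>n. dirichlet_form (w n) (w n) + l2_form (w n) (w n) \<le> M"
  shows "\<exists>r :: nat \<Rightarrow> nat. strict_mono r \<and> (\<forall>e>0. \<exists>N. \<forall>m\<ge>N. \<forall>n\<ge>N.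
    \<bar>potential_form a (\<lambda>x. w (r m) x - w (r n) x) (\<lambda>x. w (r m) x - w (r n) x)\<bar> < e)"
proof -
  obtain C where C: "0 \<le> C" "\<And>u. u \<in> H10 unit_ball \<Longrightarrow> \<bar>potential_form a u u\<bar> \<le> C * l2_form u u"
    using potential_bound[OF a] by blast
  have "(LINT x|ball_measure. (w n x)\<^sup>2) + (LINT x|ball_measure. (norm (grad (w n) x))\<^sup>2) \<le> M" for n
    using M[of n]
    by (simp add: dirichlet_form_def l2_form_def dot_square_norm power2_eq_square[of "w n x" for x] add.commute)
  from Rellich[where w=w and g="\<lambda>n. grad (w n)", OF h10_grad_self[OF w] this] obtain r :: "nat \<Rightarrow> nat" where r: "strict_mono r"
    "\<And>e. e > 0 \<Longrightarrow> \<exists>N. \<forall>m\<ge>N. \<forall>n\<ge>N. (LINT x|ball_measure. (w (r m) x - w (r n) x)\<^sup>2) < e" by auto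
  show ?thesis
  proof (intro exI[of _ r] conjI r(1) allI impI)
    fix e :: real assume e: "0 < e"
    \<comment> \<open>The denominator is \<open>C + 1\<close> because \<open>C\<close> may be
      zero.\<close>
    have "0 < e / (C + 1)" using e C by simp
    from r(2)[OF this] obtain N where N: "\<And>m n. m \<ge> N \<Longrightarrow> n \<ge> N \<Longrightarrow> (LINT x|ball_measure. (w (r m) x - w (r n) x)\<^sup>2) < e / (C + 1)" by blast
    show "\<exists>N. \<forall>m\<ge>N. \<forall>n\<ge>N. \<bar>potential_form a (\<lambda>x. w (r m) x - w (r n) x) (\<lambda>x. w (r m) x - w (r n) x)\<bar> < e"
    proof (intro exI[of _ N] allI impI)
      fix m n assume mn: "N \<le> m" "N \<le> n"
      let ?u = "\<lambda>x. w (r m) x - w (r n) x"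
      have "?u \<in> H10 unit_ball" by (rule fun_subspace_diff[OF fun_subspace_H10 w w])
      then have "\<bar>potential_form a ?u ?u\<bar> \<le> C * l2_form ?u ?u" by (rule C(2))
      also have "\<dots> \<le> C * (e / (C + 1))"
        using N[OF mn] C(1) by (intro mult_left_mono) (auto simp: l2_form_def power2_eq_square)
      also have "\<dots> < e" using e C(1) by (simp add: field_simps)
      finally show "\<bar>potential_form a ?u ?u\<bar> < e" .
    qed
  qed
qed

lemma l2_form_pencil:
  assumes X: "admissible_space X" and a: "a \<in> L_infinity unit_ball"
  shows "\<exists>C. form_pencil X dirichlet_form (potential_form a) l2_form C"
proof -
  obtain C where C: "0 \<le> C" "\<And>u. u \<in> H10 unit_ball \<Longrightarrow> \<bar>potential_form a u u\<bar> \<le> C * l2_form u u"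
    using potential_bound[OF a] by blast
  note XH = admissible_spaceD(2)[OF X]
  have "form_pencil X dirichlet_form (potential_form a) l2_form C"
  proof
    show "fun_subspace X" by (rule admissible_spaceD(1)[OF X])
    show "form_on X dirichlet_form" "form_on X (potential_form a)" "form_on X l2_form"
      using form_on_subset[OF _ XH] form_on_dirichlet form_on_potential[OF a] form_on_l2 by auto
    show "0 \<le> dirichlet_form u u" "0 \<le> l2_form u u" for u by (simp_all add: dirichlet_form_def l2_form_def)
    show "\<bar>potential_form a u u\<bar> \<le> C * l2_form u u" if "u \<in> X" for u using C(2) that XH by blast
    show "0 \<le> C" by fact
    fix w :: "nat \<Rightarrow> 'a \<Rightarrow> real" assume w: "\<And>n. w n \<in> X"
    { assume "\<And>e. e > 0 \<Longrightarrow> \<exists>N. \<forall>m\<ge>N. \<forall>n\<ge>N.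
        dirichlet_form (\<lambda>x. w m x - w n x) (\<lambda>x. w m x - w n x) + l2_form (\<lambda>x. w m x - w n x) (\<lambda>x. w m x - w n x) < e"
      from L2_Cauchy_limit[OF X w this] obtain v where v: "v \<in> X" "L2_tendsto ball_measure w v"
        "(\<lambda>n. dirichlet_form (\<lambda>x. w n x - v x) (\<lambda>x. w n x - v x)) \<longlonglongrightarrow> 0" by blast
      have "(\<lambda>n. l2_form (\<lambda>x. w n x - v x) (\<lambda>x. w n x - v x)) \<longlonglongrightarrow> 0"
        using v(2) by (simp add: L2_tendsto_def l2_form_def power2_eq_square)
      from tendsto_add[OF v(3) this] v(1)
      show "\<exists>v\<in>X. (\<lambda>n. dirichlet_form (\<lambda>x. w n x - v x) (\<lambda>x. w n x - v x) + l2_form (\<lambda>x. w n x - v x) (\<lambda>x. w n x - v x)) \<longlonglongrightarrow> 0"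
        by auto }
    fix M assume "\<And>n. dirichlet_form (w n) (w n) + l2_form (w n) (w n) \<le> M"
    then show "\<exists>r :: nat \<Rightarrow> nat. strict_mono r \<and> (\<forall>e>0. \<exists>N. \<forall>m\<ge>N. \<forall>n\<ge>N.
      \<bar>potential_form a (\<lambda>x. w (r m) x - w (r n) x) (\<lambda>x. w (r m) x - w (r n) x)\<bar> < e)"
      using w XH by (intro potential_compact[OF a]) auto
  qed
  then show ?thesis by blast
qed

text \<open>Completeness is the nontrivial property. A Cauchy sequence for the singular norm is one
  for the smaller unweighted norm, which yields a limit \<open>v\<close> in \<open>X\<close>;
  Fatou's lemma along an almost everywhere convergent subsequence then gives convergence in the
  singular norm.\<close>

lemma sing_form_pencil:
  assumes X: "admissible_space X" and a: "a \<in> L_infinity unit_ball"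
  shows "\<exists>C. form_pencil (X \<inter> sing_L2) dirichlet_form (potential_form a) sing_inner C"
proof -
  obtain C where C: "0 \<le> C" "\<And>u. u \<in> H10 unit_ball \<Longrightarrow> \<bar>potential_form a u u\<bar> \<le> C * l2_form u u"
    using potential_bound[OF a] by blast
  note XH = admissible_spaceD(2)[OF X]
  note subX = admissible_spaceD(1)[OF X]
  have le: "l2_form u u \<le> sing_inner u u" if "u \<in> X \<inter> sing_L2" for u
    using l2_le_sing H10_square_integrable(1) that XH by blast
  have sub: "fun_subspace (X \<inter> sing_L2)"
    using subX fun_subspace_sing_L2 unfolding fun_subspace_def by auto
  have "form_pencil (X \<inter> sing_L2) dirichlet_form (potential_form a) sing_inner C"
  proof
    show "fun_subspace (X \<inter> sing_L2)" by (rule sub)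
    have "X \<inter> sing_L2 \<subseteq> H10 unit_ball" using XH by auto
    then show "form_on (X \<inter> sing_L2) dirichlet_form" "form_on (X \<inter> sing_L2) (potential_form a)"
      using form_on_subset form_on_dirichlet form_on_potential[OF a] by auto
    show "form_on (X \<inter> sing_L2) sing_inner" by (rule form_on_subset[OF form_on_sing]) simp
    show "0 \<le> dirichlet_form u u" "0 \<le> sing_inner u u" for u by (simp_all add: dirichlet_form_def sing_inner_def)
    show "\<bar>potential_form a u u\<bar> \<le> C * sing_inner u u" if "u \<in> X \<inter> sing_L2" for u
    proof -
      have "\<bar>potential_form a u u\<bar> \<le> C * l2_form u u" using C(2) that XH by blast
      also have "\<dots> \<le> C * sing_inner u u" using le[OF that] C(1) by (rule mult_left_mono)
      finally show ?thesis .
    qed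
    show "0 \<le> C" by fact
    fix w :: "nat \<Rightarrow> 'a \<Rightarrow> real" assume w: "\<And>n. w n \<in> X \<inter> sing_L2"
    have wd: "(\<lambda>x. w m x - w n x) \<in> X \<inter> sing_L2" for m n by (rule fun_subspace_diff[OF sub w w])
    { assume cauchy: "\<And>e. e > 0 \<Longrightarrow> \<exists>N. \<forall>m\<ge>N. \<forall>n\<ge>N.
        dirichlet_form (\<lambda>x. w m x - w n x) (\<lambda>x. w m x - w n x) + sing_inner (\<lambda>x. w m x - w n x) (\<lambda>x. w m x - w n x) < e"
      have wX: "w n \<in> X" for n using w by blast
      have "\<exists>N. \<forall>m\<ge>N. \<forall>n\<ge>N.
        dirichlet_form (\<lambda>x. w m x - w n x) (\<lambda>x. w m x - w n x) + l2_form (\<lambda>x. w m x - w n x) (\<lambda>x. w m x - w n x) < e" if "e > 0" for e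
      proof -
        obtain N where N: "\<And>m n. m \<ge> N \<Longrightarrow> n \<ge> N \<Longrightarrow>
          dirichlet_form (\<lambda>x. w m x - w n x) (\<lambda>x. w m x - w n x) + sing_inner (\<lambda>x. w m x - w n x) (\<lambda>x. w m x - w n x) < e"
          using cauchy[OF \<open>e > 0\<close>] by blast
        show ?thesis
        proof (intro exI[of _ N] allI impI)
          fix m n assume "N \<le> m" "N \<le> n"
          from N[OF this] le[OF wd[of m n]]
          show "dirichlet_form (\<lambda>x. w m x - w n x) (\<lambda>x. w m x - w n x) + l2_form (\<lambda>x. w m x - w n x) (\<lambda>x. w m x - w n x) < e" by linarith
        qed
      qed
      from L2_Cauchy_limit[OF X wX this] obtain v where v: "v \<in> X" "L2_tendsto ball_measure w v"
        "(\<lambda>n. dirichlet_form (\<lambda>x. w n x - v x) (\<lambda>x. w n x - v x)) \<longlonglongrightarrow> 0" by blast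
      have vm: "v \<in> borel_measurable ball_measure" using v(2) by (simp add: L2_tendsto_def)
      obtain r :: "nat \<Rightarrow> nat" where r: "strict_mono r" "AE x in ball_measure. (\<lambda>n. w (r n) x) \<longlonglongrightarrow> v x"
        using L2_tendsto_AE_subseq[OF v(2)] by blast
      have sing: "square_integrable ball_measure (\<lambda>x. (w m x - w n x) / norm x)" for m n
        using wd[of m n] by (simp add: sing_L2_iff)
      have sing_eq: "sing_inner u u = (LINT x|ball_measure. (norm (u x / norm x))\<^sup>2)" for u :: "'a \<Rightarrow> real"
        by (simp add: sing_inner_eq power2_eq_square)
      have nm: "(\<lambda>x::'a. norm x) \<in> borel_measurable ball_measure"
        by (intro continuous_measurable_ball continuous_intros)
      have bnd: "square_integrable ball_measure (\<lambda>x. (w n x - v x) / norm x) \<and> sing_inner (\<lambda>x. w n x - v x) (\<lambda>x. w n x - v x) \<le> e"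
        if N: "\<And>m k. m \<ge> N \<Longrightarrow> k \<ge> N \<Longrightarrow> sing_inner (\<lambda>x. w m x - w k x) (\<lambda>x. w m x - w k x) \<le> e" and n: "n \<ge> N" for N n e
      proof -
        have [measurable]: "w n \<in> borel_measurable ball_measure" using w[of n] by (simp add: sing_L2_def)
        have m: "(\<lambda>x. (w n x - v x) / norm x) \<in> borel_measurable ball_measure" using nm vm by measurable
        have lim: "AE x in ball_measure. (\<lambda>k. (w n x - w (r k) x) / norm x) \<longlonglongrightarrow> (w n x - v x) / norm x"
          using r(2)
        proof eventually_elim
          case (elim x)
          show ?case unfolding divide_inverse by (intro tendsto_intros elim)
        qed
        have b: "(LINT x|ball_measure. (norm ((w n x - w (r k) x) / norm x))\<^sup>2) \<le> e" if "k \<ge> N" for k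
          using N[OF n, of "r k"] seq_suble[OF r(1), of k] that unfolding sing_eq by simp
        show ?thesis unfolding sing_eq using L2_bound_of_AE_lim[OF sing m lim b] by blast
      qed
      have c2: "\<exists>N. \<forall>m\<ge>N. \<forall>k\<ge>N. sing_inner (\<lambda>x. w m x - w k x) (\<lambda>x. w m x - w k x) \<le> e" if "e > 0" for e
      proof -
        obtain N where N: "\<And>m n. m \<ge> N \<Longrightarrow> n \<ge> N \<Longrightarrow>
          dirichlet_form (\<lambda>x. w m x - w n x) (\<lambda>x. w m x - w n x) + sing_inner (\<lambda>x. w m x - w n x) (\<lambda>x. w m x - w n x) < e"
          using cauchy[OF \<open>e > 0\<close>] by blast
        have "0 \<le> dirichlet_form u u" for u :: "'a \<Rightarrow> real" by (simp add: dirichlet_form_def)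
        then have "sing_inner (\<lambda>x. w m x - w k x) (\<lambda>x. w m x - w k x) \<le> e" if "N \<le> m" "N \<le> k" for m k
          using N[OF that] by (smt (verit))
        then show ?thesis by blast
      qed
      obtain N1 where N1: "\<And>m k. m \<ge> N1 \<Longrightarrow> k \<ge> N1 \<Longrightarrow> sing_inner (\<lambda>x. w m x - w k x) (\<lambda>x. w m x - w k x) \<le> 1"
        using c2[of 1] by auto
      have "(\<lambda>x. w N1 x - v x) \<in> sing_L2"
        using bnd[OF N1 order_refl] vm w[of N1] by (auto simp: sing_L2_iff)
      \<comment> \<open>\<open>v\<close> is recovered as a difference of two elements of
        \<open>sing_L2\<close>.\<close>
      then have "(\<lambda>x. w N1 x - (w N1 x - v x)) \<in> sing_L2" using fun_subspace_diff[OF fun_subspace_sing_L2 _] w[of N1] by blast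
      then have vE: "v \<in> X \<inter> sing_L2" using v(1) by simp
      have "(\<lambda>n. sing_inner (\<lambda>x. w n x - v x) (\<lambda>x. w n x - v x)) \<longlonglongrightarrow> 0"
      proof (rule LIMSEQ_I)
        fix e :: real assume e: "0 < e"
        then obtain N where N: "\<And>m k. m \<ge> N \<Longrightarrow> k \<ge> N \<Longrightarrow> sing_inner (\<lambda>x. w m x - w k x) (\<lambda>x. w m x - w k x) \<le> e/2"
          using c2[of "e/2"] by auto
        have "0 \<le> sing_inner u u" for u :: "'a \<Rightarrow> real" by (simp add: sing_inner_def)
        then have "norm (sing_inner (\<lambda>x. w n x - v x) (\<lambda>x. w n x - v x) - 0) < e" if "n \<ge> N" for n
          using bnd[OF N that] e by simp
        then show "\<exists>N. \<forall>n\<ge>N. norm (sing_inner (\<lambda>x. w n x - v x) (\<lambda>x. w n x - v x) - 0) < e" by blast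
      qed
      from tendsto_add[OF v(3) this] vE
      show "\<exists>v\<in>X \<inter> sing_L2. (\<lambda>n. dirichlet_form (\<lambda>x. w n x - v x) (\<lambda>x. w n x - v x) + sing_inner (\<lambda>x. w n x - v x) (\<lambda>x. w n x - v x)) \<longlonglongrightarrow> 0"
        by (intro bexI[OF _ vE]) simp }
    fix M assume M: "\<And>n. dirichlet_form (w n) (w n) + sing_inner (w n) (w n) \<le> M"
    show "\<exists>r :: nat \<Rightarrow> nat. strict_mono r \<and> (\<forall>e>0. \<exists>N. \<forall>m\<ge>N. \<forall>n\<ge>N.
      \<bar>potential_form a (\<lambda>x. w (r m) x - w (r n) x) (\<lambda>x. w (r m) x - w (r n) x)\<bar> < e)"
    proof (rule potential_compact[OF a])
      show "w n \<in> H10 unit_ball" for n using w XH by blast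
      show "dirichlet_form (w n) (w n) + l2_form (w n) (w n) \<le> M" for n using M[of n] le[OF w[of n]] by linarith
    qed
  qed
  then show ?thesis by blast
qed

text \<open>Polarisation reduces inner products to norms, whose convergence is known.\<close>

lemma L2_tendsto_inner_both:
  fixes s t :: "nat \<Rightarrow> 'a \<Rightarrow> 'b::euclidean_space"
  assumes s: "L2_tendsto M s f" and t: "L2_tendsto M t g"
  shows "(\<lambda>n. LINT x|M. s n x \<bullet> t n x) \<longlonglongrightarrow> (LINT x|M. f x \<bullet> g x)"
proof -
  have pol: "(LINT x|M. u x \<bullet> v x) = ((LINT x|M. (norm (u x + v x))\<^sup>2) - (LINT x|M. (norm (u x))\<^sup>2) - (LINT x|M. (norm (v x))\<^sup>2)) / 2"
    if u: "square_integrable M u" and v: "square_integrable M v" for u v :: "'a \<Rightarrow> 'b"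
  proof -
    have "(norm (u x + v x))\<^sup>2 = (norm (u x))\<^sup>2 + 2 * (u x \<bullet> v x) + (norm (v x))\<^sup>2" for x
      unfolding power2_norm_eq_inner by (simp add: algebra_simps inner_commute)
    then show ?thesis using u v square_integrable_inner[OF u v] by simp
  qed
  have sq: "square_integrable M (s n)" "square_integrable M f" "square_integrable M (t n)" "square_integrable M g" for n
    using s t by (auto simp: L2_tendsto_def)
  have "(\<lambda>n. ((LINT x|M. (norm (s n x + t n x))\<^sup>2) - (LINT x|M. (norm (s n x))\<^sup>2) - (LINT x|M. (norm (t n x))\<^sup>2)) / 2)
    \<longlonglongrightarrow> ((LINT x|M. (norm (f x + g x))\<^sup>2) - (LINT x|M. (norm (f x))\<^sup>2) - (LINT x|M. (norm (g x))\<^sup>2)) / 2"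
    by (intro tendsto_intros L2_tendsto_norm L2_tendsto_add s t) simp
  then show ?thesis unfolding pol[OF sq(1) sq(3)] pol[OF sq(2) sq(4)] .
qed

text \<open>Density in the form that \<open>neg_family_extends_chain\<close> asks for. The cutoffs
  of \<open>v\<close> and their gradients converge in \<open>L2\<close> and the potential is
  bounded, so the energies converge.\<close>

lemma singular_dense:
  fixes X :: "('a::euclidean_space \<Rightarrow> real) set"
  assumes dim: "DIM('a) \<ge> 2" and X: "admissible_space X" and a: "a \<in> L_infinity unit_ball" and v: "v \<in> X"
  shows "\<exists>s. (\<forall>n. s n \<in> X \<inter> sing_L2) \<and> (\<lambda>n. energy_form a (s n) (s n)) \<longlonglongrightarrow> energy_form a v v \<and>
    (\<forall>\<phi>\<in>X \<inter> sing_L2. (\<lambda>n. energy_form a (s n) \<phi>) \<longlonglongrightarrow> energy_form a v \<phi>)"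
proof -
  note XH = admissible_spaceD(2)[OF X]
  have vH: "h10 v (grad v)" using h10_grad_self v XH by blast
  define s where "s n x = cutoff (Suc n) x * v x" for n x
  define g where "g n x = cutoff (Suc n) x *\<^sub>R grad v x + v x *\<^sub>R cgrad (cutoff (Suc n)) x" for n x
  note cut = cutoff_approximation[OF dim vH]
  have h: "h10 (s n) (g n)" for n using cut(1)[of n] by (simp add: s_def[abs_def] g_def[abs_def])
  have ls: "L2_tendsto ball_measure s v" using cut(2) by (simp add: s_def[abs_def])
  have lg: "L2_tendsto ball_measure g (grad v)" using cut(3) by (simp add: g_def[abs_def])
  obtain C where C: "AE x in ball_measure. \<bar>a x\<bar> \<le> C" "a \<in> borel_measurable ball_measure"
    using L_infinity_bound[OF a] by metis
  have la: "L2_tendsto ball_measure (\<lambda>n x. a x * s n x) (\<lambda>x. a x * v x)"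
  proof (rule L2_tendsto_dominated[OF ls, where C=C])
    show "square_integrable ball_measure (\<lambda>x. a x * s n x)" "square_integrable ball_measure (\<lambda>x. a x * v x)" for n
      using ls by (auto intro!: L_infinity_mult[OF a] simp: L2_tendsto_def)
    show "AE x in ball_measure. norm (a x * s n x - a x * v x) \<le> C * norm (s n x - v x)" for n
      using C(1) by eventually_elim (simp add: abs_mult mult_right_mono flip: right_diff_distrib)
  qed
  have "s n \<in> X \<inter> sing_L2" for n
    using admissible_spaceD(4)[OF X v] cut(4)[of n] by (auto simp: s_def[abs_def])
  moreover have "(\<lambda>n. energy_form a (s n) (s n)) \<longlonglongrightarrow> energy_form a v v"
    unfolding energy_form_def dirichlet_form_eq[OF h h] dirichlet_form_eq[OF vH vH] potential_form_def
    using L2_tendsto_inner_both[OF lg lg] L2_tendsto_inner_both[OF la ls] by (intro tendsto_diff) auto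
  moreover have "(\<lambda>n. energy_form a (s n) \<phi>) \<longlonglongrightarrow> energy_form a v \<phi>" if \<phi>: "\<phi> \<in> X \<inter> sing_L2" for \<phi>
  proof -
    have p: "h10 \<phi> (grad \<phi>)" using \<phi> XH h10_grad_self by blast
    show ?thesis
      unfolding energy_form_def dirichlet_form_eq[OF h p] dirichlet_form_eq[OF vH p] potential_form_def
      using L2_tendsto_inner[OF lg h10_square_integrable(2)[OF p]] L2_tendsto_inner[OF la h10_square_integrable(1)[OF p]]
      by (intro tendsto_diff) auto
  qed
  ultimately show ?thesis by blast
qed

section \<open>Counting negative directions\<close>

lemma neg_family_mono: "neg_family X Q k \<Longrightarrow> X \<subseteq> Y \<Longrightarrow> neg_family Y Q k"
  unfolding neg_family_def by blast

lemma neg_family_Suc: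
  assumes "neg_family X Q (Suc k)"
  shows "neg_family X Q k"
proof -
  obtain w where w: "\<And>i. i < Suc k \<Longrightarrow> w i \<in> X"
    "\<And>c. (\<exists>i<Suc k. c i \<noteq> 0) \<Longrightarrow> Q (\<lambda>x. \<Sum>i<Suc k. c i * w i x) (\<lambda>x. \<Sum>i<Suc k. c i * w i x) < 0"
    using assms by (auto simp: neg_family_def)
  show ?thesis
    unfolding neg_family_def
  proof (intro exI[of _ w] conjI allI impI)
    show "w i \<in> X" if "i < k" for i using w(1) that by simp
    fix c :: "nat \<Rightarrow> real" assume c: "\<exists>i<k. c i \<noteq> 0"
    let ?c = "c(k := 0)"
    have "\<exists>i<Suc k. ?c i \<noteq> 0" using c by (metis fun_upd_apply less_SucI less_irrefl)
    from w(2)[OF this] show "Q (\<lambda>x. \<Sum>i<k. c i * w i x) (\<lambda>x. \<Sum>i<k. c i * w i x) < 0" by simp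
  qed
qed

lemma neg_family_le: "neg_family X Q k \<Longrightarrow> j \<le> k \<Longrightarrow> neg_family X Q j"
  by (induction k) (auto simp: le_Suc_eq dest: neg_family_Suc)

lemma neg_family_0: "neg_family X Q 0"
  by (simp add: neg_family_def)

definition neg_index :: "('a \<Rightarrow> real) set \<Rightarrow> (('a \<Rightarrow> real) \<Rightarrow> ('a \<Rightarrow> real) \<Rightarrow> real) \<Rightarrow> enat" where
  "neg_index X Q = (SUP k\<in>{k. neg_family X Q k}. enat k)"

text \<open>If every element of \<open>A\<close> is below \<open>k\<close>, the supremum is at most
  \<open>k - 1\<close>. For \<open>k = 0\<close> and empty \<open>A\<close> there would be no
  witness.\<close>

lemma enat_le_SUP_iff:
  assumes "enat k \<le> (SUP n\<in>A. enat n)" "0 < k"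
  shows "\<exists>n\<in>A. k \<le> n"
proof (rule ccontr)
  assume "\<not> (\<exists>n\<in>A. k \<le> n)"
  then have "(SUP n\<in>A. enat n) \<le> enat (k - 1)" by (intro SUP_least) (auto simp: not_le)
  then have "enat k \<le> enat (k - 1)" using assms(1) order_trans by blast
  then show False using assms(2) by simp
qed

lemma enat_le_neg_index: "enat k \<le> neg_index X Q \<longleftrightarrow> neg_family X Q k"
proof
  assume "enat k \<le> neg_index X Q"
  then show "neg_family X Q k"
    using enat_le_SUP_iff[of k "{k. neg_family X Q k}"] neg_family_le neg_family_0
    unfolding neg_index_def by (cases "k = 0") auto
qed (auto simp: neg_index_def intro: SUP_upper)

text \<open>An extended natural number is determined by the naturals below it. Together with
  \<open>enat_le_neg_index\<close> this lets finite and infinite counts be compared in the same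
  way.\<close>

lemma enat_eqI:
  assumes "\<And>k. enat k \<le> x \<longleftrightarrow> enat k \<le> y"
  shows "x = y"
proof -
  have "u \<le> v" if "\<And>k. enat k \<le> u \<Longrightarrow> enat k \<le> v" for u v :: enat
  proof (cases u)
    case (enat n) then show ?thesis using that[of n] by simp
  next
    case infinity
    then have "enat k \<le> v" for k using that[of k] by simp
    then have "v = \<infinity>" by (metis enat_ord_simps(1) not_enat_eq not_less_eq_eq order_refl)
    then show ?thesis by simp
  qed
  then show ?thesis using assms by (intro antisym) auto
qed

section \<open>Dimension modulo null sets and the Morse index\<close>

lemma ae_dim_ge:
  fixes w :: "'i \<Rightarrow> 'a::euclidean_space \<Rightarrow> real"
  assumes I: "finite I" and w: "\<And>i. i \<in> I \<Longrightarrow> w i \<in> V"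
    and ind: "\<And>c. ae_zero (\<lambda>x. \<Sum>i\<in>I. c i * w i x) \<Longrightarrow> \<forall>i\<in>I. c i = 0"
  shows "enat (card I) \<le> ae_dim V"
proof -
  obtain f where f: "bij_betw f {..<card I} I"
    using ex_bij_betw_nat_finite[OF I] by (auto simp: atLeast0LessThan)
  have "\<exists>v :: nat \<Rightarrow> 'a \<Rightarrow> real. (\<forall>i<card I. v i \<in> V) \<and>
     (\<forall>c. ae_zero (\<lambda>x. \<Sum>i<card I. c i * v i x) \<longrightarrow> (\<forall>i<card I. c i = 0))"
  proof (intro exI[of _ "\<lambda>i. w (f i)"] conjI allI impI)
    show "w (f i) \<in> V" if "i < card I" for i using w f that by (auto simp: bij_betw_def)
    fix c :: "nat \<Rightarrow> real" and i assume z: "ae_zero (\<lambda>x. \<Sum>i<card I. c i * w (f i) x)" and i: "i < card I"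
    define c' where "c' j = c (inv_into {..<card I} f j)" for j
    have c': "c' (f i) = c i" if "i < card I" for i
      using f that by (simp add: c'_def bij_betw_def inv_into_f_f)
    have "(\<Sum>i<card I. c i * w (f i) x) = (\<Sum>j\<in>I. c' j * w j x)" for x
      unfolding sum.reindex_bij_betw[OF f, symmetric, of "\<lambda>j. c' j * w j x"] using c' by (intro sum.cong) auto
    with z have "\<forall>j\<in>I. c' j = 0" using ind[of c'] by simp
    moreover have "f i \<in> I" using f i by (auto simp: bij_betw_def)
    ultimately show "c i = 0" using c'[OF i] by simp
  qed
  then show ?thesis unfolding ae_dim_def by (intro SUP_upper) simp
qed

lemma ae_dimD:
  assumes "enat k \<le> ae_dim V"
  shows "\<exists>w :: nat \<Rightarrow> 'a::euclidean_space \<Rightarrow> real. (\<forall>i<k. w i \<in> V) \<and>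
     (\<forall>c. ae_zero (\<lambda>x. \<Sum>i<k. c i * w i x) \<longrightarrow> (\<forall>i<k. c i = 0))"
proof (cases "k = 0")
  case False
  then obtain n and w :: "nat \<Rightarrow> 'a \<Rightarrow> real" where n: "k \<le> n" "\<forall>i<n. w i \<in> V"
    "\<And>c. ae_zero (\<lambda>x. \<Sum>i<n. c i * w i x) \<Longrightarrow> \<forall>i<n. c i = 0"
    using enat_le_SUP_iff[OF assms[unfolded ae_dim_def]] by auto
  show ?thesis
  proof (intro exI[of _ w] conjI allI impI)
    show "w i \<in> V" if "i < k" for i using n that by simp
    fix c :: "nat \<Rightarrow> real" and i assume z: "ae_zero (\<lambda>x. \<Sum>i<k. c i * w i x)" and i: "i < k"
    \<comment> \<open>Zero coefficients extend a relation of the shorter family to the longer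
      one.\<close>
    define c' where "c' i = (if i < k then c i else 0)" for i
    have "(\<Sum>i<n. c' i * w i x) = (\<Sum>i<k. c i * w i x)" for x
      using n(1) by (intro sum.mono_neutral_cong_right) (auto simp: c'_def)
    with z have "\<forall>i<n. c' i = 0" by (intro n(3)) simp
    then show "c i = 0" using i n(1) by (metis c'_def less_le_trans)
  qed
qed auto

text \<open>A function that vanishes almost everywhere is the \<open>L2\<close> limit of zero test
  functions, so its gradient vanishes almost everywhere as well.\<close>

lemma ae_zero_energy:
  assumes a: "a \<in> L_infinity unit_ball" and w: "w \<in> H10 unit_ball" and z: "ae_zero w"
  shows "energy_form a w w = 0"
proof -
  have "h10 w (\<lambda>x. 0)"
  proof -
    have "L2_tendsto ball_measure (\<lambda>n. (\<lambda>x::'a. 0::real)) w"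
      using H10_square_integrable(1)[OF w] z unfolding ae_zero_def
      by (intro L2_tendsto_cong[OF L2_tendsto_const[OF test_function_square_integrable[OF test_functions_zero]]])
        (auto elim: eventually_mono)
    moreover have "cgrad (\<lambda>x::'a. 0) = (\<lambda>x. 0)" by (auto intro!: cgrad_eqI)
    then have "L2_tendsto ball_measure (\<lambda>n::nat. cgrad (\<lambda>x::'a. 0)) (\<lambda>x. 0)"
      using L2_tendsto_const[OF cgrad_square_integrable[OF smooth_const]] by metis
    ultimately show ?thesis unfolding h10_def
      by (intro exI[of _ "\<lambda>n x. 0"]) (simp add: test_functions_zero)
  qed
  then have "dirichlet_form w w = 0" using dirichlet_form_eq by fastforce
  moreover have "potential_form a w w = 0"
    unfolding potential_form_def using z unfolding ae_zero_def
    by (intro integral_eq_zero_AE) (auto elim: eventually_mono)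
  ultimately show ?thesis by (simp add: energy_form_def)
qed

text \<open>An independent family inside a negative definite subspace is a negative family, and
  conversely the span \<open>V\<close> of a negative family is negative definite. Independence
  modulo null sets comes for free, because a combination that is \<open>ae_zero\<close> has energy
  zero.\<close>

lemma morse_index_eq:
  fixes a :: "'a::euclidean_space \<Rightarrow> real"
  assumes a: "a \<in> L_infinity unit_ball"
  shows "morse_index a = neg_index (H10 unit_ball) (energy_form a)"
proof (rule antisym)
  show "morse_index a \<le> neg_index (H10 unit_ball) (energy_form a)"
    unfolding morse_index_def
  proof (rule SUP_least)
    fix V :: "('a \<Rightarrow> real) set"
    assume "V \<in> {V. fun_subspace V \<and> V \<subseteq> H10 unit_ball \<and> (\<forall>w\<in>V. \<not> ae_zero w \<longrightarrow> quad_form a w < 0)}"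
    then have V: "fun_subspace V" "V \<subseteq> H10 unit_ball" "\<And>w. w \<in> V \<Longrightarrow> \<not> ae_zero w \<Longrightarrow> quad_form a w < 0" by auto
    show "ae_dim V \<le> neg_index (H10 unit_ball) (energy_form a)"
      unfolding ae_dim_def
    proof (rule SUP_least)
      fix n assume "n \<in> {n. \<exists>w :: nat \<Rightarrow> 'a \<Rightarrow> real. (\<forall>i<n. w i \<in> V) \<and> (\<forall>c. ae_zero (\<lambda>x. \<Sum>i<n. c i * w i x) \<longrightarrow> (\<forall>i<n. c i = 0))}"
      then obtain w :: "nat \<Rightarrow> 'a \<Rightarrow> real" where w: "\<And>i. i < n \<Longrightarrow> w i \<in> V"
        "\<And>c. ae_zero (\<lambda>x. \<Sum>i<n. c i * w i x) \<Longrightarrow> \<forall>i<n. c i = 0" by auto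
      have "neg_family (H10 unit_ball) (energy_form a) n"
        unfolding neg_family_def
      proof (intro exI[of _ w] conjI allI impI)
        show "w i \<in> H10 unit_ball" if "i < n" for i using w(1)[OF that] V(2) by blast
        fix c :: "nat \<Rightarrow> real" assume "\<exists>i<n. c i \<noteq> 0"
        then have "\<not> ae_zero (\<lambda>x. \<Sum>i<n. c i * w i x)" using w(2) by blast
        moreover have m: "(\<lambda>x. \<Sum>i<n. c i * w i x) \<in> V" using w(1) by (intro fun_subspace_sum[OF V(1)]) simp
        ultimately have "quad_form a (\<lambda>x. \<Sum>i<n. c i * w i x) < 0" using V(3) by blast
        then show "energy_form a (\<lambda>x. \<Sum>i<n. c i * w i x) (\<lambda>x. \<Sum>i<n. c i * w i x) < 0"
          using quad_form_energy[OF a subsetD[OF V(2) m]] by simp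
      qed
      then show "enat n \<le> neg_index (H10 unit_ball) (energy_form a)" by (simp add: enat_le_neg_index)
    qed
  qed
  show "neg_index (H10 unit_ball) (energy_form a) \<le> morse_index a"
    unfolding neg_index_def
  proof (rule SUP_least)
    fix k assume "k \<in> {k. neg_family (H10 unit_ball) (energy_form a) k}"
    then obtain w :: "nat \<Rightarrow> 'a \<Rightarrow> real" where w: "\<And>i. i < k \<Longrightarrow> w i \<in> H10 unit_ball"
      "\<And>c. (\<exists>i<k. c i \<noteq> 0) \<Longrightarrow> energy_form a (\<lambda>x. \<Sum>i<k. c i * w i x) (\<lambda>x. \<Sum>i<k. c i * w i x) < 0"
      by (auto simp: neg_family_def)
    define V where "V = range (\<lambda>c :: nat \<Rightarrow> real. \<lambda>x. \<Sum>i<k. c i * w i x)"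
    have VH: "V \<subseteq> H10 unit_ball"
      unfolding V_def using w(1) by (auto intro!: fun_subspace_sum[OF fun_subspace_H10])
    have "fun_subspace V"
      unfolding fun_subspace_def
    proof (intro conjI ballI allI)
      show "(\<lambda>x. 0) \<in> V" unfolding V_def by (intro image_eqI[of _ _ "\<lambda>i. 0"]) auto
    next
      fix u v assume "u \<in> V" "v \<in> V"
      then obtain c d where "u = (\<lambda>x. \<Sum>i<k. c i * w i x)" "v = (\<lambda>x. \<Sum>i<k. d i * w i x)" by (auto simp: V_def)
      then show "(\<lambda>x. u x + v x) \<in> V" unfolding V_def
        by (intro image_eqI[of _ _ "\<lambda>i. c i + d i"]) (auto simp: distrib_right sum.distrib)
    next
      fix b u assume "u \<in> V"
      then obtain c where "u = (\<lambda>x. \<Sum>i<k. c i * w i x)" by (auto simp: V_def)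
      then show "(\<lambda>x. b * u x) \<in> V" unfolding V_def
        by (intro image_eqI[of _ _ "\<lambda>i. b * c i"]) (auto simp: sum_distrib_left mult.assoc)
    qed
    moreover have "quad_form a v < 0" if v: "v \<in> V" and nz: "\<not> ae_zero v" for v
    proof -
      obtain c where c: "v = (\<lambda>x. \<Sum>i<k. c i * w i x)" using v by (auto simp: V_def)
      have "\<exists>i<k. c i \<noteq> 0"
      proof (rule ccontr)
        assume "\<not> (\<exists>i<k. c i \<noteq> 0)"
        then have "v = (\<lambda>x. 0)" using c by auto
        then show False using nz by (simp add: ae_zero_def)
      qed
      from w(2)[OF this] show ?thesis using quad_form_energy[OF a subsetD[OF VH v]] c by simp
    qed
    moreover have "enat (card {..<k}) \<le> ae_dim V"
    proof (rule ae_dim_ge)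
      show "w i \<in> V" if "i \<in> {..<k}" for i
        unfolding V_def using that
        by (intro image_eqI[of _ _ "\<lambda>j. if j = i then 1 else 0"]) (auto simp: if_distrib[of "\<lambda>c. c * _"] cong: if_cong)
      fix c assume z: "ae_zero (\<lambda>x. \<Sum>i<k. c i * w i x)"
      have "(\<lambda>x. \<Sum>i<k. c i * w i x) \<in> H10 unit_ball" using w(1) by (intro fun_subspace_sum[OF fun_subspace_H10]) auto
      from ae_zero_energy[OF a this z] show "\<forall>i\<in>{..<k}. c i = 0" using w(2)[of c] by force
    qed simp
    ultimately show "enat k \<le> morse_index a"
      unfolding morse_index_def using VH by (intro SUP_upper2[of V]) auto
  qed
qed

section \<open>Negative eigenvalues\<close>

lemma eigenspaceD:
  assumes a: "a \<in> L_infinity unit_ball" and X: "X \<subseteq> H10 unit_ball" and w: "w \<in> eigenspace X a \<mu>"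
  shows "w \<in> X" "\<phi> \<in> X \<Longrightarrow> energy_form a w \<phi> = \<mu> * l2_form w \<phi>"
proof -
  show wX: "w \<in> X" using w by (simp add: eigenspace_def)
  assume p: "\<phi> \<in> X"
  have H: "w \<in> H10 unit_ball" "\<phi> \<in> H10 unit_ball" using wX p X by auto
  have "(LINT x|ball_measure. grad w x \<bullet> grad \<phi> x - a x * w x * \<phi> x) = energy_form a w \<phi>"
    unfolding energy_form_def dirichlet_form_def potential_form_def
    by (intro Bochner_Integration.integral_diff square_integrable_inner square_integrable_mult L_infinity_mult[OF a]
        H10_square_integrable H)
  then show "energy_form a w \<phi> = \<mu> * l2_form w \<phi>" using w p by (simp add: eigenspace_def l2_form_def)
qed

lemma eigenspaceI:
  assumes a: "a \<in> L_infinity unit_ball" and X: "X \<subseteq> H10 unit_ball" and w: "w \<in> X"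
    and e: "\<And>\<phi>. \<phi> \<in> X \<Longrightarrow> energy_form a w \<phi> = \<mu> * l2_form w \<phi>"
  shows "w \<in> eigenspace X a \<mu>"
proof -
  have "(LINT x|ball_measure. grad w x \<bullet> grad \<phi> x - a x * w x * \<phi> x) = energy_form a w \<phi>" if p: "\<phi> \<in> X" for \<phi>
  proof -
    have H: "w \<in> H10 unit_ball" "\<phi> \<in> H10 unit_ball" using w p X by auto
    show ?thesis
      unfolding energy_form_def dirichlet_form_def potential_form_def
      by (intro Bochner_Integration.integral_diff square_integrable_inner square_integrable_mult L_infinity_mult[OF a]
          H10_square_integrable H)
  qed
  then show ?thesis using w e by (simp add: eigenspace_def l2_form_def)
qed

lemma fun_subspace_eigenspace:
  assumes a: "a \<in> L_infinity unit_ball" and sub: "fun_subspace X" and X: "X \<subseteq> H10 unit_ball"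
  shows "fun_subspace (eigenspace X a \<mu>)"
proof -
  interpret Q: sym_form X "energy_form a" using sub form_on_subset[OF form_on_energy[OF a] X] by unfold_locales
  interpret D: sym_form X l2_form using sub form_on_subset[OF form_on_l2 X] by unfold_locales
  note d = eigenspaceD[OF a X]
  show ?thesis
    unfolding fun_subspace_def
  proof (intro conjI ballI allI)
    show "(\<lambda>x. 0) \<in> eigenspace X a \<mu>"
      using fun_subspaceD(1)[OF sub] by (intro eigenspaceI[OF a X]) (auto simp: Q.zero_l D.zero_l)
  next
    fix u v assume "u \<in> eigenspace X a \<mu>" "v \<in> eigenspace X a \<mu>"
    then show "(\<lambda>x. u x + v x) \<in> eigenspace X a \<mu>"
      using d fun_subspaceD(2)[OF sub] by (intro eigenspaceI[OF a X]) (auto simp: Q.add_l D.add_l distrib_left)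
  next
    fix c u assume "u \<in> eigenspace X a \<mu>"
    then show "(\<lambda>x. c * u x) \<in> eigenspace X a \<mu>"
      using d fun_subspaceD(3)[OF sub] by (intro eigenspaceI[OF a X]) (auto simp: Q.scale_l D.scale_l)
  qed
qed

lemma sum_lessThan_add:
  fixes f :: "nat \<Rightarrow> real"
  shows "(\<Sum>i<m + n. f i) = (\<Sum>i<m. f i) + (\<Sum>i<n. f (m + i))"
  by (induction n) (auto simp: add.assoc)

lemma enat_le_add_split:
  fixes x y :: enat
  assumes "enat k \<le> x + y"
  shows "\<exists>k1 k2. k = k1 + k2 \<and> enat k1 \<le> x \<and> enat k2 \<le> y"
proof (cases x)
  case (enat m)
  show ?thesis
  proof (cases "k \<le> m")
    case True then show ?thesis using enat by (intro exI[of _ k] exI[of _ 0]) (auto simp: zero_enat_def[symmetric])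
  next
    case False
    have "enat (k - m) \<le> y" using assms enat False by (cases y) auto
    then show ?thesis using enat False by (intro exI[of _ m] exI[of _ "k - m"]) auto
  qed
next
  case infinity
  then show ?thesis by (intro exI[of _ k] exI[of _ 0]) (auto simp: zero_enat_def[symmetric])
qed

text \<open>Eigenspaces for different eigenvalues are orthogonal, and on each of them the energy is
  a negative multiple of the \<open>L2\<close> form, so independent families from them may be
  joined. The labels \<open>l i\<close> record the eigenvalues, whose distinctness from the new one
  drives the induction.\<close>

lemma eigenspaces_neg_family:
  fixes a :: "'a::euclidean_space \<Rightarrow> real"
  assumes a: "a \<in> L_infinity unit_ball" and sub: "fun_subspace X" and X: "X \<subseteq> H10 unit_ball"
    and F: "finite F" "F \<subseteq> {..<0}"
  shows "enat k \<le> (\<Sum>\<mu>\<in>F. ae_dim (eigenspace X a \<mu>)) \<Longrightarrow>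
    \<exists>w l. (\<forall>i<k. w i \<in> eigenspace X a (l i) \<and> l i \<in> F) \<and>
     (\<forall>c. (\<exists>i<k. c i \<noteq> 0) \<longrightarrow> energy_form a (\<lambda>x. \<Sum>i<k. c i * w i x) (\<lambda>x. \<Sum>i<k. c i * w i x) < 0)"
  using F
proof (induction F arbitrary: k rule: finite_induct)
  case empty
  then have "k = 0" by (simp add: zero_enat_def)
  then show ?case by auto
next
  case (insert \<mu> F)
  interpret Q: sym_form X "energy_form a" using sub form_on_subset[OF form_on_energy[OF a] X] by unfold_locales
  interpret D: sym_form X l2_form using sub form_on_subset[OF form_on_l2 X] by unfold_locales
  note eD = eigenspaceD[OF a X]
  have "enat k \<le> ae_dim (eigenspace X a \<mu>) + (\<Sum>\<mu>\<in>F. ae_dim (eigenspace X a \<mu>))"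
    using insert.prems(1) insert.hyps by simp
  then obtain k1 k2 where k: "k = k1 + k2" "enat k1 \<le> ae_dim (eigenspace X a \<mu>)"
    "enat k2 \<le> (\<Sum>\<mu>\<in>F. ae_dim (eigenspace X a \<mu>))" using enat_le_add_split by blast
  obtain w1 :: "nat \<Rightarrow> 'a \<Rightarrow> real" where w1: "\<And>i. i < k1 \<Longrightarrow> w1 i \<in> eigenspace X a \<mu>"
    "\<And>c. ae_zero (\<lambda>x. \<Sum>i<k1. c i * w1 i x) \<Longrightarrow> \<forall>i<k1. c i = 0"
    using ae_dimD[OF k(2)] by blast
  have "F \<subseteq> {..<0}" using insert.prems(2) by simp
  from insert.IH[OF k(3) this] obtain w2 l2 where
    "\<forall>i<k2. w2 i \<in> eigenspace X a (l2 i) \<and> l2 i \<in> F"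
    "\<forall>c. (\<exists>i<k2. c i \<noteq> 0) \<longrightarrow> energy_form a (\<lambda>x. \<Sum>i<k2. c i * w2 i x) (\<lambda>x. \<Sum>i<k2. c i * w2 i x) < 0"
    by (elim exE conjE)
  then have w2: "\<And>i. i < k2 \<Longrightarrow> w2 i \<in> eigenspace X a (l2 i)" "\<And>i. i < k2 \<Longrightarrow> l2 i \<in> F"
    "\<And>c. (\<exists>i<k2. c i \<noteq> 0) \<Longrightarrow> energy_form a (\<lambda>x. \<Sum>i<k2. c i * w2 i x) (\<lambda>x. \<Sum>i<k2. c i * w2 i x) < 0"
    by blast+
  define w where "w i = (if i < k1 then w1 i else w2 (i - k1))" for i
  define l where "l i = (if i < k1 then \<mu> else l2 (i - k1))" for i
  show ?case
  proof (intro exI[of _ w] exI[of _ l] conjI allI impI)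
    show "w i \<in> eigenspace X a (l i)" "l i \<in> insert \<mu> F" if "i < k" for i
      using that w1(1) w2(1,2)[of "i - k1"] by (auto simp: w_def l_def k(1))
    fix c :: "nat \<Rightarrow> real" assume c: "\<exists>i<k. c i \<noteq> 0"
    define v1 where "v1 = (\<lambda>x. \<Sum>i<k1. c i * w1 i x)"
    define c2 where "c2 i = c (k1 + i)" for i
    define v2 where "v2 = (\<lambda>x. \<Sum>i<k2. c2 i * w2 i x)"
    have sum: "(\<lambda>x. \<Sum>i<k. c i * w i x) = (\<lambda>x. v1 x + v2 x)"
      unfolding v1_def v2_def k(1) sum_lessThan_add by (auto simp: w_def c2_def)
    have v1: "v1 \<in> eigenspace X a \<mu>" unfolding v1_def
      using w1(1) by (intro fun_subspace_sum[OF fun_subspace_eigenspace[OF a sub X]]) simp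
    have v1X: "v1 \<in> X" using eD(1)[OF v1] .
    have w2X: "w2 i \<in> X" if "i < k2" for i using eD(1)[OF w2(1)[OF that]] .
    have v2X: "v2 \<in> X" unfolding v2_def using w2X by (intro fun_subspace_sum[OF sub]) simp
    have orth: "energy_form a v1 (w2 i) = 0" if i: "i < k2" for i
    proof -
      have 1: "energy_form a v1 (w2 i) = \<mu> * l2_form v1 (w2 i)" by (rule eD(2)[OF v1 w2X[OF i]])
      have "energy_form a (w2 i) v1 = l2 i * l2_form (w2 i) v1" by (rule eD(2)[OF w2(1)[OF i] v1X])
      then have "energy_form a v1 (w2 i) = l2 i * l2_form v1 (w2 i)"
        using Q.sym[OF v1X w2X[OF i]] D.sym[OF v1X w2X[OF i]] by simp
      \<comment> \<open>The energy of \<open>v1\<close> and \<open>w2 i\<close> is both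
        \<open>\<mu>\<close> times and \<open>l2 i\<close> times the same inner product; different
        factors force it to vanish.\<close>
      moreover have "l2 i \<noteq> \<mu>" using w2(2)[OF i] insert.hyps by auto
      ultimately show ?thesis using 1 by auto
    qed
    have "energy_form a v1 v2 = (\<Sum>i<k2. c2 i * energy_form a v1 (w2 i))"
      unfolding v2_def using w2X v1X by (intro Q.sum_r) auto
    then have "energy_form a v1 v2 = 0" using orth by simp
    then have total: "energy_form a (\<lambda>x. v1 x + v2 x) (\<lambda>x. v1 x + v2 x) = energy_form a v1 v1 + energy_form a v2 v2"
      using Q.square_add[OF v1X v2X] by simp
    have \<mu>: "\<mu> < 0" using insert.prems(2) by simp
    have D1: "0 \<le> l2_form v1 v1" by (simp add: l2_form_def)
    have E1: "energy_form a v1 v1 = \<mu> * l2_form v1 v1" by (rule eD(2)[OF v1 v1X])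
    then have Q1: "energy_form a v1 v1 \<le> 0" using \<mu> D1 by (simp add: mult_nonpos_nonneg)
    show "energy_form a (\<lambda>x. \<Sum>i<k. c i * w i x) (\<lambda>x. \<Sum>i<k. c i * w i x) < 0"
    proof (cases "\<exists>i<k2. c2 i \<noteq> 0")
      case True
      then have "energy_form a v2 v2 < 0" unfolding v2_def by (rule w2(3))
      then show ?thesis unfolding sum total using Q1 by linarith
    next
      case False
      then have "v2 = (\<lambda>x. 0)" unfolding v2_def by auto
      then have "energy_form a v2 v2 = 0" using Q.zero_l[OF v2X] by simp
      moreover have "\<exists>i<k1. c i \<noteq> 0"
      proof -
        obtain i where i: "i < k" "c i \<noteq> 0" using c by blast
        have "i < k1"
        proof (rule ccontr)
          assume "\<not> i < k1"
          then have "c2 (i - k1) \<noteq> 0" "i - k1 < k2" using i k(1) by (auto simp: c2_def)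
          then show False using False by blast
        qed
        then show ?thesis using i by blast
      qed
      then have "\<not> ae_zero v1" unfolding v1_def using w1(2) by blast
      then have "l2_form v1 v1 \<noteq> 0"
        using ae_zero_iff_l2[OF H10_square_integrable(1)] v1X X unfolding l2_form_def by blast
      then have "energy_form a v1 v1 < 0" unfolding E1 using D1 \<mu> by (simp add: mult_neg_pos)
      ultimately show ?thesis unfolding sum total by simp
    qed
  qed
qed

lemma pencil_energy:
  assumes "form_pencil E dirichlet_form (potential_form a) D C"
  shows "form_pencil.Q dirichlet_form (potential_form a) = energy_form a"
  by (intro ext) (simp add: form_pencil.Q_def[OF assms] energy_form_def)

text \<open>Eigenspaces provide negative families. Conversely, a negative family of size
  \<open>k\<close> yields a chain of \<open>k\<close> minimisers for the \<open>L2\<close> form;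
  these are eigenfunctions by \<open>chain_eigen\<close>, and those with a common eigenvalue are
  independent because they are orthogonal.\<close>

lemma num_neg_eigenvalues_eq:
  fixes a :: "'a::euclidean_space \<Rightarrow> real"
  assumes X: "admissible_space X" and a: "a \<in> L_infinity unit_ball"
  shows "num_neg_eigenvalues X a = neg_index X (energy_form a)"
proof (rule antisym)
  note sub = admissible_spaceD(1)[OF X] and XH = admissible_spaceD(2)[OF X]
  show "num_neg_eigenvalues X a \<le> neg_index X (energy_form a)"
    unfolding num_neg_eigenvalues_def
  proof (rule SUP_least)
    fix F :: "real set" assume F: "F \<in> {F. finite F \<and> F \<subseteq> {..<0}}"
    have "enat k \<le> neg_index X (energy_form a)" if k: "enat k \<le> (\<Sum>\<mu>\<in>F. ae_dim (eigenspace X a \<mu>))" for k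
    proof -
      obtain w l where w: "\<And>i. i < k \<Longrightarrow> w i \<in> eigenspace X a (l i)"
        "\<And>c. (\<exists>i<k. c i \<noteq> 0) \<Longrightarrow> energy_form a (\<lambda>x. \<Sum>i<k. c i * w i x) (\<lambda>x. \<Sum>i<k. c i * w i x) < 0"
        using eigenspaces_neg_family[OF a sub XH _ _ k] F by blast
      have "w i \<in> X" if "i < k" for i using eigenspaceD(1)[OF a XH w(1)[OF that]] .
      then show ?thesis using w(2) unfolding enat_le_neg_index neg_family_def by blast
    qed
    then show "(\<Sum>\<mu>\<in>F. ae_dim (eigenspace X a \<mu>)) \<le> neg_index X (energy_form a)"
      by (cases "\<Sum>\<mu>\<in>F. ae_dim (eigenspace X a \<mu>)") (auto, metis enat_ile enat_ord_code(4) ile_eSuc enat_ord_simps(1) not_enat_eq not_less_eq_eq order_refl)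
  qed
  obtain C where "form_pencil X dirichlet_form (potential_form a) l2_form C" using l2_form_pencil[OF X a] ..
  then interpret P: form_pencil X dirichlet_form "potential_form a" l2_form C .
  have PQ: "P.Q = energy_form a" by (rule pencil_energy[OF P.form_pencil_axioms])
  show "neg_index X (energy_form a) \<le> num_neg_eigenvalues X a"
    unfolding neg_index_def
  proof (rule SUP_least)
    fix k assume "k \<in> {k. neg_family X (energy_form a) k}"
    then have N: "neg_family X P.Q k" by (simp add: PQ)
    have QX: "form_on X P.Q" by (rule P.Q.form)
    \<comment> \<open>Here the pencil lives on all of \<open>X\<close>, so constant sequences serve
      as approximations.\<close>
    have dense: "\<exists>s. (\<forall>n. s n \<in> X) \<and> (\<lambda>n. P.Q (s n) (s n)) \<longlonglongrightarrow> P.Q v v \<and> (\<forall>\<phi>\<in>X. (\<lambda>n. P.Q (s n) \<phi>) \<longlonglongrightarrow> P.Q v \<phi>)"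
      if "v \<in> X" for v using that by (intro exI[of _ "\<lambda>n. v"]) auto
    have "\<exists>\<psi>. P.chain \<psi> j" if "j \<le> k" for j
      using that
    proof (induction j)
      case 0 show ?case by (simp add: P.chain_def)
    next
      case (Suc j)
      then obtain \<psi> where ch: "P.chain \<psi> j" by auto
      have "j < k" using Suc.prems by simp
      note ext = P.neg_family_minimizer[OF sub QX subset_refl dense N ch this]
      obtain \<phi> where \<phi>: "P.minimizer (\<psi> ` {..<j}) \<phi>" using ext(1) by blast
      have neg: "P.Q \<phi> \<phi> < 0" by (rule ext(2)[OF _ \<phi>])
      have im: "\<psi>(j := \<phi>) ` {..<i} = \<psi> ` {..<i}" if "i \<le> j" for i using that by (intro image_cong) auto
      have "P.chain (\<psi>(j := \<phi>)) (Suc j)"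
        unfolding P.chain_def
      proof (intro allI impI)
        fix i assume "i < Suc j"
        then have i: "i \<le> j" by simp
        show "P.minimizer ((\<psi>(j := \<phi>)) ` {..<i}) ((\<psi>(j := \<phi>)) i) \<and> P.Q ((\<psi>(j := \<phi>)) i) ((\<psi>(j := \<phi>)) i) < 0"
          unfolding im[OF i] using ch \<phi> neg i by (cases "i = j") (auto simp: P.chain_def)
      qed
      then show ?case by blast
    qed
    then obtain \<psi> where ch: "P.chain \<psi> k" by blast
    define l where "l j = P.Q (\<psi> j) (\<psi> j) / l2_form (\<psi> j) (\<psi> j)" for j
    \<comment> \<open>The distinct eigenvalues of the chain. They partition the indices below
      \<open>k\<close>, so the dimensions of their eigenspaces add up to at least
      \<open>k\<close>.\<close>
    define F where "F = l ` {..<k}"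
    have lneg: "l j < 0" if "j < k" for j using P.chainD[OF ch that] by (simp add: l_def divide_neg_pos)
    have eig: "\<psi> j \<in> eigenspace X a (l j)" if "j < k" for j
    proof (rule eigenspaceI[OF a XH P.chainD(1)[OF ch that]])
      show "energy_form a (\<psi> j) \<phi> = l j * l2_form (\<psi> j) \<phi>" if "\<phi> \<in> X" for \<phi>
        using P.chain_eigen[OF ch \<open>j < k\<close> that] unfolding l_def PQ .
    qed
    have card: "enat (card {i\<in>{..<k}. l i = \<mu>}) \<le> ae_dim (eigenspace X a \<mu>)" for \<mu>
    proof (rule ae_dim_ge)
      show "\<psi> i \<in> eigenspace X a \<mu>" if "i \<in> {i\<in>{..<k}. l i = \<mu>}" for i using eig[of i] that by auto
      fix c assume z: "ae_zero (\<lambda>x. \<Sum>i\<in>{i\<in>{..<k}. l i = \<mu>}. c i * \<psi> i x)"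
      let ?I = "{i\<in>{..<k}. l i = \<mu>}" and ?u = "\<lambda>x. \<Sum>i\<in>{i\<in>{..<k}. l i = \<mu>}. c i * \<psi> i x"
      have u: "?u \<in> X" using P.chainD(1)[OF ch] by (intro fun_subspace_sum[OF sub]) auto
      have "l2_form ?u ?u = 0"
        using z ae_zero_iff_l2[OF H10_square_integrable(1)[OF subsetD[OF XH u]]] by (simp add: l2_form_def)
      moreover have "l2_form ?u ?u = (\<Sum>i\<in>?I. (c i)\<^sup>2 * l2_form (\<psi> i) (\<psi> i))"
        using P.chainD(1)[OF ch] P.chain_orthogonal[OF ch] by (intro P.D.square_sum) auto
      moreover have "0 \<le> (c i)\<^sup>2 * l2_form (\<psi> i) (\<psi> i)" for i by (simp add: l2_form_def)
      ultimately have "\<forall>i\<in>?I. (c i)\<^sup>2 * l2_form (\<psi> i) (\<psi> i) = 0" by (simp add: sum_nonneg_eq_0_iff)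
      then show "\<forall>i\<in>?I. c i = 0" using P.chainD(3)[OF ch] by force
    qed simp
    have "k = card (\<Union>\<mu>\<in>F. {i\<in>{..<k}. l i = \<mu>})"
    proof -
      have "(\<Union>\<mu>\<in>F. {i\<in>{..<k}. l i = \<mu>}) = {..<k}" by (auto simp: F_def)
      then show ?thesis by simp
    qed
    also have "\<dots> = (\<Sum>\<mu>\<in>F. card {i\<in>{..<k}. l i = \<mu>})"
      unfolding F_def by (intro card_UN_disjoint) auto
    finally have "(of_nat k :: enat) = of_nat (\<Sum>\<mu>\<in>F. card {i\<in>{..<k}. l i = \<mu>})" by (rule arg_cong)
    then have "enat k = (\<Sum>\<mu>\<in>F. enat (card {i\<in>{..<k}. l i = \<mu>}))"
      unfolding of_nat_sum by (simp only: of_nat_eq_enat)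
    also have "\<dots> \<le> (\<Sum>\<mu>\<in>F. ae_dim (eigenspace X a \<mu>))" by (intro sum_mono card)
    also have "\<dots> \<le> num_neg_eigenvalues X a"
      unfolding num_neg_eigenvalues_def using lneg by (intro SUP_upper) (auto simp: F_def)
    finally show "enat k \<le> num_neg_eigenvalues X a" .
  qed
qed

section \<open>Negative singular eigenvalues\<close>

text \<open>The functions picked by \<open>SOME\<close> form a chain as long as the values stay
  negative, so the value at index \<open>i\<close> is negative exactly if a negative family of size
  \<open>i + 1\<close> exists. The negative indices then form an initial segment, and their number
  is the index.\<close>

lemma num_neg_sing_eigenvalues_eq:
  fixes a :: "'a::euclidean_space \<Rightarrow> real"
  assumes dim: "DIM('a) \<ge> 2" and X: "admissible_space X" and a: "a \<in> L_infinity unit_ball"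
  shows "num_neg_sing_eigenvalues X a = neg_index X (energy_form a)"
proof -
  note sub = admissible_spaceD(1)[OF X] and XH = admissible_spaceD(2)[OF X]
  define E where "E = X \<inter> sing_L2"
  obtain C where "form_pencil E dirichlet_form (potential_form a) sing_inner C"
    using sing_form_pencil[OF X a] unfolding E_def ..
  then interpret P: form_pencil E dirichlet_form "potential_form a" sing_inner C .
  have PQ: "P.Q = energy_form a" by (rule pencil_energy[OF P.form_pencil_axioms])
  have sqi: "square_integrable ball_measure w" if "w \<in> E" for w
    using H10_square_integrable(1) that XH unfolding E_def by blast
  have adm: "w \<in> sing_admissible X P \<longleftrightarrow> w \<in> E \<and> sing_inner w w \<noteq> 0 \<and> (\<forall>p\<in>P. sing_inner w p = 0)" for w P
    using ae_zero_iff_sing[OF _ sqi] unfolding sing_admissible_def E_def by blast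
  have quot: "sing_quotient a w = P.Q w w / sing_inner w w" if "w \<in> E" for w
    using quad_form_energy[OF a] that XH unfolding E_def sing_quotient_def PQ by auto
  have pos: "0 < sing_inner w w" if "w \<in> E" "sing_inner w w \<noteq> 0" for w
    using P.D_nonneg[OF that(1)] that(2) by simp
  \<comment> \<open>The infimum in the extended reals is translated into the multiplied-out notion
    of the pencil, for which existence is known.\<close>
  have attains: "attains_sing_inf X a P \<psi> \<longleftrightarrow> P.minimizer P \<psi>" for P \<psi>
  proof
    assume "attains_sing_inf X a P \<psi>"
    then have ad: "\<psi> \<in> sing_admissible X P" and eq: "ereal (sing_quotient a \<psi>) = sing_inf X a P"
      by (auto simp: attains_sing_inf_def)
    have p: "\<psi> \<in> E" "sing_inner \<psi> \<psi> \<noteq> 0" "\<forall>p\<in>P. sing_inner \<psi> p = 0" using ad by (auto simp: adm)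
    have "P.Q \<psi> \<psi> * sing_inner w w \<le> P.Q w w * sing_inner \<psi> \<psi>" if w: "w \<in> E" "\<forall>p\<in>P. sing_inner w p = 0" for w
    proof (cases "sing_inner w w = 0")
      case True
      then have "0 \<le> P.Q w w" using P.Q_lower[OF w(1)] by simp
      then show ?thesis using True pos[OF p(1,2)] by simp
    next
      case False
      then have "w \<in> sing_admissible X P" using w by (simp add: adm)
      then have "ereal (sing_quotient a \<psi>) \<le> ereal (sing_quotient a w)"
        unfolding eq sing_inf_def by (rule INF_lower)
      then show ?thesis using pos[OF p(1,2)] pos[OF w(1) False]
        by (simp add: quot p(1) w(1) divide_le_eq le_divide_eq mult.commute field_simps)
    qed
    then show "P.minimizer P \<psi>" using p by (simp add: P.minimizer_def)
  next
    assume m: "P.minimizer P \<psi>"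
    then have p: "\<psi> \<in> E" "sing_inner \<psi> \<psi> \<noteq> 0" "\<forall>p\<in>P. sing_inner \<psi> p = 0" by (auto simp: P.minimizer_def)
    have ad: "\<psi> \<in> sing_admissible X P" using p by (simp add: adm)
    have "ereal (sing_quotient a \<psi>) = (INF w\<in>sing_admissible X P. ereal (sing_quotient a w))"
    proof (rule antisym)
      show "ereal (sing_quotient a \<psi>) \<le> (INF w\<in>sing_admissible X P. ereal (sing_quotient a w))"
      proof (rule INF_greatest)
        fix w assume "w \<in> sing_admissible X P"
        then have w: "w \<in> E" "sing_inner w w \<noteq> 0" "\<forall>p\<in>P. sing_inner w p = 0" by (auto simp: adm)
        have "P.Q \<psi> \<psi> * sing_inner w w \<le> P.Q w w * sing_inner \<psi> \<psi>" using m w by (auto simp: P.minimizer_def)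
        then show "ereal (sing_quotient a \<psi>) \<le> ereal (sing_quotient a w)"
          using pos[OF p(1,2)] pos[OF w(1,2)] by (simp add: quot p(1) w(1) field_simps)
      qed
      show "(INF w\<in>sing_admissible X P. ereal (sing_quotient a w)) \<le> ereal (sing_quotient a \<psi>)"
        by (rule INF_lower[OF ad])
    qed
    then show "attains_sing_inf X a P \<psi>" using ad by (simp add: attains_sing_inf_def sing_inf_def)
  qed
  \<comment> \<open>A single competitor with negative energy makes the infimum negative. Such a
    competitor has \<open>sing_inner w w \<noteq> 0\<close> by \<open>Q_lower\<close>, so its
    quotient is meaningful.\<close>
  have inf_neg: "sing_inf X a P < 0 \<longleftrightarrow> (\<exists>w\<in>E. (\<forall>p\<in>P. sing_inner w p = 0) \<and> P.Q w w < 0)" for P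
  proof
    assume "sing_inf X a P < 0"
    then obtain w where w: "w \<in> sing_admissible X P" "sing_quotient a w < 0"
      unfolding sing_inf_def by (auto simp: INF_less_iff)
    then show "\<exists>w\<in>E. (\<forall>p\<in>P. sing_inner w p = 0) \<and> P.Q w w < 0"
      using pos[of w] by (auto simp: adm quot divide_less_0_iff)
  next
    assume "\<exists>w\<in>E. (\<forall>p\<in>P. sing_inner w p = 0) \<and> P.Q w w < 0"
    then obtain w where w: "w \<in> E" "\<forall>p\<in>P. sing_inner w p = 0" "P.Q w w < 0" by blast
    have "sing_inner w w \<noteq> 0" using P.Q_lower[OF w(1)] w(3) by auto
    then have "w \<in> sing_admissible X P" "sing_quotient a w < 0"
      using w pos[of w] by (auto simp: adm quot divide_neg_pos)
    then show "sing_inf X a P < 0" unfolding sing_inf_def by (auto simp: INF_less_iff)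
  qed
  define \<psi> where "\<psi> i = (SOME \<psi>. attains_sing_inf X a (sing_eigenfunctions X a i) \<psi>)" for i
  have funs: "sing_eigenfunctions X a i = \<psi> ` {..<i}" for i
    by (induction i) (auto simp: \<psi>_def lessThan_Suc)
  have step: "P.chain \<psi> (Suc j)" if ch: "P.chain \<psi> j" and neg: "sing_eigenvalue X a j < 0" for j
  proof -
    obtain w where w: "w \<in> E" "\<forall>p\<in>\<psi> ` {..<j}. sing_inner w p = 0" "P.Q w w < 0"
      using neg unfolding sing_eigenvalue_def funs inf_neg by blast
    have "\<psi> ` {..<j} \<subseteq> E" using P.chainD(1)[OF ch] by auto
    then have "\<exists>\<phi>. P.minimizer (\<psi> ` {..<j}) \<phi>" using w by (intro P.minimizer_exists[of _ w]) auto
    then have at: "attains_sing_inf X a (\<psi> ` {..<j}) (\<psi> j)"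
      unfolding \<psi>_def[of j] funs attains[symmetric] by (rule someI_ex)
    then have m: "P.minimizer (\<psi> ` {..<j}) (\<psi> j)" by (simp add: attains)
    then have p: "\<psi> j \<in> E" "sing_inner (\<psi> j) (\<psi> j) \<noteq> 0" by (auto simp: P.minimizer_def)
    have "P.Q (\<psi> j) (\<psi> j) * sing_inner w w \<le> P.Q w w * sing_inner (\<psi> j) (\<psi> j)"
      using m w by (auto simp: P.minimizer_def)
    also have "\<dots> < 0" using w(3) pos[OF p] by (simp add: mult_neg_pos)
    finally have "P.Q (\<psi> j) (\<psi> j) < 0" using P.D_nonneg[OF w(1)] by (smt (verit) mult_nonneg_nonneg)
    then show ?thesis using ch m unfolding P.chain_def by (auto simp: less_Suc_eq)
  qed
  \<comment> \<open>More orthogonality conditions leave fewer competitors. A negative value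
    therefore makes all earlier values negative.\<close>
  have mono: "sing_eigenvalue X a i \<le> sing_eigenvalue X a j" if "i \<le> j" for i j
  proof -
    have "sing_admissible X (\<psi> ` {..<j}) \<subseteq> sing_admissible X (\<psi> ` {..<i})"
      using that by (auto simp: sing_admissible_def)
    then show ?thesis unfolding sing_eigenvalue_def funs sing_inf_def by (intro INF_superset_mono) auto
  qed
  \<comment> \<open>Indices start at \<open>0\<close>, so index \<open>i\<close> belongs to
    \<open>Suc i\<close> functions.\<close>
  have iff: "sing_eigenvalue X a i < 0 \<longleftrightarrow> neg_family X (energy_form a) (Suc i)" for i
  proof
    assume neg: "sing_eigenvalue X a i < 0"
    have "P.chain \<psi> j" if "j \<le> Suc i" for j
      using that
    proof (induction j)
      case 0 show ?case by (simp add: P.chain_def)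
    next
      case (Suc j)
      then have "sing_eigenvalue X a j < 0" using le_less_trans[OF mono neg] by simp
      then show ?case using Suc by (intro step) auto
    qed
    then have "P.chain \<psi> (Suc i)" by simp
    from P.chain_neg_family[OF this] show "neg_family X (energy_form a) (Suc i)"
      unfolding PQ E_def by (rule neg_family_mono) simp
  next
    assume N: "neg_family X (energy_form a) (Suc i)"
    have QX: "form_on X P.Q" unfolding PQ by (rule form_on_subset[OF form_on_energy[OF a] XH])
    have EX: "E \<subseteq> X" by (simp add: E_def)
    have dense: "\<exists>s. (\<forall>n. s n \<in> E) \<and> (\<lambda>n. P.Q (s n) (s n)) \<longlonglongrightarrow> P.Q v v \<and> (\<forall>\<phi>\<in>E. (\<lambda>n. P.Q (s n) \<phi>) \<longlonglongrightarrow> P.Q v \<phi>)"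
      if "v \<in> X" for v unfolding PQ E_def by (rule singular_dense[OF dim X a that])
    have neg: "sing_eigenvalue X a j < 0" if "P.chain \<psi> j" "j \<le> i" for j
      using P.neg_family_extends_chain[OF sub QX EX dense N[folded PQ] that(1)] that(2)
      unfolding sing_eigenvalue_def funs inf_neg by simp
    have "P.chain \<psi> j" if "j \<le> i" for j
      using that
    proof (induction j)
      case 0 show ?case by (simp add: P.chain_def)
    next
      case (Suc j) then show ?case using neg[of j] by (intro step) auto
    qed
    then show "sing_eigenvalue X a i < 0" using neg by simp
  qed
  have S: "{i. sing_eigenvalue_defined X a i \<and> sing_eigenvalue X a i < 0} = {i. neg_family X (energy_form a) (Suc i)}"
  proof -
    have "sing_eigenvalue_defined X a i" if "sing_eigenvalue X a i < 0" for i
      unfolding sing_eigenvalue_defined_def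
    proof (intro allI impI)
      fix j assume "j < i"
      then have "sing_eigenvalue X a j < 0" using le_less_trans[OF mono that] by simp
      \<comment> \<open>The Hardy constant is \<open>0\<close> in the plane; the strict inequality
        comes from the negative value at \<open>j\<close>.\<close>
      also have "0 \<le> ereal (((real DIM('a) - 2) / 2)\<^sup>2)" by simp
      finally show "sing_eigenvalue X a j < ereal (((real DIM('a) - 2) / 2)\<^sup>2)" .
    qed
    then show ?thesis using iff by auto
  qed
  show ?thesis
  proof (rule enat_eqI)
    fix k
    \<comment> \<open>\<open>T\<close> is downward closed, so it has at least \<open>k\<close>
      elements exactly if it contains all indices below \<open>k\<close>; this covers infinite
      \<open>T\<close> as well.\<close>
    define T where "T = {i. neg_family X (energy_form a) (Suc i)}"
    have down: "j \<in> T" if "i \<in> T" "j \<le> i" for i j using that neg_family_le unfolding T_def by blast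
    have "enat k \<le> enat_card T \<longleftrightarrow> {..<k} \<subseteq> T"
    proof
      assume "{..<k} \<subseteq> T"
      then show "enat k \<le> enat_card T" using card_mono[of T "{..<k}"] by (auto simp: enat_card_def)
    next
      assume le: "enat k \<le> enat_card T"
      show "{..<k} \<subseteq> T"
      proof (rule ccontr)
        assume "\<not> {..<k} \<subseteq> T"
        then obtain j where j: "j < k" "j \<notin> T" by auto
        then have "T \<subseteq> {..<j}" using down by (auto simp: not_less[symmetric])
        then have "finite T" "card T \<le> j" using card_mono[of "{..<j}" T] finite_subset by auto
        then show False using le j by (simp add: enat_card_def)
      qed
    qed
    also have "\<dots> \<longleftrightarrow> neg_family X (energy_form a) k"
    proof (cases k)
      case (Suc j)
      then show ?thesis using down[of j] unfolding T_def by (auto simp: less_Suc_eq_le subset_iff)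
    qed (simp add: neg_family_0)
    finally show "enat k \<le> num_neg_sing_eigenvalues X a \<longleftrightarrow> enat k \<le> neg_index X (energy_form a)"
      unfolding num_neg_sing_eigenvalues_def S T_def enat_le_neg_index .
  qed
qed

theorem proposition1p1:
  fixes f fu :: "real \<Rightarrow> real \<Rightarrow> real"
    and u a :: "real ^ 'n \<Rightarrow> real"
  assumes dim: "CARD('n) \<ge> 2"
    and f_cont: "\<And>t. continuous_on {0..} (\<lambda>r. f r t)"
    and f_sobolev: "\<And>r. r \<ge> 0 \<Longrightarrow> f r \<in> W11_loc UNIV"
    and fu_deriv: "\<And>r. r \<ge> 0 \<Longrightarrow> has_weak_gradient UNIV (f r) (fu r)"
    and u_sol: "weak_solution f u"
    and a_eq: "a = (\<lambda>x. fu (norm x) (u x))"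
    and a_bounded: "a \<in> L_infinity unit_ball"
  shows "morse_index a = num_neg_sing_eigenvalues (H10 unit_ball) a \<and>
    (\<forall>G. orthogonal_subgroup G \<and> invariant G u \<longrightarrow>
       inv_morse_index G a = num_neg_sing_eigenvalues (H10_inv G) a) \<and>
    (radial u \<longrightarrow>
       radial_morse_index a = num_neg_sing_eigenvalues (H10_inv orthogonal_group) a)"
proof -
  have DIM: "DIM(real ^ 'n) \<ge> 2" using dim by simp
  have inv: "inv_morse_index G a = num_neg_sing_eigenvalues (H10_inv G) a" if "G \<subseteq> orthogonal_group" for G
    unfolding inv_morse_index_def
    using num_neg_eigenvalues_eq[OF admissible_H10_inv[OF that] a_bounded]
      num_neg_sing_eigenvalues_eq[OF DIM admissible_H10_inv[OF that] a_bounded] by simp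
  show ?thesis
  proof (intro conjI allI impI)
    show "morse_index a = num_neg_sing_eigenvalues (H10 unit_ball) a"
      using morse_index_eq[OF a_bounded] num_neg_sing_eigenvalues_eq[OF DIM admissible_H10 a_bounded] by simp
    show "inv_morse_index G a = num_neg_sing_eigenvalues (H10_inv G) a"
      if "orthogonal_subgroup G \<and> invariant G u" for G
      using inv that by (simp add: orthogonal_subgroup_def)
    show "radial_morse_index a = num_neg_sing_eigenvalues (H10_inv orthogonal_group) a" if "radial u"
      unfolding radial_morse_index_def by (rule inv) simp
  qed
qed

end
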